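(* Consider the two-user real Gaussian MIMO interference channel with channel matrices $H_1,H_2,H_3,H_4$ and power constraints $P_1,P_2$ (see context), where $H_3=0$ and $H_2$ and $H_4$ are square and invertible. Let $C^*$ be its sum-rate capacity. All maxima below are over symmetric positive semidefinite matrices $S_1,S_2$ with $\mathrm{tr}(S_1)\le P_1$ and $\mathrm{tr}(S_2)\le P_2$. (i) If $H_2^TH_2\prec H_4^TH_4$, then $$C^*=\max_{S_1,S_2}\ \tfrac12\log\left|I+H_1S_1H_1^T(I+H_2S_2H_2^T)^{-1}\right|+\tfrac12\log\left|I+H_4S_2H_4^T\right| .$$ (ii) If $H_2^TH_2\succeq H_4^TH_4$, then $$C^*=\max_{S_1,S_2}\ \min\left\{\tfrac12\log\left|I+H_1S_1H_1^T+H_2S_2H_2^T\right|,\ \ \tfrac12\log\left|I+H_1S_1H_1^T\right|+\tfrac12\log\left|I+H_4S_2H_4^T\right|\right\} .$$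
   Context: Channel: at each use, $y_1=H_1x_1+H_2x_2+z_1$ and $y_2=H_3x_1+H_4x_2+z_2$, where $x_i$ is the real vector sent by transmitter $i$, $y_i$ is the vector seen by receiver $i$, the $H_j$ are fixed real matrices of compatible sizes known to all, and $z_1,z_2$ are Gaussian vectors with zero mean and identity covariance, independent of the inputs and i.i.d. over channel uses. A length-$n$ code with rates $(R_1,R_2)$: independent messages $m_i$ uniform on a set of size $\lceil e^{nR_i}\rceil$; transmitter $i$ maps $m_i$ to $(x_{i,1},\dots,x_{i,n})$ subject to the average power constraint $\frac1n\sum_{j=1}^nE\|x_{i,j}\|^2\le P_i$; receiver $i$ estimates $m_i$ from $(y_{i,1},\dots,y_{i,n})$ only. A pair of nonnegative rates is achievable if there are codes with error probabilities at both receivers tending to $0$ as $n\to\infty$; the capacity region is the closure of the set of achievable pairs; the sum-rate capacity is the supremum of $R_1+R_2$ over it. Notation: $|X|$ of a matrix is its determinant; $\log$ is natural; $A\succeq B$ means $A-B$ is positive semidefinite and $A\prec B$ means $B-A$ is positive definite. *)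

theory Defs
  imports "HOL-Probability.Probability"
begin

section \<open>Matrices\<close>

definition pos_semidef :: "real^'n^'n \<Rightarrow> bool" where
  "pos_semidef A \<longleftrightarrow> transpose A = A \<and> (\<forall>x. 0 \<le> x \<bullet> (A *v x))"

definition pos_def :: "real^'n^'n \<Rightarrow> bool" where
  "pos_def A \<longleftrightarrow> transpose A = A \<and> (\<forall>x. x \<noteq> 0 \<longrightarrow> 0 < x \<bullet> (A *v x))"

definition loewner_ge :: "real^'n^'n \<Rightarrow> real^'n^'n \<Rightarrow> bool"  (infix "\<succeq>\<^sub>L" 50) where
  "A \<succeq>\<^sub>L B \<longleftrightarrow> pos_semidef (A - B)"

definition loewner_less :: "real^'n^'n \<Rightarrow> real^'n^'n \<Rightarrow> bool"  (infix "\<prec>\<^sub>L" 50) where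
  "A \<prec>\<^sub>L B \<longleftrightarrow> pos_def (B - A)"

definition cov_set :: "real \<Rightarrow> (real^'n^'n) set" where
  "cov_set P = {S. pos_semidef S \<and> trace S \<le> P}"


section \<open>The two-user Gaussian MIMO interference channel\<close>

definition std_gaussian :: "(real^'n) measure" where
  "std_gaussian = density lborel (\<lambda>z. ennreal (\<Prod>i\<in>UNIV. std_normal_density (z $ i)))"

text \<open>The joint law of the noise pair \<open>(z\<^sub>1, z\<^sub>2)\<close> in one channel use. Only the two marginals are
  prescribed; any dependence between the noises at the two receivers is allowed.\<close>

definition noise_law :: "((real^'r1) \<times> (real^'r2)) measure \<Rightarrow> bool" where
  "noise_law N \<longleftrightarrow> sets N = sets borel
     \<and> distr N borel fst = std_gaussian \<and> distr N borel snd = std_gaussian"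

definition num_msgs :: "nat \<Rightarrow> real \<Rightarrow> nat" where
  "num_msgs n R = nat \<lceil>exp (real n * R)\<rceil>"

definition msg_pmf :: "nat \<Rightarrow> real \<Rightarrow> nat pmf" where
  "msg_pmf n R = pmf_of_set {..<num_msgs n R}"

text \<open>Codewords are indexed by the message and then by the channel use \<open>j < n\<close>. The expectation in
  the power constraint is over the uniform message.\<close>

definition power_ok :: "nat \<Rightarrow> real \<Rightarrow> real \<Rightarrow> (nat \<Rightarrow> nat \<Rightarrow> real^'t) \<Rightarrow> bool" where
  "power_ok n R P x \<longleftrightarrow>
     (\<Sum>j<n. measure_pmf.expectation (msg_pmf n R) (\<lambda>m. (norm (x m j))\<^sup>2)) / real n \<le> P"

abbreviation decoder :: "nat \<Rightarrow> ((nat \<Rightarrow> real^'r) \<Rightarrow> nat) \<Rightarrow> bool" where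
  "decoder n d \<equiv> d \<in> measurable (Pi\<^sub>M {..<n} (\<lambda>_. borel)) (count_space UNIV)"

text \<open>Outcomes are \<open>((m\<^sub>1, m\<^sub>2), z)\<close> where \<open>z j\<close> is the noise pair in channel use \<open>j\<close>.\<close>

definition code_space ::
  "nat \<Rightarrow> real \<Rightarrow> real \<Rightarrow> ((real^'r1) \<times> (real^'r2)) measure
     \<Rightarrow> ((nat \<times> nat) \<times> (nat \<Rightarrow> (real^'r1) \<times> (real^'r2))) measure" where
  "code_space n R1 R2 N =
     measure_pmf (pair_pmf (msg_pmf n R1) (msg_pmf n R2)) \<Otimes>\<^sub>M Pi\<^sub>M {..<n} (\<lambda>_. N)"

definition error_prob1 where
  "error_prob1 H1 H2 N n R1 R2 x1 x2 d1 =
     measure (code_space n R1 R2 N)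
       {((m1, m2), z) \<in> space (code_space n R1 R2 N).
          d1 (\<lambda>j\<in>{..<n}. H1 *v x1 m1 j + H2 *v x2 m2 j + fst (z j)) \<noteq> m1}"
  for H1 :: "real^'t1^'r1" and H2 :: "real^'t2^'r1"
    and N :: "((real^'r1) \<times> (real^'r2)) measure" and R1 R2 :: real

definition error_prob2 where
  "error_prob2 H3 H4 N n R1 R2 x1 x2 d2 =
     measure (code_space n R1 R2 N)
       {((m1, m2), z) \<in> space (code_space n R1 R2 N).
          d2 (\<lambda>j\<in>{..<n}. H3 *v x1 m1 j + H4 *v x2 m2 j + snd (z j)) \<noteq> m2}"
  for H3 :: "real^'t1^'r2" and H4 :: "real^'t2^'r2"
    and N :: "((real^'r1) \<times> (real^'r2)) measure" and R1 R2 :: real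

definition achievable ::
  "real^'t1^'r1 \<Rightarrow> real^'t2^'r1 \<Rightarrow> real^'t1^'r2 \<Rightarrow> real^'t2^'r2
     \<Rightarrow> ((real^'r1) \<times> (real^'r2)) measure \<Rightarrow> real \<Rightarrow> real \<Rightarrow> real \<times> real \<Rightarrow> bool" where
  "achievable H1 H2 H3 H4 N P1 P2 = (\<lambda>(R1, R2). 0 \<le> R1 \<and> 0 \<le> R2 \<and>
     (\<exists>x1 x2 d1 d2.
        (\<forall>n\<ge>1. power_ok n R1 P1 (x1 n) \<and> power_ok n R2 P2 (x2 n)
           \<and> decoder n (d1 n) \<and> decoder n (d2 n))
        \<and> (\<lambda>n. error_prob1 H1 H2 N n R1 R2 (x1 n) (x2 n) (d1 n)) \<longlonglongrightarrow> 0
        \<and> (\<lambda>n. error_prob2 H3 H4 N n R1 R2 (x1 n) (x2 n) (d2 n)) \<longlonglongrightarrow> 0))"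

definition capacity_region ::
  "real^'t1^'r1 \<Rightarrow> real^'t2^'r1 \<Rightarrow> real^'t1^'r2 \<Rightarrow> real^'t2^'r2
     \<Rightarrow> ((real^'r1) \<times> (real^'r2)) measure \<Rightarrow> real \<Rightarrow> real \<Rightarrow> (real \<times> real) set" where
  "capacity_region H1 H2 H3 H4 N P1 P2 = closure {R. achievable H1 H2 H3 H4 N P1 P2 R}"

text \<open>Valued in the extended reals, so that no boundedness of the region is presupposed.\<close>

definition sum_capacity ::
  "real^'t1^'r1 \<Rightarrow> real^'t2^'r1 \<Rightarrow> real^'t1^'r2 \<Rightarrow> real^'t2^'r2
     \<Rightarrow> ((real^'r1) \<times> (real^'r2)) measure \<Rightarrow> real \<Rightarrow> real \<Rightarrow> ereal" where
  "sum_capacity H1 H2 H3 H4 N P1 P2 =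
     (SUP (R1, R2) \<in> capacity_region H1 H2 H3 H4 N P1 P2. ereal (R1 + R2))"


section \<open>Attained maxima\<close>

definition is_max_over :: "ereal \<Rightarrow> ('a \<Rightarrow> real) \<Rightarrow> 'a set \<Rightarrow> bool" where
  "is_max_over v f A \<longleftrightarrow> (\<exists>a\<in>A. v = ereal (f a)) \<and> (\<forall>a\<in>A. ereal (f a) \<le> v)"

end

theory Submission imports Defs begin

text \<open>Converse: both error probabilities depend only on the marginals of the noise, so the two
  noises may be coupled. If the interference is weak, the noise of receiver 1 is coupled so that its
  interference is a degraded version of the output of receiver 2; the true law of the pair (output of
  receiver 1, error of the linear estimate of output 2 from the interference plus noise) is compared
  with the product of Gaussians with the same average covariances. If the interference is strong,
  receiver 1 can also recover message 2. In both cases \<open>ln x \<le> x - 1\<close>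
  turns the log-likelihood ratio into a bound on the error probability, and its mean is the
  log-determinant of the average input covariances of the code.

  Achievability: codewords \<open>A g\<close> with \<open>g\<close> standard Gaussian and
  \<open>A A\<^sup>T\<close> slightly below the power limit. Receiver 1 treats the interference as
  noise if it is weak and decodes jointly, without insisting on message 2, if it is strong. The false
  alarms of the threshold test decay by a change of measure and the missed detections by Chernoff
  bounds for \<open>norm g\<close>. Markov's inequality bounds from below the probability that a random
  codebook meets the power constraint.\<close>

section \<open>Linear changes of variables\<close>

text \<open>The converse uses no entropy. The reference law has the average second moments of the
  code itself, and the logarithm of a Gaussian density ratio is quadratic, so its mean over messages
  and channel uses depends on the code only through these moments. This does at once what maximality
  of Gaussian entropy, subadditivity and concavity of the log-determinant would do, and all bounds
  for a code hold at one and the same pair of covariances. In the weak case the covariance of the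
  estimation error involves the degrading noise; a determinant identity cancels it against the
  Jacobian of the coupling. The power constraint costs little in the random coding: with mean power
  at most \<open>(1 - \<delta>) P\<close> a codebook meets it with probability at least \<delta>, a
  fixed number, while the mean error tends to 0. Covariances \<open>K\<close> are represented by
  square roots \<open>B\<close> with \<open>B B^T = K\<close>, since Gaussian vectors are images of
  standard ones; hence \<open>ln |det B|\<close> stands for half of
  \<open>ln (det K)\<close>.\<close>

lemma borel_measurable_vec_lambda:
  fixes f :: "'a \<Rightarrow> 'n::finite \<Rightarrow> real"
  assumes "\<And>i. (\<lambda>x. f x i) \<in> borel_measurable M"
  shows "(\<lambda>x. \<chi> i. f x i) \<in> borel_measurable M"
  by (subst borel_measurable_euclidean_space)
    (use assms in \<open>auto simp: Basis_vec_def inner_axis\<close>)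

text \<open>Lebesgue measure on \<open>real^'n\<close> is built from the basis vectors; indexing the
  product by the coordinates instead makes Fubini available one coordinate at a time. Both sides
  agree on boxes, and boxes determine the measure.\<close>

lemma lborel_cart:
  "(lborel :: (real^'n) measure) = distr (\<Pi>\<^sub>M i\<in>UNIV. lborel) borel (\<lambda>f. \<chi> i. f i)"
proof (rule lborel_eqI)
  interpret product_sigma_finite "\<lambda>_::'n. lborel :: real measure" ..
  have [measurable]: "(\<lambda>f. \<chi> i. f i) \<in> (\<Pi>\<^sub>M i\<in>(UNIV::'n set). (lborel::real measure)) \<rightarrow>\<^sub>M borel"
    by (intro borel_measurable_vec_lambda) measurable
  fix l u :: "real^'n" assume le: "\<And>b. b \<in> Basis \<Longrightarrow> l \<bullet> b \<le> u \<bullet> b"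
  have le': "l $ i \<le> u $ i" for i
    using le[of "axis i 1"] by (simp add: inner_axis)
  have "emeasure (distr (\<Pi>\<^sub>M i\<in>UNIV. lborel) borel (\<lambda>f. \<chi> i. f i)) (box l u)
     = emeasure (\<Pi>\<^sub>M i\<in>(UNIV::'n set). lborel) (Pi\<^sub>E UNIV (\<lambda>i. box (l $ i) (u $ i)))"
    by (subst emeasure_distr, measurable)
      (intro arg_cong2[where f=emeasure] refl, auto simp: space_PiM mem_box_cart PiE_iff)
  also have "\<dots> = (\<Prod>i\<in>UNIV. ennreal (u $ i - l $ i))"
    by (subst emeasure_PiM) (auto simp: le')
  also have "\<dots> = ennreal (\<Prod>i\<in>UNIV. (u - l) $ i)"
    by (subst prod_ennreal) (auto simp: le')
  also have "(\<Prod>i\<in>UNIV. (u - l) $ i) = (\<Prod>b\<in>Basis. (u - l) \<bullet> b)"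
    unfolding Basis_vec_def Basis_real_def
    by (subst prod.reindex_cong[where l="\<lambda>i. axis i 1" and B="UNIV::'n set" and h="\<lambda>i. (u-l)$i"])
      (auto simp: inj_on_def axis_eq_axis inner_axis)
  finally show "emeasure (distr (\<Pi>\<^sub>M i\<in>UNIV. lborel) borel (\<lambda>f. \<chi> i. f i)) (box l u)
     = ennreal (\<Prod>b\<in>Basis. (u - l) \<bullet> b)" .
qed simp

lemma measurable_PiM_cart [measurable]:
  "(\<lambda>f. \<chi> i. f i) \<in> (\<Pi>\<^sub>M i\<in>(UNIV::'n::finite set). (lborel::real measure)) \<rightarrow>\<^sub>M borel"
  by (intro borel_measurable_vec_lambda) measurable

lemma borel_measurable_matrix_vector [measurable]:
  "(*v) (A::real^'n^'m) \<in> borel_measurable borel"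
  by (intro borel_measurable_continuous_onI linear_continuous_on) simp

lemma nn_integral_cart:
  fixes f :: "real^'n \<Rightarrow> ennreal"
  assumes [measurable]: "f \<in> borel_measurable borel"
  shows "(\<integral>\<^sup>+x. f x \<partial>lborel) = (\<integral>\<^sup>+x. f (\<chi> i. x i) \<partial>(\<Pi>\<^sub>M i\<in>UNIV. lborel))"
  by (subst lborel_cart) (simp add: nn_integral_distr)

lemma nn_integral_lborel_cart_prod:
  fixes f :: "'n::finite \<Rightarrow> real \<Rightarrow> ennreal"
  assumes [measurable]: "\<And>i. f i \<in> borel_measurable borel"
  shows "(\<integral>\<^sup>+x. (\<Prod>i\<in>UNIV. f i (x $ i)) \<partial>lborel) = (\<Prod>i\<in>UNIV. \<integral>\<^sup>+x. f i x \<partial>lborel)"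
proof -
  interpret product_sigma_finite "\<lambda>_::'n. lborel :: real measure" ..
  have "(\<integral>\<^sup>+x. (\<Prod>i\<in>UNIV. f i (x i)) \<partial>(\<Pi>\<^sub>M i\<in>UNIV. lborel)) = (\<Prod>i\<in>UNIV. \<integral>\<^sup>+x. f i x \<partial>lborel)"
    by (rule product_nn_integral_prod) auto
  then show ?thesis by (subst nn_integral_cart) auto
qed

lemma nn_integral_lborel_translate:
  fixes f :: "'a::euclidean_space \<Rightarrow> ennreal"
  assumes [measurable]: "f \<in> borel_measurable borel"
  shows "(\<integral>\<^sup>+x. f (a + x) \<partial>lborel) = (\<integral>\<^sup>+x. f x \<partial>lborel)"
proof -
  have "(\<integral>\<^sup>+x. f x \<partial>lborel) = (\<integral>\<^sup>+x. f x \<partial>(distr lborel borel ((+) a)))"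
    using lborel_distr_plus[of a] by simp
  then show ?thesis by (simp add: nn_integral_distr)
qed

text \<open>With all other coordinates frozen, the shear is a translation of coordinate
  \<open>m\<close>, so integrating over that coordinate first removes it.\<close>

lemma nn_integral_shear:
  fixes f :: "real^'n \<Rightarrow> ennreal"
  assumes [measurable]: "f \<in> borel_measurable borel" and "m \<noteq> n"
  shows "(\<integral>\<^sup>+x. f (\<chi> i. if i = m then x $ m + c * x $ n else x $ i) \<partial>lborel) = (\<integral>\<^sup>+x. f x \<partial>lborel)"
proof -
  interpret product_sigma_finite "\<lambda>_::'n. lborel :: real measure" ..
  let ?I = "UNIV - {m}"
  have [measurable]: "(\<lambda>x. \<chi> i. if i = m then x $ m + c * x $ n else x $ i) \<in> borel_measurable borel"
    by (intro borel_measurable_vec_lambda) measurable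
  have U: "UNIV = insert m ?I" by auto
  have [measurable]: "(\<lambda>f. \<chi> i. f i) \<in> (\<Pi>\<^sub>M i\<in>insert m ?I. (lborel::real measure)) \<rightarrow>\<^sub>M borel"
    unfolding U[symmetric] by measurable
  have *: "(\<integral>\<^sup>+x. g x \<partial>lborel) = (\<integral>\<^sup>+x. (\<integral>\<^sup>+y. g (\<chi> i. (x(m := y)) i) \<partial>lborel) \<partial>(\<Pi>\<^sub>M i\<in>?I. lborel))"
    if [measurable]: "g \<in> borel_measurable borel" for g :: "real^'n \<Rightarrow> ennreal"
  proof -
    have "(\<integral>\<^sup>+x. g x \<partial>lborel) = (\<integral>\<^sup>+x. g (\<chi> i. x i) \<partial>(\<Pi>\<^sub>M i\<in>insert m ?I. lborel))"
      by (subst nn_integral_cart) (auto simp: U[symmetric])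
    also have "\<dots> = (\<integral>\<^sup>+x. (\<integral>\<^sup>+y. g (\<chi> i. (x(m := y)) i) \<partial>lborel) \<partial>(\<Pi>\<^sub>M i\<in>?I. lborel))"
      by (subst product_nn_integral_insert) auto
    finally show ?thesis .
  qed
  have meas: "(\<lambda>y. f (\<chi> i. (x(m := y)) i)) \<in> borel_measurable borel" for x :: "'n \<Rightarrow> real"
  proof -
    have "(\<lambda>y. \<chi> i. (x(m := y)) i) \<in> borel_measurable borel"
      by (intro borel_measurable_vec_lambda) (auto simp: fun_upd_def)
    then show ?thesis by measurable
  qed
  have "(\<integral>\<^sup>+x. f (\<chi> i. if i = m then x $ m + c * x $ n else x $ i) \<partial>lborel)
    = (\<integral>\<^sup>+x. (\<integral>\<^sup>+y. f (\<chi> i. (x(m := c * x n + y)) i) \<partial>lborel) \<partial>(\<Pi>\<^sub>M i\<in>?I. lborel))"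
    using \<open>m \<noteq> n\<close>
    by (subst *) (auto intro!: nn_integral_cong arg_cong[where f=f] simp: vec_eq_iff)
  also have "\<dots> = (\<integral>\<^sup>+x. (\<integral>\<^sup>+y. f (\<chi> i. (x(m := y)) i) \<partial>lborel) \<partial>(\<Pi>\<^sub>M i\<in>?I. lborel))"
    by (intro nn_integral_cong nn_integral_lborel_translate[of "\<lambda>y. f (\<chi> i. (x(m := y)) i)" for x] meas)
  also have "\<dots> = (\<integral>\<^sup>+x. f x \<partial>lborel)"
    by (rule *[symmetric]) simp
  finally show ?thesis .
qed

text \<open>A permutation of the coordinates sends boxes to boxes with the same side lengths in
  another order.\<close>

lemma nn_integral_permute:
  fixes f :: "real^'n \<Rightarrow> ennreal"
  assumes [measurable]: "f \<in> borel_measurable borel" and p: "bij (p::'n \<Rightarrow> 'n)"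
  shows "(\<integral>\<^sup>+x. f (\<chi> i. x $ p i) \<partial>lborel) = (\<integral>\<^sup>+x. f x \<partial>lborel)"
proof -
  have [measurable]: "(\<lambda>x. \<chi> i. x $ p i) \<in> borel_measurable (borel::(real^'n) measure)"
    by (intro borel_measurable_vec_lambda) measurable
  have "lborel = distr lborel borel (\<lambda>x::real^'n. \<chi> i. x $ p i)"
  proof (rule lborel_eqI)
    fix l u :: "real^'n" assume le: "\<And>b. b \<in> Basis \<Longrightarrow> l \<bullet> b \<le> u \<bullet> b"
    have le': "l $ i \<le> u $ i" for i
      using le[of "axis i 1"] by (simp add: inner_axis)
    have pr: "(\<Prod>b\<in>Basis. (w::real^'n) \<bullet> b) = (\<Prod>i\<in>UNIV. w $ i)" for w
      unfolding Basis_vec_def Basis_real_def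
      by (subst prod.reindex_cong[where l="\<lambda>i. axis i 1" and B="UNIV::'n set" and h="\<lambda>i. w$i"])
        (auto simp: inj_on_def axis_eq_axis inner_axis)
    let ?q = "inv p"
    have q: "p (?q i) = i" "?q (p i) = i" for i
      using p by (auto simp: bij_def surj_f_inv_f)
    have "(\<lambda>x::real^'n. \<chi> i. x $ p i) -` box l u = box (\<chi> i. l $ ?q i) (\<chi> i. u $ ?q i)"
      by (auto simp: mem_box_cart q) (metis q)+
    moreover have "emeasure lborel (box (\<chi> i. l $ ?q i) (\<chi> i. u $ ?q i)) = ennreal (\<Prod>i\<in>UNIV. (u - l) $ ?q i)"
    proof -
      have "\<forall>b\<in>Basis. (\<chi> i. l $ ?q i) \<bullet> b \<le> (\<chi> i. u $ ?q i) \<bullet> b"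
        by (auto simp: Basis_vec_def inner_axis le')
      then show ?thesis by (subst emeasure_lborel_box) (simp_all add: pr)
    qed
    ultimately have "emeasure (distr lborel borel (\<lambda>x::real^'n. \<chi> i. x $ p i)) (box l u)
      = ennreal (\<Prod>i\<in>UNIV. (u - l) $ ?q i)"
      by (simp add: emeasure_distr)
    also have "(\<Prod>i\<in>UNIV. (u - l) $ ?q i) = (\<Prod>i\<in>UNIV. (u - l) $ i)"
      by (rule prod.reindex_bij_betw[of ?q]) (use p in \<open>auto simp: bij_imp_bij_inv\<close>)
    finally show "emeasure (distr lborel borel (\<lambda>x::real^'n. \<chi> i. x $ p i)) (box l u)
      = ennreal (\<Prod>b\<in>Basis. (u - l) \<bullet> b)" by (simp add: pr)
  qed simp
  then have "(\<integral>\<^sup>+x. f x \<partial>lborel) = (\<integral>\<^sup>+x. f x \<partial>distr lborel borel (\<lambda>x::real^'n. \<chi> i. x $ p i))" by simp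
  then show ?thesis by (simp add: nn_integral_distr)
qed

lemma nn_integral_diagonal:
  fixes f :: "real^'n \<Rightarrow> ennreal"
  assumes [measurable]: "f \<in> borel_measurable borel" and c: "\<And>i. c i \<noteq> 0"
  shows "(\<integral>\<^sup>+x. f x \<partial>lborel) = ennreal \<bar>\<Prod>i\<in>UNIV. c i\<bar> * (\<integral>\<^sup>+x. f (\<chi> i. c i * x $ i) \<partial>lborel)"
proof -
  \<comment> \<open>\<open>lborel_affine_euclidean\<close> scales along basis vectors, so the
    factors, indexed by coordinates, are transported to the basis.\<close>
  define c' where "c' b = c (axis_index b)" for b :: "real^'n"
  have c': "c' (axis i 1) = c i" for i by (simp add: c'_def axis_index_axis)
  have [measurable]: "(\<lambda>x. \<chi> i. c i * x $ i) \<in> borel_measurable (borel::(real^'n) measure)"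
    by (intro borel_measurable_vec_lambda) measurable
  have B: "Basis = range (\<lambda>i::'n. axis i (1::real))" by (auto simp: Basis_vec_def)
  have inj: "inj (\<lambda>i::'n. axis i (1::real))" by (auto simp: inj_on_def axis_eq_axis)
  have T: "0 + (\<Sum>j\<in>Basis. (c' j * (x \<bullet> j)) *\<^sub>R j) = (\<chi> i. c i * x $ i)" for x :: "real^'n"
  proof -
    have "(\<Sum>j\<in>Basis. (c' j * (x \<bullet> j)) *\<^sub>R j) = (\<Sum>i\<in>UNIV. (c i * x $ i) *\<^sub>R axis i 1)"
      unfolding B by (subst sum.reindex[OF inj]) (simp add: c' inner_axis)
    then show ?thesis
      by (simp add: vec_eq_iff axis_def if_distrib cong: if_cong)
  qed
  have pr: "(\<Prod>j\<in>(Basis::(real^'n) set). \<bar>c' j\<bar>) = \<bar>\<Prod>i\<in>UNIV. c i\<bar>"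
    unfolding B by (subst prod.reindex[OF inj]) (auto simp: c' abs_prod)
  have "lborel = density (distr lborel borel (\<lambda>x. 0 + (\<Sum>j\<in>Basis. (c' j * (x \<bullet> j)) *\<^sub>R j)))
      (\<lambda>_. (\<Prod>j\<in>(Basis::(real^'n) set). \<bar>c' j\<bar>))"
    by (rule lborel_affine_euclidean) (auto simp: B c' c)
  then have "(\<integral>\<^sup>+x. f x \<partial>lborel) = (\<integral>\<^sup>+x. f x \<partial>density (distr lborel borel (\<lambda>x. \<chi> i. c i * x $ i))
      (\<lambda>_. \<bar>\<Prod>i\<in>UNIV. c i\<bar>))"
    unfolding T pr by simp
  then show ?thesis
    by (simp add: nn_integral_density nn_integral_distr nn_integral_cmult)
qed

text \<open>Induction over row operations: a matrix with a zero row is not invertible, a diagonal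
  matrix scales the coordinates, a swap of columns permutes the argument, and adding a multiple of
  one row to another shears the result. Invertibility sits inside the induction predicate because
  the matrix changes along the way.\<close>

theorem nn_integral_matrix:
  fixes A :: "real^'n^'n" and f :: "real^'n \<Rightarrow> ennreal"
  assumes "f \<in> borel_measurable borel" and "invertible A"
  shows "(\<integral>\<^sup>+x. f x \<partial>lborel) = ennreal \<bar>det A\<bar> * (\<integral>\<^sup>+x. f (A *v x) \<partial>lborel)"
proof -
  let ?P = "\<lambda>A::real^'n^'n. invertible A \<longrightarrow> (\<forall>f\<in>borel_measurable borel.
     (\<integral>\<^sup>+x. f x \<partial>lborel) = ennreal \<bar>det A\<bar> * (\<integral>\<^sup>+x. f (A *v x) \<partial>lborel))"
  have "?P A"
  proof (rule induct_matrix_row_operations)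
    fix A :: "real^'n^'n" and i assume "row i A = 0"
    then show "?P A" by (auto simp: invertible_det_nz det_zero_row)
  next
    fix A :: "real^'n^'n" assume 0: "\<And>i j. i \<noteq> j \<Longrightarrow> A$i$j = 0"
    have d: "det A = (\<Prod>i\<in>UNIV. A$i$i)" using 0 by (rule det_diagonal)
    have v: "A *v x = (\<chi> i. A$i$i * x$i)" for x
    proof -
      have "(\<Sum>j\<in>UNIV. A $ i $ j * x $ j) = (\<Sum>j\<in>UNIV. if j = i then A $ i $ i * x $ i else 0)" for i
        by (rule sum.cong) (auto simp: 0)
      then show ?thesis by (simp add: vec_eq_iff matrix_vector_mult_def)
    qed
    show "?P A"
      unfolding v d invertible_det_nz
      by (auto intro!: nn_integral_diagonal)
  next
    fix A :: "real^'n^'n" and m n :: 'n assume P: "?P A" and mn: "m \<noteq> n"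
    let ?t = "Transposition.transpose m n"
    let ?B = "\<chi> i j. A $ i $ ?t j"
    have bij: "bij ?t" by simp
    have v: "?B *v x = A *v (\<chi> i. x $ ?t i)" for x
    proof (auto simp: vec_eq_iff matrix_vector_mult_def)
      fix i
      show "(\<Sum>j\<in>UNIV. A $ i $ ?t j * x $ j) = (\<Sum>j\<in>UNIV. A $ i $ j * x $ ?t j)"
        by (subst sum.reindex_bij_betw[OF bij, symmetric]) simp
    qed
    have "?B = transpose (\<chi> i. transpose A $ ?t i)" by (simp add: vec_eq_iff transpose_def)
    then have "det ?B = of_int (sign ?t) * det A"
      by (metis det_permute_rows det_transpose permutes_swap_id UNIV_I)
    then have d: "\<bar>det ?B\<bar> = \<bar>det A\<bar>" by (simp add: abs_mult sign_def)
    show "?P ?B"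
    proof (intro impI ballI)
      fix f :: "real^'n \<Rightarrow> ennreal" assume i: "invertible ?B" and f[measurable]: "f \<in> borel_measurable borel"
      have iA: "invertible A" using i d by (auto simp: invertible_det_nz)
      have "(\<integral>\<^sup>+x. f x \<partial>lborel) = ennreal \<bar>det A\<bar> * (\<integral>\<^sup>+x. f (A *v x) \<partial>lborel)"
        using P iA f by blast
      \<comment> \<open>A swap of columns acts before \<open>A\<close>, so it is the integrand
        \<open>f (A *v _)\<close> that is permuted.\<close>
      also have "(\<integral>\<^sup>+x. f (A *v x) \<partial>lborel) = (\<integral>\<^sup>+x. f (A *v (\<chi> i. x $ ?t i)) \<partial>lborel)"
        by (rule nn_integral_permute[symmetric, of "\<lambda>x. f (A *v x)", OF _ bij]) measurable
      finally show "(\<integral>\<^sup>+x. f x \<partial>lborel) = ennreal \<bar>det ?B\<bar> * (\<integral>\<^sup>+x. f (?B *v x) \<partial>lborel)"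
        unfolding d v .
    qed
  next
    fix A :: "real^'n^'n" and m n :: 'n and c assume P: "?P A" and mn: "m \<noteq> n"
    let ?B = "\<chi> i. if i = m then row m A + c *\<^sub>R row n A else row i A"
    have v: "?B *v x = (\<chi> i. if i = m then (A *v x) $ m + c * (A *v x) $ n else (A *v x) $ i)" for x
      by (auto simp: vec_eq_iff matrix_vector_mult_def row_def algebra_simps sum.distrib sum_distrib_left)
    have d: "det ?B = det A" using det_row_operation[OF mn, of A c] unfolding scalar_mult_eq_scaleR .
    show "?P ?B"
    proof (intro impI ballI)
      fix f :: "real^'n \<Rightarrow> ennreal" assume i: "invertible ?B" and f[measurable]: "f \<in> borel_measurable borel"
      have iA: "invertible A" using i d by (auto simp: invertible_det_nz)
      let ?s = "\<lambda>x::real^'n. \<chi> i. if i = m then x $ m + c * x $ n else x $ i"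
      have [measurable]: "?s \<in> borel_measurable borel"
        by (intro borel_measurable_vec_lambda) measurable
      \<comment> \<open>A row operation acts after \<open>A\<close>: the shear is applied to
        \<open>f\<close> first, and the induction hypothesis is used for the sheared
        function.\<close>
      have "(\<integral>\<^sup>+x. f x \<partial>lborel) = (\<integral>\<^sup>+x. f (?s x) \<partial>lborel)"
        by (rule nn_integral_shear[symmetric]) (use mn in auto)
      also have "\<dots> = ennreal \<bar>det A\<bar> * (\<integral>\<^sup>+x. f (?s (A *v x)) \<partial>lborel)"
        by (rule P[rule_format, OF iA]) measurable
      finally show "(\<integral>\<^sup>+x. f x \<partial>lborel) = ennreal \<bar>det ?B\<bar> * (\<integral>\<^sup>+x. f (?B *v x) \<partial>lborel)"
        unfolding d v .
    qed
  qed
  with assms show ?thesis by blast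
qed

section \<open>Positive semidefinite matrices\<close>

lemma inner_matrix_vector: "x \<bullet> (A *v y) = (transpose A *v x) \<bullet> y" for A :: "real^'n^'m"
  by (simp add: dot_lmul_matrix)

lemma pos_semidef_mult_transpose: "pos_semidef (A ** transpose A)" for A :: "real^'m^'n"
  unfolding pos_semidef_def
  by (auto simp: matrix_transpose_mul inner_matrix_vector[of _ A] simp flip: matrix_vector_mul_assoc)

lemma matrix_eq_iff_bilinear: "A = B \<longleftrightarrow> (\<forall>x y. x \<bullet> (A *v y) = x \<bullet> (B *v y))" for A :: "real^'n^'m"
  by (metis matrix_eq vector_eq_rdot inner_commute)

text \<open>Deflation: as long as some \<open>x\<close> has a positive quadratic form, subtracting
  \<open>v v^T\<close> with \<open>v\<close> proportional to \<open>S *v x\<close> keeps the matrix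
  semidefinite and puts \<open>x\<close> into the kernel. The induction is on the rank, and bounding
  \<open>k\<close> by the rank is what lets the vectors fit into a square matrix later.\<close>

lemma pos_semidef_sum_of_squares:
  fixes S :: "real^'n^'n"
  assumes "pos_semidef S"
  shows "\<exists>c k. k \<le> CARD('n) - dim {x. S *v x = 0} \<and> (\<forall>i j. S $ i $ j = (\<Sum>t<k. c t $ i * c t $ j))"
  using assms
proof (induction "CARD('n) - dim {x. S *v x = 0}" arbitrary: S rule: less_induct)
  case less
  then have sym: "transpose S = S" and nn: "0 \<le> x \<bullet> (S *v x)" for x
    by (auto simp: pos_semidef_def)
  have sym': "x \<bullet> (S *v y) = y \<bullet> (S *v x)" for x y
    by (subst inner_matrix_vector) (simp add: sym inner_commute)
  show ?case
  proof (cases "\<forall>x. x \<bullet> (S *v x) = 0")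
    case True
    \<comment> \<open>Polarisation: a symmetric form that vanishes on the diagonal is 0.\<close>
    have "x \<bullet> (S *v y) = 0" for x y
      using True[rule_format, of "x + y"] True[rule_format, of x] True[rule_format, of y] sym'[of y x]
      by (simp add: matrix_vector_right_distrib inner_add_left inner_add_right)
    then have "S = 0" by (simp add: matrix_eq_iff_bilinear)
    then show ?thesis by (intro exI[of _ "\<lambda>_. 0"] exI[of _ 0]) auto
  next
    case False
    then obtain x where x: "0 < x \<bullet> (S *v x)" using nn by (metis less_eq_real_def)
    define v where "v = (1 / sqrt (x \<bullet> (S *v x))) *\<^sub>R (S *v x)"
    define S' where "S' = S - (\<chi> i j. v $ i * v $ j)"
    have vv: "(\<chi> i j. v $ i * v $ j) *v y = (v \<bullet> y) *\<^sub>R v" for y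
      by (simp add: vec_eq_iff matrix_vector_mult_def inner_vec_def sum_distrib_right sum_distrib_left ac_simps)
    have S'v: "S' *v y = S *v y - (v \<bullet> y) *\<^sub>R v" for y
      unfolding S'_def by (simp add: matrix_vector_mult_diff_rdistrib vv)
    have vy: "v \<bullet> y = (y \<bullet> (S *v x)) / sqrt (x \<bullet> (S *v x))" for y
      by (simp add: v_def inner_commute)
    have S'x: "S' *v x = 0"
      unfolding S'v vy using x by (simp add: v_def)
    have psd: "pos_semidef S'"
      unfolding pos_semidef_def
    proof (intro conjI allI)
      show "transpose S' = S'"
        using sym by (simp add: S'_def vec_eq_iff transpose_def mult.commute)
      fix y
      \<comment> \<open>The value of \<open>t\<close> that minimises the form at
        \<open>y - t x\<close>. The minimum is the form of \<open>S'\<close> at \<open>y\<close>, a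
        Schur complement.\<close>
      define t where "t = (y \<bullet> (S *v x)) / (x \<bullet> (S *v x))"
      have "0 \<le> (y - t *\<^sub>R x) \<bullet> (S *v (y - t *\<^sub>R x))" by (rule nn)
      also have "\<dots> = y \<bullet> (S *v y) - 2 * t * (y \<bullet> (S *v x)) + t * t * (x \<bullet> (S *v x))"
        using sym'[of x y]
        by (simp add: matrix_vector_mult_diff_distrib matrix_vector_mult_scaleR inner_diff_left inner_diff_right algebra_simps)
      also have "\<dots> = y \<bullet> (S *v y) - (v \<bullet> y) * (v \<bullet> y)"
        using x unfolding vy t_def by (simp add: field_simps)
      finally show "0 \<le> y \<bullet> (S' *v y)"
        by (simp add: S'v inner_diff_right inner_commute)
    qed
    \<comment> \<open>\<open>v\<close> is orthogonal to the kernel of \<open>S\<close>, so the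
      kernel only grows, and \<open>x\<close> is new in it.\<close>
    have "{x. S *v x = 0} \<subset> {x. S' *v x = 0}"
    proof
      show "{x. S *v x = 0} \<subseteq> {x. S' *v x = 0}"
        by (auto simp: S'v vy) (metis inner_zero_right sym' div_0 mult_zero_left scaleR_zero_left)
      show "{x. S *v x = 0} \<noteq> {x. S' *v x = 0}" using x S'x by force
    qed
    moreover have "subspace {x. S *v x = 0}" "subspace {x. S' *v x = 0}"
      by (auto simp: subspace_def matrix_vector_right_distrib matrix_vector_mult_scaleR)
    ultimately have d: "dim {x. S *v x = 0} < dim {x. S' *v x = 0}"
      by (metis dim_psubset span_eq_iff)
    have le: "dim {x. S' *v x = 0} \<le> CARD('n)"
      using dim_subset_UNIV_cart by blast
    have "CARD('n) - dim {x. S' *v x = 0} < CARD('n) - dim {x. S *v x = 0}"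
      using d le by linarith
    from less(1)[OF this psd] obtain c k where k: "k \<le> CARD('n) - dim {x. S' *v x = 0}"
      and c: "\<And>i j. S' $ i $ j = (\<Sum>t<k. c t $ i * c t $ j)" by blast
    show ?thesis
    proof (intro exI conjI allI)
      show "Suc k \<le> CARD('n) - dim {x. S *v x = 0}" using k d le by linarith
      fix i j
      have "S $ i $ j = S' $ i $ j + v $ i * v $ j" by (simp add: S'_def)
      also have "\<dots> = (\<Sum>t<Suc k. (c(k := v)) t $ i * (c(k := v)) t $ j)"
        unfolding c by simp
      finally show "S $ i $ j = (\<Sum>t<Suc k. (c(k := v)) t $ i * (c(k := v)) t $ j)" .
    qed
  qed
qed

text \<open>The vectors of the preceding lemma become columns of \<open>A\<close>; their number is
  at most the dimension, and the remaining columns are 0. A square factor can have an inverse, which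
  the whitening of Gaussian noise relies on.\<close>

theorem pos_semidef_factor:
  fixes S :: "real^'n^'n"
  assumes "pos_semidef S"
  obtains A :: "real^'n^'n" where "S = A ** transpose A"
proof -
  obtain c k where k: "k \<le> CARD('n) - dim {x. S *v x = 0}"
    and c: "\<And>i j. S $ i $ j = (\<Sum>t<k. c t $ i * c t $ j)"
    using pos_semidef_sum_of_squares[OF assms] by blast
  obtain f where f: "bij_betw f (UNIV::'n set) {..<CARD('n)}"
    using ex_bij_betw_finite_nat[of "UNIV::'n set"] by (auto simp: lessThan_atLeast0)
  define A where "A = (\<chi> i j. if f j < k then c (f j) $ i else 0)"
  have "S = A ** transpose A"
  proof (simp add: vec_eq_iff matrix_matrix_mult_def, intro allI)
    fix i j
    have "S $ i $ j = (\<Sum>t<CARD('n). if t < k then c t $ i * c t $ j else 0)"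
      unfolding c using k by (intro sum.mono_neutral_cong_left) auto
    also have "\<dots> = (\<Sum>l\<in>UNIV. if f l < k then c (f l) $ i * c (f l) $ j else 0)"
      by (rule sum.reindex_bij_betw[OF f, symmetric])
    also have "\<dots> = (\<Sum>l\<in>UNIV. A $ i $ l * transpose A $ l $ j)"
      by (rule sum.cong) (auto simp: A_def transpose_def)
    finally show "S $ i $ j = (\<Sum>l\<in>UNIV. A $ i $ l * transpose A $ l $ j)" .
  qed
  then show ?thesis by (rule that)
qed

lemma pos_def_factor:
  fixes S :: "real^'n^'n"
  assumes "pos_def S"
  obtains A :: "real^'n^'n" where "S = A ** transpose A" "invertible A"
proof -
  have "pos_semidef S"
    unfolding pos_semidef_def
  proof (intro conjI allI)
    show "0 \<le> x \<bullet> (S *v x)" for x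
      using assms by (cases "x = 0") (auto simp: pos_def_def intro: less_imp_le)
  qed (use assms in \<open>simp add: pos_def_def\<close>)
  then obtain A :: "real^'n^'n" where A: "S = A ** transpose A" by (rule pos_semidef_factor)
  have "inj ((*v) (transpose A))"
  proof (rule injI)
    fix x y assume "transpose A *v x = transpose A *v y"
    then have "S *v (x - y) = 0"
      by (simp add: A matrix_vector_mult_diff_distrib flip: matrix_vector_mul_assoc)
    then have "\<not> 0 < (x - y) \<bullet> (S *v (x - y))" by simp
    then show "x = y" using assms unfolding pos_def_def by (metis right_minus_eq)
  qed
  then have "invertible (transpose A)"
    using invertible_left_inverse matrix_left_invertible_injective by blast
  then have "invertible A" by (simp add: invertible_det_nz)
  with A show ?thesis by (rule that)
qed

lemma pos_def_det: "pos_def S \<Longrightarrow> 0 < det S"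
  by (erule pos_def_factor) (simp add: det_mul det_transpose invertible_det_nz zero_less_mult_iff linorder_neq_iff disj_commute)

lemma pos_def_invertible: "pos_def S \<Longrightarrow> invertible S"
  by (auto simp: invertible_det_nz dest: pos_def_det)

section \<open>Closure properties of semidefinite and definite matrices\<close>

lemma pos_semidef_congruence:
  fixes S :: "real^'n^'n" and H :: "real^'n^'m"
  assumes "pos_semidef S" shows "pos_semidef (H ** S ** transpose H)"
  using assms unfolding pos_semidef_def
  by (auto simp: matrix_transpose_mul matrix_mul_assoc inner_matrix_vector[of _ H] simp flip: matrix_vector_mul_assoc)

lemma transpose_add: "transpose (A + B) = transpose A + transpose (B::real^'n^'m)"
  by (simp add: vec_eq_iff transpose_def)

lemma transpose_minus: "transpose (A - B) = transpose A - transpose (B::real^'n^'m)"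
  by (simp add: vec_eq_iff transpose_def)

lemma pos_semidef_add: "pos_semidef A \<Longrightarrow> pos_semidef B \<Longrightarrow> pos_semidef (A + B)"
  by (auto simp: pos_semidef_def transpose_add matrix_vector_mult_add_rdistrib inner_add_right)

lemma pos_def_add: "pos_def A \<Longrightarrow> pos_semidef B \<Longrightarrow> pos_def (A + B)"
  by (auto simp: pos_def_def pos_semidef_def transpose_add matrix_vector_mult_add_rdistrib inner_add_right
      intro: add_pos_nonneg)

lemma pos_def_mat_1: "pos_def (mat 1)"
  by (auto simp: pos_def_def)

lemma pos_def_mat_1_add: "pos_semidef B \<Longrightarrow> pos_def (mat 1 + B)"
  by (rule pos_def_add[OF pos_def_mat_1])

lemma pos_semidef_zero: "pos_semidef 0"
  by (auto simp: pos_semidef_def transpose_def vec_eq_iff)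

lemma transpose_scaleR: "transpose (c *\<^sub>R A) = c *\<^sub>R transpose (A::real^'n^'m)"
  by (simp add: vec_eq_iff transpose_def)

lemma pos_semidef_scaleR: "0 \<le> c \<Longrightarrow> pos_semidef A \<Longrightarrow> pos_semidef (c *\<^sub>R A)"
  by (auto simp: pos_semidef_def transpose_scaleR scaleR_matrix_vector_assoc[symmetric])

lemma trace_mult_transpose: "trace (A ** transpose A) = (\<Sum>i\<in>UNIV. (norm (row i A))\<^sup>2)"
  for A :: "real^'m^'n"
  by (simp add: trace_def matrix_matrix_mult_def transpose_def row_def power2_norm_eq_inner inner_vec_def)

text \<open>An entry of \<open>A A^T\<close> is an inner product of two rows of \<open>A\<close>,
  each of norm at most the square root of the trace. This is what bounds
  \<open>cov_set\<close>.\<close>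

lemma pos_semidef_entry_le_trace:
  fixes S :: "real^'n^'n"
  assumes "pos_semidef S"
  shows "\<bar>S $ i $ j\<bar> \<le> trace S"
proof -
  from assms obtain A :: "real^'n^'n" where A: "S = A ** transpose A" by (rule pos_semidef_factor)
  have "\<bar>S $ i $ j\<bar> = \<bar>row i A \<bullet> row j A\<bar>"
    by (simp add: A matrix_matrix_mult_def transpose_def row_def inner_vec_def)
  also have "\<dots> \<le> norm (row i A) * norm (row j A)" by (rule Cauchy_Schwarz_ineq2)
  also have "\<dots> \<le> sqrt (trace S) * sqrt (trace S)"
    unfolding A trace_mult_transpose
    by (intro mult_mono real_le_rsqrt member_le_sum) (auto intro: sum_nonneg)
  also have "\<dots> = trace S"
    unfolding A trace_mult_transpose by (simp add: sum_nonneg)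
  finally show ?thesis .
qed

section \<open>Continuity, and compactness of the set of covariances\<close>

lemma continuous_on_matrix_mult [continuous_intros]:
  fixes f :: "'a::topological_space \<Rightarrow> real^'n^'m" and g :: "'a \<Rightarrow> real^'k^'n"
  assumes "continuous_on S f" "continuous_on S g"
  shows "continuous_on S (\<lambda>x. f x ** g x)"
  unfolding matrix_matrix_mult_def by (intro continuous_intros assms)

lemma continuous_on_transpose [continuous_intros]:
  fixes f :: "'a::topological_space \<Rightarrow> real^'n^'m"
  assumes "continuous_on S f" shows "continuous_on S (\<lambda>x. transpose (f x))"
  unfolding transpose_def by (intro continuous_intros assms)

lemma continuous_on_trace [continuous_intros]:
  fixes f :: "'a::topological_space \<Rightarrow> real^'n^'n"
  assumes "continuous_on S f" shows "continuous_on S (\<lambda>x. trace (f x))"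
  unfolding trace_def by (intro continuous_intros assms)

lemma continuous_on_det [continuous_intros]:
  fixes f :: "'a::topological_space \<Rightarrow> real^'n^'n"
  assumes "continuous_on S f" shows "continuous_on S (\<lambda>x. det (f x))"
  unfolding det_def by (intro continuous_intros assms)

lemma continuous_on_matrix_vector [continuous_intros]:
  fixes f :: "'a::topological_space \<Rightarrow> real^'n^'m" and g :: "'a \<Rightarrow> real^'n"
  assumes "continuous_on S f" "continuous_on S g"
  shows "continuous_on S (\<lambda>x. f x *v g x)"
  unfolding matrix_vector_mult_def by (intro continuous_intros assms)

text \<open>Each defining condition is closed, one for every test vector \<open>x\<close>, and the
  trace bounds all entries. Compactness is what makes the maxima attained.\<close>

lemma compact_cov_set: "compact (cov_set P :: (real^'n^'n) set)"
proof -
  have "cov_set P = {S::real^'n^'n. transpose S = S} \<inter> (\<Inter>x. {S. 0 \<le> x \<bullet> (S *v x)}) \<inter> {S. trace S \<le> P}"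
    by (auto simp: cov_set_def pos_semidef_def)
  also have "closed \<dots>"
    by (intro closed_Int closed_INT closed_Collect_eq closed_Collect_le ballI continuous_intros)
  finally have "closed (cov_set P :: (real^'n^'n) set)" .
  moreover have "norm S \<le> (\<Sum>i\<in>(UNIV::'n set). \<Sum>j\<in>(UNIV::'n set). P)" if "S \<in> cov_set P" for S :: "real^'n^'n"
  proof -
    have "norm S \<le> (\<Sum>i\<in>UNIV. norm (S $ i))"
      unfolding norm_vec_def by (rule L2_set_le_sum) simp
    also have "\<dots> \<le> (\<Sum>i\<in>UNIV. \<Sum>j\<in>UNIV. \<bar>S $ i $ j\<bar>)"
      by (intro sum_mono norm_le_l1_cart)
    also have "\<dots> \<le> (\<Sum>i\<in>(UNIV::'n set). \<Sum>j\<in>(UNIV::'n set). P)"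
      using that by (intro sum_mono) (auto simp: cov_set_def intro: order_trans[OF pos_semidef_entry_le_trace])
    finally show ?thesis .
  qed
  then have "bounded (cov_set P :: (real^'n^'n) set)" unfolding bounded_iff by blast
  ultimately show ?thesis by (simp add: compact_eq_bounded_closed)
qed

lemma zero_in_cov_set: "0 \<le> P \<Longrightarrow> 0 \<in> cov_set P"
  by (simp add: cov_set_def pos_semidef_zero trace_0[unfolded mat_0])

section \<open>Standard Gaussian vectors\<close>

lemma matrix_inv_right: "invertible A \<Longrightarrow> A ** matrix_inv A = mat 1"
  and matrix_inv_left: "invertible A \<Longrightarrow> matrix_inv A ** A = mat 1" for A :: "real^'n^'n"
  unfolding matrix_inv_def invertible_def by (metis (mono_tags, lifting) someI_ex)+

lemma inner_matrix_vector': "(A *v x) \<bullet> y = x \<bullet> (transpose A *v y)" for A :: "real^'n^'m"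
  using inner_matrix_vector[of y A x] by (simp only: inner_commute)

lemma matrix_add_rdistrib: "(A + B) ** C = A ** C + B ** (C::real^'k^'n)" for A :: "real^'n^'m"
  by (simp add: vec_eq_iff matrix_matrix_mult_def sum.distrib algebra_simps)

definition gauss_pdf :: "real^'n \<Rightarrow> real" where
  "gauss_pdf z = (\<Prod>i\<in>UNIV. std_normal_density (z $ i))"

lemma gauss_pdf_eq: "gauss_pdf (z::real^'n) = exp (- (norm z)\<^sup>2 / 2) / sqrt (2 * pi) ^ CARD('n)"
proof -
  have "(norm z)\<^sup>2 = (\<Sum>i\<in>UNIV. (z $ i)\<^sup>2)"
    by (simp only: power2_norm_eq_inner inner_vec_def) (simp add: power2_eq_square)
  then have "- (norm z)\<^sup>2 / 2 = (\<Sum>i\<in>UNIV. - (z $ i)\<^sup>2 / 2)"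
    by (simp add: sum_divide_distrib sum_negf)
  then have "exp (- (norm z)\<^sup>2 / 2) = (\<Prod>i\<in>UNIV. exp (- (z $ i)\<^sup>2 / 2))"
    by (simp only: exp_sum[OF finite])
  then show ?thesis
    unfolding gauss_pdf_def std_normal_density_def
    by (simp add: prod_dividef)
qed

lemma gauss_pdf_pos: "0 < gauss_pdf z"
  by (simp add: gauss_pdf_eq)

lemma borel_measurable_gauss_pdf [measurable]: "gauss_pdf \<in> borel_measurable borel"
  unfolding gauss_pdf_def by measurable

lemma std_gaussian_alt: "std_gaussian = density lborel (\<lambda>z. ennreal (gauss_pdf z))"
  by (simp add: std_gaussian_def gauss_pdf_def)

lemma space_std_gaussian [simp]: "space std_gaussian = UNIV"
  and sets_std_gaussian [simp, measurable_cong]: "sets std_gaussian = sets borel"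
  by (simp_all add: std_gaussian_def)

lemma nn_integral_std_gaussian:
  assumes [measurable]: "f \<in> borel_measurable borel"
  shows "(\<integral>\<^sup>+z. f z \<partial>std_gaussian) = (\<integral>\<^sup>+z. ennreal (gauss_pdf z) * f z \<partial>lborel)"
  unfolding std_gaussian_alt by (subst nn_integral_density) auto

lemma nn_integral_std_gaussian_prod:
  fixes f :: "'n::finite \<Rightarrow> real \<Rightarrow> ennreal"
  assumes [measurable]: "\<And>i. f i \<in> borel_measurable borel"
  shows "(\<integral>\<^sup>+z. (\<Prod>i\<in>UNIV. f i (z $ i)) \<partial>std_gaussian)
    = (\<Prod>i\<in>UNIV. \<integral>\<^sup>+x. f i x \<partial>density lborel std_normal_density)"
proof -
  have "(\<integral>\<^sup>+z. (\<Prod>i\<in>UNIV. f i (z $ i)) \<partial>std_gaussian)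
     = (\<integral>\<^sup>+z. (\<Prod>i\<in>UNIV. ennreal (std_normal_density (z $ i)) * f i (z $ i)) \<partial>lborel)"
    by (subst nn_integral_std_gaussian)
      (auto simp: gauss_pdf_def prod.distrib prod_ennreal intro!: borel_measurable_prod)
  also have "\<dots> = (\<Prod>i\<in>UNIV. \<integral>\<^sup>+x. ennreal (std_normal_density x) * f i x \<partial>lborel)"
    by (subst nn_integral_lborel_cart_prod) auto
  finally show ?thesis by (simp add: nn_integral_density)
qed

interpretation std_normal: prob_space "density lborel std_normal_density"
  by (rule prob_space_normal_density) simp

interpretation std_gaussian: prob_space "std_gaussian :: (real^'n) measure"
proof
  have "emeasure (std_gaussian :: (real^'n) measure) UNIV = (\<integral>\<^sup>+z. (\<Prod>i\<in>(UNIV::'n set). 1) \<partial>(std_gaussian :: (real^'n) measure))"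
    by simp
  also have "\<dots> = 1"
    using std_normal.emeasure_space_1 by (subst nn_integral_std_gaussian_prod) auto
  finally show "emeasure (std_gaussian :: (real^'n) measure) (space std_gaussian) = 1" by simp
qed

lemma emeasure_std_gaussian_UNIV [simp]: "emeasure (std_gaussian :: (real^'n) measure) UNIV = 1"
  using std_gaussian.emeasure_space_1[where 'n='n] by simp

lemma nn_integral_gauss_pdf [simp]: "(\<integral>\<^sup>+z. ennreal (gauss_pdf (z::real^'n)) \<partial>lborel) = 1"
  using nn_integral_std_gaussian[of "\<lambda>_::real^'n. 1"] by simp

lemma nn_integral_gauss_pdf_matrix:
  fixes C :: "real^'n^'n"
  assumes "invertible C"
  shows "(\<integral>\<^sup>+z. ennreal (gauss_pdf (C *v z)) \<partial>lborel) = ennreal (1 / \<bar>det C\<bar>)" (is "?X = _")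
proof -
  have d: "0 < \<bar>det C\<bar>" using assms by (simp add: invertible_det_nz)
  have "ennreal \<bar>det C\<bar> * ?X = 1"
    using nn_integral_matrix[OF _ assms, of "\<lambda>g. ennreal (gauss_pdf g)"] by simp
  then have "ennreal (1 / \<bar>det C\<bar>) * (ennreal \<bar>det C\<bar> * ?X) = ennreal (1 / \<bar>det C\<bar>)" by simp
  moreover have "ennreal (1 / \<bar>det C\<bar>) * ennreal \<bar>det C\<bar> = 1"
    using d by (subst ennreal_mult[symmetric]) auto
  ultimately show ?thesis by (simp flip: mult.assoc)
qed

lemma distr_std_gaussian_component:
  "distr (std_gaussian :: (real^'n) measure) borel (\<lambda>z. z $ i) = density lborel std_normal_density"
proof (rule measure_eqI)
  fix A assume "A \<in> sets (distr (std_gaussian :: (real^'n) measure) borel (\<lambda>z. z $ i))"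
  then have [measurable]: "A \<in> sets borel" by simp
  \<comment> \<open>The product formula is tested with the indicator in coordinate \<open>i\<close>
    and the constant 1 in all others.\<close>
  have "emeasure (distr (std_gaussian :: (real^'n) measure) borel (\<lambda>z. z $ i)) A
     = (\<integral>\<^sup>+z. (\<Prod>j\<in>UNIV. (if j = i then indicator A (z $ j) else 1)) \<partial>(std_gaussian :: (real^'n) measure))"
  proof -
    have "emeasure (distr (std_gaussian :: (real^'n) measure) borel (\<lambda>z. z $ i)) A
       = (\<integral>\<^sup>+x. indicator A x \<partial>distr (std_gaussian :: (real^'n) measure) borel (\<lambda>z. z $ i))" by simp
    then show ?thesis by (subst (asm) nn_integral_distr) simp_all
  qed
  also have "\<dots> = (\<Prod>j\<in>(UNIV::'n set). \<integral>\<^sup>+x. (if j = i then indicator A x else 1) \<partial>density lborel std_normal_density)"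
    by (rule nn_integral_std_gaussian_prod) measurable
  also have "\<dots> = (\<Prod>j\<in>(UNIV::'n set). if j = i then emeasure (density lborel std_normal_density) A else 1)"
    using std_normal.emeasure_space_1 by (intro prod.cong) auto
  finally show "emeasure (distr (std_gaussian :: (real^'n) measure) borel (\<lambda>z. z $ i)) A
    = emeasure (density lborel std_normal_density) A" by simp
qed simp

lemma nn_integral_std_gaussian_matrix:
  fixes B :: "real^'n^'n"
  assumes [measurable]: "h \<in> borel_measurable borel" and B: "invertible B"
  shows "(\<integral>\<^sup>+k. h (B *v k) \<partial>std_gaussian)
     = (\<integral>\<^sup>+y. ennreal (gauss_pdf (matrix_inv B *v y) / \<bar>det B\<bar>) * h y \<partial>lborel)"
proof -
  have d: "det B \<noteq> 0" using B by (simp add: invertible_det_nz)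
  have i: "matrix_inv B ** B = mat 1" using B by (rule matrix_inv_left)
  have v: "matrix_inv B *v (B *v x) = x" for x by (simp add: matrix_vector_mul_assoc i)
  have "(\<integral>\<^sup>+y. ennreal (gauss_pdf (matrix_inv B *v y) / \<bar>det B\<bar>) * h y \<partial>lborel)
     = (\<integral>\<^sup>+k. ennreal (\<bar>det B\<bar>) * (ennreal (gauss_pdf k / \<bar>det B\<bar>) * h (B *v k)) \<partial>lborel)"
    by (subst nn_integral_matrix[OF _ B], measurable) (simp add: nn_integral_cmult v)
  also have "\<dots> = (\<integral>\<^sup>+k. ennreal (gauss_pdf k) * h (B *v k) \<partial>lborel)"
    using d by (intro nn_integral_cong)
      (simp add: gauss_pdf_pos[THEN less_imp_le] flip: mult.assoc ennreal_mult)
  finally show ?thesis by (simp add: nn_integral_std_gaussian)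
qed

lemma gauss_pdf_orthogonal: "orthogonal_matrix B \<Longrightarrow> gauss_pdf (B *v z) = gauss_pdf (z::real^'n)"
  using orthogonal_transformation_matrix[of "(*v) B"]
  by (simp add: gauss_pdf_eq orthogonal_transformation matrix_vector_mul_linear)

lemma distr_std_gaussian_orthogonal:
  fixes B :: "real^'n^'n"
  assumes B: "B ** transpose B = mat 1"
  shows "distr std_gaussian borel ((*v) B) = std_gaussian"
proof (rule measure_eqI)
  have B': "transpose B ** B = mat 1" using B matrix_left_right_inverse by blast
  then have inv: "invertible B" using B by (auto simp: invertible_def)
  have o: "orthogonal_matrix B" using B B' by (simp add: orthogonal_matrix_def)
  have d: "\<bar>det B\<bar> = 1" using det_orthogonal_matrix[OF o] by auto
  fix A assume "A \<in> sets (distr (std_gaussian :: (real^'n) measure) borel ((*v) B))"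
  then have [measurable]: "A \<in> sets borel" by simp
  have "emeasure std_gaussian A = (\<integral>\<^sup>+z. ennreal (gauss_pdf z) * indicator A z \<partial>lborel)"
    by (subst nn_integral_std_gaussian[symmetric]) auto
  also have "\<dots> = (\<integral>\<^sup>+z. ennreal (gauss_pdf z) * indicator A (B *v z) \<partial>lborel)"
    by (subst nn_integral_matrix[OF _ inv], measurable) (simp add: d gauss_pdf_orthogonal[OF o])
  also have "\<dots> = (\<integral>\<^sup>+z. indicator A (B *v z) \<partial>std_gaussian)"
    by (subst nn_integral_std_gaussian) auto
  also have "\<dots> = (\<integral>\<^sup>+z. indicator A z \<partial>distr std_gaussian borel ((*v) B))"
    by (subst nn_integral_distr) auto
  also have "\<dots> = emeasure (distr std_gaussian borel ((*v) B)) A" by simp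
  finally show "emeasure (distr std_gaussian borel ((*v) B)) A = emeasure std_gaussian A" ..
qed simp

section \<open>Second moments\<close>

lemma std_gaussian_component_moments:
  shows "has_bochner_integral (std_gaussian :: (real^'n) measure) (\<lambda>z. z $ i) 0"
    and "has_bochner_integral (std_gaussian :: (real^'n) measure) (\<lambda>z. (z $ i)\<^sup>2) 1"
proof -
  have 1: "has_bochner_integral (density lborel std_normal_density) (\<lambda>x. x ^ k) r"
    if "has_bochner_integral lborel (\<lambda>x. std_normal_density x * x ^ k) r" for k r
    using that by (subst has_bochner_integral_density) auto
  have 2: "has_bochner_integral (std_gaussian :: (real^'n) measure) (\<lambda>z. (z $ i) ^ k) r"
    if "has_bochner_integral lborel (\<lambda>x. std_normal_density x * x ^ k) r" for k r
    using 1[OF that] unfolding distr_std_gaussian_component[symmetric, of i]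
    by (auto simp: has_bochner_integral_iff integrable_distr_eq integral_distr)
  show "has_bochner_integral (std_gaussian :: (real^'n) measure) (\<lambda>z. z $ i) 0"
    using 2[OF std_normal_moment_odd[of 0]] by simp
  show "has_bochner_integral (std_gaussian :: (real^'n) measure) (\<lambda>z. (z $ i)\<^sup>2) 1"
    using 2[OF std_normal_moment_even[of 1]] by simp
qed

lemma std_gaussian_mixed_moment:
  "has_bochner_integral (std_gaussian :: (real^'n) measure) (\<lambda>z. z $ i * z $ j) (if i = j then 1 else 0)"
proof (cases "i = j")
  case True
  have "has_bochner_integral (std_gaussian :: (real^'n) measure) (\<lambda>z. z $ j * z $ j) 1"
    using std_gaussian_component_moments(2)[of j] unfolding power2_eq_square .
  then show ?thesis using True by simp
next
  case False
  have "integrable (std_gaussian :: (real^'n) measure) (\<lambda>z. (z $ k)\<^sup>2)" for k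
    using std_gaussian_component_moments(2)[of k] by (simp add: has_bochner_integral_iff)
  then have "integrable (std_gaussian :: (real^'n) measure) (\<lambda>z. (z $ i)\<^sup>2 + (z $ j)\<^sup>2)"
    by (intro Bochner_Integration.integrable_add)
  then have int: "integrable (std_gaussian :: (real^'n) measure) (\<lambda>z. z $ i * z $ j)"
  proof (rule Bochner_Integration.integrable_bound)
    have "norm (x * y) \<le> norm (x\<^sup>2 + y\<^sup>2)" for x y :: real
    proof -
      have "2 * (\<bar>x\<bar> * \<bar>y\<bar>) \<le> x\<^sup>2 + y\<^sup>2"
        using sum_squares_bound[of "\<bar>x\<bar>" "\<bar>y\<bar>"] by simp
      moreover have "0 \<le> \<bar>x\<bar> * \<bar>y\<bar>" by simp
      ultimately have "\<bar>x\<bar> * \<bar>y\<bar> \<le> x\<^sup>2 + y\<^sup>2" by linarith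
      then show ?thesis by (simp add: abs_mult)
    qed
    then show "AE z in (std_gaussian :: (real^'n) measure). norm (z $ i * z $ j) \<le> norm ((z $ i)\<^sup>2 + (z $ j)\<^sup>2)"
      by auto
  qed simp
  \<comment> \<open>Reflecting coordinate \<open>i\<close> preserves the law and reverses the sign
    of \<open>z $ i * z $ j\<close>, so the mean equals its own negative.\<close>
  define s :: "'n \<Rightarrow> real" where "s k = (if k = i then -1 else 1)" for k
  define B :: "real^'n^'n" where "B = (\<chi> k l. if l = k then s k else 0)"
  have Bz: "(B *v z) $ k = s k * z $ k" for z k
    by (simp add: B_def matrix_vector_mult_def if_distrib[of "\<lambda>x. x * y" for y] cong: if_cong)
  have "B ** transpose B = mat 1"
    by (auto simp: B_def matrix_matrix_mult_def transpose_def mat_def vec_eq_iff s_def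
        if_distrib[of "\<lambda>x. x * y" for y] cong: if_cong)
  from distr_std_gaussian_orthogonal[OF this]
  have "(\<integral>z. z $ i * z $ j \<partial>(std_gaussian :: (real^'n) measure)) = (\<integral>z. z $ i * z $ j \<partial>distr std_gaussian borel ((*v) B))"
    by simp
  also have "\<dots> = - (\<integral>z. z $ i * z $ j \<partial>(std_gaussian :: (real^'n) measure))"
    using False by (subst integral_distr) (auto simp: Bz s_def)
  finally show ?thesis using int False by (simp add: has_bochner_integral_iff)
qed

text \<open>Linear terms and products of distinct coordinates have mean 0. The formula serves twice:
  for the mean log-likelihood ratio in the converse and for the mean power of a random
  codebook.\<close>

lemma std_gaussian_norm_affine:
  fixes A :: "real^'m^'n"
  shows "has_bochner_integral std_gaussian (\<lambda>g. (norm (a + A *v g))\<^sup>2) ((norm a)\<^sup>2 + trace (A ** transpose A))"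
proof -
  have "has_bochner_integral std_gaussian
     (\<lambda>g. \<Sum>i\<in>UNIV. (a $ i)\<^sup>2 + 2 * a $ i * (\<Sum>k\<in>UNIV. A $ i $ k * g $ k)
         + (\<Sum>k\<in>UNIV. \<Sum>l\<in>UNIV. A $ i $ k * A $ i $ l * (g $ k * g $ l)))
     (\<Sum>i\<in>UNIV. (a $ i)\<^sup>2 + 2 * a $ i * (\<Sum>k\<in>UNIV. A $ i $ k * 0)
         + (\<Sum>k\<in>UNIV. \<Sum>l\<in>UNIV. A $ i $ k * A $ i $ l * (if k = l then 1 else 0)))"
    by (intro has_bochner_integral_sum has_bochner_integral_add has_bochner_integral_mult_right
        std_gaussian_component_moments std_gaussian_mixed_moment)
      (auto simp: has_bochner_integral_iff std_gaussian.prob_space[unfolded space_std_gaussian])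
  moreover have "(\<Sum>i\<in>UNIV. (a $ i)\<^sup>2 + 2 * a $ i * (\<Sum>k\<in>UNIV. A $ i $ k * g $ k)
         + (\<Sum>k\<in>UNIV. \<Sum>l\<in>UNIV. A $ i $ k * A $ i $ l * (g $ k * g $ l))) = (norm (a + A *v g))\<^sup>2" for g
    unfolding power2_norm_eq_inner inner_vec_def
    by (rule sum.cong) (auto simp: matrix_vector_mult_def algebra_simps power2_eq_square sum_product)
  moreover have "(\<Sum>i\<in>UNIV. (a $ i)\<^sup>2 + 2 * a $ i * (\<Sum>k\<in>UNIV. A $ i $ k * 0)
         + (\<Sum>k\<in>UNIV. \<Sum>l\<in>UNIV. A $ i $ k * A $ i $ l * (if k = l then 1 else 0)))
      = (norm a)\<^sup>2 + trace (A ** transpose A)"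
    unfolding power2_norm_eq_inner inner_vec_def
    by (simp add: trace_def matrix_matrix_mult_def transpose_def sum.distrib
        power2_eq_square if_distrib cong: if_cong)
  ultimately show ?thesis by simp
qed

text \<open>Completing the square in \<open>g\<close> splits the joint density of \<open>g\<close>
  and \<open>y = A g + z\<close> into a Gaussian density in \<open>g\<close>, centred at a linear
  function of \<open>y\<close>, and a Gaussian density in \<open>y\<close>. The first factor
  integrates to a constant that is the same for all \<open>y\<close>.\<close>

lemma nn_integral_std_gaussian_sum_identity:
  fixes A :: "real^'m^'n" and B :: "real^'n^'n"
  assumes [measurable]: "h \<in> borel_measurable borel"
    and BB: "B ** transpose B = mat 1 + A ** transpose A"
  shows "(\<integral>\<^sup>+g. \<integral>\<^sup>+z. h (A *v g + z) \<partial>std_gaussian \<partial>std_gaussian) = (\<integral>\<^sup>+k. h (B *v k) \<partial>std_gaussian)"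
proof -
  \<comment> \<open>The inverse of the conditional covariance of \<open>g\<close> given
    \<open>y\<close>.\<close>
  define M where "M = mat 1 + transpose A ** A"
  have "pos_def M" "pos_def (B ** transpose B)"
    unfolding M_def BB using pos_semidef_mult_transpose[of "transpose A"] pos_semidef_mult_transpose[of A]
    by (auto intro!: pos_def_mat_1_add)
  then have invBB: "invertible (B ** transpose B)" and dBB: "0 < det (B ** transpose B)"
    by (auto intro: pos_def_invertible pos_def_det)
  from dBB have dB: "det B \<noteq> 0" by (auto simp: det_mul)
  then have iB: "invertible B" by (simp add: invertible_det_nz)
  from \<open>pos_def M\<close> obtain C' :: "real^'m^'m" where M: "M = C' ** transpose C'" and "invertible C'" by (rule pos_def_factor)
  define C where "C = transpose C'"
  have M: "M = transpose C ** C" and iC: "invertible C"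
    using M \<open>invertible C'\<close> by (auto simp: C_def invertible_det_nz)
  have dC: "det C \<noteq> 0" using iC by (simp add: invertible_det_nz)
  have iM: "invertible M" using \<open>pos_def M\<close> by (rule pos_def_invertible)
  \<comment> \<open>\<open>G *v y\<close> is the conditional mean of \<open>g\<close> given
    \<open>y\<close>; \<open>MG\<close> is its normal equation.\<close>
  define G where "G = matrix_inv M ** transpose A"
  have MG: "M *v (G *v y) = transpose A *v y" for y
    by (simp add: G_def matrix_vector_mul_assoc matrix_mul_assoc matrix_inv_right[OF iM])
  have Mv: "M *v g = g + transpose A *v (A *v g)" for g
    by (simp add: M_def matrix_vector_mult_add_rdistrib matrix_vector_mul_assoc)
  have square: "(norm g)\<^sup>2 + (norm (y - A *v g))\<^sup>2
      = (norm (C *v (g - G *v y)))\<^sup>2 + (norm (matrix_inv B *v y))\<^sup>2" for g y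
  proof -
    \<comment> \<open>The residual solves \<open>(B B^T) r = y\<close>, hence
      \<open>B^{-1} y = B^T r\<close>. This evaluates the square in \<open>y\<close> without
      inverting \<open>B B^T\<close>.\<close>
    define r where "r = y - A *v (G *v y)"
    have "(B ** transpose B) *v r = r + A *v (transpose A *v r)"
      unfolding BB matrix_vector_mult_add_rdistrib matrix_vector_mul_assoc[symmetric] matrix_vector_mul_lid ..
    also have "transpose A *v r = transpose A *v y - transpose A *v (A *v (G *v y))"
      by (simp only: r_def matrix_vector_mult_diff_distrib)
    also have "transpose A *v y = G *v y + transpose A *v (A *v (G *v y))"
      using MG[of y] Mv[of "G *v y"] by simp
    also have "r + A *v (G *v y + transpose A *v (A *v (G *v y)) - transpose A *v (A *v (G *v y))) = y"
      by (simp only: add_diff_cancel_right' r_def diff_add_cancel)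
    finally have r: "B *v (transpose B *v r) = y"
      by (simp only: matrix_vector_mul_assoc)
    have "matrix_inv B *v (B *v (transpose B *v r)) = transpose B *v r"
      using matrix_inv_left[OF iB] by (metis matrix_vector_mul_assoc matrix_vector_mul_lid)
    then have "matrix_inv B *v y = transpose B *v r" unfolding r .
    then have "(norm (matrix_inv B *v y))\<^sup>2 = r \<bullet> (B *v (transpose B *v r))"
      by (subst inner_matrix_vector) (simp add: power2_norm_eq_inner)
    also have "\<dots> = y \<bullet> y - (G *v y) \<bullet> (transpose A *v y)"
      unfolding r by (simp only: r_def inner_diff_left inner_matrix_vector')
    finally have 1: "(norm (matrix_inv B *v y))\<^sup>2 = y \<bullet> y - (G *v y) \<bullet> (transpose A *v y)" .
    have "(norm (C *v (g - G *v y)))\<^sup>2 = (g - G *v y) \<bullet> (M *v (g - G *v y))"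
      unfolding M power2_norm_eq_inner inner_matrix_vector' matrix_vector_mul_assoc ..
    also have "\<dots> = (g - G *v y) \<bullet> (M *v g) - (g - G *v y) \<bullet> (transpose A *v y)"
      by (simp only: matrix_vector_mult_diff_distrib MG inner_diff_right)
    also have "(g - G *v y) \<bullet> (M *v g) = g \<bullet> (M *v g) - g \<bullet> (M *v (G *v y))"
    proof -
      have "transpose M = M" by (simp add: M matrix_transpose_mul)
      then have "(G *v y) \<bullet> (M *v g) = g \<bullet> (M *v (G *v y))"
        by (subst inner_matrix_vector) (simp add: inner_commute)
      then show ?thesis by (simp only: inner_diff_left)
    qed
    finally have "(norm (C *v (g - G *v y)))\<^sup>2
      = g \<bullet> (M *v g) - g \<bullet> (M *v (G *v y)) - (g - G *v y) \<bullet> (transpose A *v y)" .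
    note that = this
    have 2: "(norm (C *v (g - G *v y)))\<^sup>2 = g \<bullet> g + (A *v g) \<bullet> (A *v g) - 2 * (g \<bullet> (transpose A *v y)) + (G *v y) \<bullet> (transpose A *v y)"
    proof -
      have "g \<bullet> (M *v (G *v y)) = g \<bullet> (transpose A *v y)" by (simp only: MG)
      moreover have "g \<bullet> (M *v g) = g \<bullet> g + (A *v g) \<bullet> (A *v g)"
        by (simp only: Mv inner_add_right inner_matrix_vector')
      ultimately show ?thesis
        using that by (simp only: inner_diff_left)
    qed
    have 3: "(A *v g) \<bullet> y = g \<bullet> (transpose A *v y)"
      by (rule inner_matrix_vector')
    then have 4: "y \<bullet> (A *v g) = g \<bullet> (transpose A *v y)" by (simp only: inner_commute)
    show ?thesis unfolding 1 2
      unfolding power2_norm_eq_inner inner_diff_left inner_diff_right 3 4 by linarith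
  qed
  have pdf: "gauss_pdf g * gauss_pdf (y - A *v g) = gauss_pdf (C *v (g - G *v y)) * gauss_pdf (matrix_inv B *v y)" for g y
  proof -
    have "- (norm g)\<^sup>2 / 2 + - (norm (y - A *v g))\<^sup>2 / 2
        = - (norm (C *v (g - G *v y)))\<^sup>2 / 2 + - (norm (matrix_inv B *v y))\<^sup>2 / 2"
      using square[of g y] by linarith
    then show ?thesis
      unfolding gauss_pdf_eq times_divide_times_eq exp_add[symmetric] by simp
  qed
  define c where "c = 1 / \<bar>det C\<bar>"
  have c: "0 < c" using dC by (simp add: c_def)
  have inner: "(\<integral>\<^sup>+g. ennreal (gauss_pdf g * gauss_pdf (y - A *v g)) \<partial>lborel) = ennreal (c * gauss_pdf (matrix_inv B *v y))" for y
  proof -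
    have "(\<integral>\<^sup>+g. ennreal (gauss_pdf (C *v (g - G *v y))) \<partial>lborel) = (\<integral>\<^sup>+g. ennreal (gauss_pdf (C *v g)) \<partial>lborel)"
      using nn_integral_lborel_translate[of "\<lambda>g. ennreal (gauss_pdf (C *v g))" "- (G *v y)"] by (simp add: add.commute)
    also have "\<dots> = ennreal c"
      unfolding c_def by (rule nn_integral_gauss_pdf_matrix[OF iC])
    finally have "(\<integral>\<^sup>+g. ennreal (gauss_pdf (C *v (g - G *v y))) \<partial>lborel) = ennreal c" .
    note * = this
    have [measurable]: "(\<lambda>g. gauss_pdf (C *v (g - G *v y))) \<in> borel_measurable borel"
      by (rule measurable_compose[OF _ borel_measurable_gauss_pdf]) measurable
    show ?thesis
      unfolding pdf using c
      by (subst ennreal_mult'', simp add: gauss_pdf_pos[THEN less_imp_le],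
          subst nn_integral_multc, measurable)
        (simp add: * ennreal_mult gauss_pdf_pos[THEN less_imp_le])
  qed
  have main: "(\<integral>\<^sup>+g. \<integral>\<^sup>+z. h (A *v g + z) \<partial>std_gaussian \<partial>std_gaussian)
      = ennreal (c * \<bar>det B\<bar>) * (\<integral>\<^sup>+k. h (B *v k) \<partial>std_gaussian)"
    if [measurable]: "h \<in> borel_measurable borel" for h
  proof -
    have "(\<integral>\<^sup>+g. \<integral>\<^sup>+z. h (A *v g + z) \<partial>std_gaussian \<partial>std_gaussian)
        = (\<integral>\<^sup>+g. ennreal (gauss_pdf g) * (\<integral>\<^sup>+z. ennreal (gauss_pdf z) * h (A *v g + z) \<partial>lborel) \<partial>lborel)"
      by (subst nn_integral_std_gaussian) (auto simp: nn_integral_std_gaussian)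
    also have "\<dots> = (\<integral>\<^sup>+g. \<integral>\<^sup>+y. ennreal (gauss_pdf g * gauss_pdf (y - A *v g)) * h y \<partial>lborel \<partial>lborel)"
    proof (rule nn_integral_cong)
      fix g :: "real^'m"
      have "(\<integral>\<^sup>+z. ennreal (gauss_pdf z) * h (A *v g + z) \<partial>lborel)
         = (\<integral>\<^sup>+y. ennreal (gauss_pdf (y - A *v g)) * h y \<partial>lborel)"
        using nn_integral_lborel_translate[of "\<lambda>y. ennreal (gauss_pdf (y - A *v g)) * h y" "A *v g"] by simp
      then show "ennreal (gauss_pdf g) * (\<integral>\<^sup>+z. ennreal (gauss_pdf z) * h (A *v g + z) \<partial>lborel)
         = (\<integral>\<^sup>+y. ennreal (gauss_pdf g * gauss_pdf (y - A *v g)) * h y \<partial>lborel)"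
        by (simp add: ennreal_mult gauss_pdf_pos[THEN less_imp_le] mult.assoc nn_integral_cmult)
    qed
    also have "\<dots> = (\<integral>\<^sup>+y. \<integral>\<^sup>+g. ennreal (gauss_pdf g * gauss_pdf (y - A *v g)) * h y \<partial>lborel \<partial>lborel)"
      by (rule lborel_pair.Fubini') measurable
    also have "\<dots> = (\<integral>\<^sup>+y. ennreal (c * gauss_pdf (matrix_inv B *v y)) * h y \<partial>lborel)"
      by (simp add: nn_integral_multc inner)
    also have "\<dots> = (\<integral>\<^sup>+y. ennreal (c * \<bar>det B\<bar>) * (ennreal (gauss_pdf (matrix_inv B *v y) / \<bar>det B\<bar>) * h y) \<partial>lborel)"
    proof (rule nn_integral_cong)
      fix y
      have "ennreal (c * gauss_pdf (matrix_inv B *v y))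
        = ennreal (c * \<bar>det B\<bar>) * ennreal (gauss_pdf (matrix_inv B *v y) / \<bar>det B\<bar>)"
        using dB c by (subst ennreal_mult[symmetric]) (auto simp: gauss_pdf_pos less_imp_le)
      then show "ennreal (c * gauss_pdf (matrix_inv B *v y)) * h y
        = ennreal (c * \<bar>det B\<bar>) * (ennreal (gauss_pdf (matrix_inv B *v y) / \<bar>det B\<bar>) * h y)"
        by (simp add: mult.assoc)
    qed
    finally show ?thesis
      by (simp add: nn_integral_cmult nn_integral_std_gaussian_matrix[OF _ iB])
  qed
  \<comment> \<open>Testing with the constant 1 shows that the two determinants cancel, in place of
    the identity \<open>det (I + A^T A) = det (I + A A^T)\<close>.\<close>
  from main[of "\<lambda>_. 1"] have "ennreal (c * \<bar>det B\<bar>) = 1" by simp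
  with main[of h] show ?thesis by simp
qed

text \<open>Whitening by the inverse of \<open>K\<close> reduces a general noise covariance to the
  identity.\<close>

theorem nn_integral_std_gaussian_sum:
  fixes A :: "real^'m^'n" and B K :: "real^'n^'n"
  assumes [measurable]: "h \<in> borel_measurable borel"
    and K: "invertible K" and BB: "B ** transpose B = A ** transpose A + K ** transpose K"
  shows "(\<integral>\<^sup>+g. \<integral>\<^sup>+z. h (A *v g + K *v z) \<partial>std_gaussian \<partial>std_gaussian) = (\<integral>\<^sup>+k. h (B *v k) \<partial>std_gaussian)"
proof -
  let ?K = "matrix_inv K"
  have KK: "K ** ?K = mat 1" "?K ** K = mat 1" using K by (auto simp: matrix_inv_right matrix_inv_left)
  then have KT: "transpose K ** transpose ?K = mat 1" by (metis matrix_transpose_mul transpose_mat)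
  have "(?K ** B) ** transpose (?K ** B) = mat 1 + (?K ** A) ** transpose (?K ** A)"
  proof -
    have "(?K ** B) ** transpose (?K ** B) = ?K ** (B ** transpose B) ** transpose ?K"
      by (simp add: matrix_transpose_mul matrix_mul_assoc)
    also have "\<dots> = ?K ** A ** transpose A ** transpose ?K + (?K ** K) ** (transpose K ** transpose ?K)"
      unfolding BB by (simp add: matrix_add_ldistrib matrix_add_rdistrib matrix_mul_assoc)
    finally show ?thesis by (simp add: KK KT matrix_transpose_mul matrix_mul_assoc)
  qed
  from nn_integral_std_gaussian_sum_identity[OF _ this, of "\<lambda>x. h (K *v x)"]
  show ?thesis
    by (simp add: matrix_vector_right_distrib matrix_vector_mul_assoc matrix_mul_assoc KK)
qed

section \<open>Images and changes of measure for product measures\<close>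

lemma indicator_PiE_restrict:
  assumes "finite I"
  shows "indicator (Pi\<^sub>E I A) (\<lambda>j\<in>I. f j) = (\<Prod>j\<in>I. indicator (A j) (f j) :: ennreal)"
proof (cases "\<forall>j\<in>I. f j \<in> A j")
  case False
  then have "(\<Prod>j\<in>I. indicator (A j) (f j) :: ennreal) = 0"
    using assms by (intro prod_zero) (auto simp: indicator_def)
  with False show ?thesis by (auto simp: indicator_def PiE_iff)
qed (auto simp: indicator_def PiE_iff)

text \<open>Rectangles determine a product measure, so an identity in each coordinate suffices.
  Density and map may differ from one coordinate to the next, as the letters of a codeword
  do.\<close>

lemma nn_integral_PiM_change:
  assumes fin: "finite I" and "prob_space M" and "prob_space Q"
    and D: "\<And>j. j \<in> I \<Longrightarrow> D j \<in> borel_measurable M"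
    and T: "\<And>j. j \<in> I \<Longrightarrow> T j \<in> M \<rightarrow>\<^sub>M Q"
    and eq: "\<And>j A. j \<in> I \<Longrightarrow> A \<in> sets Q \<Longrightarrow> (\<integral>\<^sup>+z. D j z * indicator A (T j z) \<partial>M) = emeasure Q A"
    and h: "h \<in> borel_measurable (Pi\<^sub>M I (\<lambda>_. Q))"
  shows "(\<integral>\<^sup>+z. (\<Prod>j\<in>I. D j (z j)) * h (\<lambda>j\<in>I. T j (z j)) \<partial>Pi\<^sub>M I (\<lambda>_. M)) = (\<integral>\<^sup>+y. h y \<partial>Pi\<^sub>M I (\<lambda>_. Q))"
proof -
  interpret M: product_prob_space "\<lambda>_. M" I by (rule product_prob_spaceI) fact
  interpret Q: product_prob_space "\<lambda>_. Q" I by (rule product_prob_spaceI) fact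
  let ?d = "\<lambda>z. \<Prod>j\<in>I. D j (z j)" and ?T = "\<lambda>z. \<lambda>j\<in>I. T j (z j)"
  have c: "(\<lambda>z. z j) \<in> Pi\<^sub>M I (\<lambda>_. M) \<rightarrow>\<^sub>M M" if "j \<in> I" for j
    using measurable_component_singleton[OF that, of "\<lambda>_. M"] by simp
  have d [measurable]: "?d \<in> borel_measurable (Pi\<^sub>M I (\<lambda>_. M))"
    by (intro borel_measurable_prod_ennreal measurable_compose[OF c] D)
  have t [measurable]: "?T \<in> Pi\<^sub>M I (\<lambda>_. M) \<rightarrow>\<^sub>M Pi\<^sub>M I (\<lambda>_. Q)"
    by (intro measurable_restrict measurable_compose[OF c] T)
  have "distr (density (Pi\<^sub>M I (\<lambda>_. M)) ?d) (Pi\<^sub>M I (\<lambda>_. Q)) ?T = Pi\<^sub>M I (\<lambda>_. Q)"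
  proof (rule Q.PiM_eqI[OF fin])
    fix A assume A: "\<And>j. j \<in> I \<Longrightarrow> A j \<in> sets Q"
    have box: "Pi\<^sub>E I A \<in> sets (Pi\<^sub>M I (\<lambda>_. Q))" using A fin by (intro sets_PiM_I_finite) auto
    have "emeasure (distr (density (Pi\<^sub>M I (\<lambda>_. M)) ?d) (Pi\<^sub>M I (\<lambda>_. Q)) ?T) (Pi\<^sub>E I A)
       = (\<integral>\<^sup>+y. indicator (Pi\<^sub>E I A) y \<partial>distr (density (Pi\<^sub>M I (\<lambda>_. M)) ?d) (Pi\<^sub>M I (\<lambda>_. Q)) ?T)"
      using box by simp
    also have "\<dots> = (\<integral>\<^sup>+z. indicator (Pi\<^sub>E I A) (?T z) \<partial>density (Pi\<^sub>M I (\<lambda>_. M)) ?d)"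
      using box by (subst nn_integral_distr) auto
    also have "\<dots> = (\<integral>\<^sup>+z. ?d z * indicator (Pi\<^sub>E I A) (?T z) \<partial>Pi\<^sub>M I (\<lambda>_. M))"
      using box by (subst nn_integral_density) auto
    also have "\<dots> = (\<integral>\<^sup>+z. (\<Prod>j\<in>I. D j (z j) * indicator (A j) (T j (z j))) \<partial>Pi\<^sub>M I (\<lambda>_. M))"
    proof (rule nn_integral_cong)
      fix z
      have "indicator (Pi\<^sub>E I A) (?T z) = (\<Prod>j\<in>I. indicator (A j) (T j (z j)) :: ennreal)"
        by (rule indicator_PiE_restrict[OF fin])
      then show "?d z * indicator (Pi\<^sub>E I A) (?T z) = (\<Prod>j\<in>I. D j (z j) * indicator (A j) (T j (z j)))"
        by (simp add: prod.distrib)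
    qed
    also have "\<dots> = (\<Prod>j\<in>I. \<integral>\<^sup>+z. D j z * indicator (A j) (T j z) \<partial>M)"
    proof (rule M.product_nn_integral_prod[OF fin])
      fix j assume j: "j \<in> I"
      note [measurable] = D[OF j] T[OF j] A[OF j]
      show "(\<lambda>z. D j z * indicator (A j) (T j z)) \<in> borel_measurable M" by measurable
    qed
    also have "\<dots> = (\<Prod>j\<in>I. emeasure Q (A j))"
      by (intro prod.cong refl eq A)
    finally show "emeasure (distr (density (Pi\<^sub>M I (\<lambda>_. M)) ?d) (Pi\<^sub>M I (\<lambda>_. Q)) ?T) (Pi\<^sub>E I A)
      = (\<Prod>j\<in>I. emeasure Q (A j))" .
  qed simp
  then have "(\<integral>\<^sup>+y. h y \<partial>Pi\<^sub>M I (\<lambda>_. Q))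
      = (\<integral>\<^sup>+y. h y \<partial>distr (density (Pi\<^sub>M I (\<lambda>_. M)) ?d) (Pi\<^sub>M I (\<lambda>_. Q)) ?T)" by simp
  also have "\<dots> = (\<integral>\<^sup>+z. h (?T z) \<partial>density (Pi\<^sub>M I (\<lambda>_. M)) ?d)"
    using h by (subst nn_integral_distr) auto
  also have "\<dots> = (\<integral>\<^sup>+z. ?d z * h (?T z) \<partial>Pi\<^sub>M I (\<lambda>_. M))"
    using h by (subst nn_integral_density) auto
  finally show ?thesis ..
qed

lemma nn_integral_PiM_distr:
  assumes fin: "finite I" and M: "prob_space M" and Q: "prob_space Q"
    and T [measurable]: "T \<in> M \<rightarrow>\<^sub>M Q"
    and eq: "distr M Q T = Q"
    and h: "h \<in> borel_measurable (Pi\<^sub>M I (\<lambda>_. Q))"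
  shows "(\<integral>\<^sup>+z. h (\<lambda>j\<in>I. T (z j)) \<partial>Pi\<^sub>M I (\<lambda>_. M)) = (\<integral>\<^sup>+y. h y \<partial>Pi\<^sub>M I (\<lambda>_. Q))"
proof -
  have "(\<integral>\<^sup>+z. 1 * indicator A (T z) \<partial>M) = emeasure Q A" if A: "A \<in> sets Q" for A
  proof -
    have "emeasure Q A = (\<integral>\<^sup>+z. indicator A z \<partial>distr M Q T)" using A by (simp add: eq)
    also have "\<dots> = (\<integral>\<^sup>+z. indicator A (T z) \<partial>M)" using A by (subst nn_integral_distr) auto
    finally show ?thesis by simp
  qed
  from nn_integral_PiM_change[OF fin M Q, of "\<lambda>_ _. 1" "\<lambda>_. T", OF _ T this h] show ?thesis by simp
qed

text \<open>The argument for rectangles with two independent sequences. The integrals stay iterated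
  because this is the form in which codewords and noise are averaged.\<close>

lemma nn_integral_PiM_pair:
  assumes fin: "finite I" and M: "prob_space M" and M': "prob_space M'" and Q: "prob_space Q"
    and T [measurable]: "case_prod T \<in> M \<Otimes>\<^sub>M M' \<rightarrow>\<^sub>M Q"
    and eq: "\<And>A. A \<in> sets Q \<Longrightarrow> (\<integral>\<^sup>+x. \<integral>\<^sup>+z. indicator A (T x z) \<partial>M' \<partial>M) = emeasure Q A"
    and h: "h \<in> borel_measurable (Pi\<^sub>M I (\<lambda>_. Q))"
  shows "(\<integral>\<^sup>+x. \<integral>\<^sup>+z. h (\<lambda>j\<in>I. T (x j) (z j)) \<partial>Pi\<^sub>M I (\<lambda>_. M') \<partial>Pi\<^sub>M I (\<lambda>_. M)) = (\<integral>\<^sup>+y. h y \<partial>Pi\<^sub>M I (\<lambda>_. Q))"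
proof -
  interpret M0: prob_space M by fact
  interpret M0': prob_space M' by fact
  interpret M: product_prob_space "\<lambda>_. M" I by (rule product_prob_spaceI) fact
  interpret M': product_prob_space "\<lambda>_. M'" I by (rule product_prob_spaceI) fact
  interpret Q: product_prob_space "\<lambda>_. Q" I by (rule product_prob_spaceI) fact
  let ?P = "Pi\<^sub>M I (\<lambda>_. M) \<Otimes>\<^sub>M Pi\<^sub>M I (\<lambda>_. M')"
  let ?T = "\<lambda>(x, z). \<lambda>j\<in>I. T (x j) (z j)"
  have t: "?T \<in> ?P \<rightarrow>\<^sub>M Pi\<^sub>M I (\<lambda>_. Q)"
    unfolding case_prod_beta
  proof (rule measurable_restrict)
    fix j assume j: "j \<in> I"
    have [measurable]: "(\<lambda>x. x j) \<in> Pi\<^sub>M I (\<lambda>_. M) \<rightarrow>\<^sub>M M" "(\<lambda>x. x j) \<in> Pi\<^sub>M I (\<lambda>_. M') \<rightarrow>\<^sub>M M'"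
      using j by (auto intro: measurable_component_singleton)
    have "(\<lambda>p. case_prod T (fst p j, snd p j)) \<in> ?P \<rightarrow>\<^sub>M Q" by measurable
    then show "(\<lambda>p. T (fst p j) (snd p j)) \<in> ?P \<rightarrow>\<^sub>M Q" by simp
  qed
  have fub: "(\<integral>\<^sup>+p. f (?T p) \<partial>?P)
     = (\<integral>\<^sup>+x. \<integral>\<^sup>+z. f (\<lambda>j\<in>I. T (x j) (z j)) \<partial>Pi\<^sub>M I (\<lambda>_. M') \<partial>Pi\<^sub>M I (\<lambda>_. M))"
    if "f \<in> borel_measurable (Pi\<^sub>M I (\<lambda>_. Q))" for f
    using M'.P.nn_integral_fst[OF measurable_compose[OF t that]] by simp
  have "distr ?P (Pi\<^sub>M I (\<lambda>_. Q)) ?T = Pi\<^sub>M I (\<lambda>_. Q)"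
  proof (rule Q.PiM_eqI[OF fin])
    fix A assume A: "\<And>j. j \<in> I \<Longrightarrow> A j \<in> sets Q"
    have box: "Pi\<^sub>E I A \<in> sets (Pi\<^sub>M I (\<lambda>_. Q))" using A fin by (intro sets_PiM_I_finite) auto
    have m: "(\<lambda>p. indicator (A j) (case_prod T p) :: ennreal) \<in> borel_measurable (M \<Otimes>\<^sub>M M')" if "j \<in> I" for j
      using A[OF that] by measurable
    have "emeasure (distr ?P (Pi\<^sub>M I (\<lambda>_. Q)) ?T) (Pi\<^sub>E I A)
       = (\<integral>\<^sup>+y. indicator (Pi\<^sub>E I A) y \<partial>distr ?P (Pi\<^sub>M I (\<lambda>_. Q)) ?T)"
      using box by simp
    also have "\<dots> = (\<integral>\<^sup>+p. indicator (Pi\<^sub>E I A) (?T p) \<partial>?P)"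
      using box t by (subst nn_integral_distr) auto
    also have "\<dots> = (\<integral>\<^sup>+x. \<integral>\<^sup>+z. indicator (Pi\<^sub>E I A) (\<lambda>j\<in>I. T (x j) (z j)) \<partial>Pi\<^sub>M I (\<lambda>_. M') \<partial>Pi\<^sub>M I (\<lambda>_. M))"
      using box by (intro fub) auto
    also have "\<dots> = (\<integral>\<^sup>+x. \<integral>\<^sup>+z. (\<Prod>j\<in>I. indicator (A j) (T (x j) (z j))) \<partial>Pi\<^sub>M I (\<lambda>_. M') \<partial>Pi\<^sub>M I (\<lambda>_. M))"
      by (simp only: indicator_PiE_restrict[OF fin])
    also have "\<dots> = (\<integral>\<^sup>+x. (\<Prod>j\<in>I. \<integral>\<^sup>+z. indicator (A j) (T (x j) z) \<partial>M') \<partial>Pi\<^sub>M I (\<lambda>_. M))"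
    proof (rule nn_integral_cong)
      fix x assume x: "x \<in> space (Pi\<^sub>M I (\<lambda>_. M))"
      show "(\<integral>\<^sup>+z. (\<Prod>j\<in>I. indicator (A j) (T (x j) (z j))) \<partial>Pi\<^sub>M I (\<lambda>_. M'))
         = (\<Prod>j\<in>I. \<integral>\<^sup>+z. indicator (A j) (T (x j) z) \<partial>M')"
      proof (rule M'.product_nn_integral_prod[OF fin])
        fix j assume j: "j \<in> I"
        have "x j \<in> space M" using x j by (auto simp: space_PiM PiE_iff)
        from measurable_compose[OF measurable_Pair1'[OF this] m[OF j]]
        show "(\<lambda>z. indicator (A j) (T (x j) z)::ennreal) \<in> borel_measurable M'" by simp
      qed
    qed
    also have "\<dots> = (\<Prod>j\<in>I. \<integral>\<^sup>+x. \<integral>\<^sup>+z. indicator (A j) (T x z) \<partial>M' \<partial>M)"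
    proof (rule M.product_nn_integral_prod[OF fin])
      fix j assume j: "j \<in> I"
      from M0'.borel_measurable_nn_integral_fst[OF m[OF j]]
      show "(\<lambda>x. \<integral>\<^sup>+z. indicator (A j) (T x z) \<partial>M') \<in> borel_measurable M" by simp
    qed
    also have "\<dots> = (\<Prod>j\<in>I. emeasure Q (A j))"
      by (intro prod.cong refl eq A)
    finally show "emeasure (distr ?P (Pi\<^sub>M I (\<lambda>_. Q)) ?T) (Pi\<^sub>E I A) = (\<Prod>j\<in>I. emeasure Q (A j))" .
  qed simp
  then have "(\<integral>\<^sup>+y. h y \<partial>Pi\<^sub>M I (\<lambda>_. Q)) = (\<integral>\<^sup>+y. h y \<partial>distr ?P (Pi\<^sub>M I (\<lambda>_. Q)) ?T)" by simp
  also have "\<dots> = (\<integral>\<^sup>+p. h (?T p) \<partial>?P)"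
    using h t by (subst nn_integral_distr) auto
  finally show ?thesis using fub[OF h] by simp
qed

section \<open>Exponential tail bounds for the norm of Gaussian sequences\<close>

lemma nn_integral_exp_norm_std_gaussian:
  assumes c: "0 < c"
  shows "(\<integral>\<^sup>+k. ennreal (exp ((1 - 1 / c\<^sup>2) / 2 * (norm k)\<^sup>2)) \<partial>(std_gaussian :: (real^'n) measure)) = ennreal (c ^ CARD('n))"
proof -
  \<comment> \<open>Tilting by the exponential gives, up to a factor, the density of a Gaussian with
    standard deviation \<open>c\<close>; in this parametrisation the exponential moment is finite
    for every positive \<open>c\<close>.\<close>
  define C :: "real^'n^'n" where "C = mat (1 / c)"
  have C: "C *v k = (1 / c) *\<^sub>R k" for k
    by (simp add: C_def vec_eq_iff matrix_vector_mult_def mat_def if_distrib[of "\<lambda>x. x * y" for y] cong: if_cong)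
  have d: "det C = (1 / c) ^ CARD('n)"
    unfolding C_def by (subst det_diagonal) (auto simp: mat_def)
  have "invertible C" using c by (simp add: invertible_det_nz d)
  have "gauss_pdf k * exp ((1 - 1 / c\<^sup>2) / 2 * (norm k)\<^sup>2) = gauss_pdf (C *v k)" for k
    unfolding C gauss_pdf_eq by (simp add: power_divide algebra_simps diff_divide_distrib flip: exp_add)
  then have "(\<integral>\<^sup>+k. ennreal (exp ((1 - 1 / c\<^sup>2) / 2 * (norm k)\<^sup>2)) \<partial>(std_gaussian :: (real^'n) measure))
     = (\<integral>\<^sup>+k. ennreal (gauss_pdf (C *v k)) \<partial>lborel)"
    by (subst nn_integral_std_gaussian) (auto simp: gauss_pdf_pos less_imp_le simp flip: ennreal_mult)
  also have "\<dots> = ennreal (1 / \<bar>det C\<bar>)"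
    by (rule nn_integral_gauss_pdf_matrix) fact
  finally show ?thesis using c by (simp add: d power_divide)
qed

text \<open>One exponential Markov bound for both tails: \<open>s\<close> is positive for
  \<open>c > 1\<close> and negative for \<open>c < 1\<close>, and the factor \<open>s\<close> in the
  event turns the inequality accordingly.\<close>

lemma chernoff_norm_std_gaussian:
  assumes c: "0 < c"
  defines "s \<equiv> (1 - 1 / c\<^sup>2) / 2"
  shows "(\<integral>\<^sup>+k. indicator {k. s * (\<Sum>j<n. (norm (k j))\<^sup>2) \<ge> s * (real n * t)} k \<partial>Pi\<^sub>M {..<n} (\<lambda>_. std_gaussian :: (real^'n) measure))
    \<le> ennreal ((exp (CARD('n) * ln c - s * t)) ^ n)"
proof -
  interpret product_prob_space "\<lambda>_. std_gaussian :: (real^'n) measure" "{..<n}"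
    by (rule product_prob_spaceI) (rule std_gaussian.prob_space_axioms)
  have "(\<integral>\<^sup>+k. indicator {k. s * (\<Sum>j<n. (norm (k j))\<^sup>2) \<ge> s * (real n * t)} k \<partial>Pi\<^sub>M {..<n} (\<lambda>_. std_gaussian :: (real^'n) measure))
    \<le> (\<integral>\<^sup>+k. (\<Prod>j<n. ennreal (exp (- s * t)) * ennreal (exp (s * (norm (k j))\<^sup>2))) \<partial>Pi\<^sub>M {..<n} (\<lambda>_. std_gaussian :: (real^'n) measure))"
  proof (rule nn_integral_mono)
    fix k :: "nat \<Rightarrow> real^'n"
    have "(\<Prod>j<n. ennreal (exp (- s * t)) * ennreal (exp (s * (norm (k j))\<^sup>2)))
       = ennreal (exp (\<Sum>j<n. - s * t + s * (norm (k j))\<^sup>2))"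
      by (simp add: exp_sum prod_ennreal flip: ennreal_mult exp_add)
    also have "(\<Sum>j<n. - s * t + s * (norm (k j))\<^sup>2) = s * (\<Sum>j<n. (norm (k j))\<^sup>2) - s * (real n * t)"
      by (simp add: sum.distrib sum_distrib_left sum_subtractf)
    finally show "indicator {k. s * (\<Sum>j<n. (norm (k j))\<^sup>2) \<ge> s * (real n * t)} k
       \<le> (\<Prod>j<n. ennreal (exp (- s * t)) * ennreal (exp (s * (norm (k j))\<^sup>2)))"
      by (simp add: indicator_def)
  qed
  also have "\<dots> = (\<Prod>j<n. \<integral>\<^sup>+k. ennreal (exp (- s * t)) * ennreal (exp (s * (norm k)\<^sup>2)) \<partial>(std_gaussian :: (real^'n) measure))"
    by (rule product_nn_integral_prod) auto
  also have "\<dots> = ennreal (exp (- s * t) * c ^ CARD('n)) ^ n"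
    using c nn_integral_exp_norm_std_gaussian[OF c, where 'n='n]
    by (simp add: nn_integral_cmult s_def ennreal_mult)
  also have "exp (- s * t) * c ^ CARD('n) = exp (CARD('n) * ln c - s * t)"
    using c exp_of_nat_mult[of "CARD('n)" "ln c"] by (simp add: exp_diff exp_minus divide_inverse mult.commute)
  finally show ?thesis by (simp add: ennreal_power)
qed

lemma norm_std_gaussian_upper_tail:
  assumes t: "real CARD('n) < t"
  obtains r where "0 \<le> r" "r < 1"
    "\<And>n. (\<integral>\<^sup>+k. indicator {k. (\<Sum>j<n. (norm (k j))\<^sup>2) \<ge> real n * t} k \<partial>Pi\<^sub>M {..<n} (\<lambda>_. std_gaussian :: (real^'n) measure)) \<le> ennreal (r ^ n)"
proof -
  \<comment> \<open>The exponent of the Chernoff bound for \<open>c = exp u\<close>. It vanishes at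
    \<open>u = 0\<close> with slope \<open>CARD('n) - t\<close>, here negative, so a small positive
    \<open>u\<close> makes it negative.\<close>
  let ?g = "\<lambda>u. real CARD('n) * u - (1 - exp (-2 * u)) / 2 * t"
  have "(?g has_real_derivative real CARD('n) - t) (at 0)"
    by (auto intro!: derivative_eq_intros)
  from DERIV_neg_dec_right[OF this] t obtain d where d: "d > 0" "\<And>h. 0 < h \<Longrightarrow> h < d \<Longrightarrow> ?g (0 + h) < ?g 0" by auto
  define u where "u = d / 2"
  have u: "0 < u" "?g u < 0" using d(1) d(2)[of u] by (auto simp: u_def)
  define c where "c = exp u"
  have c: "0 < c" "ln c = u" by (auto simp: c_def)
  have c2: "1 / c\<^sup>2 = exp (-2 * u)" by (simp add: c_def exp_minus field_simps flip: exp_of_nat_mult)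
  have s: "0 < (1 - 1 / c\<^sup>2) / 2" unfolding c2 using u by simp
  show thesis
  proof (rule that[of "exp (?g u)"])
    fix n
    show "(\<integral>\<^sup>+k. indicator {k. (\<Sum>j<n. (norm (k j))\<^sup>2) \<ge> real n * t} k \<partial>Pi\<^sub>M {..<n} (\<lambda>_. std_gaussian :: (real^'n) measure)) \<le> ennreal (exp (?g u) ^ n)"
      using chernoff_norm_std_gaussian[OF c(1), of n t, where 'n='n] s by (simp add: c(2) c2)
  qed (use u in auto)
qed

lemma norm_std_gaussian_lower_tail:
  assumes t: "t < real CARD('n)"
  obtains r where "0 \<le> r" "r < 1"
    "\<And>n. (\<integral>\<^sup>+k. indicator {k. (\<Sum>j<n. (norm (k j))\<^sup>2) \<le> real n * t} k \<partial>Pi\<^sub>M {..<n} (\<lambda>_. std_gaussian :: (real^'n) measure)) \<le> ennreal (r ^ n)"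
proof -
  \<comment> \<open>The same exponent; its slope at 0 is now positive, so \<open>u\<close> is chosen
    negative, that is \<open>c < 1\<close>.\<close>
  let ?g = "\<lambda>u. real CARD('n) * u - (1 - exp (-2 * u)) / 2 * t"
  have "(?g has_real_derivative real CARD('n) - t) (at 0)"
    by (auto intro!: derivative_eq_intros)
  from DERIV_pos_inc_left[OF this] t obtain d where d: "d > 0" "\<And>h. 0 < h \<Longrightarrow> h < d \<Longrightarrow> ?g (0 - h) < ?g 0" by auto
  define u where "u = - d / 2"
  have u: "u < 0" "?g u < 0" using d(1) d(2)[of "-u"] by (auto simp: u_def)
  define c where "c = exp u"
  have c: "0 < c" "ln c = u" by (auto simp: c_def)
  have c2: "1 / c\<^sup>2 = exp (-2 * u)" by (simp add: c_def exp_minus field_simps flip: exp_of_nat_mult)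
  have s: "(1 - 1 / c\<^sup>2) / 2 < 0" unfolding c2 using u by simp
  show thesis
  proof (rule that[of "exp (?g u)"])
    fix n
    show "(\<integral>\<^sup>+k. indicator {k. (\<Sum>j<n. (norm (k j))\<^sup>2) \<le> real n * t} k \<partial>Pi\<^sub>M {..<n} (\<lambda>_. std_gaussian :: (real^'n) measure)) \<le> ennreal (exp (?g u) ^ n)"
      using chernoff_norm_std_gaussian[OF c(1), of n t, where 'n='n] s by (simp add: c(2) c2)
  qed (use u in auto)
qed

section \<open>Change of measure and the weak converse\<close>

text \<open>This takes the place of Fano's inequality. \<open>exp (- L k z)\<close> is a density
  ratio of mean at most 1, and the events \<open>A k\<close> have average reference mass at most
  \<open>1 / m\<close>. Hence the ratio multiplied by \<open>m\<close> on \<open>A k\<close> has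
  average at most 2; half of it is inserted into \<open>ln x \<le> x - 1\<close>, at a loss of
  \<open>ln 2\<close> per index.\<close>

lemma weak_converse:
  fixes L :: "'k \<Rightarrow> 'z \<Rightarrow> real"
  assumes "prob_space P" and K: "finite K" "K \<noteq> {}" and m: "1 \<le> m"
    and int: "\<And>k. k \<in> K \<Longrightarrow> integrable P (L k)"
    and A: "\<And>k. k \<in> K \<Longrightarrow> A k \<in> sets P"
    and le1: "\<And>k. k \<in> K \<Longrightarrow> (\<integral>\<^sup>+z. ennreal (exp (- L k z)) \<partial>P) \<le> 1"
    and leA: "(\<Sum>k\<in>K. \<integral>\<^sup>+z. ennreal (exp (- L k z)) * indicator (A k) z \<partial>P) \<le> ennreal (card K / m)"
  shows "(\<Sum>k\<in>K. measure P (A k)) * ln m - card K * ln 2 \<le> (\<Sum>k\<in>K. \<integral>z. L k z \<partial>P)"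
proof -
  interpret prob_space P by fact
  define e where "e = (\<lambda>k z. exp (- L k z))"
  have meas [measurable]: "L k \<in> borel_measurable P" if "k \<in> K" for k
    using int[OF that] by simp
  have ie: "integrable P (e k)" if k: "k \<in> K" for k
    using le1[OF k] meas[OF k] unfolding e_def
    by (intro integrableI_nonneg) (auto intro: le_less_trans)
  have ieA: "integrable P (\<lambda>z. e k z * indicator (A k) z)" if k: "k \<in> K" for k
    using integrable_mult_indicator[OF A[OF k] ie[OF k]] by (simp add: mult.commute)
  have E1: "(\<integral>z. e k z \<partial>P) \<le> 1" if k: "k \<in> K" for k
  proof -
    have "ennreal (\<integral>z. e k z \<partial>P) = (\<integral>\<^sup>+z. ennreal (e k z) \<partial>P)"
      using ie[OF k] by (intro nn_integral_eq_integral[symmetric]) (auto simp: e_def)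
    also have "\<dots> \<le> 1" using le1[OF k] by (simp add: e_def)
    finally show ?thesis by simp
  qed
  have EA: "(\<Sum>k\<in>K. \<integral>z. e k z * indicator (A k) z \<partial>P) \<le> card K / m"
  proof -
    have "ennreal (\<Sum>k\<in>K. \<integral>z. e k z * indicator (A k) z \<partial>P) = (\<Sum>k\<in>K. ennreal (\<integral>z. e k z * indicator (A k) z \<partial>P))"
      by (intro sum_ennreal[symmetric] integral_nonneg_AE) (auto simp: e_def)
    also have "\<dots> = (\<Sum>k\<in>K. \<integral>\<^sup>+z. ennreal (e k z * indicator (A k) z) \<partial>P)"
      using ieA by (intro sum.cong refl nn_integral_eq_integral[symmetric]) (auto simp: e_def)
    also have "\<dots> = (\<Sum>k\<in>K. \<integral>\<^sup>+z. ennreal (exp (- L k z)) * indicator (A k) z \<partial>P)"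
      by (intro sum.cong refl nn_integral_cong) (auto simp: e_def indicator_def)
    also note leA
    finally show ?thesis using m by (simp add: ennreal_le_iff)
  qed
  have main: "measure P (A k) * ln m - (\<integral>z. L k z \<partial>P) - ln 2
      \<le> ((\<integral>z. e k z \<partial>P) + (m - 1) * (\<integral>z. e k z * indicator (A k) z \<partial>P)) / 2 - 1" if k: "k \<in> K" for k
  proof -
    note [measurable] = A[OF k]
    have iA: "integrable P (\<lambda>z. indicator (A k) z :: real)"
      by (simp add: integrable_indicator_iff emeasure_eq_measure)
    have "measure P (A k) * ln m - (\<integral>z. L k z \<partial>P) - ln 2 = (\<integral>z. indicator (A k) z * ln m - L k z - ln 2 \<partial>P)"
      using int[OF k] iA by (simp add: prob_space)
    also have "\<dots> \<le> (\<integral>z. (e k z + (m - 1) * (e k z * indicator (A k) z)) / 2 - 1 \<partial>P)"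
    proof (rule integral_mono)
      fix z
      \<comment> \<open>Both cases in one formula: \<open>m\<close> times the ratio on the event,
        the ratio itself off it, halved.\<close>
      let ?x = "(e k z + (m - 1) * (e k z * indicator (A k) z)) / 2"
      have x: "?x = (if z \<in> A k then m else 1) * e k z / 2" by (simp add: algebra_simps)
      have l: "ln ((if z \<in> A k then m else 1) * e k z / 2) = indicator (A k) z * ln m - L k z - ln 2"
        using m by (simp add: ln_div ln_mult e_def)
      have p: "0 < (if z \<in> A k then m else 1) * e k z / 2" using m by (simp add: e_def)
      show "indicator (A k) z * ln m - L k z - ln 2 \<le> ?x - 1"
        unfolding x using ln_le_minus_one[OF p] unfolding l .
    qed (use int[OF k] iA ie[OF k] ieA[OF k] in auto)
    also have "\<dots> = ((\<integral>z. e k z \<partial>P) + (m - 1) * (\<integral>z. e k z * indicator (A k) z \<partial>P)) / 2 - 1"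
      using ie[OF k] ieA[OF k] by (simp add: prob_space)
    finally show ?thesis .
  qed
  have "(\<Sum>k\<in>K. measure P (A k)) * ln m - (\<Sum>k\<in>K. \<integral>z. L k z \<partial>P) - card K * ln 2
      = (\<Sum>k\<in>K. measure P (A k) * ln m - (\<integral>z. L k z \<partial>P) - ln 2)"
    by (simp add: sum_subtractf sum_distrib_right)
  also have "\<dots> \<le> (\<Sum>k\<in>K. ((\<integral>z. e k z \<partial>P) + (m - 1) * (\<integral>z. e k z * indicator (A k) z \<partial>P)) / 2 - 1)"
    by (intro sum_mono main)
  also have "\<dots> = ((\<Sum>k\<in>K. \<integral>z. e k z \<partial>P) + (m - 1) * (\<Sum>k\<in>K. \<integral>z. e k z * indicator (A k) z \<partial>P)) / 2 - card K"
    by (simp add: sum_subtractf sum.distrib sum_divide_distrib[symmetric] sum_distrib_left)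
  \<comment> \<open>Per index the average is at most \<open>(1 + (m - 1) / m) / 2 \<le> 1\<close>,
    which is why the ratio was halved.\<close>
  also have "\<dots> \<le> (card K + (m - 1) * (card K / m)) / 2 - card K"
    using m EA sum_mono[of K "\<lambda>k. \<integral>z. e k z \<partial>P" "\<lambda>_. 1"] E1
    by (intro diff_right_mono divide_right_mono add_mono mult_left_mono) auto
  also have "\<dots> \<le> 0" using m by (simp add: field_simps)
  finally show ?thesis by simp
qed

text \<open>Under the reference law the acceptance regions \<open>s k\<close> have total mass equal
  to the mean number of regions that contain the output, hence at most \<open>card K / m\<close>.
  The log-likelihood ratio is additive over channel uses, so only its single-letter means
  remain.\<close>

lemma memoryless_converse:
  fixes l :: "'k \<Rightarrow> nat \<Rightarrow> 'z \<Rightarrow> real"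
  assumes M: "prob_space M" and Q: "prob_space Q" and K: "finite K" "K \<noteq> {}" and m: "1 \<le> m"
    and T: "\<And>k j. k \<in> K \<Longrightarrow> T k j \<in> M \<rightarrow>\<^sub>M Q"
    and int: "\<And>k j. k \<in> K \<Longrightarrow> integrable M (l k j)"
    and eq: "\<And>k j A. k \<in> K \<Longrightarrow> A \<in> sets Q \<Longrightarrow>
       (\<integral>\<^sup>+z. ennreal (exp (- l k j z)) * indicator A (T k j z) \<partial>M) = emeasure Q A"
    and s: "\<And>k. k \<in> K \<Longrightarrow> s k \<in> sets (Pi\<^sub>M {..<n} (\<lambda>_. Q))"
    and mult: "\<And>y. card {k\<in>K. y \<in> s k} \<le> card K / m"
  shows "(\<Sum>k\<in>K. measure (Pi\<^sub>M {..<n} (\<lambda>_. M))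
        {z \<in> space (Pi\<^sub>M {..<n} (\<lambda>_. M)). (\<lambda>j\<in>{..<n}. T k j (z j)) \<in> s k}) * ln m - card K * ln 2
      \<le> (\<Sum>k\<in>K. \<Sum>j<n. \<integral>z. l k j z \<partial>M)"
proof -
  let ?P = "Pi\<^sub>M {..<n} (\<lambda>_. M)" and ?Q = "Pi\<^sub>M {..<n} (\<lambda>_. Q)"
  interpret M: prob_space M by fact
  interpret P: prob_space ?P by (intro prob_space_PiM M)
  interpret Q: prob_space ?Q by (intro prob_space_PiM Q)
  define T' where "T' k z = (\<lambda>j\<in>{..<n}. T k j (z j))" for k z
  define L where "L k z = (\<Sum>j<n. l k j (z j))" for k z
  have c: "(\<lambda>z. z j) \<in> ?P \<rightarrow>\<^sub>M M" if "j < n" for j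
    using measurable_component_singleton[of j "{..<n}" "\<lambda>_. M"] that by simp
  have dist: "distr ?P M (\<lambda>z. z j) = M" if "j < n" for j
    using that by (intro distr_PiM_component M) auto
  have T': "T' k \<in> ?P \<rightarrow>\<^sub>M ?Q" if "k \<in> K" for k
    unfolding T'_def using that by (intro measurable_restrict measurable_compose[OF c] T) auto
  have comp: "integrable ?P (\<lambda>z. l k j (z j))" "(\<integral>z. l k j (z j) \<partial>?P) = (\<integral>z. l k j z \<partial>M)"
    if "k \<in> K" "j < n" for k j
  proof -
    have "integrable (distr ?P M (\<lambda>z. z j)) (l k j)"
      unfolding dist[OF that(2)] by (rule int[OF that(1)])
    then show "integrable ?P (\<lambda>z. l k j (z j))"
      by (rule integrable_distr[OF c[OF that(2)]])
    have "(\<integral>z. l k j z \<partial>distr ?P M (\<lambda>z. z j)) = (\<integral>z. l k j (z j) \<partial>?P)"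
      using int[OF that(1)] by (intro integral_distr c[OF that(2)]) simp
    then show "(\<integral>z. l k j (z j) \<partial>?P) = (\<integral>z. l k j z \<partial>M)"
      unfolding dist[OF that(2)] ..
  qed
  have ch: "(\<integral>\<^sup>+z. ennreal (exp (- L k z)) * h (T' k z) \<partial>?P) = (\<integral>\<^sup>+y. h y \<partial>?Q)"
    if k: "k \<in> K" and h: "h \<in> borel_measurable ?Q" for k h
  proof -
    have "(\<integral>\<^sup>+z. (\<Prod>j<n. ennreal (exp (- l k j (z j)))) * h (\<lambda>j\<in>{..<n}. T k j (z j)) \<partial>?P) = (\<integral>\<^sup>+y. h y \<partial>?Q)"
      using int[OF k] by (intro nn_integral_PiM_change M Q T k eq h) auto
    moreover have "ennreal (exp (- L k z)) = (\<Prod>j<n. ennreal (exp (- l k j (z j))))" for z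
      by (simp add: L_def prod_ennreal exp_sum flip: sum_negf)
    ultimately show ?thesis by (simp add: T'_def)
  qed
  define A where "A k = {z \<in> space ?P. T' k z \<in> s k}" for k
  have A: "A k \<in> sets ?P" if "k \<in> K" for k
    unfolding A_def using measurable_sets[OF T'[OF that] s[OF that]] by (simp add: vimage_def Int_def conj_commute)
  have "(\<Sum>k\<in>K. measure ?P (A k)) * ln m - card K * ln 2 \<le> (\<Sum>k\<in>K. \<integral>z. L k z \<partial>?P)"
  proof (rule weak_converse[OF P.prob_space_axioms K m])
    show "integrable ?P (L k)" if "k \<in> K" for k
      unfolding L_def using comp(1)[OF that] by (intro Bochner_Integration.integrable_sum) auto
    show "A k \<in> sets ?P" if "k \<in> K" for k by (rule A[OF that])
    show "(\<integral>\<^sup>+z. ennreal (exp (- L k z)) \<partial>?P) \<le> 1" if "k \<in> K" for k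
      using ch[OF that, of "\<lambda>_. 1"] Q.emeasure_space_1 by simp
    have "(\<Sum>k\<in>K. \<integral>\<^sup>+z. ennreal (exp (- L k z)) * indicator (A k) z \<partial>?P)
       = (\<Sum>k\<in>K. \<integral>\<^sup>+z. ennreal (exp (- L k z)) * indicator (s k) (T' k z) \<partial>?P)"
      by (intro sum.cong refl nn_integral_cong) (auto simp: A_def indicator_def)
    also have "\<dots> = (\<Sum>k\<in>K. \<integral>\<^sup>+y. indicator (s k) y \<partial>?Q)"
      using s by (intro sum.cong refl ch) auto
    also have "\<dots> = (\<integral>\<^sup>+y. (\<Sum>k\<in>K. indicator (s k) y) \<partial>?Q)"
      using s by (subst nn_integral_sum) auto
    also have "\<dots> \<le> (\<integral>\<^sup>+y. ennreal (card K / m) \<partial>?Q)"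
    proof (rule nn_integral_mono)
      fix y
      have "(\<Sum>k\<in>K. indicator (s k) y :: ennreal) = of_nat (card {k\<in>K. y \<in> s k})"
        using K by (simp add: indicator_def sum.If_cases Int_def)
      also have "\<dots> = ennreal (real (card {k\<in>K. y \<in> s k}))" by (simp add: ennreal_of_nat_eq_real_of_nat)
      also have "\<dots> \<le> ennreal (card K / m)" using mult[of y] by (rule ennreal_leI)
      finally show "(\<Sum>k\<in>K. indicator (s k) y) \<le> ennreal (card K / m)" .
    qed
    also have "\<dots> = ennreal (card K / m)" using Q.emeasure_space_1 by simp
    finally show "(\<Sum>k\<in>K. \<integral>\<^sup>+z. ennreal (exp (- L k z)) * indicator (A k) z \<partial>?P) \<le> ennreal (card K / m)" .
  qed
  also have "(\<Sum>k\<in>K. \<integral>z. L k z \<partial>?P) = (\<Sum>k\<in>K. \<Sum>j<n. \<integral>z. l k j z \<partial>M)"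
    unfolding L_def using comp by (intro sum.cong refl) (subst Bochner_Integration.integral_sum, auto)
  finally show ?thesis unfolding A_def T'_def .
qed

section \<open>Gaussian reference laws and their log-likelihood ratios\<close>

definition outer :: "real^'n \<Rightarrow> real^'n^'n" where
  "outer a = (\<chi> i j. a $ i * a $ j)"

definition gaussian :: "real^'n^'n \<Rightarrow> (real^'n) measure" where
  "gaussian B = distr std_gaussian borel ((*v) B)"

lemma sets_gaussian [simp, measurable_cong]: "sets (gaussian B) = sets borel"
  and space_gaussian [simp]: "space (gaussian B) = UNIV"
  by (simp_all add: gaussian_def)

lemma prob_space_gaussian: "prob_space (gaussian B)"
  unfolding gaussian_def by (intro std_gaussian.prob_space_distr) measurable

lemma nn_integral_gaussian:
  assumes "f \<in> borel_measurable borel"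
  shows "(\<integral>\<^sup>+y. f y \<partial>gaussian B) = (\<integral>\<^sup>+k. f (B *v k) \<partial>std_gaussian)"
  using assms unfolding gaussian_def by (subst nn_integral_distr) auto

lemma trace_outer: "trace (X ** outer a ** transpose X) = (norm (X *v a))\<^sup>2" for X :: "real^'n^'m"
proof -
  have "(X ** outer a ** transpose X) $ i $ i = (X *v a) $ i * (X *v a) $ i" for i
    by (simp add: matrix_matrix_mult_def matrix_vector_mult_def outer_def transpose_def sum_product sum_distrib_left sum_distrib_right ac_simps)
  then show ?thesis by (simp add: trace_def power2_norm_eq_inner inner_vec_def)
qed

lemma outer_matrix: "outer (X *v a) = X ** outer a ** transpose X" for X :: "real^'n^'m"
proof -
  have "(X ** outer a ** transpose X) $ i $ j = (X *v a) $ i * (X *v a) $ j" for i j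
    by (simp add: matrix_matrix_mult_def matrix_vector_mult_def outer_def transpose_def sum_product sum_distrib_left sum_distrib_right ac_simps)
  then show ?thesis by (simp add: vec_eq_iff) (simp add: outer_def)
qed

lemma trace_scaleR: "trace (c *\<^sub>R A) = c * trace (A :: real^'n^'n)"
  by (simp add: trace_def sum_distrib_left)

lemma trace_sum: "trace (\<Sum>i\<in>I. A i) = (\<Sum>i\<in>I. trace (A i :: real^'n^'n))"
  by (simp add: trace_def) (rule sum.swap)

lemma matrix_mult_sum_distrib: "X ** (\<Sum>i\<in>I. A i) ** Y = (\<Sum>i\<in>I. X ** A i ** (Y :: real^'k^'l))"
  for X :: "real^'n^'m"
  by (induction I rule: infinite_finite_induct)
    (auto simp: matrix_add_ldistrib matrix_add_rdistrib)

lemma matrix_mult_scaleR_distrib: "X ** (c *\<^sub>R A) ** Y = c *\<^sub>R (X ** A ** (Y :: real^'k^'l))"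
  for X :: "real^'n^'m"
  by (simp add: vec_eq_iff matrix_matrix_mult_def sum_distrib_left sum_distrib_right ac_simps)

lemma matrix_vector_mult_minus_left: "(- A) *v x = - (A *v x)" for A :: "real^'n^'m"
  by (simp add: vec_eq_iff matrix_vector_mult_def sum_negf)

interpretation std_pair: pair_prob_space std_gaussian std_gaussian ..

lemma has_bochner_integral_norm_affine:
  fixes A :: "real^'m^'n" and A' :: "real^'k^'n"
  shows "has_bochner_integral (std_gaussian \<Otimes>\<^sub>M std_gaussian) (\<lambda>z. (norm (a + A *v fst z + A' *v snd z))\<^sup>2)
     ((norm a)\<^sup>2 + trace (A ** transpose A) + trace (A' ** transpose A'))"
proof (rule has_bochner_integral_nn_integral)
  have nn: "0 \<le> trace (A' ** transpose A')" for A' :: "real^'l^'n"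
    by (simp add: trace_mult_transpose sum_nonneg)
  have nn1: "(\<integral>\<^sup>+g. ennreal ((norm (b + X *v g))\<^sup>2) \<partial>std_gaussian) = ennreal ((norm b)\<^sup>2 + trace (X ** transpose X))"
    for b and X :: "real^'l^'n"
    using std_gaussian_norm_affine[of b X] nn_integral_eq_integral[of std_gaussian "\<lambda>g. (norm (b + X *v g))\<^sup>2"]
    by (simp add: has_bochner_integral_iff)
  have "(\<integral>\<^sup>+z. ennreal ((norm (a + A *v fst z + A' *v snd z))\<^sup>2) \<partial>(std_gaussian \<Otimes>\<^sub>M std_gaussian))
     = (\<integral>\<^sup>+g. \<integral>\<^sup>+g'. ennreal ((norm (a + A *v g + A' *v g'))\<^sup>2) \<partial>std_gaussian \<partial>std_gaussian)"
    by (subst std_gaussian.nn_integral_fst[symmetric]) auto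
  also have "\<dots> = (\<integral>\<^sup>+g. ennreal ((norm (a + A *v g))\<^sup>2) + ennreal (trace (A' ** transpose A')) \<partial>std_gaussian)"
    unfolding nn1 using nn[of A'] by simp
  also have "\<dots> = ennreal ((norm a)\<^sup>2 + trace (A ** transpose A)) + ennreal (trace (A' ** transpose A'))"
    by (subst nn_integral_add) (auto simp: nn1)
  also have "\<dots> = ennreal ((norm a)\<^sup>2 + trace (A ** transpose A) + trace (A' ** transpose A'))"
    using nn[of A] nn[of A'] by simp
  finally show "(\<integral>\<^sup>+z. ennreal ((norm (a + A *v fst z + A' *v snd z))\<^sup>2) \<partial>(std_gaussian \<Otimes>\<^sub>M std_gaussian))
     = ennreal ((norm a)\<^sup>2 + trace (A ** transpose A) + trace (A' ** transpose A'))" .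
  show "0 \<le> (norm a)\<^sup>2 + trace (A ** transpose A) + trace (A' ** transpose A')"
    using nn[of A] nn[of A'] by simp
qed auto

text \<open>The reference law makes the output \<open>y\<close> and the error \<open>e\<close> of the linear estimate of
  the other output from \<open>y - a\<close> independent Gaussians; \<open>linear_llr\<close> is the log-likelihood ratio
  of the true law against it.\<close>

definition linear_obs ::
  "real^'n^'n \<Rightarrow> real^'n^'n \<Rightarrow> real^'n^'n \<Rightarrow> real^'n \<Rightarrow> real^'n \<Rightarrow> (real^'n) \<times> (real^'n) \<Rightarrow> (real^'n) \<times> (real^'n)" where
  "linear_obs R D F a b z = (a + (R *v fst z + D *v snd z), b + fst z - F *v (R *v fst z + D *v snd z))"

definition linear_llr ::
  "real^'n^'n \<Rightarrow> real^'n^'n \<Rightarrow> real^'n^'n \<Rightarrow> real^'n^'n \<Rightarrow> real^'n^'n \<Rightarrow> real^'n \<Rightarrow> real^'n \<Rightarrow> (real^'n) \<times> (real^'n) \<Rightarrow> real" where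
  "linear_llr R D F B C a b z =
     (norm (matrix_inv B *v fst (linear_obs R D F a b z)))\<^sup>2 / 2
     + (norm (matrix_inv C *v snd (linear_obs R D F a b z)))\<^sup>2 / 2
     - (norm (fst z))\<^sup>2 / 2 - (norm (snd z))\<^sup>2 / 2 + ln (\<bar>det B\<bar> * \<bar>det C\<bar> / \<bar>det D\<bar>)"

lemma measurable_linear_obs [measurable]:
  "linear_obs R D F a b \<in> borel \<Otimes>\<^sub>M borel \<rightarrow>\<^sub>M borel \<Otimes>\<^sub>M borel"
  unfolding linear_obs_def by measurable

lemma measurable_linear_llr [measurable]:
  "linear_llr R D F B C a b \<in> borel_measurable (borel \<Otimes>\<^sub>M borel)"
  unfolding linear_llr_def by measurable

text \<open>The map factors through \<open>r = R g + D g'\<close>: for fixed \<open>g\<close> it is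
  affine in \<open>g'\<close> with determinant \<open>det D\<close>, then for fixed \<open>r\<close>
  it translates \<open>g\<close>, and at last \<open>r\<close> itself is translated. So the Jacobian
  is that of \<open>D\<close>, whatever \<open>R\<close> and \<open>F\<close> are.\<close>

lemma linear_llr_change_of_measure:
  fixes R D F B C :: "real^'n^'n"
  assumes D: "invertible D" and B: "invertible B" and C: "invertible C"
    and A: "A \<in> sets (gaussian B \<Otimes>\<^sub>M gaussian C)"
  shows "(\<integral>\<^sup>+z. ennreal (exp (- linear_llr R D F B C a b z)) * indicator A (linear_obs R D F a b z)
      \<partial>(std_gaussian \<Otimes>\<^sub>M std_gaussian)) = emeasure (gaussian B \<Otimes>\<^sub>M gaussian C) A"
proof -
  have sets: "sets (gaussian B \<Otimes>\<^sub>M gaussian C) = sets (borel \<Otimes>\<^sub>M borel)"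
    by (intro sets_pair_measure_cong) auto
  have [measurable]: "A \<in> sets (borel \<Otimes>\<^sub>M borel)" using A sets by simp
  have dD: "0 < \<bar>det D\<bar>" and dB: "0 < \<bar>det B\<bar>" and dC: "0 < \<bar>det C\<bar>"
    using assms by (auto simp: invertible_det_nz)
  interpret gC: prob_space "gaussian C" by (rule prob_space_gaussian)
  define qB where "qB y = gauss_pdf (matrix_inv B *v y) / \<bar>det B\<bar>" for y
  define qC where "qC y = gauss_pdf (matrix_inv C *v y) / \<bar>det C\<bar>" for y
  have q0: "0 \<le> qB y" "0 \<le> qC y" for y
    by (auto simp: qB_def qC_def gauss_pdf_pos[THEN less_imp_le])
  have gm: "(\<lambda>y. gauss_pdf (X *v y)) \<in> borel_measurable borel" for X :: "real^'n^'n"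
    by (rule measurable_compose[OF _ borel_measurable_gauss_pdf]) measurable
  have [measurable]: "qB \<in> borel_measurable borel" "qC \<in> borel_measurable borel"
    unfolding qB_def qC_def using gm by measurable
  \<comment> \<open>The integrand in the coordinates \<open>g\<close> and
    \<open>r = R g + D g'\<close>.\<close>
  define G where "G g r = ennreal (qB (a + r) * qC (b + g - F *v r)) * indicator A (a + r, b + g - F *v r)" for g r
  have [measurable]: "(\<lambda>(g, r). G g r) \<in> borel_measurable (borel \<Otimes>\<^sub>M borel)"
    unfolding G_def by measurable
  have Gm: "(\<lambda>r. G g r) \<in> borel_measurable borel" for g
    unfolding G_def by measurable
  have pdf: "gauss_pdf (fst z) * (gauss_pdf (snd z) * exp (- linear_llr R D F B C a b z))
     = \<bar>det D\<bar> * (qB (fst (linear_obs R D F a b z)) * qC (snd (linear_obs R D F a b z)))" for z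
  proof -
    \<comment> \<open>The exponentials of the noise norms cancel against those in the two standard
      densities; the primed letters are the inverse factors.\<close>
    have alg: "(ea / p) * ((eb / p) * (eu * ev * ea' * eb' * (d / (x * y)))) = d * ((eu / p / x) * (ev / p / y))"
      if "ea * ea' = 1" "eb * eb' = 1" for ea ea' eb eb' eu ev p d x y :: real
    proof -
      have "(ea / p) * ((eb / p) * (eu * ev * ea' * eb' * (d / (x * y)))) = (ea * ea') * (eb * eb') * (eu * ev * d / (p * p * x * y))"
        by (simp add: ac_simps)
      then show ?thesis unfolding that by (simp add: ac_simps)
    qed
    let ?u = "(norm (matrix_inv B *v fst (linear_obs R D F a b z)))\<^sup>2"
    let ?v = "(norm (matrix_inv C *v snd (linear_obs R D F a b z)))\<^sup>2"
    let ?d = "\<bar>det B\<bar> * \<bar>det C\<bar> / \<bar>det D\<bar>"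
    have "exp (- ln ?d) = 1 / ?d"
      using dD dB dC by (simp add: exp_minus field_simps)
    then have d: "exp (- ln ?d) = \<bar>det D\<bar> / (\<bar>det B\<bar> * \<bar>det C\<bar>)" by simp
    have "- linear_llr R D F B C a b z
      = - ?u / 2 + - ?v / 2 + (norm (fst z))\<^sup>2 / 2 + (norm (snd z))\<^sup>2 / 2 + - ln ?d"
      by (simp add: linear_llr_def)
    then have e: "exp (- linear_llr R D F B C a b z)
      = exp (- ?u / 2) * exp (- ?v / 2) * exp ((norm (fst z))\<^sup>2 / 2) * exp ((norm (snd z))\<^sup>2 / 2) * exp (- ln ?d)"
      by (simp only: exp_add)
    show ?thesis
      unfolding qB_def qC_def gauss_pdf_eq e d by (rule alg) (simp_all flip: exp_add)
  qed
  have "(\<integral>\<^sup>+z. ennreal (exp (- linear_llr R D F B C a b z)) * indicator A (linear_obs R D F a b z)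
      \<partial>(std_gaussian \<Otimes>\<^sub>M std_gaussian))
    = (\<integral>\<^sup>+g. \<integral>\<^sup>+g'. ennreal (exp (- linear_llr R D F B C a b (g, g'))) * indicator A (linear_obs R D F a b (g, g')) \<partial>std_gaussian \<partial>std_gaussian)"
    by (subst std_gaussian.nn_integral_fst[symmetric]) auto
  also have "\<dots> = (\<integral>\<^sup>+g. \<integral>\<^sup>+g'. ennreal (gauss_pdf g) * (ennreal (gauss_pdf g') * (ennreal (exp (- linear_llr R D F B C a b (g, g'))) * indicator A (linear_obs R D F a b (g, g')))) \<partial>lborel \<partial>lborel)"
    by (subst nn_integral_std_gaussian, measurable)
      (simp add: nn_integral_std_gaussian nn_integral_cmult)
  also have "\<dots> = (\<integral>\<^sup>+g. \<integral>\<^sup>+g'. ennreal \<bar>det D\<bar> * G g (R *v g + D *v g') \<partial>lborel \<partial>lborel)"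
  proof (intro nn_integral_cong)
    fix g g' :: "real^'n"
    have "ennreal (gauss_pdf g) * (ennreal (gauss_pdf g') * ennreal (exp (- linear_llr R D F B C a b (g, g'))))
       = ennreal (gauss_pdf g * (gauss_pdf g' * exp (- linear_llr R D F B C a b (g, g'))))"
      by (simp add: ennreal_mult gauss_pdf_pos less_imp_le)
    also have "\<dots> = ennreal \<bar>det D\<bar> * ennreal (qB (a + (R *v g + D *v g')) * qC (b + g - F *v (R *v g + D *v g')))"
      using pdf[of "(g, g')"] q0 by (simp add: linear_obs_def ennreal_mult)
    finally show "ennreal (gauss_pdf g) * (ennreal (gauss_pdf g') * (ennreal (exp (- linear_llr R D F B C a b (g, g'))) * indicator A (linear_obs R D F a b (g, g'))))
       = ennreal \<bar>det D\<bar> * G g (R *v g + D *v g')"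
      by (simp add: G_def linear_obs_def flip: mult.assoc)
  qed
  also have "\<dots> = (\<integral>\<^sup>+g. \<integral>\<^sup>+r. G g r \<partial>lborel \<partial>lborel)"
  proof (rule nn_integral_cong)
    fix g :: "real^'n"
    have m: "(\<lambda>r. G g (R *v g + r)) \<in> borel_measurable borel"
      by (rule measurable_compose[OF _ Gm]) measurable
    have "(\<integral>\<^sup>+r. G g r \<partial>lborel) = (\<integral>\<^sup>+r. G g (R *v g + r) \<partial>lborel)"
      by (rule nn_integral_lborel_translate[OF Gm, symmetric])
    also have "\<dots> = ennreal \<bar>det D\<bar> * (\<integral>\<^sup>+g'. G g (R *v g + D *v g') \<partial>lborel)"
      by (rule nn_integral_matrix[OF m D])
    also have "\<dots> = (\<integral>\<^sup>+g'. ennreal \<bar>det D\<bar> * G g (R *v g + D *v g') \<partial>lborel)"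
      by (rule nn_integral_cmult[symmetric]) (use measurable_compose[OF borel_measurable_matrix_vector m, of D] in simp)
    finally show "(\<integral>\<^sup>+g'. ennreal \<bar>det D\<bar> * G g (R *v g + D *v g') \<partial>lborel) = (\<integral>\<^sup>+r. G g r \<partial>lborel)" ..
  qed
  also have "\<dots> = (\<integral>\<^sup>+r. \<integral>\<^sup>+g. G g r \<partial>lborel \<partial>lborel)"
    by (rule lborel_pair.Fubini') measurable
  also have "\<dots> = (\<integral>\<^sup>+r. \<integral>\<^sup>+e. ennreal (qB (a + r) * qC e) * indicator A (a + r, e) \<partial>lborel \<partial>lborel)"
  proof (rule nn_integral_cong)
    fix r :: "real^'n"
    have "(\<lambda>e. ennreal (qB (a + r) * qC e) * indicator A (a + r, e)) \<in> borel_measurable borel" by measurable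
    from nn_integral_lborel_translate[OF this, of "b - F *v r"]
    show "(\<integral>\<^sup>+g. G g r \<partial>lborel) = (\<integral>\<^sup>+e. ennreal (qB (a + r) * qC e) * indicator A (a + r, e) \<partial>lborel)"
      unfolding G_def by (simp add: algebra_simps)
  qed
  also have "\<dots> = (\<integral>\<^sup>+y. \<integral>\<^sup>+e. ennreal (qB y * qC e) * indicator A (y, e) \<partial>lborel \<partial>lborel)"
    by (rule nn_integral_lborel_translate[of "\<lambda>y. \<integral>\<^sup>+e. ennreal (qB y * qC e) * indicator A (y, e) \<partial>lborel"]) measurable
  also have "\<dots> = (\<integral>\<^sup>+y. ennreal (qB y) * (\<integral>\<^sup>+e. ennreal (qC e) * indicator A (y, e) \<partial>lborel) \<partial>lborel)"
    by (simp add: ennreal_mult q0 mult.assoc nn_integral_cmult)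
  also have "\<dots> = (\<integral>\<^sup>+y. \<integral>\<^sup>+e. indicator A (y, e) \<partial>gaussian C \<partial>gaussian B)"
  proof -
    have 1: "(\<integral>\<^sup>+e. indicator A (y, e) \<partial>gaussian C) = (\<integral>\<^sup>+e. ennreal (qC e) * indicator A (y, e) \<partial>lborel)" for y
      unfolding qC_def by (subst nn_integral_gaussian, measurable)
        (subst nn_integral_std_gaussian_matrix[OF _ C, of "\<lambda>e. indicator A (y, e)"], measurable)
    have 2: "(\<lambda>y. \<integral>\<^sup>+e. ennreal (qC e) * indicator A (y, e) \<partial>lborel) \<in> borel_measurable borel" by measurable
    show ?thesis
      unfolding 1 nn_integral_gaussian[OF 2] nn_integral_std_gaussian_matrix[OF 2 B] qB_def ..
  qed
  also have "\<dots> = emeasure (gaussian B \<Otimes>\<^sub>M gaussian C) A"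
    using A by (subst gC.emeasure_pair_measure) auto
  finally show ?thesis .
qed

text \<open>The mean is affine in \<open>outer a\<close> and \<open>outer b\<close>, which occur
  only inside traces. This form is chosen so that averaging over messages and channel uses passes to
  the covariance of the code.\<close>

lemma integral_linear_llr:
  fixes R D F B C :: "real^'n^'n"
  shows "has_bochner_integral (std_gaussian \<Otimes>\<^sub>M std_gaussian) (linear_llr R D F B C a b)
     (trace (matrix_inv B ** (outer a + R ** transpose R + D ** transpose D) ** transpose (matrix_inv B)) / 2
     + trace (matrix_inv C ** (outer b + (mat 1 - F ** R) ** transpose (mat 1 - F ** R) + (F ** D) ** transpose (F ** D)) ** transpose (matrix_inv C)) / 2
     - CARD('n) + ln (\<bar>det B\<bar> * \<bar>det C\<bar> / \<bar>det D\<bar>))"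
proof -
  let ?B = "matrix_inv B" and ?C = "matrix_inv C"
  have n1: "(norm (?B *v fst (linear_obs R D F a b z)))\<^sup>2 = (norm (?B *v a + (?B ** R) *v fst z + (?B ** D) *v snd z))\<^sup>2" for z
    by (simp add: linear_obs_def matrix_vector_right_distrib matrix_vector_mul_assoc add.assoc)
  have n2: "(norm (?C *v snd (linear_obs R D F a b z)))\<^sup>2
      = (norm (?C *v b + (?C ** (mat 1 - F ** R)) *v fst z + (?C ** (- (F ** D))) *v snd z))\<^sup>2" for z
  proof -
    have "snd (linear_obs R D F a b z) = b + (mat 1 - F ** R) *v fst z + (- (F ** D)) *v snd z"
      by (simp add: linear_obs_def matrix_vector_mult_diff_rdistrib matrix_vector_right_distrib matrix_vector_mul_assoc
          matrix_vector_mult_minus_left)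
    then show ?thesis
      by (simp only: matrix_vector_right_distrib matrix_vector_mul_assoc)
  qed
  have tr0: "trace (0 :: real^'n^'n) = 0" by (simp add: trace_def)
  have tr: "trace (mat 1 ** transpose (mat 1 :: real^'n^'n)) = CARD('n)" "trace (0 ** transpose (0 :: real^'n^'n)) = 0"
    by (simp_all add: trace_I tr0)
  have n3: "has_bochner_integral (std_gaussian \<Otimes>\<^sub>M std_gaussian) (\<lambda>z::(real^'n) \<times> (real^'n). (norm (fst z))\<^sup>2) CARD('n)"
      "has_bochner_integral (std_gaussian \<Otimes>\<^sub>M std_gaussian) (\<lambda>z::(real^'n) \<times> (real^'n). (norm (snd z))\<^sup>2) CARD('n)"
    using has_bochner_integral_norm_affine[of "0::real^'n" "mat 1" "0::real^'n^'n"]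
      has_bochner_integral_norm_affine[of "0::real^'n" "0::real^'n^'n" "mat 1"] by (simp_all add: tr tr0 trace_I)
  have "has_bochner_integral (std_gaussian \<Otimes>\<^sub>M std_gaussian) (linear_llr R D F B C a b)
     (((norm (?B *v a))\<^sup>2 + trace ((?B ** R) ** transpose (?B ** R)) + trace ((?B ** D) ** transpose (?B ** D))) / 2
     + ((norm (?C *v b))\<^sup>2 + trace ((?C ** (mat 1 - F ** R)) ** transpose (?C ** (mat 1 - F ** R)))
          + trace ((?C ** (- (F ** D))) ** transpose (?C ** (- (F ** D))))) / 2
     - CARD('n) / 2 - CARD('n) / 2 + ln (\<bar>det B\<bar> * \<bar>det C\<bar> / \<bar>det D\<bar>))"
    unfolding linear_llr_def[abs_def] n1 n2
    by (intro has_bochner_integral_add has_bochner_integral_diff has_bochner_integral_divide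
        has_bochner_integral_norm_affine n3)
      (simp add: has_bochner_integral_iff prob_space.prob_space[OF std_pair.prob_space_axioms])
  moreover have c: "X ** (Y ** transpose Y) ** transpose X = (X ** Y) ** transpose (X ** Y)" for X Y :: "real^'n^'n"
    by (simp add: matrix_transpose_mul matrix_mul_assoc)
  have "trace (X ** (outer v + Y ** transpose Y + Z ** transpose Z) ** transpose X)
    = (norm (X *v v))\<^sup>2 + trace ((X ** Y) ** transpose (X ** Y)) + trace ((X ** Z) ** transpose (X ** Z))"
    for X Y Z :: "real^'n^'n" and v
    by (simp only: matrix_add_ldistrib matrix_add_rdistrib trace_add trace_outer c)
  moreover have "(?C ** (- (F ** D))) ** transpose (?C ** (- (F ** D))) = (?C ** (F ** D)) ** transpose (?C ** (F ** D))"
    by (simp add: vec_eq_iff matrix_matrix_mult_def transpose_def sum_negf)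
  ultimately show ?thesis by simp
qed

text \<open>The reference covariances are the averages of the true second moments. Both traces then
  average to \<open>CARD('n)\<close>, their halves cancel the term \<open>- CARD('n)\<close>, and
  only the determinants are left.\<close>

lemma gaussian_converse:
  fixes R D F B C :: "real^'n^'n"
  assumes K: "finite K" "K \<noteq> {}" and m: "1 \<le> m" and n: "1 \<le> n"
    and inv: "invertible D" "invertible B" "invertible C"
    and BB: "B ** transpose B = (1 / (real n * card K)) *\<^sub>R (\<Sum>k\<in>K. \<Sum>j<n. outer (a k j)) + R ** transpose R + D ** transpose D"
    and CC: "C ** transpose C = (1 / (real n * card K)) *\<^sub>R (\<Sum>k\<in>K. \<Sum>j<n. outer (b k j))
        + (mat 1 - F ** R) ** transpose (mat 1 - F ** R) + (F ** D) ** transpose (F ** D)"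
    and s: "\<And>k. k \<in> K \<Longrightarrow> s k \<in> sets (Pi\<^sub>M {..<n} (\<lambda>_. borel \<Otimes>\<^sub>M borel))"
    and mult: "\<And>y. card {k\<in>K. y \<in> s k} \<le> card K / m"
  shows "(\<Sum>k\<in>K. measure (Pi\<^sub>M {..<n} (\<lambda>_. std_gaussian \<Otimes>\<^sub>M std_gaussian))
        {z \<in> space (Pi\<^sub>M {..<n} (\<lambda>_. std_gaussian \<Otimes>\<^sub>M std_gaussian)).
           (\<lambda>j\<in>{..<n}. linear_obs R D F (a k j) (b k j) (z j)) \<in> s k}) * ln m - card K * ln 2
      \<le> real n * card K * ln (\<bar>det B\<bar> * \<bar>det C\<bar> / \<bar>det D\<bar>)"
proof -
  let ?M = "std_gaussian \<Otimes>\<^sub>M (std_gaussian :: (real^'n) measure)"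
  let ?Q = "gaussian B \<Otimes>\<^sub>M gaussian C"
  let ?c = "ln (\<bar>det B\<bar> * \<bar>det C\<bar> / \<bar>det D\<bar>)" and ?N = "real n * real (card K)"
  interpret gB: prob_space "gaussian B" by (rule prob_space_gaussian)
  interpret gC: prob_space "gaussian C" by (rule prob_space_gaussian)
  interpret Q: pair_prob_space "gaussian B" "gaussian C" ..
  have setsM: "sets ?M = sets (borel \<Otimes>\<^sub>M borel)" and setsQ: "sets ?Q = sets (borel \<Otimes>\<^sub>M borel)"
    by (intro sets_pair_measure_cong; simp)+
  have N: "n \<noteq> 0" "card K \<noteq> 0" using K n by auto
  let ?l = "\<lambda>k j. linear_llr R D F B C (a k j) (b k j)"
  have "(\<Sum>k\<in>K. measure (Pi\<^sub>M {..<n} (\<lambda>_. ?M))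
        {z \<in> space (Pi\<^sub>M {..<n} (\<lambda>_. ?M)). (\<lambda>j\<in>{..<n}. linear_obs R D F (a k j) (b k j) (z j)) \<in> s k}) * ln m - card K * ln 2
     \<le> (\<Sum>k\<in>K. \<Sum>j<n. \<integral>z. ?l k j z \<partial>?M)"
  proof (rule memoryless_converse)
    show "prob_space ?M" by (rule std_pair.prob_space_axioms)
    show "prob_space ?Q" by (rule Q.prob_space_axioms)
    show "linear_obs R D F (a k j) (b k j) \<in> ?M \<rightarrow>\<^sub>M ?Q" for k j
      using measurable_linear_obs measurable_cong_sets[OF setsM setsQ] by blast
    show "integrable ?M (?l k j)" for k j
      using integral_linear_llr[of R D F B C "a k j" "b k j"] by (simp add: has_bochner_integral_iff)
    show "(\<integral>\<^sup>+z. ennreal (exp (- ?l k j z)) * indicator A (linear_obs R D F (a k j) (b k j) z) \<partial>?M) = emeasure ?Q A"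
      if "A \<in> sets ?Q" for k j A
      using inv that by (intro linear_llr_change_of_measure)
    have "sets (Pi\<^sub>M {..<n} (\<lambda>_. ?Q)) = sets (Pi\<^sub>M {..<n} (\<lambda>_. borel \<Otimes>\<^sub>M borel))"
      by (intro sets_PiM_cong setsQ refl)
    then show "s k \<in> sets (Pi\<^sub>M {..<n} (\<lambda>_. ?Q))" if "k \<in> K" for k using s[OF that] by simp
  qed (use K m mult in auto)
  also have "(\<Sum>k\<in>K. \<Sum>j<n. \<integral>z. ?l k j z \<partial>?M)
    = (\<Sum>k\<in>K. \<Sum>j<n. trace (matrix_inv B ** (outer (a k j) + (R ** transpose R + D ** transpose D)) ** transpose (matrix_inv B)) / 2
     + trace (matrix_inv C ** (outer (b k j) + ((mat 1 - F ** R) ** transpose (mat 1 - F ** R) + (F ** D) ** transpose (F ** D))) ** transpose (matrix_inv C)) / 2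
     + (?c - CARD('n)))"
    using integral_linear_llr[of R D F B C] by (intro sum.cong refl) (simp add: has_bochner_integral_iff add.assoc)
  also have "\<dots> = ?N * trace (matrix_inv B ** (B ** transpose B) ** transpose (matrix_inv B)) / 2
     + ?N * trace (matrix_inv C ** (C ** transpose C) ** transpose (matrix_inv C)) / 2 + ?N * (?c - CARD('n))"
  proof -
    \<comment> \<open>The trace is linear, so the sum over messages and channel uses moves inside,
      onto the outer products.\<close>
    have *: "(\<Sum>k\<in>K. \<Sum>j<n. trace (X ** (outer (f k j) + Y) ** transpose X)) = ?N * trace (X ** ((1 / ?N) *\<^sub>R (\<Sum>k\<in>K. \<Sum>j<n. outer (f k j)) + Y) ** transpose X)"
      for X Y :: "real^'n^'n" and f
      using N by (simp add: matrix_add_ldistrib matrix_add_rdistrib trace_add sum.distrib matrix_mult_scaleR_distrib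
          trace_scaleR matrix_mult_sum_distrib trace_sum field_simps)
    show ?thesis
      unfolding sum.distrib sum_divide_distrib[symmetric] * BB CC add.assoc by simp
  qed
  also have "\<dots> = ?N * ?c"
  proof -
    have "trace (matrix_inv X ** (X ** transpose X) ** transpose (matrix_inv X)) = CARD('n)" if "invertible X" for X :: "real^'n^'n"
    proof -
      have "matrix_inv X ** (X ** transpose X) ** transpose (matrix_inv X) = (matrix_inv X ** X) ** transpose (matrix_inv X ** X)"
        by (simp add: matrix_transpose_mul matrix_mul_assoc)
      then show ?thesis by (simp add: matrix_inv_left[OF that] trace_I)
    qed
    then show ?thesis using inv by (simp add: algebra_simps)
  qed
  finally show ?thesis .
qed

section \<open>Error probabilities as averages over message pairs\<close>

lemma measure_pair_pmf_of_set:
  fixes A :: "'k::countable set" and P :: "'z measure"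
  assumes "finite A" "A \<noteq> {}"
    and P: "prob_space P" and Q: "\<And>k. {z \<in> space P. Q k z} \<in> sets P"
  shows "measure (measure_pmf (pmf_of_set A) \<Otimes>\<^sub>M P) {p \<in> space (measure_pmf (pmf_of_set A) \<Otimes>\<^sub>M P). Q (fst p) (snd p)}
    = (\<Sum>k\<in>A. measure P {z \<in> space P. Q k z}) / card A"
proof -
  interpret P0: prob_space P by fact
  let ?S = "measure_pmf (pmf_of_set A) \<Otimes>\<^sub>M P"
  let ?E = "{p \<in> space ?S. Q (fst p) (snd p)}"
  \<comment> \<open>The message type is countable, so measurability of each section
    suffices.\<close>
  have "Measurable.pred (count_space UNIV \<Otimes>\<^sub>M P) (\<lambda>p. Q (fst p) (snd p))"
    using Q by (intro measurable_pair_measure_countable1) (auto simp: pred_def)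
  moreover have "sets ?S = sets (count_space UNIV \<Otimes>\<^sub>M P)"
    by (intro sets_pair_measure_cong) auto
  ultimately have E: "?E \<in> sets ?S"
    by (simp add: pred_def space_pair_measure)
  have "emeasure ?S ?E = (\<integral>\<^sup>+k. emeasure P {z \<in> space P. Q k z} \<partial>measure_pmf (pmf_of_set A))"
    unfolding P0.emeasure_pair_measure_alt[OF E]
    by (intro nn_integral_cong arg_cong2[where f=emeasure]) (auto simp: space_pair_measure)
  also have "\<dots> = (\<Sum>k\<in>A. emeasure P {z \<in> space P. Q k z}) / card A"
    using assms by (subst nn_integral_pmf_of_set) auto
  also have "\<dots> = ennreal ((\<Sum>k\<in>A. measure P {z \<in> space P. Q k z}) / card A)"
    using assms by (simp add: P0.emeasure_eq_measure divide_ennreal sum_nonneg card_gt_0_iff ennreal_of_nat_eq_real_of_nat)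
  finally show ?thesis
    by (simp add: measure_def sum_nonneg)
qed

text \<open>The noise is a single standard Gaussian sequence, whichever receiver is meant and
  whatever the joint law of the two noises is.\<close>

definition err_given :: "nat \<Rightarrow> ((nat \<Rightarrow> real^'n) \<Rightarrow> nat) \<Rightarrow> (nat \<Rightarrow> real^'n) \<Rightarrow> nat \<Rightarrow> real" where
  "err_given n d c m = measure (Pi\<^sub>M {..<n} (\<lambda>_. std_gaussian))
     {z \<in> space (Pi\<^sub>M {..<n} (\<lambda>_. std_gaussian)). d (\<lambda>j\<in>{..<n}. c j + z j) \<noteq> m}"

lemma measurable_decoder_shift:
  assumes "decoder n d" and f: "\<And>j. j < n \<Longrightarrow> (\<lambda>z. f z j) \<in> borel_measurable P"
  shows "{z \<in> space P. d (\<lambda>j\<in>{..<n}. f z j) = m} \<in> sets P"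
proof -
  have "(\<lambda>z. d (\<lambda>j\<in>{..<n}. f z j)) \<in> P \<rightarrow>\<^sub>M count_space UNIV"
    by (rule measurable_compose[OF measurable_restrict assms(1)]) (use f in auto)
  then show ?thesis by measurable
qed

lemma measure_PiM_distr:
  assumes N: "prob_space N" and f: "f \<in> N \<rightarrow>\<^sub>M Q" and Q: "prob_space Q" and eq: "distr N Q f = Q"
    and E: "E \<in> sets (Pi\<^sub>M {..<n::nat} (\<lambda>_. Q))"
  shows "measure (Pi\<^sub>M {..<n} (\<lambda>_. N)) {z \<in> space (Pi\<^sub>M {..<n} (\<lambda>_. N)). (\<lambda>j\<in>{..<n}. f (z j)) \<in> E}
    = measure (Pi\<^sub>M {..<n} (\<lambda>_. Q)) E"
proof -
  have c: "(\<lambda>z. z j) \<in> Pi\<^sub>M {..<n} (\<lambda>_. N) \<rightarrow>\<^sub>M N" if "j < n" for j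
    using measurable_component_singleton[of j "{..<n}" "\<lambda>_. N"] that by simp
  have t: "(\<lambda>z. \<lambda>j\<in>{..<n}. f (z j)) \<in> Pi\<^sub>M {..<n} (\<lambda>_. N) \<rightarrow>\<^sub>M Pi\<^sub>M {..<n} (\<lambda>_. Q)"
    by (intro measurable_restrict measurable_compose[OF c f]) auto
  have "{z \<in> space (Pi\<^sub>M {..<n} (\<lambda>_. N)). (\<lambda>j\<in>{..<n}. f (z j)) \<in> E} \<in> sets (Pi\<^sub>M {..<n} (\<lambda>_. N))"
    using measurable_sets[OF t E] by (simp add: vimage_def Int_def conj_commute)
  then have "emeasure (Pi\<^sub>M {..<n} (\<lambda>_. N)) {z \<in> space (Pi\<^sub>M {..<n} (\<lambda>_. N)). (\<lambda>j\<in>{..<n}. f (z j)) \<in> E}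
    = (\<integral>\<^sup>+z. indicator {z \<in> space (Pi\<^sub>M {..<n} (\<lambda>_. N)). (\<lambda>j\<in>{..<n}. f (z j)) \<in> E} z \<partial>Pi\<^sub>M {..<n} (\<lambda>_. N))"
    by simp
  also have "\<dots> = (\<integral>\<^sup>+z. indicator E (\<lambda>j\<in>{..<n}. f (z j)) \<partial>Pi\<^sub>M {..<n} (\<lambda>_. N))"
    by (intro nn_integral_cong) (auto simp: indicator_def)
  also have "\<dots> = (\<integral>\<^sup>+y. indicator E y \<partial>Pi\<^sub>M {..<n} (\<lambda>_. Q))"
    using E by (intro nn_integral_PiM_distr N f Q eq) auto
  finally show ?thesis using E by (simp add: measure_def)
qed

text \<open>\<open>f\<close> may be any function of the noise with a standard Gaussian law: a
  projection of the channel noise when error probabilities are evaluated, a linear combination of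
  two independent vectors when the noises are coupled in the converse.\<close>

lemma measure_PiM_noise:
  assumes N: "prob_space N" and f: "f \<in> borel_measurable N" and eq: "distr N borel f = std_gaussian"
    and d: "decoder n d"
  shows "measure (Pi\<^sub>M {..<n} (\<lambda>_. N)) {z \<in> space (Pi\<^sub>M {..<n} (\<lambda>_. N)). d (\<lambda>j\<in>{..<n}. c j + f (z j)) \<noteq> m}
    = err_given n d c m"
proof -
  let ?P = "Pi\<^sub>M {..<n} (\<lambda>_. std_gaussian)"
  have c: "(\<lambda>z. z j) \<in> borel_measurable ?P" if "j < n" for j
    using measurable_component_singleton[of j "{..<n}" "\<lambda>_. std_gaussian"] that by simp
  let ?E = "{z \<in> space ?P. d (\<lambda>j\<in>{..<n}. c j + z j) \<noteq> m}"
  have "space ?P - {z \<in> space ?P. d (\<lambda>j\<in>{..<n}. c j + z j) = m} \<in> sets ?P"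
    by (intro sets.Diff sets.top measurable_decoder_shift[OF d]) (intro borel_measurable_add borel_measurable_const c)
  also have "space ?P - {z \<in> space ?P. d (\<lambda>j\<in>{..<n}. c j + z j) = m} = ?E" by auto
  finally have E: "?E \<in> sets ?P" .
  have fN: "f \<in> N \<rightarrow>\<^sub>M std_gaussian" using f by simp
  have dN: "distr N std_gaussian f = std_gaussian"
    using eq by (metis distr_cong sets_std_gaussian)
  have "{z \<in> space (Pi\<^sub>M {..<n} (\<lambda>_. N)). d (\<lambda>j\<in>{..<n}. c j + f (z j)) \<noteq> m}
    = {z \<in> space (Pi\<^sub>M {..<n} (\<lambda>_. N)). (\<lambda>j\<in>{..<n}. f (z j)) \<in> ?E}"
  proof -
    have "(\<lambda>j\<in>{..<n}. c j + (\<lambda>j\<in>{..<n}. f (z j)) j) = (\<lambda>j\<in>{..<n}. c j + f (z j))" for z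
      by (auto simp: restrict_def)
    moreover have "(\<lambda>j\<in>{..<n}. f (z j)) \<in> space ?P" for z
      by (auto simp: space_PiM)
    ultimately show ?thesis by simp
  qed
  then show ?thesis
    using measure_PiM_distr[OF N fN std_gaussian.prob_space_axioms dN E] by (simp add: err_given_def)
qed

lemma err_given_bounds: "0 \<le> err_given n d c m" "err_given n d c m \<le> 1"
proof -
  interpret prob_space "Pi\<^sub>M {..<n} (\<lambda>_. std_gaussian :: (real^'n) measure)"
    by (intro prob_space_PiM std_gaussian.prob_space_axioms)
  show "0 \<le> err_given n d c m" "err_given n d c m \<le> 1" for d :: "(nat \<Rightarrow> real^'n) \<Rightarrow> nat" and c
    by (simp_all add: err_given_def)
qed

lemma num_msgs_pos: "0 < num_msgs n R"
  unfolding num_msgs_def by (simp add: less_ceiling_iff)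

lemma num_msgs_ge: "exp (real n * R) \<le> num_msgs n R"
  unfolding num_msgs_def by (rule order_trans[OF le_of_int_ceiling]) simp

lemma msg_pair_pmf: "pair_pmf (msg_pmf n R1) (msg_pmf n R2) = pmf_of_set ({..<num_msgs n R1} \<times> {..<num_msgs n R2})"
  unfolding msg_pmf_def using num_msgs_pos[of n R1] num_msgs_pos[of n R2]
  by (intro pmf_eqI) (auto simp: pmf_pair indicator_def card_cartesian_product lessThan_empty_iff split: prod.splits)

text \<open>Signal \<open>c\<close>, sought message \<open>t\<close> and noise projection
  \<open>f\<close> are left open, so that both receivers are instances.\<close>

lemma error_prob_eq:
  fixes N :: "((real^'r1) \<times> (real^'r2)) measure" and f :: "(real^'r1) \<times> (real^'r2) \<Rightarrow> real^'n"
  assumes N: "prob_space N" and f: "f \<in> borel_measurable N" and eq: "distr N borel f = std_gaussian"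
    and d: "decoder n d"
  shows "measure (code_space n R1 R2 N)
       {((m1, m2), z) \<in> space (code_space n R1 R2 N). d (\<lambda>j\<in>{..<n}. c (m1, m2) j + f (z j)) \<noteq> t (m1, m2)}
    = (\<Sum>k\<in>{..<num_msgs n R1} \<times> {..<num_msgs n R2}. err_given n d (c k) (t k)) / (num_msgs n R1 * num_msgs n R2)"
proof -
  let ?A = "{..<num_msgs n R1} \<times> {..<num_msgs n R2}" and ?P = "Pi\<^sub>M {..<n} (\<lambda>_. N)"
  have P: "prob_space ?P" by (intro prob_space_PiM N)
  have cN: "(\<lambda>z. f (z j)) \<in> borel_measurable ?P" if "j < n" for j
    using measurable_compose[OF measurable_component_singleton[of j "{..<n}" "\<lambda>_. N"] f] that by simp
  have A: "finite ?A" "?A \<noteq> {}" using num_msgs_pos by (auto simp: lessThan_empty_iff)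
  have Q: "{z \<in> space ?P. d (\<lambda>j\<in>{..<n}. c k j + f (z j)) \<noteq> t k} \<in> sets ?P" for k
  proof -
    have "space ?P - {z \<in> space ?P. d (\<lambda>j\<in>{..<n}. c k j + f (z j)) = t k} \<in> sets ?P"
      by (intro sets.Diff sets.top measurable_decoder_shift[OF d]) (intro borel_measurable_add borel_measurable_const cN)
    also have "space ?P - {z \<in> space ?P. d (\<lambda>j\<in>{..<n}. c k j + f (z j)) = t k}
      = {z \<in> space ?P. d (\<lambda>j\<in>{..<n}. c k j + f (z j)) \<noteq> t k}" by auto
    finally show ?thesis .
  qed
  have "{((m1, m2), z) \<in> space (code_space n R1 R2 N). d (\<lambda>j\<in>{..<n}. c (m1, m2) j + f (z j)) \<noteq> t (m1, m2)}
     = {p \<in> space (code_space n R1 R2 N). d (\<lambda>j\<in>{..<n}. c (fst p) j + f (snd p j)) \<noteq> t (fst p)}"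
    by auto
  then show ?thesis
    using measure_pair_pmf_of_set[OF A P Q]
    by (simp add: code_space_def msg_pair_pmf measure_PiM_noise[OF N f eq d] card_cartesian_product)
qed

lemma noise_law_prob_space:
  assumes "noise_law N" shows "prob_space N"
proof -
  have s: "sets N = sets borel" using assms by (simp add: noise_law_def)
  have f: "fst \<in> borel_measurable N"
    unfolding measurable_cong_sets[OF s refl] by (intro borel_measurable_continuous_onI continuous_intros)
  have "emeasure N (space N) = emeasure (distr N borel fst) UNIV"
    by (subst emeasure_distr[OF f]) auto
  then show ?thesis using assms by (intro prob_spaceI) (simp add: noise_law_def)
qed

lemma error_prob1_eq:
  assumes N: "noise_law N" and d: "decoder n d"
  shows "error_prob1 H1 H2 N n R1 R2 x1 x2 d
    = (\<Sum>k\<in>{..<num_msgs n R1} \<times> {..<num_msgs n R2}. err_given n d (\<lambda>j. H1 *v x1 (fst k) j + H2 *v x2 (snd k) j) (fst k))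
        / (num_msgs n R1 * num_msgs n R2)"
proof -
  have s: "sets N = sets borel" using N by (simp add: noise_law_def)
  have f: "fst \<in> borel_measurable N"
    unfolding measurable_cong_sets[OF s refl] by (intro borel_measurable_continuous_onI continuous_intros)
  show ?thesis
    unfolding error_prob1_def
    using error_prob_eq[OF noise_law_prob_space[OF N] f _ d, of R1 R2 "\<lambda>k j. H1 *v x1 (fst k) j + H2 *v x2 (snd k) j" fst] N
    by (simp add: noise_law_def)
qed

lemma error_prob2_eq:
  assumes N: "noise_law N" and d: "decoder n d"
  shows "error_prob2 H3 H4 N n R1 R2 x1 x2 d
    = (\<Sum>k\<in>{..<num_msgs n R1} \<times> {..<num_msgs n R2}. err_given n d (\<lambda>j. H3 *v x1 (fst k) j + H4 *v x2 (snd k) j) (snd k))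
        / (num_msgs n R1 * num_msgs n R2)"
proof -
  have s: "sets N = sets borel" using N by (simp add: noise_law_def)
  have f: "snd \<in> borel_measurable N"
    unfolding measurable_cong_sets[OF s refl] by (intro borel_measurable_continuous_onI continuous_intros)
  show ?thesis
    unfolding error_prob2_def
    using error_prob_eq[OF noise_law_prob_space[OF N] f _ d, of R1 R2 "\<lambda>k j. H3 *v x1 (fst k) j + H4 *v x2 (snd k) j" snd] N
    by (simp add: noise_law_def)
qed

section \<open>The average covariance of a code\<close>

lemma pos_semidef_outer: "pos_semidef (outer a)"
proof -
  have "outer a *v x = (a \<bullet> x) *\<^sub>R a" for x
    by (simp add: vec_eq_iff matrix_vector_mult_def outer_def inner_vec_def sum_distrib_right sum_distrib_left ac_simps)
  then have "x \<bullet> (outer a *v x) = (a \<bullet> x) * (a \<bullet> x)" for x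
    by (simp add: inner_commute)
  moreover have "transpose (outer a) = outer a"
    by (simp add: outer_def vec_eq_iff transpose_def mult.commute)
  ultimately show ?thesis by (simp add: pos_semidef_def)
qed

lemma pos_semidef_sum: "(\<And>i. i \<in> I \<Longrightarrow> pos_semidef (f i)) \<Longrightarrow> pos_semidef (\<Sum>i\<in>I. f i)"
  by (induction I rule: infinite_finite_induct) (auto intro: pos_semidef_add pos_semidef_zero)

lemma trace_outer_self: "trace (outer a) = (norm a)\<^sup>2"
  by (simp add: trace_def outer_def power2_norm_eq_inner inner_vec_def)

definition code_mean :: "nat \<Rightarrow> (nat \<Rightarrow> nat \<Rightarrow> real^'t) \<Rightarrow> nat \<Rightarrow> real^'t" where
  "code_mean M x j = (1 / M) *\<^sub>R (\<Sum>m<M. x m j)"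

text \<open>Centred at the mean over messages in each channel use separately. Centring makes the two
  users uncorrelated over uniform message pairs, and the decoders can add the known means
  back.\<close>

definition code_cov :: "nat \<Rightarrow> nat \<Rightarrow> (nat \<Rightarrow> nat \<Rightarrow> real^'t) \<Rightarrow> real^'t^'t" where
  "code_cov n M x = (1 / (real n * real M)) *\<^sub>R (\<Sum>m<M. \<Sum>j<n. outer (x m j - code_mean M x j))"

lemma sum_centred: "0 < M \<Longrightarrow> (\<Sum>m<M. x m j - code_mean M x j) = 0"
  by (simp add: code_mean_def sum_subtractf sum_constant_scaleR del: sum_constant)

text \<open>The cross term vanishes, so centring removes exactly the power of the mean and the power
  constraint survives.\<close>

lemma sum_norm_centred_le:
  assumes M: "0 < M"
  shows "(\<Sum>m<M. (norm (x m j - code_mean M x j))\<^sup>2) \<le> (\<Sum>m<M. (norm (x m j))\<^sup>2)"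
proof -
  let ?c = "code_mean M x j"
  have "(\<Sum>m<M. (norm (x m j))\<^sup>2) = (\<Sum>m<M. (norm (x m j - ?c))\<^sup>2 + 2 * ((x m j - ?c) \<bullet> ?c) + (norm ?c)\<^sup>2)"
    by (intro sum.cong refl) (simp add: power2_norm_eq_inner inner_diff_left inner_diff_right inner_commute)
  also have "\<dots> = (\<Sum>m<M. (norm (x m j - ?c))\<^sup>2) + 2 * ((\<Sum>m<M. x m j - ?c) \<bullet> ?c) + M * (norm ?c)\<^sup>2"
    by (simp add: sum.distrib inner_sum_left sum_distrib_left)
  finally show ?thesis by (simp add: sum_centred[OF M])
qed

lemma code_cov_in_cov_set:
  assumes n: "1 \<le> n" and p: "power_ok n R P x"
  shows "code_cov n (num_msgs n R) x \<in> cov_set P"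
proof -
  let ?M = "num_msgs n R"
  have M: "0 < ?M" by (rule num_msgs_pos)
  have "trace (code_cov n ?M x) = (1 / (real n * ?M)) * (\<Sum>j<n. \<Sum>m<?M. (norm (x m j - code_mean ?M x j))\<^sup>2)"
    unfolding code_cov_def by (subst sum.swap) (simp add: trace_scaleR trace_sum trace_outer_self)
  also have "\<dots> \<le> (1 / (real n * ?M)) * (\<Sum>j<n. \<Sum>m<?M. (norm (x m j))\<^sup>2)"
    by (intro mult_left_mono sum_mono sum_norm_centred_le M) auto
  also have "\<dots> = (\<Sum>j<n. (\<Sum>m<?M. (norm (x m j))\<^sup>2) / ?M) / n"
    by (simp add: sum_divide_distrib[symmetric])
  also have "\<dots> = (\<Sum>j<n. measure_pmf.expectation (msg_pmf n R) (\<lambda>m. (norm (x m j))\<^sup>2)) / real n"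
    using M by (simp add: msg_pmf_def integral_pmf_of_set lessThan_empty_iff)
  also have "\<dots> \<le> P" using p by (simp add: power_ok_def)
  finally have "trace (code_cov n ?M x) \<le> P" .
  moreover have "pos_semidef (code_cov n ?M x)"
    unfolding code_cov_def by (intro pos_semidef_scaleR pos_semidef_sum pos_semidef_outer) auto
  ultimately show ?thesis by (simp add: cov_set_def)
qed

text \<open>Independence of the messages in finite form: the sum over all pairs of a cross product
  of centred codewords vanishes because one factor already sums to 0.\<close>

lemma average_outer_codes:
  fixes X :: "real^'t^'n" and Y :: "real^'u^'n"
  assumes M: "0 < M1" "0 < M2"
  shows "(1 / (real n * card ({..<M1} \<times> {..<M2}))) *\<^sub>R (\<Sum>k\<in>{..<M1} \<times> {..<M2}. \<Sum>j<n.
      outer (X *v (x1 (fst k) j - code_mean M1 x1 j) + Y *v (x2 (snd k) j - code_mean M2 x2 j)))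
    = X ** code_cov n M1 x1 ** transpose X + Y ** code_cov n M2 x2 ** transpose Y"
proof -
  define u where "u m j = X *v (x1 m j - code_mean M1 x1 j)" for m j
  define v where "v m j = Y *v (x2 m j - code_mean M2 x2 j)" for m j
  define cr where "cr a b = (\<chi> i j. a $ i * b $ j + b $ i * a $ j)" for a b :: "real^'n"
  have o: "outer (a + b) = outer a + outer b + cr a b" for a b :: "real^'n"
    by (simp add: vec_eq_iff outer_def cr_def algebra_simps)
  have u0: "(\<Sum>m<M1. u m j) = 0" for j
    unfolding u_def linear_sum[OF matrix_vector_mul_linear, symmetric] sum_centred[OF M(1)] by simp
  have cr0: "(\<Sum>m<M1. cr (u m j) b) = 0" for j b
  proof -
    have "(\<Sum>m<M1. cr (u m j) b) = cr (\<Sum>m<M1. u m j) b"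
      by (simp add: vec_eq_iff cr_def sum.distrib sum_distrib_left sum_distrib_right)
    then show ?thesis by (simp add: u0) (simp add: cr_def vec_eq_iff)
  qed
  have "(\<Sum>k\<in>{..<M1} \<times> {..<M2}. \<Sum>j<n. outer (u (fst k) j + v (snd k) j))
    = (\<Sum>m1<M1. \<Sum>m2<M2. \<Sum>j<n. outer (u m1 j + v m2 j))"
    by (subst sum.cartesian_product[of "\<lambda>m1 m2. \<Sum>j<n. outer (u m1 j + v m2 j)"]) (rule sum.cong, auto)
  also have "\<dots> = (\<Sum>m1<M1. \<Sum>m2<M2. \<Sum>j<n. outer (u m1 j)) + (\<Sum>m1<M1. \<Sum>m2<M2. \<Sum>j<n. outer (v m2 j))
     + (\<Sum>m1<M1. \<Sum>m2<M2. \<Sum>j<n. cr (u m1 j) (v m2 j))"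
    by (simp add: o sum.distrib)
  also have "(\<Sum>m1<M1. \<Sum>m2<M2. \<Sum>j<n. cr (u m1 j) (v m2 j)) = (\<Sum>m2<M2. \<Sum>j<n. \<Sum>m1<M1. cr (u m1 j) (v m2 j))"
    by (subst sum.swap) (intro sum.cong refl sum.swap)
  also have "\<dots> = 0" by (simp add: cr0)
  also have "(\<Sum>m1<M1. \<Sum>m2<M2. \<Sum>j<n. outer (u m1 j)) = M2 *\<^sub>R (\<Sum>m1<M1. \<Sum>j<n. outer (u m1 j))"
    by (simp add: sum_constant_scaleR scaleR_sum_right del: sum_constant)
  also have "(\<Sum>m1<M1. \<Sum>m2<M2. \<Sum>j<n. outer (v m2 j)) = M1 *\<^sub>R (\<Sum>m2<M2. \<Sum>j<n. outer (v m2 j))"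
    by (simp add: sum_constant_scaleR del: sum_constant)
  finally have s: "(\<Sum>k\<in>{..<M1} \<times> {..<M2}. \<Sum>j<n. outer (u (fst k) j + v (snd k) j))
    = M2 *\<^sub>R (\<Sum>m1<M1. \<Sum>j<n. outer (u m1 j)) + M1 *\<^sub>R (\<Sum>m2<M2. \<Sum>j<n. outer (v m2 j))" by simp
  have "(1 / (real n * card ({..<M1} \<times> {..<M2}))) *\<^sub>R (\<Sum>k\<in>{..<M1} \<times> {..<M2}. \<Sum>j<n. outer (u (fst k) j + v (snd k) j))
    = (1 / (real n * M1)) *\<^sub>R (\<Sum>m1<M1. \<Sum>j<n. outer (u m1 j)) + (1 / (real n * M2)) *\<^sub>R (\<Sum>m2<M2. \<Sum>j<n. outer (v m2 j))"
    unfolding s using M by (simp add: scaleR_add_right card_cartesian_product)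
  also have "\<dots> = X ** code_cov n M1 x1 ** transpose X + Y ** code_cov n M2 x2 ** transpose Y"
    by (simp add: u_def v_def outer_matrix code_cov_def matrix_mult_scaleR_distrib matrix_mult_sum_distrib)
  finally show ?thesis by (simp add: u_def v_def)
qed

section \<open>Coupled noises and the converse for one code\<close>

lemma distr_pair_linear:
  fixes R D :: "real^'n^'n"
  assumes "invertible D" "R ** transpose R + D ** transpose D = mat 1"
  shows "distr (std_gaussian \<Otimes>\<^sub>M std_gaussian) borel (\<lambda>z. R *v fst z + D *v snd z) = std_gaussian"
proof (rule measure_eqI)
  fix A assume "A \<in> sets (distr (std_gaussian \<Otimes>\<^sub>M std_gaussian) borel (\<lambda>z. R *v fst z + D *v snd z))"
  then have [measurable]: "A \<in> sets borel" by simp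
  have "emeasure (distr (std_gaussian \<Otimes>\<^sub>M std_gaussian) borel (\<lambda>z. R *v fst z + D *v snd z)) A
    = (\<integral>\<^sup>+y. indicator A y \<partial>distr (std_gaussian \<Otimes>\<^sub>M std_gaussian) borel (\<lambda>z. R *v fst z + D *v snd z))" by simp
  also have "\<dots> = (\<integral>\<^sup>+z. indicator A (R *v fst z + D *v snd z) \<partial>(std_gaussian \<Otimes>\<^sub>M std_gaussian))"
    by (rule nn_integral_distr) measurable
  also have "\<dots> = (\<integral>\<^sup>+g. \<integral>\<^sup>+g'. indicator A (R *v g + D *v g') \<partial>std_gaussian \<partial>std_gaussian)"
    by (subst std_gaussian.nn_integral_fst[symmetric]) auto
  also have "\<dots> = (\<integral>\<^sup>+k. indicator A (mat 1 *v k) \<partial>std_gaussian)"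
    using assms by (intro nn_integral_std_gaussian_sum) auto
  finally show "emeasure (distr (std_gaussian \<Otimes>\<^sub>M std_gaussian) borel (\<lambda>z. R *v fst z + D *v snd z)) A
    = emeasure std_gaussian A" by simp
qed simp

text \<open>This covers the coupling in which the coefficient of the second vector is 0 and so has
  no inverse.\<close>

lemma distr_pair_fst: "distr (std_gaussian \<Otimes>\<^sub>M (std_gaussian :: (real^'m) measure)) borel fst = (std_gaussian :: (real^'n) measure)"
proof (rule measure_eqI)
  fix A assume "A \<in> sets (distr (std_gaussian \<Otimes>\<^sub>M (std_gaussian :: (real^'m) measure)) borel (fst :: (real^'n) \<times> _ \<Rightarrow> _))"
  then have A: "A \<in> sets (std_gaussian :: (real^'n) measure)" by simp
  have "fst -` A \<inter> space (std_gaussian \<Otimes>\<^sub>M (std_gaussian :: (real^'m) measure)) = A \<times> space std_gaussian"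
    by (auto simp: space_pair_measure)
  then show "emeasure (distr (std_gaussian \<Otimes>\<^sub>M (std_gaussian :: (real^'m) measure)) borel fst) A = emeasure std_gaussian A"
    using A by (subst emeasure_distr) (auto simp: std_gaussian.emeasure_pair_measure_Times)
qed simp

definition avg_err :: "nat \<Rightarrow> nat \<Rightarrow> nat \<Rightarrow> ((nat \<Rightarrow> real^'n) \<Rightarrow> nat) \<Rightarrow> (nat \<times> nat \<Rightarrow> nat \<Rightarrow> real^'n) \<Rightarrow> (nat \<times> nat \<Rightarrow> nat) \<Rightarrow> real" where
  "avg_err n M1 M2 d c t = (\<Sum>k\<in>{..<M1} \<times> {..<M2}. err_given n d (c k) (t k)) / (M1 * M2)"

text \<open>\<open>sh k\<close> is a part of the signal that may depend on the hypothesised pair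
  \<open>k\<close>: it holds the mean of the code and, if desired, the codeword of the other user.
  It is handed to the decoder when \<open>k\<close> is tested, and \<open>m\<close> measures how few
  pairs one output can then accept.\<close>

lemma single_user_converse:
  fixes X :: "real^'t^'n" and Y :: "real^'u^'n" and B :: "real^'n^'n"
  assumes n: "1 \<le> n" and M: "0 < M1" "0 < M2" and m: "1 \<le> m" and d: "decoder n d"
    and B: "invertible B"
    and BB: "B ** transpose B = mat 1 + X ** code_cov n M1 x1 ** transpose X + Y ** code_cov n M2 x2 ** transpose Y"
    and c: "\<And>k j. c k j = X *v (x1 (fst k) j - code_mean M1 x1 j) + Y *v (x2 (snd k) j - code_mean M2 x2 j) + sh k j"
    and mult: "\<And>y. real (card {k\<in>{..<M1} \<times> {..<M2}. d (\<lambda>j\<in>{..<n}. y j + sh k j) = t k}) \<le> M1 * M2 / m"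
  shows "(1 - avg_err n M1 M2 d c t) * ln m - ln 2 \<le> real n * ln \<bar>det B\<bar>"
proof -
  let ?K = "{..<M1} \<times> {..<M2}"
  let ?P = "Pi\<^sub>M {..<n} (\<lambda>_. (std_gaussian :: (real^'n) measure) \<Otimes>\<^sub>M (std_gaussian :: (real^'n) measure))"
  interpret P: prob_space ?P by (intro prob_space_PiM std_pair.prob_space_axioms)
  have K: "finite ?K" "?K \<noteq> {}" "card ?K = M1 * M2"
    using M by (auto simp: lessThan_empty_iff card_cartesian_product)
  define a where "a k j = X *v (x1 (fst k) j - code_mean M1 x1 j) + Y *v (x2 (snd k) j - code_mean M2 x2 j)" for k j
  define s where "s k = {y \<in> space (Pi\<^sub>M {..<n} (\<lambda>_. (borel :: (real^'n) measure) \<Otimes>\<^sub>M (borel :: (real^'n) measure))). d (\<lambda>j\<in>{..<n}. fst (y j) + sh k j) = t k}" for k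
  have avg: "(1 / (real n * card ?K)) *\<^sub>R (\<Sum>k\<in>?K. \<Sum>j<n. outer (a k j)) = X ** code_cov n M1 x1 ** transpose X + Y ** code_cov n M2 x2 ** transpose Y"
    unfolding a_def by (rule average_outer_codes[OF M])
  have comp: "(\<lambda>y. fst (y j)) \<in> borel_measurable (Pi\<^sub>M {..<n} (\<lambda>_. (borel :: (real^'n) measure) \<Otimes>\<^sub>M (borel :: (real^'n) measure)))" if "j < n" for j
    using that measurable_compose[OF measurable_component_singleton[of j "{..<n}" "\<lambda>_. borel \<Otimes>\<^sub>M borel"] measurable_fst] by simp
  \<comment> \<open>With \<open>R = 0\<close>, \<open>D = mat 1\<close> and \<open>F = 0\<close> the
    second observed component is fresh noise, with the same law under the true and the reference
    measure.\<close>
  have "(\<Sum>k\<in>?K. measure ?P {z \<in> space ?P. (\<lambda>j\<in>{..<n}. linear_obs 0 (mat 1) 0 (a k j) 0 (z j)) \<in> s k}) * ln m - card ?K * ln 2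
      \<le> real n * card ?K * ln (\<bar>det B\<bar> * \<bar>det (mat 1 :: real^'n^'n)\<bar> / \<bar>det (mat 1 :: real^'n^'n)\<bar>)"
  proof (rule gaussian_converse[where b = "\<lambda>_ _. 0"])
    show "B ** transpose B = (1 / (real n * card ?K)) *\<^sub>R (\<Sum>k\<in>?K. \<Sum>j<n. outer (a k j)) + 0 ** transpose 0 + mat 1 ** transpose (mat 1)"
      unfolding avg BB by (simp add: add_ac)
    show "mat 1 ** transpose (mat 1) = (1 / (real n * card ?K)) *\<^sub>R (\<Sum>k\<in>?K. \<Sum>j<n. outer 0)
        + (mat 1 - 0 ** 0) ** transpose (mat 1 - 0 ** 0) + (0 ** mat 1) ** transpose ((0::real^'n^'n) ** mat 1)"
      by (simp add: outer_def flip: zero_vec_def)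
    show "s k \<in> sets (Pi\<^sub>M {..<n} (\<lambda>_. borel \<Otimes>\<^sub>M borel))" for k
      unfolding s_def by (intro measurable_decoder_shift[OF d] borel_measurable_add borel_measurable_const comp)
    show "card {k \<in> ?K. y \<in> s k} \<le> card ?K / m" for y
    proof -
      have "card {k \<in> ?K. y \<in> s k} \<le> card {k\<in>?K. d (\<lambda>j\<in>{..<n}. fst (y j) + sh k j) = t k}"
        by (intro card_mono) (auto simp: s_def)
      then have "real (card {k \<in> ?K. y \<in> s k}) \<le> real (card {k\<in>?K. d (\<lambda>j\<in>{..<n}. fst (y j) + sh k j) = t k})"
        by simp
      also have "\<dots> \<le> M1 * M2 / m" using mult[of "\<lambda>j. fst (y j)"] by simp
      finally show ?thesis unfolding K(3) .
    qed
  qed (use K m n B in \<open>auto simp: invertible_det_nz\<close>)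
  also have "(\<Sum>k\<in>?K. measure ?P {z \<in> space ?P. (\<lambda>j\<in>{..<n}. linear_obs 0 (mat 1) 0 (a k j) 0 (z j)) \<in> s k})
    = (\<Sum>k\<in>?K. 1 - err_given n d (c k) (t k))"
  proof (rule sum.cong[OF refl])
    fix k
    have f: "(snd :: (real^'n) \<times> (real^'n) \<Rightarrow> _) \<in> borel_measurable ((std_gaussian :: (real^'n) measure) \<Otimes>\<^sub>M (std_gaussian :: (real^'n) measure))" by measurable
    have "distr ((std_gaussian :: (real^'n) measure) \<Otimes>\<^sub>M std_gaussian) borel snd = (std_gaussian :: (real^'n) measure)"
      using distr_pair_linear[of "mat 1 :: real^'n^'n" 0] by (simp add: invertible_det_nz)
    note e = measure_PiM_noise[OF std_pair.prob_space_axioms f this d, of "c k" "t k"]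
    have c': "(\<lambda>j\<in>{..<n}. fst ((\<lambda>j\<in>{..<n}. linear_obs 0 (mat 1) 0 (a k j) 0 (z j)) j) + sh k j) = (\<lambda>j\<in>{..<n}. c k j + snd (z j))" for z
      by (auto simp: restrict_def c a_def linear_obs_def fun_eq_iff)
    have sp: "(\<lambda>j\<in>{..<n}. linear_obs 0 (mat 1) 0 (a k j) 0 (z j)) \<in> space (Pi\<^sub>M {..<n} (\<lambda>_. (borel :: (real^'n) measure) \<Otimes>\<^sub>M (borel :: (real^'n) measure)))" for z
      by (auto simp: space_PiM space_pair_measure)
    have "{z \<in> space ?P. (\<lambda>j\<in>{..<n}. linear_obs 0 (mat 1) 0 (a k j) 0 (z j)) \<in> s k}
       = {z \<in> space ?P. d (\<lambda>j\<in>{..<n}. c k j + snd (z j)) = t k}"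
      unfolding s_def using sp c' by simp
    also have "\<dots> = space ?P - {z \<in> space ?P. d (\<lambda>j\<in>{..<n}. c k j + snd (z j)) \<noteq> t k}" by auto
    also have "measure ?P \<dots> = 1 - err_given n d (c k) (t k)"
    proof (subst P.prob_compl)
      have sn: "(\<lambda>z. snd (z j)) \<in> borel_measurable ?P" if "j < n" for j
        using that measurable_compose[OF measurable_component_singleton[of j "{..<n}" "\<lambda>_. std_gaussian \<Otimes>\<^sub>M std_gaussian"] f] by simp
      have "space ?P - {z \<in> space ?P. d (\<lambda>j\<in>{..<n}. c k j + snd (z j)) = t k} \<in> sets ?P"
        by (intro sets.Diff sets.top measurable_decoder_shift[OF d] borel_measurable_add borel_measurable_const sn)
      also have "space ?P - {z \<in> space ?P. d (\<lambda>j\<in>{..<n}. c k j + snd (z j)) = t k}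
        = {z \<in> space ?P. d (\<lambda>j\<in>{..<n}. c k j + snd (z j)) \<noteq> t k}" by auto
      finally show "{z \<in> space ?P. d (\<lambda>j\<in>{..<n}. c k j + snd (z j)) \<noteq> t k} \<in> sets ?P" .
    qed (simp add: e)
    finally show "measure ?P {z \<in> space ?P. (\<lambda>j\<in>{..<n}. linear_obs 0 (mat 1) 0 (a k j) 0 (z j)) \<in> s k} = 1 - err_given n d (c k) (t k)" .
  qed
  also have "(\<Sum>k\<in>?K. 1 - err_given n d (c k) (t k)) = card ?K * (1 - avg_err n M1 M2 d c t)"
    unfolding avg_err_def sum_subtractf using M by (simp add: field_simps card_cartesian_product)
  finally have "card ?K * ((1 - avg_err n M1 M2 d c t) * ln m - ln 2) \<le> card ?K * (real n * ln \<bar>det B\<bar>)"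
    by (simp add: algebra_simps)
  moreover have "0 < real (card ?K)" unfolding K(3) using M by simp
  ultimately show ?thesis by (simp only: mult_le_cancel_left_pos)
qed

text \<open>\<open>recover\<close> rebuilds the output of receiver 2 from the two observed
  components once the signal of user 1 is removed. A pair is accepted if \<open>d1\<close> finds its
  first message and \<open>d2\<close>, applied to the output rebuilt with that first message, finds
  its second. The effective number of messages is then the full product
  \<open>M1 M2\<close>.\<close>

lemma two_user_converse:
  fixes H1 :: "real^'t^'n" and H2 H4 Y :: "real^'u^'n" and R D F B C G G' J J' :: "real^'n^'n"
  assumes n: "1 \<le> n" and M: "0 < M1" "0 < M2" and d1: "decoder n d1" and d2: "decoder n d2"
    and inv: "invertible D" "invertible B" "invertible C"
    and noise1: "R ** transpose R + D ** transpose D = mat 1"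
    and noise2: "distr (std_gaussian \<Otimes>\<^sub>M std_gaussian) borel (\<lambda>z. G *v fst z + G' *v snd z) = std_gaussian"
    and recover: "\<And>x g g'. J *v (Y *v x + g - F *v (R *v g + D *v g')) + J' *v (H2 *v x + (R *v g + D *v g'))
        = H4 *v x + (G *v g + G' *v g')"
    and BB: "B ** transpose B = mat 1 + H1 ** code_cov n M1 x1 ** transpose H1 + H2 ** code_cov n M2 x2 ** transpose H2"
    and CC: "C ** transpose C = Y ** code_cov n M2 x2 ** transpose Y
        + (mat 1 - F ** R) ** transpose (mat 1 - F ** R) + (F ** D) ** transpose (F ** D)"
  shows "(1 - avg_err n M1 M2 d1 (\<lambda>k j. H1 *v x1 (fst k) j + H2 *v x2 (snd k) j) fst
            - avg_err n M1 M2 d2 (\<lambda>k j. H4 *v x2 (snd k) j) snd) * ln (real M1 * real M2) - ln 2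
      \<le> real n * ln (\<bar>det B\<bar> * \<bar>det C\<bar> / \<bar>det D\<bar>)"
proof -
  let ?K = "{..<M1} \<times> {..<M2}"
  let ?P = "Pi\<^sub>M {..<n} (\<lambda>_. (std_gaussian :: (real^'n) measure) \<Otimes>\<^sub>M (std_gaussian :: (real^'n) measure))"
  let ?S = "Pi\<^sub>M {..<n} (\<lambda>_. (borel :: (real^'n) measure) \<Otimes>\<^sub>M (borel :: (real^'n) measure))"
  interpret P: prob_space ?P by (intro prob_space_PiM std_pair.prob_space_axioms)
  have K: "finite ?K" "?K \<noteq> {}" "card ?K = M1 * M2"
    using M by (auto simp: lessThan_empty_iff card_cartesian_product)
  define c1 where "c1 k j = H1 *v x1 (fst k) j + H2 *v x2 (snd k) j" for k :: "nat \<times> nat" and j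
  define c2 where "c2 k j = H4 *v x2 (snd k) j" for k :: "nat \<times> nat" and j
  define a where "a k j = H1 *v (x1 (fst k) j - code_mean M1 x1 j) + H2 *v (x2 (snd k) j - code_mean M2 x2 j)" for k :: "nat \<times> nat" and j
  \<comment> \<open>The zero coefficient of user 1 gives the shape that
    \<open>average_outer_codes\<close> expects.\<close>
  define b where "b k j = (0 :: real^'t^'n) *v (x1 (fst k) j - code_mean M1 x1 j) + Y *v (x2 (snd k) j - code_mean M2 x2 j)" for k :: "nat \<times> nat" and j
  define r1 where "r1 y j = fst (y j) + (H1 *v code_mean M1 x1 j + H2 *v code_mean M2 x2 j)" for y :: "nat \<Rightarrow> (real^'n) \<times> (real^'n)" and j
  \<comment> \<open>The centred signal of the hypothesised message \<open>m\<close> is subtracted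
    from the first component before \<open>J'\<close> is applied; the mean of user 2 is added back
    at the end.\<close>
  define r2 where "r2 m y j = J *v snd (y j) + J' *v (fst (y j) - H1 *v (x1 m j - code_mean M1 x1 j)) + H4 *v code_mean M2 x2 j"
    for m and y :: "nat \<Rightarrow> (real^'n) \<times> (real^'n)" and j
  define s where "s k = {y \<in> space ?S. d1 (\<lambda>j\<in>{..<n}. r1 y j) = fst k} \<inter> {y \<in> space ?S. d2 (\<lambda>j\<in>{..<n}. r2 (fst k) y j) = snd k}" for k
  have avg1: "(1 / (real n * card ?K)) *\<^sub>R (\<Sum>k\<in>?K. \<Sum>j<n. outer (a k j)) = H1 ** code_cov n M1 x1 ** transpose H1 + H2 ** code_cov n M2 x2 ** transpose H2"
    unfolding a_def by (rule average_outer_codes[OF M])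
  have avg2: "(1 / (real n * card ?K)) *\<^sub>R (\<Sum>k\<in>?K. \<Sum>j<n. outer (b k j)) = Y ** code_cov n M2 x2 ** transpose Y"
    unfolding b_def average_outer_codes[OF M] by simp
  have yj: "(\<lambda>y. y j) \<in> ?S \<rightarrow>\<^sub>M borel \<Otimes>\<^sub>M borel" if "j < n" for j
    using that measurable_component_singleton[of j "{..<n}" "\<lambda>_. borel \<Otimes>\<^sub>M borel"] by simp
  have m1: "(\<lambda>y. r1 y j) \<in> borel_measurable ?S" and m2: "(\<lambda>y. r2 m y j) \<in> borel_measurable ?S" if "j < n" for j m
  proof -
    note [measurable] = yj[OF that]
    show "(\<lambda>y. r1 y j) \<in> borel_measurable ?S" "(\<lambda>y. r2 m y j) \<in> borel_measurable ?S"
      unfolding r1_def r2_def by measurable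
  qed
  let ?obs = "\<lambda>k z. \<lambda>j\<in>{..<n}. linear_obs R D F (a k j) (b k j) (z j)"
  have M12: "1 \<le> real M1 * real M2"
  proof -
    have "1 \<le> M1 * M2" using M by simp
    then show ?thesis by (metis of_nat_1 of_nat_le_iff of_nat_mult)
  qed
  have up: "(\<Sum>k\<in>?K. measure ?P {z \<in> space ?P. ?obs k z \<in> s k}) * ln (real M1 * real M2) - card ?K * ln 2
      \<le> real n * card ?K * ln (\<bar>det B\<bar> * \<bar>det C\<bar> / \<bar>det D\<bar>)"
  proof (rule gaussian_converse)
    show "B ** transpose B = (1 / (real n * card ?K)) *\<^sub>R (\<Sum>k\<in>?K. \<Sum>j<n. outer (a k j)) + R ** transpose R + D ** transpose D"
      unfolding avg1 BB using noise1 by (simp add: add_ac)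
    show "C ** transpose C = (1 / (real n * card ?K)) *\<^sub>R (\<Sum>k\<in>?K. \<Sum>j<n. outer (b k j))
        + (mat 1 - F ** R) ** transpose (mat 1 - F ** R) + (F ** D) ** transpose (F ** D)"
      unfolding avg2 CC ..
    show "s k \<in> sets ?S" for k
      unfolding s_def by (intro sets.Int measurable_decoder_shift[OF d1] measurable_decoder_shift[OF d2] m1 m2)
    show "card {k \<in> ?K. y \<in> s k} \<le> card ?K / (real M1 * real M2)" for y
    proof -
      \<comment> \<open>\<open>d1\<close> fixes the first message; with it fixed, \<open>d2\<close>
        fixes the second.\<close>
      have "card {k \<in> ?K. y \<in> s k} \<le> Suc 0"
        by (subst card_le_Suc0_iff_eq) (auto simp: s_def)
      then show ?thesis unfolding K(3) using M by simp
    qed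
  qed (use K n inv M12 in auto)
  have "(\<Sum>k\<in>?K. 1 - err_given n d1 (c1 k) (fst k) - err_given n d2 (c2 k) (snd k))
    \<le> (\<Sum>k\<in>?K. measure ?P {z \<in> space ?P. ?obs k z \<in> s k})"
  proof (rule sum_mono)
    fix k :: "nat \<times> nat"
    have f1: "(\<lambda>z. R *v fst z + D *v snd z) \<in> borel_measurable ((std_gaussian :: (real^'n) measure) \<Otimes>\<^sub>M (std_gaussian :: (real^'n) measure))"
      and f2: "(\<lambda>z. G *v fst z + G' *v snd z) \<in> borel_measurable ((std_gaussian :: (real^'n) measure) \<Otimes>\<^sub>M (std_gaussian :: (real^'n) measure))"
      by measurable
    note e1 = measure_PiM_noise[OF std_pair.prob_space_axioms f1 distr_pair_linear[OF inv(1) noise1] d1, of "c1 k" "fst k"]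
    note e2 = measure_PiM_noise[OF std_pair.prob_space_axioms f2 noise2 d2, of "c2 k" "snd k"]
    let ?F1 = "{z \<in> space ?P. d1 (\<lambda>j\<in>{..<n}. c1 k j + (R *v fst (z j) + D *v snd (z j))) \<noteq> fst k}"
    let ?F2 = "{z \<in> space ?P. d2 (\<lambda>j\<in>{..<n}. c2 k j + (G *v fst (z j) + G' *v snd (z j))) \<noteq> snd k}"
    have q1: "(\<lambda>j\<in>{..<n}. r1 (?obs k z) j) = (\<lambda>j\<in>{..<n}. c1 k j + (R *v fst (z j) + D *v snd (z j)))" for z
      by (auto simp: restrict_def c1_def r1_def a_def linear_obs_def fun_eq_iff matrix_vector_mult_diff_distrib)
    have q2: "(\<lambda>j\<in>{..<n}. r2 (fst k) (?obs k z) j) = (\<lambda>j\<in>{..<n}. c2 k j + (G *v fst (z j) + G' *v snd (z j)))" for z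
    proof (rule restrict_ext)
      fix j assume "j \<in> {..<n}"
      then have "r2 (fst k) (?obs k z) j
        = J *v (Y *v (x2 (snd k) j - code_mean M2 x2 j) + fst (z j) - F *v (R *v fst (z j) + D *v snd (z j)))
          + J' *v (H2 *v (x2 (snd k) j - code_mean M2 x2 j) + (R *v fst (z j) + D *v snd (z j))) + H4 *v code_mean M2 x2 j"
        by (simp add: r2_def linear_obs_def a_def b_def)
      also have "\<dots> = c2 k j + (G *v fst (z j) + G' *v snd (z j))"
        unfolding recover by (simp add: c2_def matrix_vector_mult_diff_distrib)
      finally show "r2 (fst k) (?obs k z) j = c2 k j + (G *v fst (z j) + G' *v snd (z j))" .
    qed
    have sp: "?obs k z \<in> space ?S" for z
      by (auto simp: space_PiM space_pair_measure)
    have zj: "(\<lambda>z. z j) \<in> ?P \<rightarrow>\<^sub>M std_gaussian \<Otimes>\<^sub>M std_gaussian" if "j < n" for j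
      using that measurable_component_singleton[of j "{..<n}" "\<lambda>_. std_gaussian \<Otimes>\<^sub>M std_gaussian"] by simp
    have F1: "?F1 \<in> sets ?P"
    proof -
      have "space ?P - {z \<in> space ?P. d1 (\<lambda>j\<in>{..<n}. c1 k j + (R *v fst (z j) + D *v snd (z j))) = fst k} \<in> sets ?P"
        using measurable_compose[OF zj f1]
        by (intro sets.Diff sets.top measurable_decoder_shift[OF d1] borel_measurable_add[OF borel_measurable_const]) auto
      also have "space ?P - {z \<in> space ?P. d1 (\<lambda>j\<in>{..<n}. c1 k j + (R *v fst (z j) + D *v snd (z j))) = fst k} = ?F1" by auto
      finally show ?thesis .
    qed
    have F2: "?F2 \<in> sets ?P"
    proof -
      have "space ?P - {z \<in> space ?P. d2 (\<lambda>j\<in>{..<n}. c2 k j + (G *v fst (z j) + G' *v snd (z j))) = snd k} \<in> sets ?P"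
        using measurable_compose[OF zj f2]
        by (intro sets.Diff sets.top measurable_decoder_shift[OF d2] borel_measurable_add[OF borel_measurable_const]) auto
      also have "space ?P - {z \<in> space ?P. d2 (\<lambda>j\<in>{..<n}. c2 k j + (G *v fst (z j) + G' *v snd (z j))) = snd k} = ?F2" by auto
      finally show ?thesis .
    qed
    \<comment> \<open>A pair is accepted exactly when both decoders succeed on their coupled
      outputs, whence the union bound.\<close>
    have "{z \<in> space ?P. ?obs k z \<in> s k} = space ?P - (?F1 \<union> ?F2)"
      unfolding s_def using sp q1 q2 by auto
    then have "measure ?P {z \<in> space ?P. ?obs k z \<in> s k} = 1 - measure ?P (?F1 \<union> ?F2)"
      using P.prob_compl[of "?F1 \<union> ?F2"] F1 F2 by simp
    moreover have "measure ?P (?F1 \<union> ?F2) \<le> measure ?P ?F1 + measure ?P ?F2"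
      using F1 F2 by (rule measure_Un_le)
    ultimately show "1 - err_given n d1 (c1 k) (fst k) - err_given n d2 (c2 k) (snd k) \<le> measure ?P {z \<in> space ?P. ?obs k z \<in> s k}"
      unfolding e1[symmetric] e2[symmetric] by linarith
  qed
  then have "(\<Sum>k\<in>?K. 1 - err_given n d1 (c1 k) (fst k) - err_given n d2 (c2 k) (snd k)) * ln (real M1 * real M2)
      \<le> (\<Sum>k\<in>?K. measure ?P {z \<in> space ?P. ?obs k z \<in> s k}) * ln (real M1 * real M2)"
    using M12 by (intro mult_right_mono) auto
  with up have "(\<Sum>k\<in>?K. 1 - err_given n d1 (c1 k) (fst k) - err_given n d2 (c2 k) (snd k)) * ln (real M1 * real M2) - card ?K * ln 2
      \<le> real n * card ?K * ln (\<bar>det B\<bar> * \<bar>det C\<bar> / \<bar>det D\<bar>)"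
    by linarith
  also have "(\<Sum>k\<in>?K. 1 - err_given n d1 (c1 k) (fst k) - err_given n d2 (c2 k) (snd k))
     = card ?K * (1 - avg_err n M1 M2 d1 c1 fst - avg_err n M1 M2 d2 c2 snd)"
    unfolding avg_err_def sum_subtractf using M by (simp add: field_simps card_cartesian_product)
  finally have "card ?K * ((1 - avg_err n M1 M2 d1 c1 fst - avg_err n M1 M2 d2 c2 snd) * ln (real M1 * real M2) - ln 2)
      \<le> card ?K * (real n * ln (\<bar>det B\<bar> * \<bar>det C\<bar> / \<bar>det D\<bar>))"
    by (simp add: algebra_simps)
  moreover have "0 < real (card ?K)" unfolding K(3) using M by simp
  ultimately show ?thesis unfolding c1_def[abs_def] c2_def[abs_def] by (simp only: mult_le_cancel_left_pos)
qed

section \<open>The converse in the two interference regimes\<close>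

definition gain :: "real^'m^'n \<Rightarrow> real^'m^'m \<Rightarrow> real^'n^'n" where
  "gain H S = H ** S ** transpose H"

lemma pos_semidef_gain: "pos_semidef S \<Longrightarrow> pos_semidef (gain H S)"
  unfolding gain_def by (rule pos_semidef_congruence)

lemma matrix_sub_ldistrib: "A ** (B - C) = A ** B - A ** (C::real^'k^'n)" for A :: "real^'n^'m"
  by (simp add: vec_eq_iff matrix_matrix_mult_def sum_subtractf algebra_simps)

lemma matrix_sub_rdistrib: "(A - B) ** C = A ** C - B ** (C::real^'k^'n)" for A :: "real^'n^'m"
  by (simp add: vec_eq_iff matrix_matrix_mult_def sum_subtractf algebra_simps)

section \<open>Contractions and degraded channels\<close>

lemma contraction_transpose:
  fixes R :: "real^'n^'n"
  assumes "\<And>x. x \<noteq> 0 \<Longrightarrow> norm (R *v x) < norm x" and "x \<noteq> 0"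
  shows "norm (transpose R *v x) < norm x"
proof (cases "transpose R *v x = 0")
  case False
  let ?y = "transpose R *v x"
  \<comment> \<open>With \<open>y = R^T x\<close>, Cauchy-Schwarz bounds the squared norm of
    \<open>y\<close> by \<open>norm x * norm (R *v y)\<close>; contraction of \<open>R\<close> then
    lets one factor \<open>norm y\<close> cancel.\<close>
  have "norm ?y * norm ?y = x \<bullet> (R *v ?y)"
    by (subst inner_matrix_vector) (simp only: power2_norm_eq_inner power2_eq_square[symmetric])
  also have "\<dots> \<le> norm x * norm (R *v ?y)" by (rule norm_cauchy_schwarz)
  also have "\<dots> < norm x * norm ?y"
    using assms False by (intro mult_strict_left_mono) auto
  finally show ?thesis by (rule mult_right_less_imp_less) simp
qed (use assms in simp)

lemma contraction_transpose_le:
  fixes R :: "real^'n^'n"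
  assumes "\<And>x. norm (R *v x) \<le> norm x"
  shows "norm (transpose R *v x) \<le> norm x"
proof (cases "transpose R *v x = 0")
  case False
  let ?y = "transpose R *v x"
  have "norm ?y * norm ?y = x \<bullet> (R *v ?y)"
    by (subst inner_matrix_vector) (simp only: power2_norm_eq_inner power2_eq_square[symmetric])
  also have "\<dots> \<le> norm x * norm (R *v ?y)" by (rule norm_cauchy_schwarz)
  also have "\<dots> \<le> norm x * norm ?y"
    using assms by (intro mult_left_mono) auto
  finally show ?thesis using False by (simp add: mult_le_cancel_right)
qed simp

lemma quadratic_form_mult_transpose: "x \<bullet> ((R ** transpose R) *v x) = (norm (transpose R *v x))\<^sup>2" for R :: "real^'m^'n"
  unfolding matrix_vector_mul_assoc[symmetric] inner_matrix_vector[of x R] power2_norm_eq_inner ..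

lemma quadratic_form_transpose_mult: "x \<bullet> ((transpose R ** R) *v x) = (norm (R *v x))\<^sup>2" for R :: "real^'m^'n"
  using quadratic_form_mult_transpose[of x "transpose R"] by simp

lemma transpose_defect: "transpose (mat 1 - R ** transpose R) = mat 1 - R ** transpose R" for R :: "real^'m^'n"
  by (simp add: transpose_minus matrix_transpose_mul)

text \<open>\<open>R\<close> maps \<open>K x\<close> to \<open>H x\<close>, so the order of the Gram
  matrices says that \<open>R\<close> is a strict contraction. The conclusion makes
  \<open>mat 1 - R R^T\<close> the covariance of a noise that completes \<open>R g\<close> to a
  standard Gaussian vector.\<close>

lemma degradation_pos_def:
  fixes H K :: "real^'n^'n"
  assumes K: "invertible K" and less: "transpose H ** H \<prec>\<^sub>L transpose K ** K"
  defines "R \<equiv> H ** matrix_inv K"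
  shows "pos_def (mat 1 - R ** transpose R)"
proof -
  have contr: "norm (R *v x) < norm x" if x: "x \<noteq> 0" for x
  proof -
    let ?y = "matrix_inv K *v x"
    have Ky: "K *v ?y = x" by (simp add: matrix_vector_mul_assoc matrix_inv_right[OF K])
    then have "?y \<noteq> 0" using x by auto
    then have "0 < ?y \<bullet> ((transpose K ** K - transpose H ** H) *v ?y)"
      using less by (auto simp: loewner_less_def pos_def_def)
    then have "(norm (H *v ?y))\<^sup>2 < (norm (K *v ?y))\<^sup>2"
      by (simp only: matrix_vector_mult_diff_rdistrib inner_diff_right quadratic_form_transpose_mult)
    then have "norm (H *v ?y) < norm x" unfolding Ky by (rule power2_less_imp_less) simp
    then show ?thesis by (simp add: R_def matrix_vector_mul_assoc)
  qed
  have c: "norm (transpose R *v x) < norm x" if "x \<noteq> 0" for x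
    using contr that by (rule contraction_transpose)
  have "0 < x \<bullet> ((mat 1 - R ** transpose R) *v x)" if "x \<noteq> 0" for x
  proof -
    have "x \<bullet> ((mat 1 - R ** transpose R) *v x) = (norm x)\<^sup>2 - (norm (transpose R *v x))\<^sup>2"
      by (simp only: matrix_vector_mult_diff_rdistrib inner_diff_right quadratic_form_mult_transpose matrix_vector_mul_lid power2_norm_eq_inner)
    moreover have "(norm (transpose R *v x))\<^sup>2 < (norm x)\<^sup>2"
      by (rule power_strict_mono[OF c[OF that]]) auto
    ultimately show ?thesis by simp
  qed
  then show ?thesis unfolding pos_def_def by (blast intro: transpose_defect)
qed

text \<open>Under the non-strict order the completing covariance may be singular.\<close>

lemma degradation_pos_semidef:
  fixes H K :: "real^'n^'n"
  assumes K: "invertible K" and le: "transpose K ** K \<succeq>\<^sub>L transpose H ** H"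
  defines "R \<equiv> H ** matrix_inv K"
  shows "pos_semidef (mat 1 - R ** transpose R)"
proof -
  have contr: "norm (R *v x) \<le> norm x" for x
  proof -
    let ?y = "matrix_inv K *v x"
    have Ky: "K *v ?y = x" by (simp add: matrix_vector_mul_assoc matrix_inv_right[OF K])
    have "0 \<le> ?y \<bullet> ((transpose K ** K - transpose H ** H) *v ?y)"
      using le by (auto simp: loewner_ge_def pos_semidef_def)
    then have "(norm (H *v ?y))\<^sup>2 \<le> (norm (K *v ?y))\<^sup>2"
      by (simp only: matrix_vector_mult_diff_rdistrib inner_diff_right quadratic_form_transpose_mult)
    then have "norm (H *v ?y) \<le> norm x" unfolding Ky by (rule power2_le_imp_le) simp
    then show ?thesis by (simp add: R_def matrix_vector_mul_assoc)
  qed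
  have c: "norm (transpose R *v x) \<le> norm x" for x
    using contr by (rule contraction_transpose_le)
  have "0 \<le> x \<bullet> ((mat 1 - R ** transpose R) *v x)" for x
  proof -
    have "x \<bullet> ((mat 1 - R ** transpose R) *v x) = (norm x)\<^sup>2 - (norm (transpose R *v x))\<^sup>2"
      by (simp only: matrix_vector_mult_diff_rdistrib inner_diff_right quadratic_form_mult_transpose matrix_vector_mul_lid power2_norm_eq_inner)
    moreover have "(norm (transpose R *v x))\<^sup>2 \<le> (norm x)\<^sup>2"
      by (rule power_mono[OF c]) auto
    ultimately show ?thesis by simp
  qed
  then show ?thesis unfolding pos_semidef_def by (blast intro: transpose_defect)
qed

lemma pos_def_mat_1_gain: "pos_semidef S \<Longrightarrow> pos_def (mat 1 + gain H S)"
  by (intro pos_def_mat_1_add pos_semidef_gain)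

lemma det_square_root: "K = B ** transpose B \<Longrightarrow> det K = (det B)\<^sup>2" for B :: "real^'n^'n"
  by (simp add: det_mul power2_eq_square)

text \<open>\<open>B\<close> is a square root of the covariance \<open>K\<close>; this is the origin
  of the factor one half in the rates.\<close>

lemma ln_abs_det: "K = B ** transpose B \<Longrightarrow> det B \<noteq> 0 \<Longrightarrow> ln \<bar>det B\<bar> = ln (det K) / 2" for B :: "real^'n^'n"
proof -
  assume K: "K = B ** transpose B" and B: "det B \<noteq> 0"
  have "det K = \<bar>det B\<bar> ^ 2" by (simp add: det_square_root[OF K])
  then have "ln (det K) = 2 * ln \<bar>det B\<bar>" using B by (simp only: ln_realpow zero_less_abs_iff)
  then show ?thesis by simp
qed

text \<open>Here \<open>F\<close> is the linear estimator of \<open>v\<close> from \<open>u = R v + w\<close> when \<open>v\<close> has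
  covariance \<open>K4\<close> and \<open>w\<close> has covariance \<open>W\<close>, and \<open>E\<close> is its error covariance.\<close>

lemma estimation_error_det:
  fixes R W K4 K2 :: "real^'n^'n"
  assumes R: "invertible R" and K2: "invertible K2" and K2_eq: "K2 = W + R ** K4 ** transpose R"
    and sym: "transpose K4 = K4" "transpose K2 = K2"
  defines "F \<equiv> K4 ** transpose R ** matrix_inv K2"
  defines "E \<equiv> (mat 1 - F ** R) ** K4 ** transpose (mat 1 - F ** R) + F ** W ** transpose F"
  shows "det E * det K2 = det W * det K4"
proof -
  have FK2: "F ** K2 = K4 ** transpose R"
    by (simp add: F_def matrix_mul_assoc[symmetric] matrix_inv_left[OF K2])
  have W: "W = K2 - R ** K4 ** transpose R" by (simp add: K2_eq)
  \<comment> \<open>The estimation error is uncorrelated with the observation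
    \<open>u\<close>.\<close>
  have 1: "(mat 1 - F ** R) ** K4 ** transpose R = F ** W"
    by (simp add: W FK2 matrix_sub_rdistrib matrix_sub_ldistrib matrix_mul_assoc)
  have "E = (mat 1 - F ** R) ** K4 - (mat 1 - F ** R) ** K4 ** transpose R ** transpose F + F ** W ** transpose F"
    unfolding E_def by (simp add: transpose_minus matrix_transpose_mul matrix_sub_ldistrib matrix_mul_assoc)
  then have E: "E = (mat 1 - F ** R) ** K4" unfolding 1 by simp
  \<comment> \<open>\<open>R\<close> intertwines \<open>mat 1 - F R\<close> and
    \<open>mat 1 - R F\<close>; being invertible, it forces their determinants to agree.\<close>
  have "R ** (mat 1 - F ** R) = (mat 1 - R ** F) ** R"
    by (simp add: matrix_sub_ldistrib matrix_sub_rdistrib matrix_mul_assoc)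
  then have "det R * det (mat 1 - F ** R) = det (mat 1 - R ** F) * det R"
    by (metis det_mul)
  then have d: "det (mat 1 - F ** R) = det (mat 1 - R ** F)"
    using R by (simp add: invertible_det_nz)
  have "(mat 1 - R ** F) ** K2 = K2 - R ** (F ** K2)"
    by (simp add: matrix_sub_rdistrib matrix_mul_assoc)
  also have "\<dots> = W" by (simp add: FK2 W matrix_mul_assoc)
  finally have "det (mat 1 - R ** F) * det K2 = det W" by (metis det_mul)
  then show ?thesis by (simp add: E det_mul d mult_ac)
qed

section \<open>From bounds for one code to bounds for achievable rates\<close>

lemma rate_limit:
  fixes e L :: "nat \<Rightarrow> real"
  assumes e: "e \<longlonglongrightarrow> 0" and r: "0 \<le> r"
    and L: "\<And>n. 1 \<le> n \<Longrightarrow> real n * r \<le> L n"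
    and le: "\<And>n. 1 \<le> n \<Longrightarrow> e n \<le> 1 \<Longrightarrow> (1 - e n) * L n - c \<le> real n * V"
  shows "r \<le> V"
proof -
  have "(\<lambda>n. (1 - e n) * r - c / real n) \<longlonglongrightarrow> (1 - 0) * r - 0"
    by (intro tendsto_intros e lim_const_over_n)
  moreover have "\<forall>\<^sub>F n in sequentially. (1 - e n) * r - c / real n \<le> V"
  proof -
    have "\<forall>\<^sub>F n in sequentially. e n < 1" using order_tendstoD(2)[OF e, of 1] by simp
    then show ?thesis using eventually_ge_at_top[of 1]
    proof eventually_elim
    case (elim n)
    \<comment> \<open>Once \<open>e n < 1\<close>, the lower bound for \<open>L n\<close> may be
      multiplied by \<open>1 - e n\<close>; division by \<open>n\<close> then makes the constant
      \<open>c\<close> disappear in the limit.\<close>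
    then have "(1 - e n) * (real n * r) \<le> (1 - e n) * L n"
      using L[of n] by (intro mult_left_mono) auto
    then have "(1 - e n) * (real n * r) - c \<le> real n * V"
      using le[of n] elim by linarith
    then show ?case using elim by (simp add: field_simps)
    qed
  qed
  ultimately have "(1 - 0) * r - 0 \<le> V"
    by (intro tendsto_upperbound) auto
  then show ?thesis by simp
qed

lemma ln_num_msgs_ge: "real n * R \<le> ln (num_msgs n R)"
  using num_msgs_ge[of n R] num_msgs_pos[of n R] by (simp add: ln_ge_iff)

lemma ln_num_msgs_mult_ge: "real n * (R1 + R2) \<le> ln (real (num_msgs n R1) * real (num_msgs n R2))"
  using ln_num_msgs_ge[of n R1] ln_num_msgs_ge[of n R2] num_msgs_pos[of n R1] num_msgs_pos[of n R2]
  by (simp add: ln_mult algebra_simps)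

lemma error_prob1_avg_err:
  "noise_law N \<Longrightarrow> decoder n d \<Longrightarrow> error_prob1 H1 H2 N n R1 R2 x1 x2 d
     = avg_err n (num_msgs n R1) (num_msgs n R2) d (\<lambda>k j. H1 *v x1 (fst k) j + H2 *v x2 (snd k) j) fst"
  by (simp add: error_prob1_eq avg_err_def)

lemma error_prob2_avg_err:
  "noise_law N \<Longrightarrow> decoder n d \<Longrightarrow> error_prob2 0 H4 N n R1 R2 x1 x2 d
     = avg_err n (num_msgs n R1) (num_msgs n R2) d (\<lambda>k j. H4 *v x2 (snd k) j) snd"
  by (simp add: error_prob2_eq avg_err_def)

text \<open>Receiver 2 has noise \<open>g\<close>, receiver 1 has \<open>R g + D g'\<close>, and the
  second observed component is the error of the estimate by \<open>F\<close>. Since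
  \<open>det E * det K2 = det W * det K4\<close> and \<open>W = D D^T\<close>, the degrading noise
  cancels in \<open>|det B| |det C| / |det D|\<close>, whose square is
  \<open>det K1 * det K4 / det K2\<close>.\<close>

lemma code_weak_interference_bound:
  fixes H1 :: "real^'t^'n" and H2 H4 :: "real^'n^'n"
  assumes inv: "invertible H2" "invertible H4" and less: "transpose H2 ** H2 \<prec>\<^sub>L transpose H4 ** H4"
    and n: "1 \<le> n" and M: "0 < M1" "0 < M2" and d: "decoder n d1" "decoder n d2"
    and S1: "pos_semidef (code_cov n M1 x1)" and S2: "pos_semidef (code_cov n M2 x2)"
  shows "(1 - (avg_err n M1 M2 d1 (\<lambda>k j. H1 *v x1 (fst k) j + H2 *v x2 (snd k) j) fst
            + avg_err n M1 M2 d2 (\<lambda>k j. H4 *v x2 (snd k) j) snd)) * ln (real M1 * real M2) - ln 2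
      \<le> real n * ((ln (det (mat 1 + gain H1 (code_cov n M1 x1) + gain H2 (code_cov n M2 x2)))
           - ln (det (mat 1 + gain H2 (code_cov n M2 x2))) + ln (det (mat 1 + gain H4 (code_cov n M2 x2)))) / 2)"
proof -
  let ?S1 = "code_cov n M1 x1" and ?S2 = "code_cov n M2 x2"
  define R where "R = H2 ** matrix_inv H4"
  define W where "W = mat 1 - R ** transpose R"
  define K1 where "K1 = mat 1 + gain H1 ?S1 + gain H2 ?S2"
  define K2 where "K2 = mat 1 + gain H2 ?S2"
  define K4 where "K4 = mat 1 + gain H4 ?S2"
  define F where "F = K4 ** transpose R ** matrix_inv K2"
  \<comment> \<open>The coefficient of the codeword of user 2 in the estimation error.\<close>
  define Y where "Y = H4 - F ** H2"
  define E where "E = (mat 1 - F ** R) ** K4 ** transpose (mat 1 - F ** R) + F ** W ** transpose F"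
  have W: "pos_def W" unfolding W_def R_def by (rule degradation_pos_def[OF inv(2) less])
  have K1: "pos_def K1" unfolding K1_def by (intro pos_def_add pos_def_mat_1_gain pos_semidef_gain S1 S2)
  have K2: "pos_def K2" and K4: "pos_def K4" unfolding K2_def K4_def by (intro pos_def_mat_1_gain S2)+
  have RH4: "R ** H4 = H2" by (simp add: R_def matrix_mul_assoc[symmetric] matrix_inv_left[OF inv(2)])
  have "det R * det H4 = det H2" using RH4 by (metis det_mul)
  then have R: "invertible R" using inv by (auto simp: invertible_det_nz)
  have K2_eq: "K2 = W + R ** K4 ** transpose R"
  proof -
    have "R ** gain H4 ?S2 ** transpose R = (R ** H4) ** ?S2 ** transpose (R ** H4)"
      by (simp add: gain_def matrix_transpose_mul matrix_mul_assoc)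
    then show ?thesis unfolding RH4
      by (simp add: K2_def W_def K4_def gain_def matrix_add_ldistrib matrix_add_rdistrib)
  qed
  have detE: "det E * det K2 = det W * det K4"
    unfolding E_def F_def using K2 K4 K2_eq R
    by (intro estimation_error_det) (auto simp: pos_def_invertible pos_def_def)
  then have "det E \<noteq> 0" using pos_def_det[OF W] pos_def_det[OF K4] by auto
  from W obtain D :: "real^'n^'n" where D: "W = D ** transpose D" "invertible D" by (rule pos_def_factor)
  from K1 obtain B :: "real^'n^'n" where B: "K1 = B ** transpose B" "invertible B" by (rule pos_def_factor)
  have E_eq: "E = Y ** ?S2 ** transpose Y + (mat 1 - F ** R) ** transpose (mat 1 - F ** R) + (F ** D) ** transpose (F ** D)"
  proof -
    have Y: "Y = (mat 1 - F ** R) ** H4" by (simp add: Y_def matrix_sub_rdistrib matrix_mul_assoc[symmetric] RH4)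
    have "(mat 1 - F ** R) ** K4 ** transpose (mat 1 - F ** R)
      = Y ** ?S2 ** transpose Y + (mat 1 - F ** R) ** transpose (mat 1 - F ** R)"
      unfolding Y by (simp add: K4_def gain_def matrix_add_ldistrib matrix_add_rdistrib matrix_transpose_mul matrix_mul_assoc)
    moreover have "F ** W ** transpose F = (F ** D) ** transpose (F ** D)"
      by (simp add: D(1) matrix_transpose_mul matrix_mul_assoc)
    ultimately show ?thesis by (simp add: E_def)
  qed
  have "pos_semidef E"
    unfolding E_eq by (intro pos_semidef_add pos_semidef_mult_transpose pos_semidef_congruence S2)
  then obtain C :: "real^'n^'n" where C: "E = C ** transpose C" by (rule pos_semidef_factor)
  then have dC: "det C \<noteq> 0" using \<open>det E \<noteq> 0\<close> by (auto simp: det_square_root)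
  have noise2: "distr ((std_gaussian :: (real^'n) measure) \<Otimes>\<^sub>M (std_gaussian :: (real^'n) measure)) borel (\<lambda>z. mat 1 *v fst z + 0 *v snd z) = std_gaussian"
    using distr_pair_fst by (simp add: fst_def[abs_def] del: fst_def)
  have "(1 - avg_err n M1 M2 d1 (\<lambda>k j. H1 *v x1 (fst k) j + H2 *v x2 (snd k) j) fst
            - avg_err n M1 M2 d2 (\<lambda>k j. H4 *v x2 (snd k) j) snd) * ln (real M1 * real M2) - ln 2
      \<le> real n * ln (\<bar>det B\<bar> * \<bar>det C\<bar> / \<bar>det D\<bar>)"
  \<comment> \<open>The output of receiver 2 is the estimation error plus the estimate, hence
    \<open>J = mat 1\<close> and \<open>J' = F\<close>.\<close>
  proof (rule two_user_converse[OF n M d D(2) B(2) _ _ noise2, where Y = Y and J = "mat 1" and J' = F and F = F and R = R])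
    show "invertible C" using dC by (simp add: invertible_det_nz)
    show "R ** transpose R + D ** transpose D = mat 1" unfolding D(1)[symmetric] W_def by simp
    show "mat 1 *v (Y *v x + g - F *v (R *v g + D *v g')) + F *v (H2 *v x + (R *v g + D *v g'))
        = H4 *v x + (mat 1 *v g + 0 *v g')" for x g g'
      by (simp add: Y_def matrix_vector_mult_diff_rdistrib matrix_vector_mul_assoc[symmetric] matrix_vector_right_distrib)
    show "B ** transpose B = mat 1 + H1 ** ?S1 ** transpose H1 + H2 ** ?S2 ** transpose H2"
      unfolding B(1)[symmetric] K1_def gain_def ..
    show "C ** transpose C = Y ** ?S2 ** transpose Y + (mat 1 - F ** R) ** transpose (mat 1 - F ** R) + (F ** D) ** transpose (F ** D)"
      unfolding C[symmetric] by (rule E_eq)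
  qed
  also have "ln (\<bar>det B\<bar> * \<bar>det C\<bar> / \<bar>det D\<bar>) = (ln (det K1) - ln (det K2) + ln (det K4)) / 2"
  proof -
    have dB: "det B \<noteq> 0" and dD: "det D \<noteq> 0" using B D by (auto simp: invertible_det_nz)
    have dE: "0 < det E" using dC by (simp add: det_square_root[OF C])
    have "ln (det E) + ln (det K2) = ln (det W) + ln (det K4)"
      using detE dE pos_def_det[OF W] pos_def_det[OF K4] pos_def_det[OF K2] by (metis ln_mult_pos)
    moreover have "ln (\<bar>det B\<bar> * \<bar>det C\<bar> / \<bar>det D\<bar>) = ln \<bar>det B\<bar> + ln \<bar>det C\<bar> - ln \<bar>det D\<bar>"
      using dB dC dD by (simp add: ln_mult ln_div)
    ultimately show ?thesis
      unfolding ln_abs_det[OF B(1) dB] ln_abs_det[OF C dC] ln_abs_det[OF D(1) dD] by (simp add: field_simps)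
  qed
  finally show ?thesis unfolding K1_def K2_def K4_def by (simp add: algebra_simps)
qed

text \<open>Here receiver 2 is the degraded one: its output is \<open>T\<close> applied to the
  interference plus noise at receiver 1, plus \<open>W g\<close> with fresh noise \<open>g\<close>.
  The second observed component is this \<open>g\<close> alone, so only the determinant for the
  output of receiver 1 remains.\<close>

lemma code_strong_interference_bound:
  fixes H1 :: "real^'t^'n" and H2 H4 :: "real^'n^'n"
  assumes inv: "invertible H2" "invertible H4" and le: "transpose H2 ** H2 \<succeq>\<^sub>L transpose H4 ** H4"
    and n: "1 \<le> n" and M: "0 < M1" "0 < M2" and d: "decoder n d1" "decoder n d2"
    and S1: "pos_semidef (code_cov n M1 x1)" and S2: "pos_semidef (code_cov n M2 x2)"
  shows "(1 - (avg_err n M1 M2 d1 (\<lambda>k j. H1 *v x1 (fst k) j + H2 *v x2 (snd k) j) fst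
            + avg_err n M1 M2 d2 (\<lambda>k j. H4 *v x2 (snd k) j) snd)) * ln (real M1 * real M2) - ln 2
      \<le> real n * (ln (det (mat 1 + gain H1 (code_cov n M1 x1) + gain H2 (code_cov n M2 x2))) / 2)"
proof -
  let ?S1 = "code_cov n M1 x1" and ?S2 = "code_cov n M2 x2"
  define T where "T = H4 ** matrix_inv H2"
  define K1 where "K1 = mat 1 + gain H1 ?S1 + gain H2 ?S2"
  have K1: "pos_def K1" unfolding K1_def by (intro pos_def_add pos_def_mat_1_gain pos_semidef_gain S1 S2)
  have TH2: "T ** H2 = H4" by (simp add: T_def matrix_mul_assoc[symmetric] matrix_inv_left[OF inv(1)])
  have "det T * det H2 = det H4" using TH2 by (metis det_mul)
  then have T: "invertible T" using inv by (auto simp: invertible_det_nz)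
  have "pos_semidef (mat 1 - T ** transpose T)" unfolding T_def by (rule degradation_pos_semidef[OF inv(1) le])
  then obtain W :: "real^'n^'n" where W: "mat 1 - T ** transpose T = W ** transpose W" by (rule pos_semidef_factor)
  from K1 obtain B :: "real^'n^'n" where B: "K1 = B ** transpose B" "invertible B" by (rule pos_def_factor)
  \<comment> \<open>\<open>W\<close> may be singular; \<open>T\<close> is invertible, so it is the
    coefficient of the second vector.\<close>
  have noise2: "distr (std_gaussian \<Otimes>\<^sub>M std_gaussian) borel (\<lambda>z. W *v fst z + T *v snd z) = std_gaussian"
    by (rule distr_pair_linear[OF T]) (simp flip: W)
  have "(1 - avg_err n M1 M2 d1 (\<lambda>k j. H1 *v x1 (fst k) j + H2 *v x2 (snd k) j) fst
            - avg_err n M1 M2 d2 (\<lambda>k j. H4 *v x2 (snd k) j) snd) * ln (real M1 * real M2) - ln 2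
      \<le> real n * ln (\<bar>det B\<bar> * \<bar>det (mat 1 :: real^'n^'n)\<bar> / \<bar>det (mat 1 :: real^'n^'n)\<bar>)"
  proof (rule two_user_converse[OF n M d _ B(2) _ _ noise2, where Y = 0 and J = W and J' = T and F = 0 and R = 0])
    show "B ** transpose B = mat 1 + H1 ** ?S1 ** transpose H1 + H2 ** ?S2 ** transpose H2"
      unfolding B(1)[symmetric] K1_def gain_def ..
    show "W *v (0 *v x + g - 0 *v (0 *v g + mat 1 *v g')) + T *v (H2 *v x + (0 *v g + mat 1 *v g'))
        = H4 *v x + (W *v g + T *v g')" for x :: "real^'n" and g g' :: "real^'n"
      unfolding TH2[symmetric] by (simp add: matrix_vector_mul_assoc[symmetric] matrix_vector_right_distrib)
  qed (auto simp: invertible_det_nz)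
  also have "ln (\<bar>det B\<bar> * \<bar>det (mat 1 :: real^'n^'n)\<bar> / \<bar>det (mat 1 :: real^'n^'n)\<bar>) = ln (det K1) / 2"
    using ln_abs_det[OF B(1)] B(2) by (simp add: invertible_det_nz)
  finally show ?thesis unfolding K1_def by (simp add: algebra_simps)
qed

text \<open>The codeword of user 2 is revealed through \<open>sh\<close>. For each second message
  one first message can be accepted, so at most \<open>M2\<close> of the \<open>M1 M2\<close> pairs
  are, and the effective number of messages is \<open>M1\<close>.\<close>

lemma code_user1_bound:
  fixes H1 :: "real^'t^'n" and H2 :: "real^'n^'n"
  assumes n: "1 \<le> n" and M: "0 < M1" "0 < M2" and d: "decoder n d1"
    and S1: "pos_semidef (code_cov n M1 x1)"
  shows "(1 - avg_err n M1 M2 d1 (\<lambda>k j. H1 *v x1 (fst k) j + H2 *v x2 (snd k) j) fst) * ln (real M1) - ln 2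
      \<le> real n * (ln (det (mat 1 + gain H1 (code_cov n M1 x1))) / 2)"
proof -
  have "pos_def (mat 1 + gain H1 (code_cov n M1 x1))" by (rule pos_def_mat_1_gain[OF S1])
  then obtain B :: "real^'n^'n"
    where B: "mat 1 + gain H1 (code_cov n M1 x1) = B ** transpose B" "invertible B" by (rule pos_def_factor)
  define sh where "sh k j = H1 *v code_mean M1 x1 j + H2 *v x2 (snd k) j" for k :: "nat \<times> nat" and j
  have m: "1 \<le> real M1" using M by simp
  have BB: "B ** transpose B = mat 1 + H1 ** code_cov n M1 x1 ** transpose H1
      + (0 :: real^'n^'n) ** code_cov n M2 x2 ** transpose (0 :: real^'n^'n)"
    unfolding B(1)[symmetric] gain_def by simp
  have c: "H1 *v x1 (fst k) j + H2 *v x2 (snd k) j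
     = H1 *v (x1 (fst k) j - code_mean M1 x1 j) + (0 :: real^'n^'n) *v (x2 (snd k) j - code_mean M2 x2 j) + sh k j" for k j
    by (simp add: sh_def matrix_vector_mult_diff_distrib)
  have mult: "real (card {k \<in> {..<M1} \<times> {..<M2}. d1 (\<lambda>j\<in>{..<n}. y j + sh k j) = fst k}) \<le> real (M1 * M2) / real M1" for y
  proof -
    let ?d = "\<lambda>m. d1 (\<lambda>j\<in>{..<n}. y j + (H1 *v code_mean M1 x1 j + H2 *v x2 m j))"
    have "card {k \<in> {..<M1} \<times> {..<M2}. d1 (\<lambda>j\<in>{..<n}. y j + sh k j) = fst k} \<le> card ((\<lambda>m. (?d m, m)) ` {..<M2})"
      by (intro card_mono) (auto simp: image_iff sh_def)
    also have "\<dots> \<le> M2" using card_image_le[of "{..<M2}" "\<lambda>m. (?d m, m)"] by simp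
    finally show ?thesis using M by simp
  qed
  have "(1 - avg_err n M1 M2 d1 (\<lambda>k j. H1 *v x1 (fst k) j + H2 *v x2 (snd k) j) fst) * ln (real M1) - ln 2
    \<le> real n * ln \<bar>det B\<bar>"
    by (rule single_user_converse[OF n M m d B(2) BB c]) (use mult in simp)
  also have "ln \<bar>det B\<bar> = ln (det (mat 1 + gain H1 (code_cov n M1 x1))) / 2"
    using B(2) by (intro ln_abs_det B(1)) (simp add: invertible_det_nz)
  finally show ?thesis .
qed

text \<open>One output determines the accepted second message, which can be paired with any first
  message, so the effective number of messages is \<open>M2\<close>.\<close>

lemma code_user2_bound:
  fixes H4 :: "real^'u^'n"
  assumes n: "1 \<le> n" and M: "0 < M1" "0 < M2" and d: "decoder n d2"
    and S2: "pos_semidef (code_cov n M2 x2)"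
  shows "(1 - avg_err n M1 M2 d2 (\<lambda>k j. H4 *v x2 (snd k) j) snd) * ln (real M2) - ln 2
      \<le> real n * (ln (det (mat 1 + gain H4 (code_cov n M2 x2))) / 2)"
proof -
  have "pos_def (mat 1 + gain H4 (code_cov n M2 x2))" by (rule pos_def_mat_1_gain[OF S2])
  then obtain B :: "real^'n^'n"
    where B: "mat 1 + gain H4 (code_cov n M2 x2) = B ** transpose B" "invertible B" by (rule pos_def_factor)
  define sh where "sh k j = H4 *v code_mean M2 x2 j" for k :: "nat \<times> nat" and j
  have m: "1 \<le> real M2" using M by simp
  \<comment> \<open>The first user enters through the zero matrix; the codebook \<open>x2\<close>
    fills its place.\<close>
  have BB: "B ** transpose B = mat 1 + (0 :: real^'u^'n) ** code_cov n M1 x2 ** transpose (0 :: real^'u^'n)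
      + H4 ** code_cov n M2 x2 ** transpose H4"
    unfolding B(1)[symmetric] gain_def by simp
  have c: "H4 *v x2 (snd k) j
     = (0 :: real^'u^'n) *v (x2 (fst k) j - code_mean M1 x2 j) + H4 *v (x2 (snd k) j - code_mean M2 x2 j) + sh k j" for k j
    by (simp add: sh_def matrix_vector_mult_diff_distrib)
  have mult: "real (card {k \<in> {..<M1} \<times> {..<M2}. d2 (\<lambda>j\<in>{..<n}. y j + sh k j) = snd k}) \<le> real (M1 * M2) / real M2" for y
  proof -
    let ?d = "d2 (\<lambda>j\<in>{..<n}. y j + H4 *v code_mean M2 x2 j)"
    have "card {k \<in> {..<M1} \<times> {..<M2}. d2 (\<lambda>j\<in>{..<n}. y j + sh k j) = snd k} \<le> card ({..<M1} \<times> {?d})"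
      by (intro card_mono) (auto simp: sh_def)
    then show ?thesis using M by (simp add: card_cartesian_product)
  qed
  have "(1 - avg_err n M1 M2 d2 (\<lambda>k j. H4 *v x2 (snd k) j) snd) * ln (real M2) - ln 2
    \<le> real n * ln \<bar>det B\<bar>"
    by (rule single_user_converse[OF n M m d B(2) BB c]) (use mult in simp)
  also have "ln \<bar>det B\<bar> = ln (det (mat 1 + gain H4 (code_cov n M2 x2))) / 2"
    using B(2) by (intro ln_abs_det B(1)) (simp add: invertible_det_nz)
  finally show ?thesis .
qed

theorem converse_weak_interference:
  fixes H1 :: "real^'t^'n" and H2 H4 :: "real^'n^'n"
  assumes N: "noise_law N" and inv: "invertible H2" "invertible H4" and less: "transpose H2 ** H2 \<prec>\<^sub>L transpose H4 ** H4"
    and ach: "achievable H1 H2 0 H4 N P1 P2 (R1, R2)"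
    and V: "\<And>S1 S2. S1 \<in> cov_set P1 \<Longrightarrow> S2 \<in> cov_set P2 \<Longrightarrow>
       (ln (det (mat 1 + gain H1 S1 + gain H2 S2)) - ln (det (mat 1 + gain H2 S2)) + ln (det (mat 1 + gain H4 S2))) / 2 \<le> V"
  shows "R1 + R2 \<le> V"
proof -
  from ach obtain x1 x2 d1 d2 where R: "0 \<le> R1" "0 \<le> R2"
    and all: "\<forall>n\<ge>1. power_ok n R1 P1 (x1 n) \<and> power_ok n R2 P2 (x2 n) \<and> decoder n (d1 n) \<and> decoder n (d2 n)"
    and lim: "(\<lambda>n. error_prob1 H1 H2 N n R1 R2 (x1 n) (x2 n) (d1 n)) \<longlonglongrightarrow> 0"
      "(\<lambda>n. error_prob2 0 H4 N n R1 R2 (x1 n) (x2 n) (d2 n)) \<longlonglongrightarrow> 0"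
    unfolding achievable_def prod.case by blast
  from all have ok: "\<And>n. 1 \<le> n \<Longrightarrow> power_ok n R1 P1 (x1 n)" "\<And>n. 1 \<le> n \<Longrightarrow> power_ok n R2 P2 (x2 n)"
      "\<And>n. 1 \<le> n \<Longrightarrow> decoder n (d1 n)" "\<And>n. 1 \<le> n \<Longrightarrow> decoder n (d2 n)"
    by blast+
  let ?e = "\<lambda>n. error_prob1 H1 H2 N n R1 R2 (x1 n) (x2 n) (d1 n) + error_prob2 0 H4 N n R1 R2 (x1 n) (x2 n) (d2 n)"
  show ?thesis
  proof (rule rate_limit)
    show "?e \<longlonglongrightarrow> 0" using tendsto_add[OF lim] by simp
    show "0 \<le> R1 + R2" using R by simp
    show "real n * (R1 + R2) \<le> ln (real (num_msgs n R1) * real (num_msgs n R2))" for n by (rule ln_num_msgs_mult_ge)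
    fix n :: nat assume n: "1 \<le> n"
    let ?S1 = "code_cov n (num_msgs n R1) (x1 n)" and ?S2 = "code_cov n (num_msgs n R2) (x2 n)"
    have S: "?S1 \<in> cov_set P1" "?S2 \<in> cov_set P2" using ok n by (auto intro: code_cov_in_cov_set)
    have "(1 - ?e n) * ln (real (num_msgs n R1) * real (num_msgs n R2)) - ln 2 \<le>
        real n * ((ln (det (mat 1 + gain H1 ?S1 + gain H2 ?S2)) - ln (det (mat 1 + gain H2 ?S2)) + ln (det (mat 1 + gain H4 ?S2))) / 2)"
      unfolding error_prob1_avg_err[OF N ok(3)[OF n]] error_prob2_avg_err[OF N ok(4)[OF n]]
      using S by (intro code_weak_interference_bound inv less n num_msgs_pos ok) (auto simp: cov_set_def)
    also have "\<dots> \<le> real n * V" by (intro mult_left_mono V S) auto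
    finally show "(1 - ?e n) * ln (real (num_msgs n R1) * real (num_msgs n R2)) - ln 2 \<le> real n * V" .
  qed
qed

text \<open>Both bounds hold at the same pair of covariances, those of the code of length
  \<open>n\<close>, so their minimum is bounded there before anything is maximised. Maximising them
  separately would only give a minimum of two maxima.\<close>

theorem converse_strong_interference:
  fixes H1 :: "real^'t^'n" and H2 H4 :: "real^'n^'n"
  assumes N: "noise_law N" and inv: "invertible H2" "invertible H4" and le: "transpose H2 ** H2 \<succeq>\<^sub>L transpose H4 ** H4"
    and ach: "achievable H1 H2 0 H4 N P1 P2 (R1, R2)"
    and V: "\<And>S1 S2. S1 \<in> cov_set P1 \<Longrightarrow> S2 \<in> cov_set P2 \<Longrightarrow>
       min (ln (det (mat 1 + gain H1 S1 + gain H2 S2)) / 2)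
         (ln (det (mat 1 + gain H1 S1)) / 2 + ln (det (mat 1 + gain H4 S2)) / 2) \<le> V"
  shows "R1 + R2 \<le> V"
proof -
  from ach obtain x1 x2 d1 d2 where R: "0 \<le> R1" "0 \<le> R2"
    and all: "\<forall>n\<ge>1. power_ok n R1 P1 (x1 n) \<and> power_ok n R2 P2 (x2 n) \<and> decoder n (d1 n) \<and> decoder n (d2 n)"
    and lim: "(\<lambda>n. error_prob1 H1 H2 N n R1 R2 (x1 n) (x2 n) (d1 n)) \<longlonglongrightarrow> 0"
      "(\<lambda>n. error_prob2 0 H4 N n R1 R2 (x1 n) (x2 n) (d2 n)) \<longlonglongrightarrow> 0"
    unfolding achievable_def prod.case by blast
  from all have ok: "\<And>n. 1 \<le> n \<Longrightarrow> power_ok n R1 P1 (x1 n)" "\<And>n. 1 \<le> n \<Longrightarrow> power_ok n R2 P2 (x2 n)"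
      "\<And>n. 1 \<le> n \<Longrightarrow> decoder n (d1 n)" "\<And>n. 1 \<le> n \<Longrightarrow> decoder n (d2 n)"
    by blast+
  let ?e1 = "\<lambda>n. error_prob1 H1 H2 N n R1 R2 (x1 n) (x2 n) (d1 n)"
  let ?e2 = "\<lambda>n. error_prob2 0 H4 N n R1 R2 (x1 n) (x2 n) (d2 n)"
  show ?thesis
  proof (rule rate_limit)
    show "(\<lambda>n. ?e1 n + ?e2 n) \<longlonglongrightarrow> 0" using tendsto_add[OF lim] by simp
    show "0 \<le> R1 + R2" using R by simp
    show "real n * (R1 + R2) \<le> ln (real (num_msgs n R1) * real (num_msgs n R2))" for n by (rule ln_num_msgs_mult_ge)
    fix n :: nat assume n: "1 \<le> n"
    let ?S1 = "code_cov n (num_msgs n R1) (x1 n)" and ?S2 = "code_cov n (num_msgs n R2) (x2 n)"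
    let ?M1 = "real (num_msgs n R1)" and ?M2 = "real (num_msgs n R2)"
    have S: "?S1 \<in> cov_set P1" "?S2 \<in> cov_set P2" using ok n by (auto intro: code_cov_in_cov_set)
    have M: "1 \<le> ?M1" "1 \<le> ?M2" using num_msgs_pos[of n R1] num_msgs_pos[of n R2] by simp_all
    have e: "0 \<le> ?e1 n" "0 \<le> ?e2 n" by (simp_all add: error_prob1_def error_prob2_def)
    have sum: "(1 - (?e1 n + ?e2 n)) * ln (?M1 * ?M2) - ln 2 \<le> real n * (ln (det (mat 1 + gain H1 ?S1 + gain H2 ?S2)) / 2)"
      unfolding error_prob1_avg_err[OF N ok(3)[OF n]] error_prob2_avg_err[OF N ok(4)[OF n]]
      using S by (intro code_strong_interference_bound inv le n num_msgs_pos ok) (auto simp: cov_set_def)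
    have u1: "(1 - ?e1 n) * ln ?M1 - ln 2 \<le> real n * (ln (det (mat 1 + gain H1 ?S1)) / 2)"
      unfolding error_prob1_avg_err[OF N ok(3)[OF n]]
      using S by (intro code_user1_bound n num_msgs_pos ok) (auto simp: cov_set_def)
    have u2: "(1 - ?e2 n) * ln ?M2 - ln 2 \<le> real n * (ln (det (mat 1 + gain H4 ?S2)) / 2)"
      unfolding error_prob2_avg_err[OF N ok(4)[OF n]]
      using S by (intro code_user2_bound n num_msgs_pos ok) (auto simp: cov_set_def)
    \<comment> \<open>The single-user bounds carry different error weights; passing to the common
      weight only drops nonnegative terms.\<close>
    have "(1 - (?e1 n + ?e2 n)) * ln (?M1 * ?M2) = (1 - ?e1 n) * ln ?M1 + (1 - ?e2 n) * ln ?M2 - ?e2 n * ln ?M1 - ?e1 n * ln ?M2"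
      using M by (simp add: ln_mult algebra_simps)
    moreover have "0 \<le> ?e2 n * ln ?M1" "0 \<le> ?e1 n * ln ?M2" using e M by simp_all
    \<comment> \<open>One \<open>ln 2\<close> for each user; the joint bound is weakened to the same
      constant next.\<close>
    ultimately have "(1 - (?e1 n + ?e2 n)) * ln (?M1 * ?M2) - 2 * ln 2
      \<le> real n * (ln (det (mat 1 + gain H1 ?S1)) / 2 + ln (det (mat 1 + gain H4 ?S2)) / 2)"
      using u1 u2 unfolding distrib_left by linarith
    moreover have "(1 - (?e1 n + ?e2 n)) * ln (?M1 * ?M2) - 2 * ln 2 \<le> real n * (ln (det (mat 1 + gain H1 ?S1 + gain H2 ?S2)) / 2)"
      using sum ln_gt_zero[of "2::real"] by linarith
    ultimately have "(1 - (?e1 n + ?e2 n)) * ln (?M1 * ?M2) - 2 * ln 2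
      \<le> real n * min (ln (det (mat 1 + gain H1 ?S1 + gain H2 ?S2)) / 2) (ln (det (mat 1 + gain H1 ?S1)) / 2 + ln (det (mat 1 + gain H4 ?S2)) / 2)"
      by (simp add: min_def)
    also have "\<dots> \<le> real n * V" by (intro mult_left_mono V S) auto
    finally show "(1 - (?e1 n + ?e2 n)) * ln (?M1 * ?M2) - 2 * ln 2 \<le> real n * V" .
  qed
qed

section \<open>Random Gaussian codebooks and threshold decoding\<close>

abbreviation gauss_seq :: "nat \<Rightarrow> (nat \<Rightarrow> real^'n) measure" where
  "gauss_seq n \<equiv> Pi\<^sub>M {..<n} (\<lambda>_. std_gaussian)"

interpretation gauss_seq: prob_space "gauss_seq n :: (nat \<Rightarrow> real^'n) measure" for n
  by (intro prob_space_PiM std_gaussian.prob_space_axioms)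

lemma measurable_gauss_seq_component:
  "j < n \<Longrightarrow> (\<lambda>x. x j) \<in> borel_measurable (gauss_seq n :: (nat \<Rightarrow> real^'n) measure)"
  using measurable_component_singleton[of j "{..<n}" "\<lambda>_. std_gaussian"] by simp

text \<open>The log-density ratio of \<open>r\<close> under noise \<open>Bn\<close> around \<open>v\<close> and under \<open>B\<close> around \<open>0\<close>.\<close>

definition info_density :: "real^'n^'n \<Rightarrow> real^'n^'n \<Rightarrow> real^'n \<Rightarrow> real^'n \<Rightarrow> real" where
  "info_density Bn B v r = (norm (matrix_inv B *v r))\<^sup>2 / 2 - (norm (matrix_inv Bn *v (r - v)))\<^sup>2 / 2
     + ln (\<bar>det B\<bar> / \<bar>det Bn\<bar>)"

text \<open>The threshold \<open>g\<close> will lie below the typical value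
  \<open>ln (|det B| / |det Bn|)\<close> and above the rate, unless the rate is 0.\<close>

definition passes :: "real^'n^'n \<Rightarrow> real^'n^'n \<Rightarrow> real \<Rightarrow> nat \<Rightarrow> (nat \<Rightarrow> real^'n) \<Rightarrow> (nat \<Rightarrow> real^'n) \<Rightarrow> bool" where
  "passes Bn B g n v r \<longleftrightarrow> real n * g \<le> (\<Sum>j<n. info_density Bn B (v j) (r j))"

lemma borel_measurable_info_density [measurable (raw)]:
  assumes [measurable]: "f \<in> borel_measurable M" "g \<in> borel_measurable M"
  shows "(\<lambda>x. info_density Bn B (f x) (g x)) \<in> borel_measurable M"
proof -
  have v: "(\<lambda>x. X *v h x) \<in> borel_measurable M" if "h \<in> borel_measurable M" for h :: "_ \<Rightarrow> real^'k" and X :: "real^'k^'k"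
    using measurable_compose[OF that borel_measurable_matrix_vector] .
  have [measurable]: "(\<lambda>x. matrix_inv B *v g x) \<in> borel_measurable M"
      "(\<lambda>x. matrix_inv Bn *v (g x - f x)) \<in> borel_measurable M"
    by (intro v borel_measurable_diff assms)+
  show ?thesis unfolding info_density_def by measurable
qed

lemma pred_passes [measurable (raw)]:
  assumes f: "\<And>j. j < n \<Longrightarrow> (\<lambda>x. f x j) \<in> borel_measurable M" and g: "\<And>j. j < n \<Longrightarrow> (\<lambda>x. g x j) \<in> borel_measurable M"
  shows "Measurable.pred M (\<lambda>x. passes Bn B t n (f x) (g x))"
proof -
  have [measurable]: "(\<lambda>x. \<Sum>j<n. info_density Bn B (f x j) (g x j)) \<in> borel_measurable M"
    by (intro borel_measurable_sum borel_measurable_info_density f g) auto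
  show ?thesis unfolding passes_def by measurable
qed

text \<open>For every fixed \<open>v\<close> the exponential is a ratio of two probability
  densities, integrated against its denominator.\<close>

lemma nn_integral_exp_info_density:
  fixes Bn B :: "real^'n^'n"
  assumes B: "invertible B" and Bn: "invertible Bn"
  shows "(\<integral>\<^sup>+k. ennreal (exp (info_density Bn B v (B *v k))) \<partial>std_gaussian) = 1"
proof -
  let ?C = "matrix_inv Bn ** B"
  have dB: "0 < \<bar>det B\<bar>" and dn: "0 < \<bar>det Bn\<bar>" using B Bn by (auto simp: invertible_det_nz)
  have i: "matrix_inv B *v (B *v k) = k" for k
    by (simp add: matrix_vector_mul_assoc matrix_inv_left[OF B])
  have "det (matrix_inv Bn) * det Bn = 1" using matrix_inv_left[OF Bn] by (metis det_I det_mul)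
  then have dC: "\<bar>det ?C\<bar> = \<bar>det B\<bar> / \<bar>det Bn\<bar>"
    using dn by (simp add: det_mul abs_mult field_simps) (metis abs_1 abs_mult mult.commute)
  have C: "invertible ?C" using dC dB dn by (auto simp: invertible_det_nz)
  let ?w = "- (matrix_inv Bn *v v)"
  \<comment> \<open>The standard density in \<open>k\<close> cancels the first square of the
    information density; the Gaussian density at \<open>Bn^{-1} (B k - v)\<close> and its Jacobian
    remain.\<close>
  have "gauss_pdf k * exp (info_density Bn B v (B *v k)) = gauss_pdf (?w + ?C *v k) * (\<bar>det B\<bar> / \<bar>det Bn\<bar>)" for k
  proof -
    have "matrix_inv Bn *v (B *v k - v) = ?w + ?C *v k"
      by (simp add: matrix_vector_mult_diff_distrib matrix_vector_mul_assoc)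
    then have "info_density Bn B v (B *v k) = (norm k)\<^sup>2 / 2 + - (norm (?w + ?C *v k))\<^sup>2 / 2 + ln (\<bar>det B\<bar> / \<bar>det Bn\<bar>)"
      by (simp add: info_density_def i)
    moreover have "exp (ln (\<bar>det B\<bar> / \<bar>det Bn\<bar>)) = \<bar>det B\<bar> / \<bar>det Bn\<bar>"
      using dB dn by (intro exp_ln) simp
    ultimately have "exp (info_density Bn B v (B *v k)) = exp ((norm k)\<^sup>2 / 2) * exp (- (norm (?w + ?C *v k))\<^sup>2 / 2) * (\<bar>det B\<bar> / \<bar>det Bn\<bar>)"
      by (simp only: exp_add)
    moreover have "exp (- (norm k)\<^sup>2 / 2) * exp ((norm k)\<^sup>2 / 2) = 1" by (simp flip: exp_add)
    ultimately show ?thesis unfolding gauss_pdf_eq by (simp add: field_simps)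
  qed
  then have e: "ennreal (gauss_pdf k) * ennreal (exp (info_density Bn B v (B *v k)))
      = ennreal \<bar>det ?C\<bar> * ennreal (gauss_pdf (?w + ?C *v k))" for k
    unfolding dC by (simp add: gauss_pdf_pos less_imp_le mult.commute flip: ennreal_mult)
  have m: "(\<lambda>y. gauss_pdf (?w + y)) \<in> borel_measurable borel"
    by (rule measurable_compose[OF _ borel_measurable_gauss_pdf]) measurable
  have "(\<integral>\<^sup>+k. ennreal (exp (info_density Bn B v (B *v k))) \<partial>std_gaussian)
    = (\<integral>\<^sup>+k. ennreal \<bar>det ?C\<bar> * ennreal (gauss_pdf (?w + ?C *v k)) \<partial>lborel)"
    by (subst nn_integral_std_gaussian, measurable) (simp only: e)
  also have "\<dots> = ennreal \<bar>det ?C\<bar> * (\<integral>\<^sup>+k. ennreal (gauss_pdf (?w + ?C *v k)) \<partial>lborel)"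
    using measurable_compose[OF borel_measurable_matrix_vector m, of ?C] by (intro nn_integral_cmult) simp
  also have "\<dots> = (\<integral>\<^sup>+y. ennreal (gauss_pdf (?w + y)) \<partial>lborel)"
    using m by (intro nn_integral_matrix[OF _ C, symmetric]) simp
  also have "\<dots> = 1"
    using nn_integral_lborel_translate[of "\<lambda>y. ennreal (gauss_pdf y)" ?w] by simp
  finally show ?thesis .
qed

text \<open>Passing means that the product of the density ratios is at least
  \<open>exp (n g)\<close>, while its mean under an independent output is 1.\<close>

lemma false_alarm:
  fixes Bn B :: "real^'n^'n"
  assumes B: "invertible B" and Bn: "invertible Bn"
  shows "(\<integral>\<^sup>+k. of_bool (passes Bn B g n v (\<lambda>j. B *v k j)) \<partial>gauss_seq n) \<le> ennreal (exp (- real n * g))"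
proof -
  interpret product_prob_space "\<lambda>_. std_gaussian :: (real^'n) measure" "{..<n}"
    by (rule product_prob_spaceI) (rule std_gaussian.prob_space_axioms)
  have i: "(\<lambda>k. info_density Bn B (v j) (B *v k)) \<in> borel_measurable (std_gaussian :: (real^'n) measure)" for j
    by (rule borel_measurable_info_density) (rule borel_measurable_const, measurable)
  have m: "(\<lambda>k. ennreal (exp (info_density Bn B (v j) (B *v k)))) \<in> borel_measurable (std_gaussian :: (real^'n) measure)" for j
    using i[of j] by measurable
  have "(\<integral>\<^sup>+k. of_bool (passes Bn B g n v (\<lambda>j. B *v k j)) \<partial>gauss_seq n)
    \<le> (\<integral>\<^sup>+k. (\<Prod>j<n. ennreal (exp (- g)) * ennreal (exp (info_density Bn B (v j) (B *v k j)))) \<partial>gauss_seq n)"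
  proof (rule nn_integral_mono)
    fix k :: "nat \<Rightarrow> real^'n"
    have "(\<Prod>j<n. ennreal (exp (- g)) * ennreal (exp (info_density Bn B (v j) (B *v k j))))
       = ennreal (exp (\<Sum>j<n. - g + info_density Bn B (v j) (B *v k j)))"
      by (simp add: exp_sum prod_ennreal flip: ennreal_mult exp_add)
    also have "(\<Sum>j<n. - g + info_density Bn B (v j) (B *v k j)) = (\<Sum>j<n. info_density Bn B (v j) (B *v k j)) - real n * g"
      by (simp add: sum.distrib sum_subtractf)
    finally show "of_bool (passes Bn B g n v (\<lambda>j. B *v k j)) \<le> (\<Prod>j<n. ennreal (exp (- g)) * ennreal (exp (info_density Bn B (v j) (B *v k j))))"
      by (simp add: passes_def)
  qed
  also have "\<dots> = (\<Prod>j<n. \<integral>\<^sup>+k. ennreal (exp (- g)) * ennreal (exp (info_density Bn B (v j) (B *v k))) \<partial>(std_gaussian :: (real^'n) measure))"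
    using m by (intro product_nn_integral_prod borel_measurable_times_ennreal borel_measurable_const) auto
  also have "\<dots> = (\<Prod>j<n. ennreal (exp (- g)))"
    using m by (simp add: nn_integral_cmult nn_integral_exp_info_density[OF B Bn])
  also have "\<dots> = ennreal (exp (- g)) ^ n" by simp
  also have "\<dots> = ennreal (exp (- real n * g))"
    by (simp add: ennreal_power flip: exp_of_nat_mult)
  finally show ?thesis .
qed

text \<open>Both normalised square norms concentrate at \<open>CARD('n)\<close> per channel use,
  where the information density equals \<open>ln (|det B| / |det Bn|)\<close>. A threshold lower by
  \<open>e\<close> is missed only if one of them is off by \<open>e\<close> in the harmful
  direction.\<close>

lemma not_passes_cases:
  fixes Bn B :: "real^'n^'n" and e :: real
  assumes "\<not> passes Bn B g n v r" and "g \<le> ln (\<bar>det B\<bar> / \<bar>det Bn\<bar>) - e"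
  shows "real n * (CARD('n) + e) \<le> (\<Sum>j<n. (norm (matrix_inv Bn *v (r j - v j)))\<^sup>2)
       \<or> (\<Sum>j<n. (norm (matrix_inv B *v r j))\<^sup>2) \<le> real n * (CARD('n) - e)"
proof (rule ccontr)
  assume neg: "\<not> ?thesis"
  let ?c = "ln (\<bar>det B\<bar> / \<bar>det Bn\<bar>)"
  have "(\<Sum>j<n. info_density Bn B (v j) (r j))
    = (\<Sum>j<n. (norm (matrix_inv B *v r j))\<^sup>2) / 2 - (\<Sum>j<n. (norm (matrix_inv Bn *v (r j - v j)))\<^sup>2) / 2 + real n * ?c"
    by (simp add: info_density_def sum.distrib sum_subtractf sum_divide_distrib)
  also have "\<dots> \<ge> real n * (CARD('n) - e) / 2 - real n * (CARD('n) + e) / 2 + real n * ?c"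
    using neg by (intro add_right_mono diff_mono divide_right_mono) auto
  finally have "real n * (?c - e) \<le> (\<Sum>j<n. info_density Bn B (v j) (r j))"
    by (simp add: algebra_simps add_divide_distrib diff_divide_distrib)
  moreover have "real n * g \<le> real n * (?c - e)" using assms(2) by (intro mult_left_mono) auto
  ultimately show False using assms(1) by (simp add: passes_def)
qed

lemma nn_integral_gauss_seq_sum:
  fixes A :: "real^'m^'n" and B K :: "real^'n^'n"
  assumes K: "invertible K" and BB: "B ** transpose B = A ** transpose A + K ** transpose K"
    and h: "h \<in> borel_measurable (Pi\<^sub>M {..<n} (\<lambda>_. borel :: (real^'n) measure))"
  shows "(\<integral>\<^sup>+x. \<integral>\<^sup>+z. h (\<lambda>j\<in>{..<n}. A *v x j + K *v z j) \<partial>gauss_seq n \<partial>gauss_seq n)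
    = (\<integral>\<^sup>+k. h (\<lambda>j\<in>{..<n}. B *v k j) \<partial>gauss_seq n)"
proof -
  have h': "h \<in> borel_measurable (Pi\<^sub>M {..<n} (\<lambda>_. gaussian B))"
  proof -
    have "sets (Pi\<^sub>M {..<n} (\<lambda>_. gaussian B)) = sets (Pi\<^sub>M {..<n} (\<lambda>_. borel))" by (intro sets_PiM_cong) auto
    then show ?thesis using h measurable_cong_sets by blast
  qed
  have "(\<integral>\<^sup>+x. \<integral>\<^sup>+z. h (\<lambda>j\<in>{..<n}. A *v x j + K *v z j) \<partial>gauss_seq n \<partial>gauss_seq n) = (\<integral>\<^sup>+y. h y \<partial>Pi\<^sub>M {..<n} (\<lambda>_. gaussian B))"
  proof (rule nn_integral_PiM_pair[where T = "\<lambda>x z. A *v x + K *v z"])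
    show "(\<lambda>(x, z). A *v x + K *v z) \<in> std_gaussian \<Otimes>\<^sub>M std_gaussian \<rightarrow>\<^sub>M gaussian B"
      by measurable
    fix E assume E: "E \<in> sets (gaussian B)"
    then have [measurable]: "E \<in> sets borel" by simp
    have "(\<integral>\<^sup>+x. \<integral>\<^sup>+z. indicator E (A *v x + K *v z) \<partial>std_gaussian \<partial>std_gaussian) = (\<integral>\<^sup>+k. indicator E (B *v k) \<partial>std_gaussian)"
      by (rule nn_integral_std_gaussian_sum[OF _ K BB]) measurable
    also have "\<dots> = (\<integral>\<^sup>+y. indicator E y \<partial>gaussian B)"
      by (subst nn_integral_gaussian) auto
    finally show "(\<integral>\<^sup>+x. \<integral>\<^sup>+z. indicator E (A *v x + K *v z) \<partial>std_gaussian \<partial>std_gaussian) = emeasure (gaussian B) E"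
      using E by simp
  qed (auto intro: std_gaussian.prob_space_axioms prob_space_gaussian h')
  also have "\<dots> = (\<integral>\<^sup>+k. h (\<lambda>j\<in>{..<n}. B *v k j) \<partial>gauss_seq n)"
  proof (rule nn_integral_PiM_distr[symmetric])
    show "distr std_gaussian (gaussian B) ((*v) B) = gaussian B"
      unfolding gaussian_def by (intro distr_cong) auto
  qed (auto intro: std_gaussian.prob_space_axioms prob_space_gaussian h')
  finally show ?thesis .
qed

text \<open>Normalised by the inverse of \<open>B\<close>, the sum is again a standard Gaussian
  sequence; \<open>Q\<close> stands for a tail event of its square norm.\<close>

lemma gauss_seq_sum_tail:
  fixes A :: "real^'m^'n" and B K :: "real^'n^'n"
  assumes K: "invertible K" and B: "invertible B" and BB: "B ** transpose B = A ** transpose A + K ** transpose K"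
    and P: "\<And>t. Measurable.pred borel (Q t)"
  shows "(\<integral>\<^sup>+x. \<integral>\<^sup>+z. of_bool (Q n (\<Sum>j<n. (norm (matrix_inv B *v (A *v x j + K *v z j)))\<^sup>2)) \<partial>gauss_seq n \<partial>gauss_seq n)
    = (\<integral>\<^sup>+k. of_bool (Q n (\<Sum>j<n. (norm (k j :: real^'n))\<^sup>2)) \<partial>gauss_seq n)"
proof -
  let ?h = "\<lambda>y. of_bool (Q n (\<Sum>j<n. (norm (matrix_inv B *v y j))\<^sup>2)) :: ennreal"
  have c: "(\<lambda>y. matrix_inv B *v y j) \<in> borel_measurable (Pi\<^sub>M {..<n} (\<lambda>_. borel))" if "j < n" for j
    using that measurable_compose[OF measurable_component_singleton[of j "{..<n}" "\<lambda>_. borel"] borel_measurable_matrix_vector] by simp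
  have "(\<lambda>y. \<Sum>j<n. (norm (matrix_inv B *v y j))\<^sup>2) \<in> borel_measurable (Pi\<^sub>M {..<n} (\<lambda>_. borel))"
    by (intro borel_measurable_sum borel_measurable_power borel_measurable_norm c) auto
  from measurable_compose[OF this P[of n, unfolded pred_def[symmetric]]]
  have h: "?h \<in> borel_measurable (Pi\<^sub>M {..<n} (\<lambda>_. borel))" by measurable
  have "matrix_inv B *v (B *v k) = k" for k
    by (simp add: matrix_vector_mul_assoc matrix_inv_left[OF B])
  then show ?thesis
    using nn_integral_gauss_seq_sum[OF K BB h] by simp
qed

lemma nn_integral_PiM_one:
  assumes M: "prob_space M" and i: "i \<in> I" and h: "h \<in> borel_measurable M"
  shows "(\<integral>\<^sup>+C. h (C i) \<partial>Pi\<^sub>M I (\<lambda>_. M)) = (\<integral>\<^sup>+x. h x \<partial>M)"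
proof -
  have "(\<integral>\<^sup>+x. h x \<partial>M) = (\<integral>\<^sup>+x. h x \<partial>distr (Pi\<^sub>M I (\<lambda>_. M)) M (\<lambda>C. C i))"
    using distr_PiM_component[of I "\<lambda>_. M" i] M i by simp
  also have "\<dots> = (\<integral>\<^sup>+C. h (C i) \<partial>Pi\<^sub>M I (\<lambda>_. M))"
    using measurable_component_singleton[OF i, of "\<lambda>_. M"] h by (intro nn_integral_distr) auto
  finally show ?thesis ..
qed

text \<open>Distinct codewords of a random codebook are independent: coordinate \<open>a\<close> is
  split off and integrated for itself.\<close>

lemma nn_integral_PiM_two:
  assumes M: "prob_space M" and I: "finite I" "a \<in> I" "b \<in> I" "a \<noteq> b"
    and h: "case_prod h \<in> borel_measurable (M \<Otimes>\<^sub>M M)"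
  shows "(\<integral>\<^sup>+C. h (C b) (C a) \<partial>Pi\<^sub>M I (\<lambda>_. M)) = (\<integral>\<^sup>+x'. \<integral>\<^sup>+x. h x' x \<partial>M \<partial>M)"
proof -
  interpret M: prob_space M by fact
  interpret product_sigma_finite "\<lambda>_. M" ..
  define I' where "I' = I - {a}"
  have ins: "I = insert a I'" and I': "finite I'" "a \<notin> I'" "b \<in> I'" using I by (auto simp: I'_def)
  have c: "(\<lambda>C. C i) \<in> Pi\<^sub>M I (\<lambda>_. M) \<rightarrow>\<^sub>M M" if "i \<in> I" for i
    using measurable_component_singleton[OF that, of "\<lambda>_. M"] by simp
  have m: "(\<lambda>C. h (C b) (C a)) \<in> borel_measurable (Pi\<^sub>M (insert a I') (\<lambda>_. M))"
    using measurable_compose[OF measurable_Pair[OF c[OF I(3)] c[OF I(2)]] h] unfolding ins by simp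
  have "(\<integral>\<^sup>+C. h (C b) (C a) \<partial>Pi\<^sub>M (insert a I') (\<lambda>_. M))
    = (\<integral>\<^sup>+C. (\<integral>\<^sup>+x. h ((C(a := x)) b) ((C(a := x)) a) \<partial>M) \<partial>Pi\<^sub>M I' (\<lambda>_. M))"
    by (rule product_nn_integral_insert[OF I'(1,2) m])
  also have "\<dots> = (\<integral>\<^sup>+C. (\<integral>\<^sup>+x. h (C b) x \<partial>M) \<partial>Pi\<^sub>M I' (\<lambda>_. M))"
    using I(4) by simp
  also have "\<dots> = (\<integral>\<^sup>+x'. \<integral>\<^sup>+x. h x' x \<partial>M \<partial>M)"
    by (rule nn_integral_PiM_one[OF M I'(3)]) (use M.borel_measurable_nn_integral_fst[OF h] in simp)
  finally show ?thesis unfolding ins .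
qed

section \<open>Decoders from tests, averaged over random codebooks\<close>

definition least_dec :: "nat \<Rightarrow> (nat \<Rightarrow> 'y \<Rightarrow> bool) \<Rightarrow> 'y \<Rightarrow> nat" where
  "least_dec M T y = (LEAST m. m < M \<and> T m y)"

lemma measurable_least_dec:
  assumes "\<And>m. Measurable.pred N (T m)"
  shows "least_dec M T \<in> N \<rightarrow>\<^sub>M count_space UNIV"
proof -
  have "Measurable.pred N (\<lambda>y. m < M \<and> T m y)" for m
    using assms[of m] by (cases "m < M") simp_all
  then show ?thesis unfolding least_dec_def[abs_def] by (rule measurable_Least)
qed

text \<open>If nothing passes, the sent message has failed its own test; so the default value of
  \<open>LEAST\<close> is covered by the first alternative.\<close>

lemma least_dec_error:
  assumes "m < M" "least_dec M T y \<noteq> m"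
  shows "\<not> T m y \<or> (\<exists>m'\<in>{..<M} - {m}. T m' y)"
proof (rule ccontr)
  assume neg: "\<not> ?thesis"
  from neg have u: "m' = m" if "m' < M \<and> T m' y" for m'
    using that by blast
  have "(LEAST m'. m' < M \<and> T m' y) = m"
  proof (rule Least_equality)
    show "m < M \<and> T m y" using neg assms(1) by blast
    show "m \<le> m'" if "m' < M \<and> T m' y" for m' unfolding u[OF that] ..
  qed
  then show False using assms(2) by (simp add: least_dec_def)
qed

lemma nn_integral_union_bound:
  assumes s0: "g0 \<in> borel_measurable M"
    and s1: "\<And>i. i \<in> A \<Longrightarrow> g1 i \<in> borel_measurable M"
    and s2: "\<And>i j. i \<in> A \<Longrightarrow> j \<in> B \<Longrightarrow> g2 i j \<in> borel_measurable M"
  shows "(\<integral>\<^sup>+x. g0 x + (\<Sum>i\<in>A. g1 i x) + (\<Sum>i\<in>A. \<Sum>j\<in>B. g2 i j x) \<partial>M)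
    = (\<integral>\<^sup>+x. g0 x \<partial>M) + (\<Sum>i\<in>A. \<integral>\<^sup>+x. g1 i x \<partial>M) + (\<Sum>i\<in>A. \<Sum>j\<in>B. \<integral>\<^sup>+x. g2 i j x \<partial>M)"
proof -
  have a: "(\<lambda>x. \<Sum>i\<in>A. g1 i x) \<in> borel_measurable M"
    by (intro borel_measurable_sum s1)
  have b: "(\<lambda>x. \<Sum>j\<in>B. g2 i j x) \<in> borel_measurable M" if "i \<in> A" for i
    using that by (intro borel_measurable_sum s2)
  have c: "(\<lambda>x. \<Sum>i\<in>A. \<Sum>j\<in>B. g2 i j x) \<in> borel_measurable M"
    by (intro borel_measurable_sum b)
  have "(\<integral>\<^sup>+x. (\<Sum>i\<in>A. \<Sum>j\<in>B. g2 i j x) \<partial>M) = (\<Sum>i\<in>A. \<Sum>j\<in>B. \<integral>\<^sup>+x. g2 i j x \<partial>M)"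
    by (subst nn_integral_sum, erule b) (intro sum.cong refl nn_integral_sum s2)
  moreover have "(\<integral>\<^sup>+x. (\<Sum>i\<in>A. g1 i x) \<partial>M) = (\<Sum>i\<in>A. \<integral>\<^sup>+x. g1 i x \<partial>M)"
    by (rule nn_integral_sum) (rule s1)
  ultimately show ?thesis
    by (simp only: nn_integral_add[OF borel_measurable_add[OF s0 a] c] nn_integral_add[OF s0 a])
qed

text \<open>\<open>miss\<close> is the event that the sent pair fails its test;
  \<open>fa1\<close> and \<open>fa2\<close> that a pair with a wrong first message and the right, respectively a
  wrong, second message passes it.\<close>

lemma random_codebooks:
  fixes m1 m2 M1 M2 :: nat
  assumes \<mu>1: "prob_space \<mu>1" and \<mu>2: "prob_space \<mu>2" and \<nu>: "prob_space \<nu>"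
    and m1: "m1 < M1" and m2: "m2 < M2"
    and miss: "miss \<in> borel_measurable (\<mu>1 \<Otimes>\<^sub>M \<mu>2 \<Otimes>\<^sub>M \<nu>)"
    and fa1: "fa1 \<in> borel_measurable (\<mu>1 \<Otimes>\<^sub>M \<mu>1 \<Otimes>\<^sub>M \<mu>2 \<Otimes>\<^sub>M \<nu>)"
    and fa2: "fa2 \<in> borel_measurable (\<mu>1 \<Otimes>\<^sub>M \<mu>1 \<Otimes>\<^sub>M \<mu>2 \<Otimes>\<^sub>M \<mu>2 \<Otimes>\<^sub>M \<nu>)"
    and q0: "(\<integral>\<^sup>+x1. \<integral>\<^sup>+x2. \<integral>\<^sup>+z. miss (x1, x2, z) \<partial>\<nu> \<partial>\<mu>2 \<partial>\<mu>1) \<le> q0"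
    and q1: "(\<integral>\<^sup>+x1'. \<integral>\<^sup>+x1. \<integral>\<^sup>+x2. \<integral>\<^sup>+z. fa1 (x1', x1, x2, z) \<partial>\<nu> \<partial>\<mu>2 \<partial>\<mu>1 \<partial>\<mu>1) \<le> q1"
    and q2: "(\<integral>\<^sup>+x1'. \<integral>\<^sup>+x1. \<integral>\<^sup>+x2'. \<integral>\<^sup>+x2. \<integral>\<^sup>+z. fa2 (x1', x1, x2', x2, z) \<partial>\<nu> \<partial>\<mu>2 \<partial>\<mu>2 \<partial>\<mu>1 \<partial>\<mu>1) \<le> q2"
  defines "b \<equiv> \<lambda>C1 C2. (\<integral>\<^sup>+z. miss (C1 m1, C2 m2, z) \<partial>\<nu>)
      + (\<Sum>m1'\<in>{..<M1} - {m1}. \<integral>\<^sup>+z. fa1 (C1 m1', C1 m1, C2 m2, z) \<partial>\<nu>)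
      + (\<Sum>m1'\<in>{..<M1} - {m1}. \<Sum>m2'\<in>{..<M2} - {m2}. \<integral>\<^sup>+z. fa2 (C1 m1', C1 m1, C2 m2', C2 m2, z) \<partial>\<nu>)"
  shows "case_prod b \<in> borel_measurable (Pi\<^sub>M {..<M1} (\<lambda>_. \<mu>1) \<Otimes>\<^sub>M Pi\<^sub>M {..<M2} (\<lambda>_. \<mu>2))"
    and "(\<integral>\<^sup>+C1. \<integral>\<^sup>+C2. b C1 C2 \<partial>Pi\<^sub>M {..<M2} (\<lambda>_. \<mu>2) \<partial>Pi\<^sub>M {..<M1} (\<lambda>_. \<mu>1))
       \<le> q0 + ennreal (real (M1 - 1)) * q1 + ennreal (real (M1 - 1) * real (M2 - 1)) * q2"
proof -
  let ?P1 = "Pi\<^sub>M {..<M1} (\<lambda>_. \<mu>1)" and ?P2 = "Pi\<^sub>M {..<M2} (\<lambda>_. \<mu>2)"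
  interpret \<mu>1: prob_space \<mu>1 by fact
  interpret \<mu>2: prob_space \<mu>2 by fact
  interpret \<nu>: prob_space \<nu> by fact
  interpret P1: prob_space ?P1 by (intro prob_space_PiM \<mu>1)
  interpret P2: prob_space ?P2 by (intro prob_space_PiM \<mu>2)
  note [measurable] = miss fa1 fa2
  have c1 [measurable]: "(\<lambda>C. C i) \<in> ?P1 \<rightarrow>\<^sub>M \<mu>1" if "i < M1" for i
    using measurable_component_singleton[of i "{..<M1}" "\<lambda>_. \<mu>1"] that by simp
  have c2 [measurable]: "(\<lambda>C. C i) \<in> ?P2 \<rightarrow>\<^sub>M \<mu>2" if "i < M2" for i
    using measurable_component_singleton[of i "{..<M2}" "\<lambda>_. \<mu>2"] that by simp
  \<comment> \<open>The noise is integrated out first; what remains depends on at most two codewords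
    of each codebook, and distinct codewords are independent.\<close>
  define f0 where "f0 = (\<lambda>(x1, x2). \<integral>\<^sup>+z. miss (x1, x2, z) \<partial>\<nu>)"
  define f1 where "f1 = (\<lambda>(x1', x1, x2). \<integral>\<^sup>+z. fa1 (x1', x1, x2, z) \<partial>\<nu>)"
  define f2 where "f2 = (\<lambda>(x1', x1, x2', x2). \<integral>\<^sup>+z. fa2 (x1', x1, x2', x2, z) \<partial>\<nu>)"
  have f0 [measurable]: "f0 \<in> borel_measurable (\<mu>1 \<Otimes>\<^sub>M \<mu>2)"
    unfolding f0_def by measurable
  have f1 [measurable]: "f1 \<in> borel_measurable (\<mu>1 \<Otimes>\<^sub>M \<mu>1 \<Otimes>\<^sub>M \<mu>2)"
    unfolding f1_def by measurable
  have f2 [measurable]: "f2 \<in> borel_measurable (\<mu>1 \<Otimes>\<^sub>M \<mu>1 \<Otimes>\<^sub>M \<mu>2 \<Otimes>\<^sub>M \<mu>2)"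
    unfolding f2_def by measurable
  have b: "b = (\<lambda>C1 C2. f0 (C1 m1, C2 m2) + (\<Sum>m1'\<in>{..<M1} - {m1}. f1 (C1 m1', C1 m1, C2 m2))
      + (\<Sum>m1'\<in>{..<M1} - {m1}. \<Sum>m2'\<in>{..<M2} - {m2}. f2 (C1 m1', C1 m1, C2 m2', C2 m2)))"
    unfolding b_def f0_def f1_def f2_def by simp
  have b0 [measurable]: "(\<lambda>(C1, C2). f0 (C1 m1, C2 m2)) \<in> borel_measurable (?P1 \<Otimes>\<^sub>M ?P2)"
    using m1 m2 by measurable
  have b1 [measurable]: "(\<lambda>(C1, C2). f1 (C1 m1', C1 m1, C2 m2)) \<in> borel_measurable (?P1 \<Otimes>\<^sub>M ?P2)" if "m1' < M1" for m1'
    using m1 m2 that by measurable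
  have b2 [measurable]: "(\<lambda>(C1, C2). f2 (C1 m1', C1 m1, C2 m2', C2 m2)) \<in> borel_measurable (?P1 \<Otimes>\<^sub>M ?P2)"
    if "m1' < M1" "m2' < M2" for m1' m2'
    using m1 m2 that by measurable
  show "case_prod b \<in> borel_measurable (?P1 \<Otimes>\<^sub>M ?P2)"
    unfolding b case_prod_unfold
    by (intro borel_measurable_add borel_measurable_sum b0[unfolded case_prod_unfold] b1[unfolded case_prod_unfold]
        b2[unfolded case_prod_unfold]) auto
  have I0: "(\<integral>\<^sup>+C1. \<integral>\<^sup>+C2. f0 (C1 m1, C2 m2) \<partial>?P2 \<partial>?P1) \<le> q0"
  proof -
    have "(\<integral>\<^sup>+C1. \<integral>\<^sup>+C2. f0 (C1 m1, C2 m2) \<partial>?P2 \<partial>?P1) = (\<integral>\<^sup>+C1. \<integral>\<^sup>+x2. f0 (C1 m1, x2) \<partial>\<mu>2 \<partial>?P1)"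
    proof (rule nn_integral_cong)
      fix C1 assume "C1 \<in> space ?P1"
      then have [measurable]: "C1 m1 \<in> space \<mu>1" using m1 by (auto simp: space_PiM)
      show "(\<integral>\<^sup>+C2. f0 (C1 m1, C2 m2) \<partial>?P2) = (\<integral>\<^sup>+x2. f0 (C1 m1, x2) \<partial>\<mu>2)"
        using m2 by (intro nn_integral_PiM_one[OF \<mu>2]) auto
    qed
    also have "\<dots> = (\<integral>\<^sup>+x1. \<integral>\<^sup>+x2. f0 (x1, x2) \<partial>\<mu>2 \<partial>\<mu>1)"
      using m1 by (intro nn_integral_PiM_one[OF \<mu>1]) auto
    finally show ?thesis using q0 by (simp add: f0_def)
  qed
  have I1: "(\<integral>\<^sup>+C1. \<integral>\<^sup>+C2. f1 (C1 m1', C1 m1, C2 m2) \<partial>?P2 \<partial>?P1) \<le> q1" if m1': "m1' < M1" "m1' \<noteq> m1" for m1'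
  proof -
    have "(\<integral>\<^sup>+C1. \<integral>\<^sup>+C2. f1 (C1 m1', C1 m1, C2 m2) \<partial>?P2 \<partial>?P1) = (\<integral>\<^sup>+C1. \<integral>\<^sup>+x2. f1 (C1 m1', C1 m1, x2) \<partial>\<mu>2 \<partial>?P1)"
    proof (rule nn_integral_cong)
      fix C1 assume "C1 \<in> space ?P1"
      then have [measurable]: "C1 m1 \<in> space \<mu>1" "C1 m1' \<in> space \<mu>1" using m1 m1' by (auto simp: space_PiM)
      show "(\<integral>\<^sup>+C2. f1 (C1 m1', C1 m1, C2 m2) \<partial>?P2) = (\<integral>\<^sup>+x2. f1 (C1 m1', C1 m1, x2) \<partial>\<mu>2)"
        using m2 by (intro nn_integral_PiM_one[OF \<mu>2]) auto
    qed
    also have "\<dots> = (\<integral>\<^sup>+x1'. \<integral>\<^sup>+x1. \<integral>\<^sup>+x2. f1 (x1', x1, x2) \<partial>\<mu>2 \<partial>\<mu>1 \<partial>\<mu>1)"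
      using m1 m1' by (intro nn_integral_PiM_two[OF \<mu>1]) auto
    finally show ?thesis using q1 by (simp add: f1_def)
  qed
  have I2: "(\<integral>\<^sup>+C1. \<integral>\<^sup>+C2. f2 (C1 m1', C1 m1, C2 m2', C2 m2) \<partial>?P2 \<partial>?P1) \<le> q2"
    if m1': "m1' < M1" "m1' \<noteq> m1" and m2': "m2' < M2" "m2' \<noteq> m2" for m1' m2'
  proof -
    have "(\<integral>\<^sup>+C1. \<integral>\<^sup>+C2. f2 (C1 m1', C1 m1, C2 m2', C2 m2) \<partial>?P2 \<partial>?P1)
      = (\<integral>\<^sup>+C1. \<integral>\<^sup>+x2'. \<integral>\<^sup>+x2. f2 (C1 m1', C1 m1, x2', x2) \<partial>\<mu>2 \<partial>\<mu>2 \<partial>?P1)"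
    proof (rule nn_integral_cong)
      fix C1 assume "C1 \<in> space ?P1"
      then have [measurable]: "C1 m1 \<in> space \<mu>1" "C1 m1' \<in> space \<mu>1" using m1 m1' by (auto simp: space_PiM)
      show "(\<integral>\<^sup>+C2. f2 (C1 m1', C1 m1, C2 m2', C2 m2) \<partial>?P2) = (\<integral>\<^sup>+x2'. \<integral>\<^sup>+x2. f2 (C1 m1', C1 m1, x2', x2) \<partial>\<mu>2 \<partial>\<mu>2)"
        using m2 m2' by (intro nn_integral_PiM_two[OF \<mu>2]) auto
    qed
    also have "\<dots> = (\<integral>\<^sup>+x1'. \<integral>\<^sup>+x1. \<integral>\<^sup>+x2'. \<integral>\<^sup>+x2. f2 (x1', x1, x2', x2) \<partial>\<mu>2 \<partial>\<mu>2 \<partial>\<mu>1 \<partial>\<mu>1)"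
      using m1 m1' by (intro nn_integral_PiM_two[OF \<mu>1]) auto
    finally show ?thesis using q2 by (simp add: f2_def)
  qed
  have inner: "(\<lambda>C1. \<integral>\<^sup>+C2. g C1 C2 \<partial>?P2) \<in> borel_measurable ?P1"
    if "(\<lambda>(C1, C2). g C1 C2) \<in> borel_measurable (?P1 \<Otimes>\<^sub>M ?P2)" for g :: "_ \<Rightarrow> _ \<Rightarrow> ennreal"
    using P2.borel_measurable_nn_integral_fst[OF that] by simp
  have slice: "(\<lambda>C2. g C1 C2) \<in> borel_measurable ?P2"
    if "(\<lambda>(C1, C2). g C1 C2) \<in> borel_measurable (?P1 \<Otimes>\<^sub>M ?P2)" "C1 \<in> space ?P1" for g :: "_ \<Rightarrow> _ \<Rightarrow> ennreal" and C1
    using measurable_compose[OF measurable_Pair1'[OF that(2)] that(1)] by simp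
  let ?A = "{..<M1} - {m1}" and ?B = "{..<M2} - {m2}"
  have "(\<integral>\<^sup>+C1. \<integral>\<^sup>+C2. b C1 C2 \<partial>?P2 \<partial>?P1)
    = (\<integral>\<^sup>+C1. (\<integral>\<^sup>+C2. f0 (C1 m1, C2 m2) \<partial>?P2) + (\<Sum>m1'\<in>?A. \<integral>\<^sup>+C2. f1 (C1 m1', C1 m1, C2 m2) \<partial>?P2)
        + (\<Sum>m1'\<in>?A. \<Sum>m2'\<in>?B. \<integral>\<^sup>+C2. f2 (C1 m1', C1 m1, C2 m2', C2 m2) \<partial>?P2) \<partial>?P1)"
  proof (rule nn_integral_cong)
    fix C1 assume C1: "C1 \<in> space ?P1"
    have s0: "(\<lambda>C2. f0 (C1 m1, C2 m2)) \<in> borel_measurable ?P2"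
      by (rule slice[OF b0 C1])
    have s1: "(\<lambda>C2. f1 (C1 m1', C1 m1, C2 m2)) \<in> borel_measurable ?P2" if "m1' \<in> ?A" for m1'
      using that by (intro slice[OF b1 C1]) auto
    have s2: "(\<lambda>C2. f2 (C1 m1', C1 m1, C2 m2', C2 m2)) \<in> borel_measurable ?P2" if "m1' \<in> ?A" "m2' \<in> ?B" for m1' m2'
      using that by (intro slice[OF b2 C1]) auto
    show "(\<integral>\<^sup>+C2. b C1 C2 \<partial>?P2) = (\<integral>\<^sup>+C2. f0 (C1 m1, C2 m2) \<partial>?P2) + (\<Sum>m1'\<in>?A. \<integral>\<^sup>+C2. f1 (C1 m1', C1 m1, C2 m2) \<partial>?P2)
        + (\<Sum>m1'\<in>?A. \<Sum>m2'\<in>?B. \<integral>\<^sup>+C2. f2 (C1 m1', C1 m1, C2 m2', C2 m2) \<partial>?P2)"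
      unfolding b by (rule nn_integral_union_bound[OF s0 s1 s2])
  qed
  also have "\<dots> = (\<integral>\<^sup>+C1. \<integral>\<^sup>+C2. f0 (C1 m1, C2 m2) \<partial>?P2 \<partial>?P1)
      + (\<Sum>m1'\<in>?A. \<integral>\<^sup>+C1. \<integral>\<^sup>+C2. f1 (C1 m1', C1 m1, C2 m2) \<partial>?P2 \<partial>?P1)
      + (\<Sum>m1'\<in>?A. \<Sum>m2'\<in>?B. \<integral>\<^sup>+C1. \<integral>\<^sup>+C2. f2 (C1 m1', C1 m1, C2 m2', C2 m2) \<partial>?P2 \<partial>?P1)"
  proof -
    have s0: "(\<lambda>C1. \<integral>\<^sup>+C2. f0 (C1 m1, C2 m2) \<partial>?P2) \<in> borel_measurable ?P1"
      by (rule inner[OF b0])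
    have s1: "(\<lambda>C1. \<integral>\<^sup>+C2. f1 (C1 m1', C1 m1, C2 m2) \<partial>?P2) \<in> borel_measurable ?P1" if "m1' \<in> ?A" for m1'
      using that by (intro inner[OF b1]) auto
    have s2: "(\<lambda>C1. \<integral>\<^sup>+C2. f2 (C1 m1', C1 m1, C2 m2', C2 m2) \<partial>?P2) \<in> borel_measurable ?P1" if "m1' \<in> ?A" "m2' \<in> ?B" for m1' m2'
      using that by (intro inner[OF b2]) auto
    show ?thesis by (rule nn_integral_union_bound[OF s0 s1 s2])
  qed
  also have "\<dots> \<le> q0 + (\<Sum>m1'\<in>?A. q1) + (\<Sum>m1'\<in>?A. \<Sum>m2'\<in>?B. q2)"
    using I0 I1 I2 by (intro add_mono sum_mono) auto
  also have "\<dots> = q0 + ennreal (real (M1 - 1)) * q1 + ennreal (real (M1 - 1) * real (M2 - 1)) * q2"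
  proof -
    \<comment> \<open>Exactly \<open>M - 1\<close> wrong messages: with a single message, as at rate
      0, these terms vanish.\<close>
    have c: "card ?A = M1 - 1" "card ?B = M2 - 1" using m1 m2 by simp_all
    have "(\<Sum>m1'\<in>?A. q1) = ennreal (real (M1 - 1)) * q1"
      by (simp only: sum_constant c ennreal_of_nat_eq_real_of_nat)
    moreover have "(\<Sum>m1'\<in>?A. \<Sum>m2'\<in>?B. q2) = ennreal (real (M1 - 1) * real (M2 - 1)) * q2"
      by (simp only: sum_constant c ennreal_of_nat_eq_real_of_nat ennreal_mult of_nat_0_le_iff mult.assoc)
    ultimately show ?thesis by simp
  qed
  finally show "(\<integral>\<^sup>+C1. \<integral>\<^sup>+C2. b C1 C2 \<partial>?P2 \<partial>?P1) \<le> q0 + ennreal (real (M1 - 1)) * q1 + ennreal (real (M1 - 1) * real (M2 - 1)) * q2" .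
qed

definition received :: "nat \<Rightarrow> real^'t^'n \<Rightarrow> real^'u^'n \<Rightarrow> (nat \<Rightarrow> real^'t) \<Rightarrow> (nat \<Rightarrow> real^'u) \<Rightarrow> (nat \<Rightarrow> real^'n) \<Rightarrow> nat \<Rightarrow> real^'n" where
  "received n X1 X2 x1 x2 z = (\<lambda>j\<in>{..<n}. X1 *v x1 j + X2 *v x2 j + z j)"

text \<open>Only the majorant \<open>b\<close> is required to be measurable in the codebooks, so
  that the error of the chosen decoders need not be. The first user is the one decoded; receiver 2
  is described by exchanging the users.\<close>

definition good_receiver :: "nat \<Rightarrow> nat \<Rightarrow> nat \<Rightarrow> real^'t^'n \<Rightarrow> real^'u^'n \<Rightarrow> real \<Rightarrow> bool" where
  "good_receiver n M1 M2 X1 X2 \<eta> \<longleftrightarrow> (\<exists>d b.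
     (\<forall>C1 C2. decoder n (d C1 C2 :: (nat \<Rightarrow> real^'n) \<Rightarrow> nat))
     \<and> case_prod b \<in> borel_measurable (Pi\<^sub>M {..<M1} (\<lambda>_. gauss_seq n :: (nat \<Rightarrow> real^'t) measure) \<Otimes>\<^sub>M Pi\<^sub>M {..<M2} (\<lambda>_. gauss_seq n :: (nat \<Rightarrow> real^'u) measure))
     \<and> (\<forall>C1\<in>space (Pi\<^sub>M {..<M1} (\<lambda>_. gauss_seq n)). \<forall>C2\<in>space (Pi\<^sub>M {..<M2} (\<lambda>_. gauss_seq n)).
          ennreal (avg_err n M1 M2 (d C1 C2) (\<lambda>k j. X1 *v C1 (fst k) j + X2 *v C2 (snd k) j) fst) \<le> b C1 C2)
     \<and> (\<integral>\<^sup>+C1. \<integral>\<^sup>+C2. b C1 C2 \<partial>Pi\<^sub>M {..<M2} (\<lambda>_. gauss_seq n) \<partial>Pi\<^sub>M {..<M1} (\<lambda>_. gauss_seq n)) \<le> ennreal \<eta>)"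

text \<open>A first message is accepted if it passes together with some second message, right or
  wrong. An error is therefore a miss of the sent pair or a pass of a pair with a wrong first
  message; \<open>cover\<close> assigns the latter to \<open>fa1\<close> if its second message is
  right, and to \<open>fa1\<close> or \<open>fa2\<close> otherwise.\<close>

lemma receiver_from_test:
  fixes X1 :: "real^'t^'n" and X2 :: "real^'u^'n"
  assumes M: "0 < M1" "0 < M2"
    and tst: "\<And>x1 x2. Measurable.pred (Pi\<^sub>M {..<n} (\<lambda>_. borel)) (tst x1 x2)"
    and miss: "(\<lambda>(x1, x2, z). of_bool (\<not> tst x1 x2 (received n X1 X2 x1 x2 z)) :: ennreal)
        \<in> borel_measurable (gauss_seq n \<Otimes>\<^sub>M gauss_seq n \<Otimes>\<^sub>M gauss_seq n)"
    and fa1: "fa1 \<in> borel_measurable (gauss_seq n \<Otimes>\<^sub>M gauss_seq n \<Otimes>\<^sub>M gauss_seq n \<Otimes>\<^sub>M gauss_seq n)"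
    and fa2: "fa2 \<in> borel_measurable (gauss_seq n \<Otimes>\<^sub>M gauss_seq n \<Otimes>\<^sub>M gauss_seq n \<Otimes>\<^sub>M gauss_seq n \<Otimes>\<^sub>M gauss_seq n)"
    and cover: "\<And>x1' x1 x2 z. tst x1' x2 (received n X1 X2 x1 x2 z) \<Longrightarrow> 1 \<le> fa1 (x1', x1, x2, z)"
      "\<And>x1' x1 x2' x2 z. tst x1' x2' (received n X1 X2 x1 x2 z) \<Longrightarrow> 1 \<le> fa1 (x1', x1, x2, z) \<or> 1 \<le> fa2 (x1', x1, x2', x2, z)"
    and q0: "(\<integral>\<^sup>+x1. \<integral>\<^sup>+x2. \<integral>\<^sup>+z. of_bool (\<not> tst x1 x2 (received n X1 X2 x1 x2 z)) \<partial>gauss_seq n \<partial>gauss_seq n \<partial>gauss_seq n) \<le> ennreal q0"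
    and q1: "(\<integral>\<^sup>+x1'. \<integral>\<^sup>+x1. \<integral>\<^sup>+x2. \<integral>\<^sup>+z. fa1 (x1', x1, x2, z) \<partial>gauss_seq n \<partial>gauss_seq n \<partial>gauss_seq n \<partial>gauss_seq n) \<le> ennreal q1"
    and q2: "(\<integral>\<^sup>+x1'. \<integral>\<^sup>+x1. \<integral>\<^sup>+x2'. \<integral>\<^sup>+x2. \<integral>\<^sup>+z. fa2 (x1', x1, x2', x2, z) \<partial>gauss_seq n \<partial>gauss_seq n \<partial>gauss_seq n \<partial>gauss_seq n \<partial>gauss_seq n) \<le> ennreal q2"
    and nn: "0 \<le> q0" "0 \<le> q1" "0 \<le> q2"
  shows "good_receiver n M1 M2 X1 X2 (q0 + real (M1 - 1) * q1 + real (M1 - 1) * real (M2 - 1) * q2)"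
proof -
  let ?g1 = "gauss_seq n :: (nat \<Rightarrow> real^'t) measure" and ?g2 = "gauss_seq n :: (nat \<Rightarrow> real^'u) measure"
  let ?g = "gauss_seq n :: (nat \<Rightarrow> real^'n) measure"
  let ?P1 = "Pi\<^sub>M {..<M1} (\<lambda>_. ?g1)" and ?P2 = "Pi\<^sub>M {..<M2} (\<lambda>_. ?g2)" and ?K = "{..<M1} \<times> {..<M2}"
  let ?\<eta> = "q0 + real (M1 - 1) * q1 + real (M1 - 1) * real (M2 - 1) * q2"
  interpret P1: prob_space ?P1 by (intro prob_space_PiM gauss_seq.prob_space_axioms)
  interpret P2: prob_space ?P2 by (intro prob_space_PiM gauss_seq.prob_space_axioms)
  define ms where "ms = (\<lambda>(x1, x2, z). of_bool (\<not> tst x1 x2 (received n X1 X2 x1 x2 z)) :: ennreal)"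
  define T where "T C1 C2 m y \<longleftrightarrow> (\<exists>m2\<in>{..<M2}. tst (C1 m) (C2 m2) y)" for C1 C2 and m :: nat and y
  define d where "d C1 C2 = least_dec M1 (T C1 C2)" for C1 C2
  define bk where "bk k C1 C2 = (\<integral>\<^sup>+z. ms (C1 (fst k), C2 (snd k), z) \<partial>?g)
      + (\<Sum>m1'\<in>{..<M1} - {fst k}. \<integral>\<^sup>+z. fa1 (C1 m1', C1 (fst k), C2 (snd k), z) \<partial>?g)
      + (\<Sum>m1'\<in>{..<M1} - {fst k}. \<Sum>m2'\<in>{..<M2} - {snd k}. \<integral>\<^sup>+z. fa2 (C1 m1', C1 (fst k), C2 m2', C2 (snd k), z) \<partial>?g)"
    for k :: "nat \<times> nat" and C1 C2
  define w where "w = ennreal (1 / (real M1 * real M2))"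
  define b where "b C1 C2 = (\<Sum>k\<in>?K. bk k C1 C2) * w" for C1 C2
  have msm: "ms \<in> borel_measurable (?g1 \<Otimes>\<^sub>M ?g2 \<Otimes>\<^sub>M ?g)" unfolding ms_def by (rule miss)
  have rc: "case_prod (bk k) \<in> borel_measurable (?P1 \<Otimes>\<^sub>M ?P2)"
     "(\<integral>\<^sup>+C1. \<integral>\<^sup>+C2. bk k C1 C2 \<partial>?P2 \<partial>?P1) \<le> ennreal ?\<eta>" if k: "k \<in> ?K" for k
  proof -
    have k': "fst k < M1" "snd k < M2" using k by auto
    have q0': "(\<integral>\<^sup>+x1. \<integral>\<^sup>+x2. \<integral>\<^sup>+z. ms (x1, x2, z) \<partial>?g \<partial>?g2 \<partial>?g1) \<le> ennreal q0"
      using q0 by (simp add: ms_def)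
    note r = random_codebooks[OF gauss_seq.prob_space_axioms gauss_seq.prob_space_axioms gauss_seq.prob_space_axioms k' msm fa1 fa2 q0' q1 q2]
    show "case_prod (bk k) \<in> borel_measurable (?P1 \<Otimes>\<^sub>M ?P2)"
      using r(1) unfolding bk_def[abs_def] .
    have "ennreal ?\<eta> = ennreal q0 + ennreal (real (M1 - 1)) * ennreal q1 + ennreal (real (M1 - 1) * real (M2 - 1)) * ennreal q2"
      using nn by (simp add: ennreal_mult ennreal_plus mult.assoc)
    then show "(\<integral>\<^sup>+C1. \<integral>\<^sup>+C2. bk k C1 C2 \<partial>?P2 \<partial>?P1) \<le> ennreal ?\<eta>"
      using r(2) unfolding bk_def[abs_def] by simp
  qed
  have T: "Measurable.pred (Pi\<^sub>M {..<n} (\<lambda>_. borel)) (T C1 C2 m)" for C1 C2 m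
    unfolding T_def[abs_def] by (intro pred_intros_finite tst) auto
  have dec: "decoder n (d C1 C2)" for C1 C2
    unfolding d_def by (rule measurable_least_dec) (rule T)
  have err: "ennreal (err_given n (d C1 C2) (\<lambda>j. X1 *v C1 (fst k) j + X2 *v C2 (snd k) j) (fst k)) \<le> bk k C1 C2"
    if k: "k \<in> ?K" and C1: "C1 \<in> space ?P1" and C2: "C2 \<in> space ?P2" for k C1 C2
  proof -
    have s1: "C1 m \<in> space ?g1" if "m < M1" for m using C1 that by (auto simp: space_PiM PiE_iff)
    have s2: "C2 m \<in> space ?g2" if "m < M2" for m using C2 that by (auto simp: space_PiM PiE_iff)
    have k': "fst k < M1" "snd k < M2" using k by auto
    let ?E = "{z \<in> space ?g. d C1 C2 (\<lambda>j\<in>{..<n}. X1 *v C1 (fst k) j + X2 *v C2 (snd k) j + z j) \<noteq> fst k}"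
    have "ennreal (err_given n (d C1 C2) (\<lambda>j. X1 *v C1 (fst k) j + X2 *v C2 (snd k) j) (fst k)) = emeasure ?g ?E"
      unfolding err_given_def by (simp add: gauss_seq.emeasure_eq_measure)
    also have "\<dots> = (\<integral>\<^sup>+z. indicator ?E z \<partial>?g)"
    proof (cases "?E \<in> sets ?g")
      case False
      have "space ?g - {z \<in> space ?g. d C1 C2 (\<lambda>j\<in>{..<n}. X1 *v C1 (fst k) j + X2 *v C2 (snd k) j + z j) = fst k} \<in> sets ?g"
        by (intro sets.Diff sets.top measurable_decoder_shift[OF dec] borel_measurable_add borel_measurable_const measurable_gauss_seq_component)
      also have "space ?g - {z \<in> space ?g. d C1 C2 (\<lambda>j\<in>{..<n}. X1 *v C1 (fst k) j + X2 *v C2 (snd k) j + z j) = fst k} = ?E" by auto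
      finally show ?thesis using False by simp
    qed simp
    also have "\<dots> \<le> (\<integral>\<^sup>+z. ms (C1 (fst k), C2 (snd k), z)
      + (\<Sum>m1'\<in>{..<M1} - {fst k}. fa1 (C1 m1', C1 (fst k), C2 (snd k), z))
      + (\<Sum>m1'\<in>{..<M1} - {fst k}. \<Sum>m2'\<in>{..<M2} - {snd k}. fa2 (C1 m1', C1 (fst k), C2 m2', C2 (snd k), z)) \<partial>?g)"
    proof (rule nn_integral_mono)
      fix z
      let ?y = "received n X1 X2 (C1 (fst k)) (C2 (snd k)) z"
      let ?S1 = "\<Sum>m1'\<in>{..<M1} - {fst k}. fa1 (C1 m1', C1 (fst k), C2 (snd k), z)"
      let ?S2 = "\<Sum>m1'\<in>{..<M1} - {fst k}. \<Sum>m2'\<in>{..<M2} - {snd k}. fa2 (C1 m1', C1 (fst k), C2 m2', C2 (snd k), z)"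
      have "1 \<le> ms (C1 (fst k), C2 (snd k), z) + ?S1 + ?S2" if "z \<in> ?E"
      proof -
        have "least_dec M1 (T C1 C2) ?y \<noteq> fst k"
          using that by (simp add: d_def received_def)
        from least_dec_error[OF k'(1) this] consider "\<not> T C1 C2 (fst k) ?y"
          | m1' m2' where "m1' \<in> {..<M1} - {fst k}" "m2' < M2" "tst (C1 m1') (C2 m2') ?y"
          unfolding T_def by auto
        then show ?thesis
        proof cases
          case 1
          then have "ms (C1 (fst k), C2 (snd k), z) = 1"
            using k' by (auto simp: T_def ms_def)
          then show ?thesis by (simp add: add.assoc)
        next
          case 2
          have S1: "fa1 (C1 m1', C1 (fst k), C2 (snd k), z) \<le> ?S1"
            using 2(1) by (intro member_le_sum) auto
          show ?thesis
          proof (cases "1 \<le> fa1 (C1 m1', C1 (fst k), C2 (snd k), z)")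
            case True
            then have "1 \<le> ?S1" using S1 by (rule order_trans)
            then show ?thesis by (rule add_increasing2[OF zero_le add_increasing[OF zero_le]])
          next
            case False
            \<comment> \<open>When \<open>fa1\<close> does not cover the event, the accepted second
              message is a wrong one, and \<open>fa2\<close> covers it.\<close>
            then have ne: "m2' \<noteq> snd k" using cover(1)[of "C1 m1'" "C2 (snd k)" "C1 (fst k)" z] 2(3) by auto
            have "1 \<le> fa2 (C1 m1', C1 (fst k), C2 m2', C2 (snd k), z)"
              using cover(2)[OF 2(3)] False by simp
            also have "\<dots> \<le> (\<Sum>m2'\<in>{..<M2} - {snd k}. fa2 (C1 m1', C1 (fst k), C2 m2', C2 (snd k), z))"
              using 2(2) ne by (intro member_le_sum) auto
            also have "\<dots> \<le> ?S2"
              using 2(1) by (intro member_le_sum) auto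
            finally show ?thesis by (rule add_increasing[OF zero_le])
          qed
        qed
      qed
      then show "indicator ?E z \<le> ms (C1 (fst k), C2 (snd k), z) + ?S1 + ?S2"
      proof (cases "z \<in> ?E")
        case False
        then have "indicator ?E z = (0 :: ennreal)" by (rule indicator_simps(2))
        then show ?thesis by (simp only: zero_le)
      qed (simp only: indicator_simps(1))
    qed
    also have "\<dots> = bk k C1 C2"
      unfolding bk_def
    proof (rule nn_integral_union_bound)
      show "(\<lambda>z. ms (C1 (fst k), C2 (snd k), z)) \<in> borel_measurable ?g"
        using s1[OF k'(1)] s2[OF k'(2)] by (intro measurable_compose[OF _ msm]) measurable
      show "(\<lambda>z. fa1 (C1 m1', C1 (fst k), C2 (snd k), z)) \<in> borel_measurable ?g" if "m1' \<in> {..<M1} - {fst k}" for m1'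
        using s1[OF k'(1)] s2[OF k'(2)] s1[of m1'] that by (intro measurable_compose[OF _ fa1]) (auto intro!: measurable_Pair)
      show "(\<lambda>z. fa2 (C1 m1', C1 (fst k), C2 m2', C2 (snd k), z)) \<in> borel_measurable ?g"
        if "m1' \<in> {..<M1} - {fst k}" "m2' \<in> {..<M2} - {snd k}" for m1' m2'
        using s1[OF k'(1)] s2[OF k'(2)] s1[of m1'] s2[of m2'] that by (intro measurable_compose[OF _ fa2]) (auto intro!: measurable_Pair)
    qed
    finally show ?thesis .
  qed
  have avg: "ennreal (avg_err n M1 M2 (d C1 C2) (\<lambda>k j. X1 *v C1 (fst k) j + X2 *v C2 (snd k) j) fst) \<le> b C1 C2"
    if "C1 \<in> space ?P1" "C2 \<in> space ?P2" for C1 C2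
  proof -
    let ?e = "\<lambda>k. err_given n (d C1 C2) (\<lambda>j. X1 *v C1 (fst k) j + X2 *v C2 (snd k) j) (fst k)"
    have "ennreal (avg_err n M1 M2 (d C1 C2) (\<lambda>k j. X1 *v C1 (fst k) j + X2 *v C2 (snd k) j) fst)
       = ennreal ((\<Sum>k\<in>?K. ?e k) * (1 / (real M1 * real M2)))"
      by (simp add: avg_err_def)
    also have "\<dots> = (\<Sum>k\<in>?K. ennreal (?e k)) * w"
      unfolding w_def by (subst ennreal_mult) (auto intro: sum_nonneg err_given_bounds simp: sum_ennreal err_given_bounds)
    also have "\<dots> \<le> b C1 C2"
      unfolding b_def using that by (intro mult_right_mono sum_mono err) auto
    finally show ?thesis .
  qed
  have bm: "case_prod b \<in> borel_measurable (?P1 \<Otimes>\<^sub>M ?P2)"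
    unfolding b_def[abs_def] case_prod_unfold
    by (intro borel_measurable_times_ennreal borel_measurable_sum borel_measurable_const rc(1)[unfolded case_prod_unfold])
  have "(\<integral>\<^sup>+C1. \<integral>\<^sup>+C2. b C1 C2 \<partial>?P2 \<partial>?P1) = (\<integral>\<^sup>+p. case_prod b p \<partial>(?P1 \<Otimes>\<^sub>M ?P2))"
    using P2.nn_integral_fst[OF bm] by simp
  also have "\<dots> = (\<Sum>k\<in>?K. \<integral>\<^sup>+p. case_prod (bk k) p \<partial>(?P1 \<Otimes>\<^sub>M ?P2)) * w"
    unfolding b_def[abs_def] case_prod_unfold using rc(1)[unfolded case_prod_unfold]
    by (subst nn_integral_multc, intro borel_measurable_sum, simp) (subst nn_integral_sum, auto)
  also have "\<dots> = (\<Sum>k\<in>?K. \<integral>\<^sup>+C1. \<integral>\<^sup>+C2. bk k C1 C2 \<partial>?P2 \<partial>?P1) * w"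
    using P2.nn_integral_fst[OF rc(1)] by (intro arg_cong2[where f="(*)"] sum.cong refl) simp
  also have "\<dots> \<le> (\<Sum>k\<in>?K. ennreal ?\<eta>) * w"
    by (intro mult_right_mono sum_mono rc(2)) auto
  also have "\<dots> = ennreal ?\<eta>"
  proof -
    have "(\<Sum>k\<in>?K. ennreal ?\<eta>) * w = ennreal (real (card ?K)) * ennreal ?\<eta> * w"
      by (simp only: sum_constant ennreal_of_nat_eq_real_of_nat)
    also have "\<dots> = ennreal (real (card ?K) * ?\<eta> * (1 / (real M1 * real M2)))"
      unfolding w_def using nn by (subst ennreal_mult, auto)+
    also have "real (card ?K) * ?\<eta> * (1 / (real M1 * real M2)) = ?\<eta>"
      using M by (simp add: card_cartesian_product)
    finally show ?thesis .
  qed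
  finally have "(\<integral>\<^sup>+C1. \<integral>\<^sup>+C2. b C1 C2 \<partial>?P2 \<partial>?P1) \<le> ennreal ?\<eta>" .
  then show ?thesis
    unfolding good_receiver_def using dec bm avg by blast
qed

section \<open>Laws of the received sequence\<close>

lemma passes_cong:
  "(\<And>j. j < n \<Longrightarrow> v j = v' j) \<Longrightarrow> (\<And>j. j < n \<Longrightarrow> r j = r' j) \<Longrightarrow> passes Bn B g n v r = passes Bn B g n v' r'"
  by (simp add: passes_def)

lemma measurable_gauss_seq_apply:
  assumes "f \<in> M \<rightarrow>\<^sub>M gauss_seq n" "j < n"
  shows "(\<lambda>p. f p j) \<in> borel_measurable M" "(\<lambda>p. X *v f p j) \<in> borel_measurable M"
proof -
  show 1: "(\<lambda>p. f p j) \<in> borel_measurable M"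
    using measurable_compose[OF assms(1) measurable_gauss_seq_component[OF assms(2)]] .
  show "(\<lambda>p. X *v f p j) \<in> borel_measurable M"
    using measurable_compose[OF 1 borel_measurable_matrix_vector] .
qed

lemma measurable_received_component:
  assumes "f1 \<in> M \<rightarrow>\<^sub>M gauss_seq n" "f2 \<in> M \<rightarrow>\<^sub>M gauss_seq n" "f3 \<in> M \<rightarrow>\<^sub>M gauss_seq n" "j < n"
  shows "(\<lambda>p. received n X1 X2 (f1 p) (f2 p) (f3 p) j) \<in> borel_measurable M"
  using assms by (simp add: received_def borel_measurable_add measurable_gauss_seq_apply)

lemma measurable_seq_component: "j < n \<Longrightarrow> (\<lambda>y. y j) \<in> borel_measurable (Pi\<^sub>M {..<n} (\<lambda>_. borel))"
  using measurable_component_singleton[of j "{..<n}" "\<lambda>_. borel"] by simp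

lemma nn_integral_triple:
  assumes "prob_space M1" "prob_space M2" "prob_space M3" and F: "F \<in> borel_measurable (M1 \<Otimes>\<^sub>M M2 \<Otimes>\<^sub>M M3)"
  shows "(\<integral>\<^sup>+x. \<integral>\<^sup>+y. \<integral>\<^sup>+z. F (x, y, z) \<partial>M3 \<partial>M2 \<partial>M1) = (\<integral>\<^sup>+p. F p \<partial>(M1 \<Otimes>\<^sub>M M2 \<Otimes>\<^sub>M M3))"
proof -
  interpret M2: prob_space M2 by fact
  interpret M3: prob_space M3 by fact
  interpret P: pair_prob_space M2 M3 ..
  have "(\<integral>\<^sup>+p. F p \<partial>(M1 \<Otimes>\<^sub>M M2 \<Otimes>\<^sub>M M3)) = (\<integral>\<^sup>+x. \<integral>\<^sup>+q. F (x, q) \<partial>(M2 \<Otimes>\<^sub>M M3) \<partial>M1)"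
    by (rule P.nn_integral_fst[OF F, symmetric])
  also have "\<dots> = (\<integral>\<^sup>+x. \<integral>\<^sup>+y. \<integral>\<^sup>+z. F (x, y, z) \<partial>M3 \<partial>M2 \<partial>M1)"
  proof (rule nn_integral_cong)
    fix x assume "x \<in> space M1"
    then have "(\<lambda>q. F (x, q)) \<in> borel_measurable (M2 \<Otimes>\<^sub>M M3)"
      using measurable_compose[OF measurable_Pair1' F] by blast
    from M3.nn_integral_fst[OF this]
    show "(\<integral>\<^sup>+q. F (x, q) \<partial>(M2 \<Otimes>\<^sub>M M3)) = (\<integral>\<^sup>+y. \<integral>\<^sup>+z. F (x, y, z) \<partial>M3 \<partial>M2)" ..
  qed
  finally show ?thesis ..
qed

text \<open>The law of a sum is applied twice: interference and noise merge into one Gaussian noise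
  with square root \<open>K\<close>, and the signal is then added to it.\<close>

lemma nn_integral_received:
  fixes X1 :: "real^'t^'n" and X2 :: "real^'u^'n" and B :: "real^'n^'n"
  assumes BB: "B ** transpose B = X1 ** transpose X1 + (X2 ** transpose X2 + mat 1)"
    and h: "h \<in> borel_measurable (Pi\<^sub>M {..<n} (\<lambda>_. borel))"
  shows "(\<integral>\<^sup>+x1. \<integral>\<^sup>+x2. \<integral>\<^sup>+z. h (received n X1 X2 x1 x2 z) \<partial>gauss_seq n \<partial>gauss_seq n \<partial>gauss_seq n)
    = (\<integral>\<^sup>+k. h (\<lambda>j\<in>{..<n}. B *v k j) \<partial>gauss_seq n)"
proof -
  have "pos_def (X2 ** transpose X2 + mat 1)"
    unfolding add.commute[of _ "mat 1"] by (intro pos_def_mat_1_add pos_semidef_mult_transpose)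
  then obtain K :: "real^'n^'n" where K: "X2 ** transpose X2 + mat 1 = K ** transpose K" "invertible K" by (rule pos_def_factor)
  have "(\<integral>\<^sup>+x2. \<integral>\<^sup>+z. h (received n X1 X2 x1 x2 z) \<partial>gauss_seq n \<partial>gauss_seq n)
    = (\<integral>\<^sup>+k. h (\<lambda>j\<in>{..<n}. X1 *v x1 j + K *v k j) \<partial>gauss_seq n)" for x1
  proof -
    define h' where "h' r = h (\<lambda>j\<in>{..<n}. X1 *v x1 j + r j)" for r
    have "(\<lambda>r. \<lambda>j\<in>{..<n}. X1 *v x1 j + r j) \<in> Pi\<^sub>M {..<n} (\<lambda>_. borel) \<rightarrow>\<^sub>M Pi\<^sub>M {..<n} (\<lambda>_. borel)"
      by (intro measurable_restrict borel_measurable_add borel_measurable_const measurable_seq_component) auto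
    then have h': "h' \<in> borel_measurable (Pi\<^sub>M {..<n} (\<lambda>_. borel))"
      unfolding h'_def using h by (rule measurable_compose)
    have 1: "h (received n X1 X2 x1 x2 z) = h' (\<lambda>j\<in>{..<n}. X2 *v x2 j + mat 1 *v z j)" for x2 z
      unfolding h'_def received_def by (intro arg_cong[where f=h]) (auto simp: restrict_def add.assoc)
    have 2: "h (\<lambda>j\<in>{..<n}. X1 *v x1 j + K *v k j) = h' (\<lambda>j\<in>{..<n}. K *v k j)" for k
      unfolding h'_def by (intro arg_cong[where f=h]) (auto simp: restrict_def)
    show ?thesis unfolding 1 2
      using K(1) by (intro nn_integral_gauss_seq_sum h') (auto simp: invertible_det_nz)
  qed
  then have "(\<integral>\<^sup>+x1. \<integral>\<^sup>+x2. \<integral>\<^sup>+z. h (received n X1 X2 x1 x2 z) \<partial>gauss_seq n \<partial>gauss_seq n \<partial>gauss_seq n)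
     = (\<integral>\<^sup>+x1. \<integral>\<^sup>+k. h (\<lambda>j\<in>{..<n}. X1 *v x1 j + K *v k j) \<partial>gauss_seq n \<partial>gauss_seq n)" by simp
  also have "\<dots> = (\<integral>\<^sup>+k. h (\<lambda>j\<in>{..<n}. B *v k j) \<partial>gauss_seq n)"
    using BB K by (intro nn_integral_gauss_seq_sum h) auto
  finally show ?thesis .
qed

lemma measurable_seq_pred_passes:
  "Measurable.pred (Pi\<^sub>M {..<n} (\<lambda>_. borel)) (\<lambda>y. passes Bn B g n v y)"
  by (intro pred_passes borel_measurable_const measurable_seq_component)

text \<open>A wrong codeword is independent of what is received, so it may be held fixed as
  \<open>v\<close>.\<close>

lemma received_false_alarm:
  fixes X1 :: "real^'t^'n" and X2 :: "real^'u^'n" and B Bn :: "real^'n^'n"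
  assumes BB: "B ** transpose B = X1 ** transpose X1 + (X2 ** transpose X2 + mat 1)"
    and B: "invertible B" and Bn: "invertible Bn"
  shows "(\<integral>\<^sup>+x1. \<integral>\<^sup>+x2. \<integral>\<^sup>+z. of_bool (passes Bn B g n v (received n X1 X2 x1 x2 z)) \<partial>gauss_seq n \<partial>gauss_seq n \<partial>gauss_seq n)
    \<le> ennreal (exp (- real n * g))"
proof -
  note [measurable] = measurable_seq_pred_passes
  have h: "(\<lambda>y. of_bool (passes Bn B g n v y)::ennreal) \<in> borel_measurable (Pi\<^sub>M {..<n} (\<lambda>_. borel))" by measurable
  have "passes Bn B g n v (\<lambda>j\<in>{..<n}. B *v k j) = passes Bn B g n v (\<lambda>j. B *v k j)" for k
    by (rule passes_cong) auto
  then show ?thesis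
    using nn_integral_received[OF BB h] false_alarm[OF B Bn, where g = g and n = n and v = v] by simp
qed

lemma nn_integral_le_const:
  assumes "prob_space M" "\<And>x. f x \<le> (c::ennreal)"
  shows "(\<integral>\<^sup>+x. f x \<partial>M) \<le> c"
proof -
  interpret prob_space M by fact
  have "(\<integral>\<^sup>+x. f x \<partial>M) \<le> (\<integral>\<^sup>+x. c \<partial>M)" by (intro nn_integral_mono assms(2))
  then show ?thesis by (simp add: emeasure_space_1)
qed

lemma received_lower_tail:
  fixes X1 :: "real^'t^'n" and X2 :: "real^'u^'n" and B :: "real^'n^'n"
  assumes BB: "B ** transpose B = X1 ** transpose X1 + (X2 ** transpose X2 + mat 1)" and B: "invertible B"
  shows "(\<integral>\<^sup>+x1. \<integral>\<^sup>+x2. \<integral>\<^sup>+z. of_bool ((\<Sum>j<n. (norm (matrix_inv B *v received n X1 X2 x1 x2 z j))\<^sup>2) \<le> t) \<partial>gauss_seq n \<partial>gauss_seq n \<partial>gauss_seq n)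
    = (\<integral>\<^sup>+k. of_bool ((\<Sum>j<n. (norm (k j :: real^'n))\<^sup>2) \<le> t) \<partial>gauss_seq n)"
proof -
  have "(\<lambda>y. \<Sum>j<n. (norm (matrix_inv B *v y j))\<^sup>2) \<in> borel_measurable (Pi\<^sub>M {..<n} (\<lambda>_. borel))"
    by (intro borel_measurable_sum borel_measurable_power measurable_compose[OF _ borel_measurable_norm]
        measurable_compose[OF _ borel_measurable_matrix_vector] measurable_seq_component) auto
  note [measurable] = this
  have h: "(\<lambda>y. of_bool ((\<Sum>j<n. (norm (matrix_inv B *v y j))\<^sup>2) \<le> t) :: ennreal) \<in> borel_measurable (Pi\<^sub>M {..<n} (\<lambda>_. borel))"
    by measurable
  have "matrix_inv B *v (B *v k) = k" for k
    by (simp add: matrix_vector_mul_assoc matrix_inv_left[OF B])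
  then show ?thesis using nn_integral_received[OF BB h] by simp
qed

lemma std_gaussian_tails:
  fixes e :: real
  assumes e: "0 < e"
  obtains r where "0 \<le> r" "r < 1"
    "\<And>n. (\<integral>\<^sup>+k. of_bool (real n * (CARD('n) + e) \<le> (\<Sum>j<n. (norm (k j))\<^sup>2)) \<partial>(gauss_seq n :: (nat \<Rightarrow> real^'n) measure)) \<le> ennreal (r ^ n)"
    "\<And>n. (\<integral>\<^sup>+k. of_bool ((\<Sum>j<n. (norm (k j))\<^sup>2) \<le> real n * (CARD('n) - e)) \<partial>(gauss_seq n :: (nat \<Rightarrow> real^'n) measure)) \<le> ennreal (r ^ n)"
proof -
  obtain r1 where r1: "0 \<le> r1" "r1 < 1"
    "\<And>n. (\<integral>\<^sup>+k. indicator {k. (\<Sum>j<n. (norm (k j))\<^sup>2) \<ge> real n * (CARD('n) + e)} k \<partial>(gauss_seq n :: (nat \<Rightarrow> real^'n) measure)) \<le> ennreal (r1 ^ n)"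
    using norm_std_gaussian_upper_tail[where 'n='n, of "CARD('n) + e"] e by auto
  obtain r2 where r2: "0 \<le> r2" "r2 < 1"
    "\<And>n. (\<integral>\<^sup>+k. indicator {k. (\<Sum>j<n. (norm (k j))\<^sup>2) \<le> real n * (CARD('n) - e)} k \<partial>(gauss_seq n :: (nat \<Rightarrow> real^'n) measure)) \<le> ennreal (r2 ^ n)"
    using norm_std_gaussian_lower_tail[where 'n='n, of "CARD('n) - e"] e by auto
  have le: "ennreal (r1 ^ n) \<le> ennreal (max r1 r2 ^ n)" "ennreal (r2 ^ n) \<le> ennreal (max r1 r2 ^ n)" for n
    using r1(1) r2(1) by (intro ennreal_leI power_mono; simp)+
  show thesis
    by (rule that[of "max r1 r2"])
      (use r1 r2 order_trans[OF r1(3) le(1)] order_trans[OF r2(3) le(2)] in \<open>auto simp: indicator_def of_bool_def\<close>)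
qed

lemma pred_norm_sum_ge:
  assumes "\<And>j. j < n \<Longrightarrow> (\<lambda>p. f p j) \<in> borel_measurable M"
  shows "Measurable.pred M (\<lambda>p. t \<le> (\<Sum>j<n. (norm (f p j :: real^'n))\<^sup>2))"
    and "Measurable.pred M (\<lambda>p. (\<Sum>j<n. (norm (f p j :: real^'n))\<^sup>2) \<le> t)"
proof -
  have [measurable]: "(\<lambda>p. \<Sum>j<n. (norm (f p j))\<^sup>2) \<in> borel_measurable M"
    by (intro borel_measurable_sum borel_measurable_power measurable_compose[OF _ borel_measurable_norm] assms) auto
  show "Measurable.pred M (\<lambda>p. t \<le> (\<Sum>j<n. (norm (f p j :: real^'n))\<^sup>2))"
    "Measurable.pred M (\<lambda>p. (\<Sum>j<n. (norm (f p j :: real^'n))\<^sup>2) \<le> t)" by measurable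
qed

lemma measurable_of_bool: "Measurable.pred M P \<Longrightarrow> (\<lambda>p. of_bool (P p) :: ennreal) \<in> borel_measurable M"
  by measurable

lemma triple_proj:
  "fst \<in> M1 \<Otimes>\<^sub>M M2 \<Otimes>\<^sub>M M3 \<rightarrow>\<^sub>M M1" "(\<lambda>p. fst (snd p)) \<in> M1 \<Otimes>\<^sub>M M2 \<Otimes>\<^sub>M M3 \<rightarrow>\<^sub>M M2"
  "(\<lambda>p. snd (snd p)) \<in> M1 \<Otimes>\<^sub>M M2 \<Otimes>\<^sub>M M3 \<rightarrow>\<^sub>M M3"
  by measurable

section \<open>Error bounds for the two decoding rules\<close>

lemma treat_interference_as_noise:
  fixes X1 :: "real^'t^'n" and X2 :: "real^'u^'n" and B Bn :: "real^'n^'n"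
  assumes Bn: "invertible Bn" "Bn ** transpose Bn = X2 ** transpose X2 + mat 1"
    and B: "invertible B" "B ** transpose B = X1 ** transpose X1 + (X2 ** transpose X2 + mat 1)"
    and g: "g < ln (\<bar>det B\<bar> / \<bar>det Bn\<bar>)"
  obtains r where "0 \<le> r" "r < 1"
    "\<And>n M1 M2. 0 < M1 \<Longrightarrow> 0 < M2 \<Longrightarrow> good_receiver n M1 M2 X1 X2 (2 * r ^ n + real (M1 - 1) * exp (- real n * g))"
proof -
  \<comment> \<open>The slack between the threshold and the typical information density; it becomes
    the deviation in the tail bounds.\<close>
  define e where "e = ln (\<bar>det B\<bar> / \<bar>det Bn\<bar>) - g"
  have e: "0 < e" "g \<le> ln (\<bar>det B\<bar> / \<bar>det Bn\<bar>) - e" using g by (auto simp: e_def)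
  obtain r where r: "0 \<le> r" "r < 1"
    and up: "\<And>n. (\<integral>\<^sup>+k. of_bool (real n * (CARD('n) + e) \<le> (\<Sum>j<n. (norm (k j))\<^sup>2)) \<partial>(gauss_seq n :: (nat \<Rightarrow> real^'n) measure)) \<le> ennreal (r ^ n)"
    and lo: "\<And>n. (\<integral>\<^sup>+k. of_bool ((\<Sum>j<n. (norm (k j))\<^sup>2) \<le> real n * (CARD('n) - e)) \<partial>(gauss_seq n :: (nat \<Rightarrow> real^'n) measure)) \<le> ennreal (r ^ n)"
    using std_gaussian_tails[OF e(1), where 'n='n] by blast
  have "good_receiver n M1 M2 X1 X2 (2 * r ^ n + real (M1 - 1) * exp (- real n * g))" if M: "0 < M1" "0 < M2" for n M1 M2
  proof -
    let ?gt = "gauss_seq n :: (nat \<Rightarrow> real^'t) measure" and ?gu = "gauss_seq n :: (nat \<Rightarrow> real^'u) measure"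
    let ?g = "gauss_seq n :: (nat \<Rightarrow> real^'n) measure"
    let ?M = "?gt \<Otimes>\<^sub>M ?gu \<Otimes>\<^sub>M ?g"
    \<comment> \<open>The second codeword is ignored, so a false alarm does not depend on the second
      message: \<open>fa1\<close> covers both kinds, and \<open>fa2\<close> is 0.\<close>
    define tst where "tst x1 x2 y = passes Bn B g n (\<lambda>j. X1 *v x1 j) y" for x1 :: "nat \<Rightarrow> real^'t" and x2 :: "nat \<Rightarrow> real^'u" and y
    define fa1 where "fa1 = (\<lambda>(x1', x1, x2, z). of_bool (passes Bn B g n (\<lambda>j. X1 *v x1' j) (received n X1 X2 x1 x2 z)) :: ennreal)"
    \<comment> \<open>The two ways to miss: interference plus noise is too large, or the received
      sequence is too small. Each has probability at most \<open>r ^ n\<close>.\<close>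
    define U where "U x1 x2 z = (of_bool (real n * (CARD('n) + e) \<le> (\<Sum>j<n. (norm (matrix_inv Bn *v (X2 *v x2 j + mat 1 *v z j)))\<^sup>2)) :: ennreal)"
      for x1 :: "nat \<Rightarrow> real^'t" and x2 z
    define L where "L x1 x2 z = (of_bool ((\<Sum>j<n. (norm (matrix_inv B *v received n X1 X2 x1 x2 z j))\<^sup>2) \<le> real n * (CARD('n) - e)) :: ennreal)"
      for x1 x2 z
    have mU: "(\<lambda>p. U (fst p) (fst (snd p)) (snd (snd p))) \<in> borel_measurable ?M"
      unfolding U_def
      by (intro measurable_of_bool pred_norm_sum_ge measurable_compose[OF _ borel_measurable_matrix_vector]
          borel_measurable_add measurable_gauss_seq_apply(1)[OF triple_proj(2)] measurable_gauss_seq_apply(1)[OF triple_proj(3)])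
    have mL: "(\<lambda>p. L (fst p) (fst (snd p)) (snd (snd p))) \<in> borel_measurable ?M"
      unfolding L_def
      by (intro measurable_of_bool pred_norm_sum_ge measurable_compose[OF _ borel_measurable_matrix_vector]
          measurable_received_component triple_proj)
    have mt: "(\<lambda>(x1, x2, z). of_bool (\<not> tst x1 x2 (received n X1 X2 x1 x2 z)) :: ennreal) \<in> borel_measurable ?M"
      unfolding tst_def case_prod_unfold
      by (intro measurable_of_bool pred_intros_logic pred_passes measurable_gauss_seq_apply(2)[OF triple_proj(1)]
          measurable_received_component triple_proj)
    have q0: "(\<integral>\<^sup>+x1. \<integral>\<^sup>+x2. \<integral>\<^sup>+z. of_bool (\<not> tst x1 x2 (received n X1 X2 x1 x2 z)) \<partial>?g \<partial>?gu \<partial>?gt) \<le> ennreal (2 * r ^ n)"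
    proof -
      have le: "of_bool (\<not> tst x1 x2 (received n X1 X2 x1 x2 z)) \<le> U x1 x2 z + L x1 x2 z" for x1 x2 z
      proof (cases "tst x1 x2 (received n X1 X2 x1 x2 z)")
        case False
        have "(\<Sum>j<n. (norm (matrix_inv Bn *v (received n X1 X2 x1 x2 z j - X1 *v x1 j)))\<^sup>2)
            = (\<Sum>j<n. (norm (matrix_inv Bn *v (X2 *v x2 j + mat 1 *v z j)))\<^sup>2)"
          by (intro sum.cong) (auto simp: received_def algebra_simps)
        with not_passes_cases[OF False[unfolded tst_def] e(2)]
        have "U x1 x2 z = 1 \<or> L x1 x2 z = 1" unfolding U_def L_def by auto
        then show ?thesis by (auto simp: add_increasing2 add_increasing)
      qed simp
      have "(\<integral>\<^sup>+x1. \<integral>\<^sup>+x2. \<integral>\<^sup>+z. of_bool (\<not> tst x1 x2 (received n X1 X2 x1 x2 z)) \<partial>?g \<partial>?gu \<partial>?gt)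
        \<le> (\<integral>\<^sup>+x1. \<integral>\<^sup>+x2. \<integral>\<^sup>+z. U x1 x2 z + L x1 x2 z \<partial>?g \<partial>?gu \<partial>?gt)"
        by (intro nn_integral_mono le)
      also have "\<dots> = (\<integral>\<^sup>+p. U (fst p) (fst (snd p)) (snd (snd p)) + L (fst p) (fst (snd p)) (snd (snd p)) \<partial>?M)"
        using nn_integral_triple[OF gauss_seq.prob_space_axioms gauss_seq.prob_space_axioms gauss_seq.prob_space_axioms
            borel_measurable_add[OF mU mL]] by simp
      also have "\<dots> = (\<integral>\<^sup>+p. U (fst p) (fst (snd p)) (snd (snd p)) \<partial>?M) + (\<integral>\<^sup>+p. L (fst p) (fst (snd p)) (snd (snd p)) \<partial>?M)"
        by (rule nn_integral_add[OF mU mL])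
      also have "(\<integral>\<^sup>+p. U (fst p) (fst (snd p)) (snd (snd p)) \<partial>?M) \<le> ennreal (r ^ n)"
      proof -
        have "(\<integral>\<^sup>+p. U (fst p) (fst (snd p)) (snd (snd p)) \<partial>?M) = (\<integral>\<^sup>+x1. \<integral>\<^sup>+x2. \<integral>\<^sup>+z. U x1 x2 z \<partial>?g \<partial>?gu \<partial>?gt)"
          using nn_integral_triple[OF gauss_seq.prob_space_axioms gauss_seq.prob_space_axioms gauss_seq.prob_space_axioms mU] by simp
        also have "\<dots> \<le> ennreal (r ^ n)"
        proof (rule nn_integral_le_const[OF gauss_seq.prob_space_axioms])
          fix x1
          have "(\<integral>\<^sup>+x2. \<integral>\<^sup>+z. U x1 x2 z \<partial>?g \<partial>?gu)
             = (\<integral>\<^sup>+k. of_bool (real n * (CARD('n) + e) \<le> (\<Sum>j<n. (norm (k j))\<^sup>2)) \<partial>?g)"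
            unfolding U_def using Bn
            by (intro gauss_seq_sum_tail[where Q = "\<lambda>n s. real n * (CARD('n) + e) \<le> s"]) (auto simp: invertible_det_nz)
          then show "(\<integral>\<^sup>+x2. \<integral>\<^sup>+z. U x1 x2 z \<partial>?g \<partial>?gu) \<le> ennreal (r ^ n)" using up by simp
        qed
        finally show ?thesis .
      qed
      also have "(\<integral>\<^sup>+p. L (fst p) (fst (snd p)) (snd (snd p)) \<partial>?M) \<le> ennreal (r ^ n)"
      proof -
        have "(\<integral>\<^sup>+p. L (fst p) (fst (snd p)) (snd (snd p)) \<partial>?M) = (\<integral>\<^sup>+x1. \<integral>\<^sup>+x2. \<integral>\<^sup>+z. L x1 x2 z \<partial>?g \<partial>?gu \<partial>?gt)"
          using nn_integral_triple[OF gauss_seq.prob_space_axioms gauss_seq.prob_space_axioms gauss_seq.prob_space_axioms mL] by simp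
        also have "\<dots> = (\<integral>\<^sup>+k. of_bool ((\<Sum>j<n. (norm (k j))\<^sup>2) \<le> real n * (CARD('n) - e)) \<partial>?g)"
          unfolding L_def by (rule received_lower_tail[OF B(2,1)])
        also have "\<dots> \<le> ennreal (r ^ n)" by (rule lo)
        finally show ?thesis .
      qed
      also have "ennreal (r ^ n) + ennreal (r ^ n) = ennreal (2 * r ^ n)"
        using r by (simp flip: ennreal_plus)
      finally show ?thesis by (simp add: add_mono)
    qed
    have "good_receiver n M1 M2 X1 X2 (2 * r ^ n + real (M1 - 1) * exp (- real n * g) + real (M1 - 1) * real (M2 - 1) * 0)"
    proof (rule receiver_from_test[OF M _ mt])
      show "Measurable.pred (Pi\<^sub>M {..<n} (\<lambda>_. borel)) (tst x1 x2)" for x1 x2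
        unfolding tst_def[abs_def] by (rule measurable_seq_pred_passes)
      show "fa1 \<in> borel_measurable (?gt \<Otimes>\<^sub>M ?gt \<Otimes>\<^sub>M ?gu \<Otimes>\<^sub>M ?g)"
        unfolding fa1_def case_prod_unfold
        by (intro measurable_of_bool pred_passes measurable_gauss_seq_apply(2)[OF measurable_fst]
          measurable_received_component measurable_compose[OF measurable_snd triple_proj(1)]
          measurable_compose[OF measurable_snd triple_proj(2)] measurable_compose[OF measurable_snd triple_proj(3)])
      show "(\<integral>\<^sup>+x1'. \<integral>\<^sup>+x1. \<integral>\<^sup>+x2. \<integral>\<^sup>+z. fa1 (x1', x1, x2, z) \<partial>?g \<partial>?gu \<partial>?gt \<partial>?gt) \<le> ennreal (exp (- real n * g))"
        unfolding fa1_def prod.case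
        by (intro nn_integral_le_const gauss_seq.prob_space_axioms received_false_alarm B Bn(1))
      show "(\<lambda>_. 0) \<in> borel_measurable (?gt \<Otimes>\<^sub>M ?gt \<Otimes>\<^sub>M ?gu \<Otimes>\<^sub>M ?gu \<Otimes>\<^sub>M ?g)" by simp
    qed (use r q0 in \<open>auto simp: tst_def fa1_def\<close>)
    then show ?thesis by simp
  qed
  with r show thesis by (rule that)
qed

lemma matrix_inv_mat_1: "matrix_inv (mat 1 :: real^'n^'n) = mat 1"
  using matrix_inv_left[of "mat 1 :: real^'n^'n"] by (simp add: invertible_det_nz)

text \<open>Two thresholds for two kinds of error. If only the first message is wrong, subtracting
  the codeword of user 2 leaves a channel without interference, tested with \<open>g1\<close>; if
  both are wrong, the pair is compared with the whole output, tested with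
  \<open>g12\<close>.\<close>

lemma joint_decoding:
  fixes X1 :: "real^'t^'n" and X2 :: "real^'u^'n" and B1 B :: "real^'n^'n"
  assumes B1: "invertible B1" "B1 ** transpose B1 = X1 ** transpose X1 + mat 1"
    and B: "invertible B" "B ** transpose B = X1 ** transpose X1 + (X2 ** transpose X2 + mat 1)"
    and g1: "g1 < ln \<bar>det B1\<bar>" and g12: "g12 < ln \<bar>det B\<bar>"
  obtains r where "0 \<le> r" "r < 1"
    "\<And>n M1 M2. 0 < M1 \<Longrightarrow> 0 < M2 \<Longrightarrow> good_receiver n M1 M2 X1 X2
       (3 * r ^ n + real (M1 - 1) * exp (- real n * g1) + real (M1 - 1) * real (M2 - 1) * exp (- real n * g12))"
proof -
  let ?I = "mat 1 :: real^'n^'n"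
  have I: "invertible ?I" by (simp add: invertible_det_nz)
  define e where "e = min (ln \<bar>det B1\<bar> - g1) (ln \<bar>det B\<bar> - g12)"
  have e: "0 < e" "g1 \<le> ln (\<bar>det B1\<bar> / \<bar>det ?I\<bar>) - e" "g12 \<le> ln (\<bar>det B\<bar> / \<bar>det ?I\<bar>) - e"
    using g1 g12 by (auto simp: e_def)
  obtain r where r: "0 \<le> r" "r < 1"
    and up: "\<And>n. (\<integral>\<^sup>+k. of_bool (real n * (CARD('n) + e) \<le> (\<Sum>j<n. (norm (k j))\<^sup>2)) \<partial>(gauss_seq n :: (nat \<Rightarrow> real^'n) measure)) \<le> ennreal (r ^ n)"
    and lo: "\<And>n. (\<integral>\<^sup>+k. of_bool ((\<Sum>j<n. (norm (k j))\<^sup>2) \<le> real n * (CARD('n) - e)) \<partial>(gauss_seq n :: (nat \<Rightarrow> real^'n) measure)) \<le> ennreal (r ^ n)"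
    using std_gaussian_tails[OF e(1), where 'n='n] by blast
  have "good_receiver n M1 M2 X1 X2
       (3 * r ^ n + real (M1 - 1) * exp (- real n * g1) + real (M1 - 1) * real (M2 - 1) * exp (- real n * g12))"
    if M: "0 < M1" "0 < M2" for n M1 M2
  proof -
    let ?gt = "gauss_seq n :: (nat \<Rightarrow> real^'t) measure" and ?gu = "gauss_seq n :: (nat \<Rightarrow> real^'u) measure"
    let ?g = "gauss_seq n :: (nat \<Rightarrow> real^'n) measure"
    let ?M = "?gt \<Otimes>\<^sub>M ?gu \<Otimes>\<^sub>M ?g"
    note pa = gauss_seq.prob_space_axioms
    define tst where "tst x1 x2 y \<longleftrightarrow> passes ?I B1 g1 n (\<lambda>j. X1 *v x1 j) (\<lambda>j. y j - X2 *v x2 j)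
        \<and> passes ?I B g12 n (\<lambda>j. X1 *v x1 j + X2 *v x2 j) y" for x1 :: "nat \<Rightarrow> real^'t" and x2 :: "nat \<Rightarrow> real^'u" and y
    define fa1 where "fa1 = (\<lambda>(x1', x1, x2 :: nat \<Rightarrow> real^'u, z). of_bool (passes ?I B1 g1 n (\<lambda>j. X1 *v x1' j) (\<lambda>j. X1 *v x1 j + z j)) :: ennreal)"
    define fa2 where "fa2 = (\<lambda>(x1', x1, x2', x2, z). of_bool (passes ?I B g12 n (\<lambda>j. X1 *v x1' j + X2 *v x2' j) (received n X1 X2 x1 x2 z)) :: ennreal)"
    \<comment> \<open>The noise tail is shared by both tests while the output tails differ: three
      tail events, hence the factor 3.\<close>
    define U where "U x1 x2 z = (of_bool (real n * (CARD('n) + e) \<le> (\<Sum>j<n. (norm (z j))\<^sup>2)) :: ennreal)"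
      for x1 :: "nat \<Rightarrow> real^'t" and x2 :: "nat \<Rightarrow> real^'u" and z :: "nat \<Rightarrow> real^'n"
    define L1 where "L1 x1 x2 z = (of_bool ((\<Sum>j<n. (norm (matrix_inv B1 *v (X1 *v x1 j + ?I *v z j)))\<^sup>2) \<le> real n * (CARD('n) - e)) :: ennreal)"
      for x1 and x2 :: "nat \<Rightarrow> real^'u" and z
    define L where "L x1 x2 z = (of_bool ((\<Sum>j<n. (norm (matrix_inv B *v received n X1 X2 x1 x2 z j))\<^sup>2) \<le> real n * (CARD('n) - e)) :: ennreal)"
      for x1 x2 z
    have mU: "(\<lambda>p. U (fst p) (fst (snd p)) (snd (snd p))) \<in> borel_measurable ?M"
      unfolding U_def
      by (intro measurable_of_bool pred_norm_sum_ge measurable_gauss_seq_apply(1)[OF triple_proj(3)])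
    have mL1: "(\<lambda>p. L1 (fst p) (fst (snd p)) (snd (snd p))) \<in> borel_measurable ?M"
      unfolding L1_def
      by (intro measurable_of_bool pred_norm_sum_ge measurable_compose[OF _ borel_measurable_matrix_vector]
          borel_measurable_add measurable_gauss_seq_apply(1)[OF triple_proj(1)] measurable_gauss_seq_apply(1)[OF triple_proj(3)])
    have mL: "(\<lambda>p. L (fst p) (fst (snd p)) (snd (snd p))) \<in> borel_measurable ?M"
      unfolding L_def
      by (intro measurable_of_bool pred_norm_sum_ge measurable_compose[OF _ borel_measurable_matrix_vector]
          measurable_received_component triple_proj)
    have mt: "(\<lambda>(x1, x2, z). of_bool (\<not> tst x1 x2 (received n X1 X2 x1 x2 z)) :: ennreal) \<in> borel_measurable ?M"
      unfolding tst_def case_prod_unfold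
      by (intro measurable_of_bool pred_intros_logic pred_passes borel_measurable_diff borel_measurable_add
          measurable_gauss_seq_apply(2)[OF triple_proj(1)] measurable_gauss_seq_apply(2)[OF triple_proj(2)]
          measurable_received_component triple_proj)
    have m1: "fa1 \<in> borel_measurable (?gt \<Otimes>\<^sub>M ?gt \<Otimes>\<^sub>M ?gu \<Otimes>\<^sub>M ?g)"
      unfolding fa1_def case_prod_unfold
      by (intro measurable_of_bool pred_passes borel_measurable_add measurable_gauss_seq_apply(2)[OF measurable_fst]
        measurable_gauss_seq_apply(2)[OF measurable_compose[OF measurable_snd triple_proj(1)]]
        measurable_gauss_seq_apply(1)[OF measurable_compose[OF measurable_snd triple_proj(3)]])
    have m2 [measurable]: "fa2 \<in> borel_measurable (?gt \<Otimes>\<^sub>M ?gt \<Otimes>\<^sub>M ?gu \<Otimes>\<^sub>M ?gu \<Otimes>\<^sub>M ?g)"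
    proof -
      let ?M2 = "?gt \<Otimes>\<^sub>M ?gt \<Otimes>\<^sub>M ?gu \<Otimes>\<^sub>M ?gu \<Otimes>\<^sub>M ?g"
      have p: "(\<lambda>p. fst (snd p)) \<in> ?M2 \<rightarrow>\<^sub>M ?gt" "(\<lambda>p. fst (snd (snd p))) \<in> ?M2 \<rightarrow>\<^sub>M ?gu"
        "(\<lambda>p. fst (snd (snd (snd p)))) \<in> ?M2 \<rightarrow>\<^sub>M ?gu" "(\<lambda>p. snd (snd (snd (snd p)))) \<in> ?M2 \<rightarrow>\<^sub>M ?g"
        by measurable
      show ?thesis
        unfolding fa2_def case_prod_unfold
        by (intro measurable_of_bool pred_passes borel_measurable_add measurable_gauss_seq_apply(2)[OF measurable_fst]
          measurable_gauss_seq_apply(2)[OF p(2)] measurable_received_component p)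
    qed
    have q0: "(\<integral>\<^sup>+x1. \<integral>\<^sup>+x2. \<integral>\<^sup>+z. of_bool (\<not> tst x1 x2 (received n X1 X2 x1 x2 z)) \<partial>?g \<partial>?gu \<partial>?gt) \<le> ennreal (3 * r ^ n)"
    proof -
      have le: "of_bool (\<not> tst x1 x2 (received n X1 X2 x1 x2 z)) \<le> U x1 x2 z + L1 x1 x2 z + L x1 x2 z" for x1 x2 z
      proof (cases "tst x1 x2 (received n X1 X2 x1 x2 z)")
        case False
        let ?y = "received n X1 X2 x1 x2 z"
        have s1: "(\<Sum>j<n. (norm (matrix_inv ?I *v (?y j - X2 *v x2 j - X1 *v x1 j)))\<^sup>2) = (\<Sum>j<n. (norm (z j))\<^sup>2)"
          and s2: "(\<Sum>j<n. (norm (matrix_inv B1 *v (?y j - X2 *v x2 j)))\<^sup>2) = (\<Sum>j<n. (norm (matrix_inv B1 *v (X1 *v x1 j + ?I *v z j)))\<^sup>2)"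
          and s3: "(\<Sum>j<n. (norm (matrix_inv ?I *v (?y j - (X1 *v x1 j + X2 *v x2 j))))\<^sup>2) = (\<Sum>j<n. (norm (z j))\<^sup>2)"
          by (intro sum.cong; simp add: received_def matrix_inv_mat_1 algebra_simps)+
        from False consider "\<not> passes ?I B1 g1 n (\<lambda>j. X1 *v x1 j) (\<lambda>j. ?y j - X2 *v x2 j)"
          | "\<not> passes ?I B g12 n (\<lambda>j. X1 *v x1 j + X2 *v x2 j) ?y" unfolding tst_def by blast
        then have "U x1 x2 z = 1 \<or> L1 x1 x2 z = 1 \<or> L x1 x2 z = 1"
        proof cases
          case 1
          from not_passes_cases[OF 1 e(2)] show ?thesis unfolding s1 s2 U_def L1_def by auto
        next
          case 2
          from not_passes_cases[OF 2 e(3)] show ?thesis unfolding s3 U_def L_def by auto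
        qed
        then show ?thesis by (auto simp: add_increasing2 add_increasing)
      qed simp
      let ?U = "\<lambda>p. U (fst p) (fst (snd p)) (snd (snd p))" and ?L1 = "\<lambda>p. L1 (fst p) (fst (snd p)) (snd (snd p))"
        and ?L = "\<lambda>p. L (fst p) (fst (snd p)) (snd (snd p))"
      have "(\<integral>\<^sup>+x1. \<integral>\<^sup>+x2. \<integral>\<^sup>+z. of_bool (\<not> tst x1 x2 (received n X1 X2 x1 x2 z)) \<partial>?g \<partial>?gu \<partial>?gt)
        \<le> (\<integral>\<^sup>+x1. \<integral>\<^sup>+x2. \<integral>\<^sup>+z. U x1 x2 z + L1 x1 x2 z + L x1 x2 z \<partial>?g \<partial>?gu \<partial>?gt)"
        by (intro nn_integral_mono le)
      also have "\<dots> = (\<integral>\<^sup>+p. ?U p + ?L1 p + ?L p \<partial>?M)"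
        using nn_integral_triple[OF pa pa pa borel_measurable_add[OF borel_measurable_add[OF mU mL1] mL]] by simp
      also have "\<dots> = (\<integral>\<^sup>+p. ?U p \<partial>?M) + (\<integral>\<^sup>+p. ?L1 p \<partial>?M) + (\<integral>\<^sup>+p. ?L p \<partial>?M)"
        by (simp only: nn_integral_add[OF borel_measurable_add[OF mU mL1] mL] nn_integral_add[OF mU mL1])
      also have "(\<integral>\<^sup>+p. ?U p \<partial>?M) \<le> ennreal (r ^ n)"
      proof -
        have "(\<integral>\<^sup>+p. ?U p \<partial>?M) = (\<integral>\<^sup>+x1. \<integral>\<^sup>+x2. \<integral>\<^sup>+z. U x1 x2 z \<partial>?g \<partial>?gu \<partial>?gt)"
          using nn_integral_triple[OF pa pa pa mU] by simp
        also have "\<dots> \<le> ennreal (r ^ n)"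
          unfolding U_def by (rule nn_integral_le_const[OF pa], rule nn_integral_le_const[OF pa]) (rule up)
        finally show ?thesis .
      qed
      also have "(\<integral>\<^sup>+p. ?L1 p \<partial>?M) \<le> ennreal (r ^ n)"
      proof -
        have "(\<integral>\<^sup>+p. ?L1 p \<partial>?M) = (\<integral>\<^sup>+x1. \<integral>\<^sup>+x2. \<integral>\<^sup>+z. L1 x1 x2 z \<partial>?g \<partial>?gu \<partial>?gt)"
          using nn_integral_triple[OF pa pa pa mL1] by simp
        \<comment> \<open>\<open>L1\<close> is constant in its second argument, so
          \<open>undefined\<close> stands for any value.\<close>
        also have "\<dots> = (\<integral>\<^sup>+x1. \<integral>\<^sup>+z. L1 x1 undefined z \<partial>?g \<partial>?gt)"
          unfolding L1_def by (simp add: gauss_seq.emeasure_space_1)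
        also have "\<dots> = (\<integral>\<^sup>+k. of_bool ((\<Sum>j<n. (norm (k j))\<^sup>2) \<le> real n * (CARD('n) - e)) \<partial>?g)"
          unfolding L1_def using B1 I
          by (intro gauss_seq_sum_tail[where Q = "\<lambda>n s. s \<le> real n * (CARD('n) - e)"]) auto
        also have "\<dots> \<le> ennreal (r ^ n)" by (rule lo)
        finally show ?thesis .
      qed
      also have "(\<integral>\<^sup>+p. ?L p \<partial>?M) \<le> ennreal (r ^ n)"
      proof -
        have "(\<integral>\<^sup>+p. ?L p \<partial>?M) = (\<integral>\<^sup>+x1. \<integral>\<^sup>+x2. \<integral>\<^sup>+z. L x1 x2 z \<partial>?g \<partial>?gu \<partial>?gt)"
          using nn_integral_triple[OF pa pa pa mL] by simp
        also have "\<dots> = (\<integral>\<^sup>+k. of_bool ((\<Sum>j<n. (norm (k j))\<^sup>2) \<le> real n * (CARD('n) - e)) \<partial>?g)"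
          unfolding L_def by (rule received_lower_tail[OF B(2,1)])
        also have "\<dots> \<le> ennreal (r ^ n)" by (rule lo)
        finally show ?thesis .
      qed
      also have "ennreal (r ^ n) + ennreal (r ^ n) + ennreal (r ^ n) = ennreal (3 * r ^ n)"
        using r by (simp flip: ennreal_plus)
      finally show ?thesis by (simp add: add_mono)
    qed
    show ?thesis
    proof (rule receiver_from_test[OF M _ mt m1 m2])
      show "Measurable.pred (Pi\<^sub>M {..<n} (\<lambda>_. borel)) (tst x1 x2)" for x1 x2
        unfolding tst_def[abs_def]
        by (intro pred_intros_logic measurable_seq_pred_passes pred_passes borel_measurable_const borel_measurable_diff measurable_seq_component)
      show "(\<integral>\<^sup>+x1'. \<integral>\<^sup>+x1. \<integral>\<^sup>+x2. \<integral>\<^sup>+z. fa1 (x1', x1, x2, z) \<partial>?g \<partial>?gu \<partial>?gt \<partial>?gt) \<le> ennreal (exp (- real n * g1))"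
      proof (rule nn_integral_le_const[OF pa])
        fix x1'
        let ?h = "\<lambda>y. of_bool (passes ?I B1 g1 n (\<lambda>j. X1 *v x1' j) y) :: ennreal"
        have h: "?h \<in> borel_measurable (Pi\<^sub>M {..<n} (\<lambda>_. borel))" by (intro measurable_of_bool measurable_seq_pred_passes)
        have 1: "passes ?I B1 g1 n (\<lambda>j. X1 *v x1' j) (\<lambda>j. X1 *v x1 j + z j)
            = passes ?I B1 g1 n (\<lambda>j. X1 *v x1' j) (\<lambda>j\<in>{..<n}. X1 *v x1 j + ?I *v z j)" for x1 z
          by (rule passes_cong) auto
        have 2: "passes ?I B1 g1 n (\<lambda>j. X1 *v x1' j) (\<lambda>j\<in>{..<n}. B1 *v k j)
            = passes ?I B1 g1 n (\<lambda>j. X1 *v x1' j) (\<lambda>j. B1 *v k j)" for k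
          by (rule passes_cong) auto
        have "(\<integral>\<^sup>+x1. \<integral>\<^sup>+x2. \<integral>\<^sup>+z. fa1 (x1', x1, x2, z) \<partial>?g \<partial>?gu \<partial>?gt)
          = (\<integral>\<^sup>+x1. \<integral>\<^sup>+z. ?h (\<lambda>j\<in>{..<n}. X1 *v x1 j + ?I *v z j) \<partial>?g \<partial>?gt)"
          unfolding fa1_def prod.case 1 by (simp add: gauss_seq.emeasure_space_1)
        also have "\<dots> = (\<integral>\<^sup>+k. ?h (\<lambda>j\<in>{..<n}. B1 *v k j) \<partial>?g)"
          using B1 by (intro nn_integral_gauss_seq_sum[OF I _ h]) simp
        also have "\<dots> \<le> ennreal (exp (- real n * g1))"
          unfolding 2 by (rule false_alarm[OF B1(1) I])
        finally show "(\<integral>\<^sup>+x1. \<integral>\<^sup>+x2. \<integral>\<^sup>+z. fa1 (x1', x1, x2, z) \<partial>?g \<partial>?gu \<partial>?gt) \<le> ennreal (exp (- real n * g1))" .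
      qed
      show "(\<integral>\<^sup>+x1'. \<integral>\<^sup>+x1. \<integral>\<^sup>+x2'. \<integral>\<^sup>+x2. \<integral>\<^sup>+z. fa2 (x1', x1, x2', x2, z) \<partial>?g \<partial>?gu \<partial>?gu \<partial>?gt \<partial>?gt)
         \<le> ennreal (exp (- real n * g12))"
      proof -
        \<comment> \<open>The wrong second codeword is moved outward, so that both wrong codewords
          are fixed while the received sequence is averaged.\<close>
        have "(\<integral>\<^sup>+x1'. \<integral>\<^sup>+x1. \<integral>\<^sup>+x2'. \<integral>\<^sup>+x2. \<integral>\<^sup>+z. fa2 (x1', x1, x2', x2, z) \<partial>?g \<partial>?gu \<partial>?gu \<partial>?gt \<partial>?gt)
          = (\<integral>\<^sup>+x1'. \<integral>\<^sup>+x2'. \<integral>\<^sup>+x1. \<integral>\<^sup>+x2. \<integral>\<^sup>+z. fa2 (x1', x1, x2', x2, z) \<partial>?g \<partial>?gu \<partial>?gt \<partial>?gu \<partial>?gt)"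
        proof (rule nn_integral_cong)
          fix x1' assume [measurable]: "x1' \<in> space ?gt"
          interpret pair_sigma_finite ?gt ?gu ..
          have "(\<lambda>(x1, x2'). \<integral>\<^sup>+x2. \<integral>\<^sup>+z. fa2 (x1', x1, x2', x2, z) \<partial>?g \<partial>?gu) \<in> borel_measurable (?gt \<Otimes>\<^sub>M ?gu)"
            by measurable
          from Fubini'[OF this]
          show "(\<integral>\<^sup>+x1. \<integral>\<^sup>+x2'. \<integral>\<^sup>+x2. \<integral>\<^sup>+z. fa2 (x1', x1, x2', x2, z) \<partial>?g \<partial>?gu \<partial>?gu \<partial>?gt)
            = (\<integral>\<^sup>+x2'. \<integral>\<^sup>+x1. \<integral>\<^sup>+x2. \<integral>\<^sup>+z. fa2 (x1', x1, x2', x2, z) \<partial>?g \<partial>?gu \<partial>?gt \<partial>?gu)" by simp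
        qed
        also have "\<dots> \<le> ennreal (exp (- real n * g12))"
          unfolding fa2_def prod.case
          by (intro nn_integral_le_const pa received_false_alarm B I)
        finally show ?thesis .
      qed
      show "1 \<le> fa1 (x1', x1, x2, z)" if "tst x1' x2 (received n X1 X2 x1 x2 z)" for x1' x1 x2 z
      proof -
        have "passes ?I B1 g1 n (\<lambda>j. X1 *v x1' j) (\<lambda>j. received n X1 X2 x1 x2 z j - X2 *v x2 j)
            = passes ?I B1 g1 n (\<lambda>j. X1 *v x1' j) (\<lambda>j. X1 *v x1 j + z j)"
          by (rule passes_cong) (auto simp: received_def)
        then show ?thesis using that by (simp add: tst_def fa1_def)
      qed
    qed (use r q0 in \<open>auto simp: tst_def fa2_def\<close>)
  qed
  with r show thesis by (rule that)
qed

section \<open>Selecting codebooks that meet the power constraint\<close>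

lemma markov_power:
  assumes "prob_space P" and p: "p \<in> borel_measurable P" and nn: "\<And>x. 0 \<le> p x"
    and le: "(\<integral>\<^sup>+x. ennreal (p x) \<partial>P) \<le> ennreal ((1 - \<delta>) * c)" and c: "0 \<le> c" and \<delta>: "0 < \<delta>" "\<delta> \<le> 1"
  shows "\<delta> \<le> measure P {x \<in> space P. p x \<le> c}"
proof -
  interpret prob_space P by fact
  note [measurable] = p
  let ?B = "{x \<in> space P. \<not> p x \<le> c}"
  have B: "measure P ?B \<le> 1 - \<delta>"
  \<comment> \<open>Power limit 0 is allowed: then the mean is 0 and the power vanishes almost
    surely, whereas Markov's inequality divides by \<open>c\<close>.\<close>
  proof (cases "c = 0")
    case True
    then have "(\<integral>\<^sup>+x. ennreal (p x) \<partial>P) = 0" using le by simp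
    then have "AE x in P. ennreal (p x) = 0" by (subst (asm) nn_integral_0_iff_AE) auto
    then have "AE x in P. x \<notin> ?B"
    proof (rule eventually_mono)
      show "x \<notin> ?B" if "ennreal (p x) = 0" for x
        using that True nn[of x] by (simp add: ennreal_eq_0_iff)
    qed
    then have "measure P ?B = 0" by (subst prob_eq_0) auto
    then show ?thesis using \<delta> by simp
  next
    case False
    have "ennreal (c * measure P ?B) = (\<integral>\<^sup>+x. ennreal c * indicator ?B x \<partial>P)"
      using c by (subst nn_integral_cmult_indicator) (auto simp: emeasure_eq_measure ennreal_mult)
    also have "\<dots> \<le> (\<integral>\<^sup>+x. ennreal (p x) \<partial>P)"
      by (intro nn_integral_mono) (auto simp: indicator_def intro: ennreal_leI)
    also note le
    finally have "c * measure P ?B \<le> (1 - \<delta>) * c" using c \<delta> by (simp add: ennreal_le_iff)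
    then show ?thesis using c False by (simp add: mult.commute)
  qed
  have "measure P {x \<in> space P. p x \<le> c} = 1 - measure P ?B"
  proof -
    have "{x \<in> space P. p x \<le> c} = space P - ?B" by auto
    then show ?thesis using prob_compl[of ?B] by simp
  qed
  with B show ?thesis by simp
qed

text \<open>The product of the good sets has mass at least \<open>\<delta> * \<delta>\<close>. If
  \<open>b\<close> exceeded the bound everywhere on it, its integral would be at least
  \<open>2 * \<eta>\<close>; the factor 2 makes the contradiction strict.\<close>

lemma pick_point:
  assumes "prob_space P1" "prob_space P2" and b: "case_prod b \<in> borel_measurable (P1 \<Otimes>\<^sub>M P2)"
    and G: "G1 \<in> sets P1" "G2 \<in> sets P2" "\<delta> \<le> measure P1 G1" "\<delta> \<le> measure P2 G2"
    and le: "(\<integral>\<^sup>+x. \<integral>\<^sup>+y. b x y \<partial>P2 \<partial>P1) \<le> ennreal \<eta>" and \<eta>: "0 < \<eta>" and \<delta>: "0 < \<delta>"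
  shows "\<exists>x\<in>G1. \<exists>y\<in>G2. b x y \<le> ennreal (2 * \<eta> / \<delta>\<^sup>2)"
proof (rule ccontr)
  interpret P1: prob_space P1 by fact
  interpret P2: prob_space P2 by fact
  let ?c = "2 * \<eta> / \<delta>\<^sup>2"
  assume "\<not> ?thesis"
  then have gt: "ennreal ?c \<le> b x y" if "x \<in> G1" "y \<in> G2" for x y using that by (meson linear)
  have c: "0 \<le> ?c" using \<eta> by simp
  have "\<eta> < ?c * (\<delta> * \<delta>)" using \<eta> \<delta> by (simp add: power2_eq_square)
  also have "\<dots> \<le> ?c * (measure P1 G1 * measure P2 G2)"
    using G \<delta> c by (intro mult_left_mono mult_mono) auto
  finally have "ennreal \<eta> < ennreal (?c * (measure P1 G1 * measure P2 G2))" using \<eta> by (simp add: ennreal_less_iff)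
  also have "\<dots> = ennreal ?c * emeasure P2 G2 * emeasure P1 G1"
  proof -
    have "ennreal (?c * (measure P1 G1 * measure P2 G2)) = ennreal (?c * measure P2 G2 * measure P1 G1)"
      by (simp only: mult_ac)
    also have "\<dots> = ennreal ?c * ennreal (measure P2 G2) * ennreal (measure P1 G1)"
      using c by (simp only: ennreal_mult mult_nonneg_nonneg measure_nonneg)
    finally show ?thesis by (simp only: P1.emeasure_eq_measure P2.emeasure_eq_measure)
  qed
  also have "\<dots> = (\<integral>\<^sup>+x. (\<integral>\<^sup>+y. ennreal ?c * indicator G2 y \<partial>P2) * indicator G1 x \<partial>P1)"
    by (simp only: nn_integral_cmult_indicator[OF G(1)] nn_integral_cmult_indicator[OF G(2)])
  also have "\<dots> \<le> (\<integral>\<^sup>+x. \<integral>\<^sup>+y. b x y \<partial>P2 \<partial>P1)"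
  proof (rule nn_integral_mono)
    fix x
    show "(\<integral>\<^sup>+y. ennreal ?c * indicator G2 y \<partial>P2) * indicator G1 x \<le> (\<integral>\<^sup>+y. b x y \<partial>P2)"
    proof (cases "x \<in> G1")
      case True
      then show ?thesis using gt by (simp only: indicator_simps mult_1_right) (intro nn_integral_mono, auto simp: indicator_def)
    qed simp
  qed
  finally show False using le by simp
qed

section \<open>Achievable rates\<close>

lemma power_ok_iff:
  "power_ok n R P x \<longleftrightarrow>
     (\<Sum>j<n. (\<Sum>m<num_msgs n R. (norm (x m j))\<^sup>2) / real (num_msgs n R)) / real n \<le> P"
proof -
  have "measure_pmf.expectation (msg_pmf n R) (\<lambda>m. (norm (x m j))\<^sup>2)
      = (\<Sum>m<num_msgs n R. (norm (x m j))\<^sup>2) / real (num_msgs n R)" for j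
    unfolding msg_pmf_def using num_msgs_pos[of n R]
    by (subst integral_pmf_of_set) (auto simp: lessThan_empty_iff)
  then show ?thesis unfolding power_ok_def by simp
qed

text \<open>Every letter of the random codebook has the same mean power, so averaging over messages
  and channel uses preserves it.\<close>

lemma mean_codebook_power:
  fixes A :: "real^'m^'t"
  assumes n: "0 < n" and M: "0 < M"
  shows "(\<integral>\<^sup>+C. ennreal ((\<Sum>j<n. (\<Sum>m<M. (norm (A *v C m j))\<^sup>2) / real M) / real n) \<partial>Pi\<^sub>M {..<M} (\<lambda>_. gauss_seq n))
    = ennreal (trace (A ** transpose A))"
    and "(\<lambda>C. (\<Sum>j<n. (\<Sum>m<M. (norm (A *v C m j))\<^sup>2) / real M) / real n) \<in> borel_measurable (Pi\<^sub>M {..<M} (\<lambda>_. gauss_seq n))"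
proof -
  let ?P = "Pi\<^sub>M {..<M} (\<lambda>_. gauss_seq n :: (nat \<Rightarrow> real^'m) measure)"
  let ?t = "trace (A ** transpose A)"
  have m0: "(\<lambda>k. (norm (A *v k))\<^sup>2) \<in> borel_measurable (std_gaussian :: (real^'m) measure)"
    using std_gaussian_norm_affine[of 0 A] by (auto dest: borel_measurable_has_bochner_integral)
  have m1: "(\<lambda>x. (norm (A *v x j))\<^sup>2) \<in> borel_measurable (gauss_seq n)" if "j < n" for j
    using that by (intro borel_measurable_power measurable_compose[OF _ borel_measurable_norm]
        measurable_gauss_seq_apply(2)[OF measurable_ident_sets]) auto
  have m2: "(\<lambda>C. (norm (A *v C m j))\<^sup>2) \<in> borel_measurable ?P" if mj: "m < M" "j < n" for m j
  proof -
    have "(\<lambda>C. C m) \<in> ?P \<rightarrow>\<^sub>M gauss_seq n"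
      using mj(1) by (intro measurable_component_singleton) simp
    from measurable_compose[OF this m1[OF mj(2)]] show ?thesis .
  qed
  show "(\<lambda>C. (\<Sum>j<n. (\<Sum>m<M. (norm (A *v C m j))\<^sup>2) / real M) / real n) \<in> borel_measurable ?P"
    by (intro borel_measurable_divide borel_measurable_sum borel_measurable_const m2) auto
  have nn: "0 \<le> ?t" by (auto simp: trace_mult_transpose intro: sum_nonneg)
  have i0: "(\<integral>\<^sup>+k. ennreal ((norm (A *v k))\<^sup>2) \<partial>std_gaussian) = ennreal ?t"
    using std_gaussian_norm_affine[of 0 A] by (subst nn_integral_eq_integral) (auto simp: has_bochner_integral_iff)
  have i2: "(\<integral>\<^sup>+C. ennreal ((norm (A *v C m j))\<^sup>2) \<partial>?P) = ennreal ?t" if "m < M" "j < n" for m j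
  proof -
    have "(\<integral>\<^sup>+C. ennreal ((norm (A *v C m j))\<^sup>2) \<partial>?P) = (\<integral>\<^sup>+x. ennreal ((norm (A *v x j))\<^sup>2) \<partial>gauss_seq n)"
      using that by (intro nn_integral_PiM_one[OF gauss_seq.prob_space_axioms] measurable_compose[OF m1 measurable_ennreal]) auto
    also have "\<dots> = (\<integral>\<^sup>+k. ennreal ((norm (A *v k))\<^sup>2) \<partial>std_gaussian)"
      using that by (intro nn_integral_PiM_one[OF std_gaussian.prob_space_axioms] measurable_compose[OF m0 measurable_ennreal]) auto
    finally show ?thesis by (simp add: i0)
  qed
  let ?w = "1 / (real n * real M)"
  have eq: "(\<Sum>j<n. (\<Sum>m<M. (norm (A *v C m j))\<^sup>2) / real M) / real n = ?w * (\<Sum>j<n. \<Sum>m<M. (norm (A *v C m j))\<^sup>2)" for C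
    by (simp add: sum_divide_distrib sum_distrib_left mult.commute)
  have "(\<integral>\<^sup>+C. ennreal ((\<Sum>j<n. (\<Sum>m<M. (norm (A *v C m j))\<^sup>2) / real M) / real n) \<partial>?P)
     = (\<integral>\<^sup>+C. ennreal ?w * (\<Sum>j<n. \<Sum>m<M. ennreal ((norm (A *v C m j))\<^sup>2)) \<partial>?P)"
    unfolding eq by (intro nn_integral_cong) (simp only: ennreal_mult sum_nonneg zero_le_power2 sum_ennreal zero_le_divide_1_iff mult_nonneg_nonneg of_nat_0_le_iff)
  also have "\<dots> = ennreal ?w * (\<Sum>j<n. \<Sum>m<M. \<integral>\<^sup>+C. ennreal ((norm (A *v C m j))\<^sup>2) \<partial>?P)"
  proof -
    have m3: "(\<lambda>C. ennreal ((norm (A *v C m j))\<^sup>2)) \<in> borel_measurable ?P" if "m < M" "j < n" for m j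
      using measurable_compose[OF m2[OF that] measurable_ennreal] .
    have "(\<integral>\<^sup>+C. ennreal ?w * (\<Sum>j<n. \<Sum>m<M. ennreal ((norm (A *v C m j))\<^sup>2)) \<partial>?P)
      = ennreal ?w * (\<integral>\<^sup>+C. (\<Sum>j<n. \<Sum>m<M. ennreal ((norm (A *v C m j))\<^sup>2)) \<partial>?P)"
      by (intro nn_integral_cmult borel_measurable_sum m3) auto
    also have "(\<integral>\<^sup>+C. (\<Sum>j<n. \<Sum>m<M. ennreal ((norm (A *v C m j))\<^sup>2)) \<partial>?P)
      = (\<Sum>j<n. \<integral>\<^sup>+C. (\<Sum>m<M. ennreal ((norm (A *v C m j))\<^sup>2)) \<partial>?P)"
      by (intro nn_integral_sum borel_measurable_sum m3) auto
    also have "\<dots> = (\<Sum>j<n. \<Sum>m<M. \<integral>\<^sup>+C. ennreal ((norm (A *v C m j))\<^sup>2) \<partial>?P)"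
      by (intro sum.cong nn_integral_sum m3) auto
    finally show ?thesis .
  qed
  also have "(\<Sum>j<n. \<Sum>m<M. \<integral>\<^sup>+C. ennreal ((norm (A *v C m j))\<^sup>2) \<partial>?P) = (\<Sum>j<n. \<Sum>m<M. ennreal ?t)"
    by (intro sum.cong i2) auto
  also have "\<dots> = ennreal (real n * real M * ?t)"
  proof -
    have "(\<Sum>j<n. \<Sum>m<M. ennreal ?t) = ennreal (\<Sum>j<n. \<Sum>m<M. ?t)"
      using nn by (simp only: sum_ennreal sum_nonneg)
    then show ?thesis by (simp add: mult.assoc)
  qed
  also have "ennreal ?w * ennreal (real n * real M * ?t) = ennreal (?w * (real n * real M * ?t))"
    using nn by (subst ennreal_mult[symmetric]) auto
  also have "?w * (real n * real M * ?t) = ?t" using n M by simp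
  finally show "(\<integral>\<^sup>+C. ennreal ((\<Sum>j<n. (\<Sum>m<M. (norm (A *v C m j))\<^sup>2) / real M) / real n) \<partial>?P) = ennreal ?t" .
qed

text \<open>\<open>good_receiver\<close> decodes its first user, so for receiver 2 the users are
  exchanged and the sum over pairs is reindexed.\<close>

lemma avg_err_swap: "avg_err n M1 M2 d (\<lambda>k. c (prod.swap k)) (\<lambda>k. t (prod.swap k)) = avg_err n M2 M1 d c t"
proof -
  have "(\<Sum>k\<in>{..<M1} \<times> {..<M2}. err_given n d (c (prod.swap k)) (t (prod.swap k)))
     = (\<Sum>k\<in>{..<M2} \<times> {..<M1}. err_given n d (c k) (t k))"
    by (rule sum.reindex_bij_betw[where g = "\<lambda>k. err_given n d (c k) (t k)"])
      (auto simp: bij_betw_def inj_on_def product_swap)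
  then show ?thesis by (simp add: avg_err_def mult.commute)
qed

text \<open>One pair of codebooks has to serve both receivers and meet both power constraints, so
  the two majorants are added and a single point is picked. The strict bound makes \<eta>
  positive.\<close>

lemma codebooks_exist:
  fixes H1 :: "real^'t^'n" and H2 H4 :: "real^'n^'n" and A1 :: "real^'t^'t" and A2 :: "real^'n^'n"
  assumes N: "noise_law N" and n: "1 \<le> n" and P: "0 \<le> P1" "0 \<le> P2" and \<delta>: "0 < \<delta>" "\<delta> \<le> 1"
    and tr: "trace (A1 ** transpose A1) \<le> (1 - \<delta>) * P1" "trace (A2 ** transpose A2) \<le> (1 - \<delta>) * P2"
    and rc1: "good_receiver n (num_msgs n R1) (num_msgs n R2) (H1 ** A1) (H2 ** A2) \<eta>1"
    and rc2: "good_receiver n (num_msgs n R2) (num_msgs n R1) (H4 ** A2) (0 :: real^'t^'n) \<eta>2"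
    and \<eta>: "0 \<le> \<eta>1" "0 \<le> \<eta>2" "\<eta>1 + \<eta>2 < \<eta>"
  shows "\<exists>x1 x2 d1 d2. power_ok n R1 P1 x1 \<and> power_ok n R2 P2 x2 \<and> decoder n d1 \<and> decoder n d2
     \<and> error_prob1 H1 H2 N n R1 R2 x1 x2 d1 \<le> 2 * \<eta> / \<delta>\<^sup>2 \<and> error_prob2 0 H4 N n R1 R2 x1 x2 d2 \<le> 2 * \<eta> / \<delta>\<^sup>2"
proof -
  let ?M1 = "num_msgs n R1" and ?M2 = "num_msgs n R2"
  let ?P1 = "Pi\<^sub>M {..<?M1} (\<lambda>_. gauss_seq n :: (nat \<Rightarrow> real^'t) measure)"
  let ?P2 = "Pi\<^sub>M {..<?M2} (\<lambda>_. gauss_seq n :: (nat \<Rightarrow> real^'n) measure)"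
  have pr: "prob_space ?P1" "prob_space ?P2" by (intro prob_space_PiM gauss_seq.prob_space_axioms)+
  interpret Q1: prob_space ?P1 by (rule pr)
  interpret Q2: prob_space ?P2 by (rule pr)
  interpret Q: pair_sigma_finite ?P1 ?P2 ..
  from rc1 obtain d1 b1 where d1: "\<And>C1 C2. decoder n (d1 C1 C2)"
    and b1: "case_prod b1 \<in> borel_measurable (?P1 \<Otimes>\<^sub>M ?P2)"
    and e1: "\<And>C1 C2. C1 \<in> space ?P1 \<Longrightarrow> C2 \<in> space ?P2 \<Longrightarrow>
       ennreal (avg_err n ?M1 ?M2 (d1 C1 C2) (\<lambda>k j. (H1 ** A1) *v C1 (fst k) j + (H2 ** A2) *v C2 (snd k) j) fst) \<le> b1 C1 C2"
    and i1: "(\<integral>\<^sup>+C1. \<integral>\<^sup>+C2. b1 C1 C2 \<partial>?P2 \<partial>?P1) \<le> ennreal \<eta>1"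
    unfolding good_receiver_def by blast
  from rc2 obtain d2 b2 where d2: "\<And>C2 C1. decoder n (d2 C2 C1)"
    and b2: "case_prod b2 \<in> borel_measurable (?P2 \<Otimes>\<^sub>M ?P1)"
    and e2: "\<And>C2 C1. C2 \<in> space ?P2 \<Longrightarrow> C1 \<in> space ?P1 \<Longrightarrow>
       ennreal (avg_err n ?M2 ?M1 (d2 C2 C1) (\<lambda>k j. (H4 ** A2) *v C2 (fst k) j + (0 :: real^'t^'n) *v C1 (snd k) j) fst) \<le> b2 C2 C1"
    and i2: "(\<integral>\<^sup>+C2. \<integral>\<^sup>+C1. b2 C2 C1 \<partial>?P1 \<partial>?P2) \<le> ennreal \<eta>2"
    unfolding good_receiver_def by blast
  have b2': "(\<lambda>(C1, C2). b2 C2 C1) \<in> borel_measurable (?P1 \<Otimes>\<^sub>M ?P2)"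
    using measurable_compose[OF measurable_pair_swap' b2] by (simp add: case_prod_unfold)
  \<comment> \<open>Receiver 2 lists the codebooks in the opposite order; Fubini aligns
    them.\<close>
  have i2': "(\<integral>\<^sup>+C1. \<integral>\<^sup>+C2. b2 C2 C1 \<partial>?P2 \<partial>?P1) \<le> ennreal \<eta>2"
    using Q.Fubini'[OF b2'] i2 by simp
  define b where "b C1 C2 = b1 C1 C2 + b2 C2 C1" for C1 C2
  have bm: "case_prod b \<in> borel_measurable (?P1 \<Otimes>\<^sub>M ?P2)"
    unfolding b_def[abs_def] case_prod_unfold
    by (intro borel_measurable_add b1[unfolded case_prod_unfold] b2'[unfolded case_prod_unfold])
  have "(\<integral>\<^sup>+C1. \<integral>\<^sup>+C2. b C1 C2 \<partial>?P2 \<partial>?P1) = (\<integral>\<^sup>+p. case_prod b p \<partial>(?P1 \<Otimes>\<^sub>M ?P2))"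
    using Q2.nn_integral_fst[OF bm] by simp
  also have "\<dots> = (\<integral>\<^sup>+p. case_prod b1 p \<partial>(?P1 \<Otimes>\<^sub>M ?P2)) + (\<integral>\<^sup>+p. (\<lambda>(C1, C2). b2 C2 C1) p \<partial>(?P1 \<Otimes>\<^sub>M ?P2))"
    unfolding b_def[abs_def] by (subst nn_integral_add[OF b1 b2', symmetric]) (simp add: case_prod_unfold)
  also have "\<dots> = (\<integral>\<^sup>+C1. \<integral>\<^sup>+C2. b1 C1 C2 \<partial>?P2 \<partial>?P1) + (\<integral>\<^sup>+C1. \<integral>\<^sup>+C2. b2 C2 C1 \<partial>?P2 \<partial>?P1)"
    using Q2.nn_integral_fst[OF b1] Q2.nn_integral_fst[OF b2'] by simp
  also have "\<dots> \<le> ennreal \<eta>1 + ennreal \<eta>2" by (intro add_mono i1 i2')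
  also have "\<dots> \<le> ennreal \<eta>" using \<eta> by (simp flip: ennreal_plus add: ennreal_leI)
  finally have ib: "(\<integral>\<^sup>+C1. \<integral>\<^sup>+C2. b C1 C2 \<partial>?P2 \<partial>?P1) \<le> ennreal \<eta>" .
  define p1 where "p1 C = (\<Sum>j<n. (\<Sum>m<?M1. (norm (A1 *v C m j))\<^sup>2) / real ?M1) / real n" for C
  define p2 where "p2 C = (\<Sum>j<n. (\<Sum>m<?M2. (norm (A2 *v C m j))\<^sup>2) / real ?M2) / real n" for C
  have pm: "p1 \<in> borel_measurable ?P1" "p2 \<in> borel_measurable ?P2"
    unfolding p1_def[abs_def] p2_def[abs_def] using n by (intro mean_codebook_power(2) num_msgs_pos; simp)+
  let ?G1 = "{C \<in> space ?P1. p1 C \<le> P1}" and ?G2 = "{C \<in> space ?P2. p2 C \<le> P2}"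
  have G1: "\<delta> \<le> measure ?P1 ?G1"
  proof (rule markov_power[OF pr(1) pm(1) _ _ P(1) \<delta>])
    show "0 \<le> p1 C" for C unfolding p1_def by (intro divide_nonneg_nonneg sum_nonneg) auto
    show "(\<integral>\<^sup>+C. ennreal (p1 C) \<partial>?P1) \<le> ennreal ((1 - \<delta>) * P1)"
      unfolding p1_def using n tr(1) by (subst mean_codebook_power(1)) (auto simp: num_msgs_pos intro: ennreal_leI)
  qed
  have G2: "\<delta> \<le> measure ?P2 ?G2"
  proof (rule markov_power[OF pr(2) pm(2) _ _ P(2) \<delta>])
    show "0 \<le> p2 C" for C unfolding p2_def by (intro divide_nonneg_nonneg sum_nonneg) auto
    show "(\<integral>\<^sup>+C. ennreal (p2 C) \<partial>?P2) \<le> ennreal ((1 - \<delta>) * P2)"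
      unfolding p2_def using n tr(2) by (subst mean_codebook_power(1)) (auto simp: num_msgs_pos intro: ennreal_leI)
  qed
  have Gs: "?G1 \<in> sets ?P1" "?G2 \<in> sets ?P2" using pm by measurable
  have \<eta>0: "0 < \<eta>" using \<eta> by simp
  from pick_point[OF pr bm Gs G1 G2 ib \<eta>0 \<delta>(1)] obtain C1 C2
    where C: "C1 \<in> ?G1" "C2 \<in> ?G2" and le: "b C1 C2 \<le> ennreal (2 * \<eta> / \<delta>\<^sup>2)" by blast
  define x1 where "x1 m j = A1 *v C1 m j" for m j
  define x2 where "x2 m j = A2 *v C2 m j" for m j
  have c0: "0 \<le> 2 * \<eta> / \<delta>\<^sup>2" using \<eta>0 by simp
  have s: "C1 \<in> space ?P1" "C2 \<in> space ?P2" using C by auto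
  have "power_ok n R1 P1 x1" "power_ok n R2 P2 x2"
    using C unfolding power_ok_iff x1_def x2_def p1_def p2_def by auto
  moreover have "error_prob1 H1 H2 N n R1 R2 x1 x2 (d1 C1 C2) \<le> 2 * \<eta> / \<delta>\<^sup>2"
  proof -
    have "error_prob1 H1 H2 N n R1 R2 x1 x2 (d1 C1 C2)
        = avg_err n ?M1 ?M2 (d1 C1 C2) (\<lambda>k j. (H1 ** A1) *v C1 (fst k) j + (H2 ** A2) *v C2 (snd k) j) fst"
      by (simp add: error_prob1_avg_err[OF N d1] x1_def x2_def matrix_vector_mul_assoc)
    moreover have "ennreal \<dots> \<le> ennreal (2 * \<eta> / \<delta>\<^sup>2)"
      using e1[OF s] le unfolding b_def by (meson add_increasing2 order_trans order_refl zero_le)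
    ultimately show ?thesis using c0 by (simp add: ennreal_le_iff)
  qed
  moreover have "error_prob2 0 H4 N n R1 R2 x1 x2 (d2 C2 C1) \<le> 2 * \<eta> / \<delta>\<^sup>2"
  proof -
    have "error_prob2 0 H4 N n R1 R2 x1 x2 (d2 C2 C1) = avg_err n ?M1 ?M2 (d2 C2 C1) (\<lambda>k j. (H4 ** A2) *v C2 (snd k) j) snd"
      by (simp add: error_prob2_avg_err[OF N d2] x2_def matrix_vector_mul_assoc)
    also have "\<dots> = avg_err n ?M2 ?M1 (d2 C2 C1) (\<lambda>k j. (H4 ** A2) *v C2 (fst k) j + (0 :: real^'t^'n) *v C1 (snd k) j) fst"
      using avg_err_swap[of n ?M1 ?M2 "d2 C2 C1" "\<lambda>k j. (H4 ** A2) *v C2 (fst k) j" fst] by simp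
    finally have "error_prob2 0 H4 N n R1 R2 x1 x2 (d2 C2 C1) = \<dots>" .
    moreover have "ennreal \<dots> \<le> ennreal (2 * \<eta> / \<delta>\<^sup>2)"
      using e2[OF s(2,1)] le unfolding b_def by (meson add_increasing order_trans order_refl zero_le)
    ultimately show ?thesis using c0 by (simp add: ennreal_le_iff)
  qed
  ultimately show ?thesis using d1 d2 by blast
qed

lemma achievable_from_receivers:
  fixes H1 :: "real^'t^'n" and H2 H4 :: "real^'n^'n" and A1 :: "real^'t^'t" and A2 :: "real^'n^'n"
  assumes N: "noise_law N" and P: "0 \<le> P1" "0 \<le> P2" and R: "0 \<le> R1" "0 \<le> R2" and \<delta>: "0 < \<delta>" "\<delta> \<le> 1"
    and tr: "trace (A1 ** transpose A1) \<le> (1 - \<delta>) * P1" "trace (A2 ** transpose A2) \<le> (1 - \<delta>) * P2"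
    and rc1: "\<And>n. good_receiver n (num_msgs n R1) (num_msgs n R2) (H1 ** A1) (H2 ** A2) (\<eta>1 n)"
    and rc2: "\<And>n. good_receiver n (num_msgs n R2) (num_msgs n R1) (H4 ** A2) (0 :: real^'t^'n) (\<eta>2 n)"
    and \<eta>: "\<And>n. 0 \<le> \<eta>1 n" "\<And>n. 0 \<le> \<eta>2 n" and lim: "\<eta>1 \<longlonglongrightarrow> 0" "\<eta>2 \<longlonglongrightarrow> 0"
  shows "achievable H1 H2 0 H4 N P1 P2 (R1, R2)"
proof -
  \<comment> \<open>The term \<open>(1/2) ^ n\<close> keeps the bound strictly above the sum and
    still tends to 0.\<close>
  define \<eta> where "\<eta> n = \<eta>1 n + \<eta>2 n + (1/2) ^ n" for n
  define e where "e n = 2 * \<eta> n / \<delta>\<^sup>2" for n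
  have "(\<lambda>n. 2 * (\<eta>1 n + \<eta>2 n + (1/2) ^ n) / \<delta>\<^sup>2) \<longlonglongrightarrow> 2 * (0 + 0 + 0) / \<delta>\<^sup>2"
    using \<delta> by (intro tendsto_intros lim LIMSEQ_realpow_zero) auto
  then have e: "e \<longlonglongrightarrow> 0" by (simp add: e_def[abs_def] \<eta>_def[abs_def])
  have "\<forall>n. \<exists>x1 x2 d1 d2. 1 \<le> n \<longrightarrow> power_ok n R1 P1 x1 \<and> power_ok n R2 P2 x2 \<and> decoder n d1 \<and> decoder n d2
     \<and> error_prob1 H1 H2 N n R1 R2 x1 x2 d1 \<le> e n \<and> error_prob2 0 H4 N n R1 R2 x1 x2 d2 \<le> e n"
  proof
    fix n
    have lt: "\<eta>1 n + \<eta>2 n < \<eta> n" by (simp add: \<eta>_def)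
    show "\<exists>x1 x2 d1 d2. 1 \<le> n \<longrightarrow> power_ok n R1 P1 x1 \<and> power_ok n R2 P2 x2 \<and> decoder n d1 \<and> decoder n d2
     \<and> error_prob1 H1 H2 N n R1 R2 x1 x2 d1 \<le> e n \<and> error_prob2 0 H4 N n R1 R2 x1 x2 d2 \<le> e n"
      using codebooks_exist[OF N _ P \<delta> tr rc1 rc2 \<eta> lt] unfolding e_def by blast
  qed
  from choice[OF this] obtain x1 where "\<forall>n. \<exists>x2 d1 d2. 1 \<le> n \<longrightarrow> power_ok n R1 P1 (x1 n) \<and> power_ok n R2 P2 x2 \<and> decoder n d1 \<and> decoder n d2
     \<and> error_prob1 H1 H2 N n R1 R2 (x1 n) x2 d1 \<le> e n \<and> error_prob2 0 H4 N n R1 R2 (x1 n) x2 d2 \<le> e n" by (rule exE)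
  from choice[OF this] obtain x2 where "\<forall>n. \<exists>d1 d2. 1 \<le> n \<longrightarrow> power_ok n R1 P1 (x1 n) \<and> power_ok n R2 P2 (x2 n) \<and> decoder n d1 \<and> decoder n d2
     \<and> error_prob1 H1 H2 N n R1 R2 (x1 n) (x2 n) d1 \<le> e n \<and> error_prob2 0 H4 N n R1 R2 (x1 n) (x2 n) d2 \<le> e n" by (rule exE)
  from choice[OF this] obtain d1 where "\<forall>n. \<exists>d2. 1 \<le> n \<longrightarrow> power_ok n R1 P1 (x1 n) \<and> power_ok n R2 P2 (x2 n) \<and> decoder n (d1 n) \<and> decoder n d2
     \<and> error_prob1 H1 H2 N n R1 R2 (x1 n) (x2 n) (d1 n) \<le> e n \<and> error_prob2 0 H4 N n R1 R2 (x1 n) (x2 n) d2 \<le> e n" by (rule exE)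
  from choice[OF this] obtain d2 where all: "\<forall>n. 1 \<le> n \<longrightarrow> power_ok n R1 P1 (x1 n) \<and> power_ok n R2 P2 (x2 n) \<and> decoder n (d1 n) \<and> decoder n (d2 n)
     \<and> error_prob1 H1 H2 N n R1 R2 (x1 n) (x2 n) (d1 n) \<le> e n \<and> error_prob2 0 H4 N n R1 R2 (x1 n) (x2 n) (d2 n) \<le> e n" by (rule exE)
  have l1: "(\<lambda>n. error_prob1 H1 H2 N n R1 R2 (x1 n) (x2 n) (d1 n)) \<longlonglongrightarrow> 0"
  proof (rule tendsto_sandwich[OF _ _ tendsto_const e])
    show "\<forall>\<^sub>F n in sequentially. error_prob1 H1 H2 N n R1 R2 (x1 n) (x2 n) (d1 n) \<le> e n"
      using all by (intro eventually_sequentiallyI[of 1]) blast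
  qed (simp add: error_prob1_def)
  have l2: "(\<lambda>n. error_prob2 0 H4 N n R1 R2 (x1 n) (x2 n) (d2 n)) \<longlonglongrightarrow> 0"
  proof (rule tendsto_sandwich[OF _ _ tendsto_const e])
    show "\<forall>\<^sub>F n in sequentially. error_prob2 0 H4 N n R1 R2 (x1 n) (x2 n) (d2 n) \<le> e n"
      using all by (intro eventually_sequentiallyI[of 1]) blast
  qed (simp add: error_prob2_def)
  show ?thesis
    unfolding achievable_def prod.case
    by (intro conjI R exI[of _ x1] exI[of _ x2] exI[of _ d1] exI[of _ d2] l1 l2) (use all in blast)
qed

section \<open>Numbers of messages and achievable rate pairs\<close>

lemma num_msgs_minus_one_le: "real (num_msgs n R - 1) \<le> exp (real n * R)"
proof -
  have "int (num_msgs n R - 1) = \<lceil>exp (real n * R)\<rceil> - 1"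
    using num_msgs_pos[of n R] unfolding num_msgs_def by linarith
  then have "real (num_msgs n R - 1) = real_of_int (\<lceil>exp (real n * R)\<rceil> - 1)" by (metis of_int_of_nat_eq)
  then show ?thesis by linarith
qed

lemma num_msgs_zero [simp]: "num_msgs n 0 = 1"
  by (simp add: num_msgs_def)

text \<open>At rate 0 there is a single message and the product is exactly 0, whatever
  \<open>g\<close> is. This keeps rate 0 available where the bound on the rate is 0 itself.\<close>

lemma msgs_vanish_pair:
  assumes "R1 = 0 \<or> R2 = 0 \<or> R1 + R2 < g"
  shows "(\<lambda>n. real (num_msgs n R1 - 1) * real (num_msgs n R2 - 1) * exp (- real n * g)) \<longlonglongrightarrow> 0"
proof (cases "R1 = 0 \<or> R2 = 0")
  case False
  show ?thesis
  proof (rule tendsto_sandwich[OF _ _ tendsto_const])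
    show "\<forall>\<^sub>F n in sequentially. real (num_msgs n R1 - 1) * real (num_msgs n R2 - 1) * exp (- real n * g)
       \<le> exp (R1 + R2 - g) ^ n"
    proof (rule always_eventually, rule allI)
      fix n
      have "real (num_msgs n R1 - 1) * real (num_msgs n R2 - 1) * exp (- real n * g)
        \<le> exp (real n * R1) * exp (real n * R2) * exp (- real n * g)"
        by (intro mult_right_mono mult_mono num_msgs_minus_one_le) auto
      also have "\<dots> = exp (R1 + R2 - g) ^ n"
        by (simp add: exp_of_nat_mult[symmetric] algebra_simps flip: exp_add)
      finally show "real (num_msgs n R1 - 1) * real (num_msgs n R2 - 1) * exp (- real n * g) \<le> exp (R1 + R2 - g) ^ n" .
    qed
    show "(\<lambda>n. exp (R1 + R2 - g) ^ n) \<longlonglongrightarrow> 0"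
      using False assms by (intro LIMSEQ_realpow_zero) auto
  qed simp
qed auto

lemma msgs_vanish:
  assumes "R = 0 \<or> R < g"
  shows "(\<lambda>n. real (num_msgs n R - 1) * exp (- real n * g)) \<longlonglongrightarrow> 0"
proof (cases "R = 0")
  case False
  show ?thesis
  proof (rule tendsto_sandwich[OF _ _ tendsto_const])
    show "\<forall>\<^sub>F n in sequentially. real (num_msgs n R - 1) * exp (- real n * g) \<le> exp (R - g) ^ n"
    proof (rule always_eventually, rule allI)
      fix n
      have "real (num_msgs n R - 1) * exp (- real n * g) \<le> exp (real n * R) * exp (- real n * g)"
        by (intro mult_right_mono num_msgs_minus_one_le) auto
      also have "\<dots> = exp (R - g) ^ n"
        by (simp add: exp_of_nat_mult[symmetric] algebra_simps flip: exp_add)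
      finally show "real (num_msgs n R - 1) * exp (- real n * g) \<le> exp (R - g) ^ n" .
    qed
    show "(\<lambda>n. exp (R - g) ^ n) \<longlonglongrightarrow> 0"
      using False assms by (intro LIMSEQ_realpow_zero) auto
  qed simp
qed auto

lemma gain_factor: "gain H (A ** transpose A) = (H ** A) ** transpose (H ** A)"
  by (simp add: gain_def matrix_transpose_mul matrix_mul_assoc)

text \<open>\<open>P\<close> stands for a vanishing rate. If \<open>R < c\<close> fails,
  \<open>P\<close> holds, and any number below \<open>c\<close> can serve as threshold.\<close>

lemma zero_or_less_between:
  fixes R c :: real
  assumes "P \<or> R < c" obtains g where "P \<or> R < g" "g < c"
proof (cases "R < c")
  case True
  then show thesis using dense that by blast
next
  case False
  then show thesis using assms that[of "c - 1"] by auto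
qed

text \<open>Treating interference as noise, with the zero matrix as interfering channel and user 2
  in the place of the decoded user.\<close>

lemma interference_free_receiver:
  fixes H4 :: "real^'n^'n" and A2 :: "real^'n^'n"
  assumes R2: "R2 = 0 \<or> R2 < ln (det (mat 1 + gain H4 (A2 ** transpose A2))) / 2"
  obtains \<eta> where "\<And>n. good_receiver n (num_msgs n R2) (num_msgs n R1) (H4 ** A2) (0 :: real^'t^'n) (\<eta> n)"
    "\<And>n. 0 \<le> \<eta> n" "\<eta> \<longlonglongrightarrow> 0"
proof -
  let ?K = "mat 1 + gain H4 (A2 ** transpose A2)" and ?I = "mat 1 :: real^'n^'n"
  have "pos_def ?K" by (intro pos_def_mat_1_gain pos_semidef_mult_transpose)
  then obtain B :: "real^'n^'n" where B: "?K = B ** transpose B" "invertible B" by (rule pos_def_factor)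
  from zero_or_less_between[OF R2] obtain g where g: "R2 = 0 \<or> R2 < g" "g < ln (det ?K) / 2" .
  have "g < ln (\<bar>det B\<bar> / \<bar>det ?I\<bar>)"
    using g(2) ln_abs_det[OF B(1)] B(2) by (simp add: invertible_det_nz)
  moreover have "B ** transpose B = (H4 ** A2) ** transpose (H4 ** A2) + ((0 :: real^'t^'n) ** transpose (0 :: real^'t^'n) + ?I)"
    using B(1) unfolding gain_factor by (simp add: add.commute)
  ultimately obtain r where r: "0 \<le> r" "r < 1"
    "\<And>n M1 M2. 0 < M1 \<Longrightarrow> 0 < M2 \<Longrightarrow> good_receiver n M1 M2 (H4 ** A2) (0 :: real^'t^'n) (2 * r ^ n + real (M1 - 1) * exp (- real n * g))"
    using treat_interference_as_noise[of ?I "0 :: real^'t^'n" B "H4 ** A2" g] B(2) by (auto simp: invertible_det_nz)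
  show thesis
  proof (rule that[of "\<lambda>n. 2 * r ^ n + real (num_msgs n R2 - 1) * exp (- real n * g)"])
    show "good_receiver n (num_msgs n R2) (num_msgs n R1) (H4 ** A2) (0 :: real^'t^'n)
        (2 * r ^ n + real (num_msgs n R2 - 1) * exp (- real n * g))" for n
      by (intro r num_msgs_pos)
    show "0 \<le> 2 * r ^ n + real (num_msgs n R2 - 1) * exp (- real n * g)" for n using r(1) by simp
    have "(\<lambda>n. 2 * r ^ n + real (num_msgs n R2 - 1) * exp (- real n * g)) \<longlonglongrightarrow> 2 * 0 + 0"
      using r g(1) by (intro tendsto_intros LIMSEQ_realpow_zero msgs_vanish) auto
    then show "(\<lambda>n. 2 * r ^ n + real (num_msgs n R2 - 1) * exp (- real n * g)) \<longlonglongrightarrow> 0" by simp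
  qed
qed

lemma achievable_treating_interference_as_noise:
  fixes H1 :: "real^'t^'n" and H2 H4 :: "real^'n^'n"
  assumes N: "noise_law N" and P: "0 \<le> P1" "0 \<le> P2" and R: "0 \<le> R1" "0 \<le> R2" and \<delta>: "0 < \<delta>" "\<delta> \<le> 1"
    and S: "pos_semidef S1" "pos_semidef S2" "trace S1 \<le> (1 - \<delta>) * P1" "trace S2 \<le> (1 - \<delta>) * P2"
    and R1: "R1 = 0 \<or> R1 < (ln (det (mat 1 + gain H1 S1 + gain H2 S2)) - ln (det (mat 1 + gain H2 S2))) / 2"
    and R2: "R2 = 0 \<or> R2 < ln (det (mat 1 + gain H4 S2)) / 2"
  shows "achievable H1 H2 0 H4 N P1 P2 (R1, R2)"
proof -
  obtain A1 :: "real^'t^'t" where A1: "S1 = A1 ** transpose A1" using S(1) by (rule pos_semidef_factor)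
  obtain A2 :: "real^'n^'n" where A2: "S2 = A2 ** transpose A2" using S(2) by (rule pos_semidef_factor)
  let ?Kn = "mat 1 + gain H2 S2" and ?K = "mat 1 + gain H1 S1 + gain H2 S2"
  have pd: "pos_def ?Kn" "pos_def ?K"
    by (intro pos_def_mat_1_gain pos_def_add pos_semidef_gain S)+
  obtain Bn :: "real^'n^'n" where Bn: "?Kn = Bn ** transpose Bn" "invertible Bn" using pd(1) by (rule pos_def_factor)
  obtain B :: "real^'n^'n" where B: "?K = B ** transpose B" "invertible B" using pd(2) by (rule pos_def_factor)
  from zero_or_less_between[OF R1] obtain g
    where g: "R1 = 0 \<or> R1 < g" "g < (ln (det ?K) - ln (det ?Kn)) / 2" .
  have nz: "det B \<noteq> 0" "det Bn \<noteq> 0" using B Bn by (auto simp: invertible_det_nz)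
  have g': "g < ln (\<bar>det B\<bar> / \<bar>det Bn\<bar>)"
    using g(2) nz ln_abs_det[OF B(1) nz(1)] ln_abs_det[OF Bn(1) nz(2)] by (simp add: ln_div diff_divide_distrib)
  have e: "Bn ** transpose Bn = (H2 ** A2) ** transpose (H2 ** A2) + mat 1"
    "B ** transpose B = (H1 ** A1) ** transpose (H1 ** A1) + ((H2 ** A2) ** transpose (H2 ** A2) + mat 1)"
    unfolding Bn(1)[symmetric] B(1)[symmetric] A1 A2 gain_factor by (simp_all add: ac_simps)
  obtain r where r: "0 \<le> r" "r < 1"
    "\<And>n M1 M2. 0 < M1 \<Longrightarrow> 0 < M2 \<Longrightarrow> good_receiver n M1 M2 (H1 ** A1) (H2 ** A2) (2 * r ^ n + real (M1 - 1) * exp (- real n * g))"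
    using treat_interference_as_noise[OF Bn(2) e(1) B(2) e(2) g'] by blast
  obtain \<eta> where \<eta>: "\<And>n. good_receiver n (num_msgs n R2) (num_msgs n R1) (H4 ** A2) (0 :: real^'t^'n) (\<eta> n)"
    "\<And>n. 0 \<le> \<eta> n" "\<eta> \<longlonglongrightarrow> 0"
    using interference_free_receiver[OF R2[unfolded A2]] by blast
  show ?thesis
  proof (rule achievable_from_receivers[OF N P R \<delta> S(3,4)[unfolded A1 A2] _ \<eta>(1) _ \<eta>(2) _ \<eta>(3)])
    show "good_receiver n (num_msgs n R1) (num_msgs n R2) (H1 ** A1) (H2 ** A2)
        (2 * r ^ n + real (num_msgs n R1 - 1) * exp (- real n * g))" for n
      by (intro r num_msgs_pos)
    have "(\<lambda>n. 2 * r ^ n + real (num_msgs n R1 - 1) * exp (- real n * g)) \<longlonglongrightarrow> 2 * 0 + 0"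
      using r g(1) by (intro tendsto_intros LIMSEQ_realpow_zero msgs_vanish) auto
    then show "(\<lambda>n. 2 * r ^ n + real (num_msgs n R1 - 1) * exp (- real n * g)) \<longlonglongrightarrow> 0" by simp
  qed (use r(1) in auto)
qed

text \<open>The sum constraint concerns pairs with both messages wrong; such pairs exist only if
  both rates are nonzero, hence the alternative in \<open>R12\<close>.\<close>

lemma achievable_joint_decoding:
  fixes H1 :: "real^'t^'n" and H2 H4 :: "real^'n^'n"
  assumes N: "noise_law N" and P: "0 \<le> P1" "0 \<le> P2" and R: "0 \<le> R1" "0 \<le> R2" and \<delta>: "0 < \<delta>" "\<delta> \<le> 1"
    and S: "pos_semidef S1" "pos_semidef S2" "trace S1 \<le> (1 - \<delta>) * P1" "trace S2 \<le> (1 - \<delta>) * P2"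
    and R1: "R1 = 0 \<or> R1 < ln (det (mat 1 + gain H1 S1)) / 2"
    and R2: "R2 = 0 \<or> R2 < ln (det (mat 1 + gain H4 S2)) / 2"
    and R12: "(R1 = 0 \<or> R2 = 0) \<or> R1 + R2 < ln (det (mat 1 + gain H1 S1 + gain H2 S2)) / 2"
  shows "achievable H1 H2 0 H4 N P1 P2 (R1, R2)"
proof -
  obtain A1 :: "real^'t^'t" where A1: "S1 = A1 ** transpose A1" using S(1) by (rule pos_semidef_factor)
  obtain A2 :: "real^'n^'n" where A2: "S2 = A2 ** transpose A2" using S(2) by (rule pos_semidef_factor)
  let ?K1 = "mat 1 + gain H1 S1" and ?K = "mat 1 + gain H1 S1 + gain H2 S2"
  have pd: "pos_def ?K1" "pos_def ?K"
    by (intro pos_def_mat_1_gain pos_def_add pos_semidef_gain S)+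
  obtain B1 :: "real^'n^'n" where B1: "?K1 = B1 ** transpose B1" "invertible B1" using pd(1) by (rule pos_def_factor)
  obtain B :: "real^'n^'n" where B: "?K = B ** transpose B" "invertible B" using pd(2) by (rule pos_def_factor)
  from zero_or_less_between[OF R1] obtain g1 where g1: "R1 = 0 \<or> R1 < g1" "g1 < ln (det ?K1) / 2" .
  from zero_or_less_between[OF R12] obtain g12 where g12: "(R1 = 0 \<or> R2 = 0) \<or> R1 + R2 < g12" "g12 < ln (det ?K) / 2" .
  have nz: "det B \<noteq> 0" "det B1 \<noteq> 0" using B B1 by (auto simp: invertible_det_nz)
  have g': "g1 < ln \<bar>det B1\<bar>" "g12 < ln \<bar>det B\<bar>"
    using g1(2) g12(2) ln_abs_det[OF B(1) nz(1)] ln_abs_det[OF B1(1) nz(2)] by simp_all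
  have e: "B1 ** transpose B1 = (H1 ** A1) ** transpose (H1 ** A1) + mat 1"
    "B ** transpose B = (H1 ** A1) ** transpose (H1 ** A1) + ((H2 ** A2) ** transpose (H2 ** A2) + mat 1)"
    unfolding B1(1)[symmetric] B(1)[symmetric] A1 A2 gain_factor by (simp_all add: ac_simps)
  obtain r where r: "0 \<le> r" "r < 1"
    "\<And>n M1 M2. 0 < M1 \<Longrightarrow> 0 < M2 \<Longrightarrow> good_receiver n M1 M2 (H1 ** A1) (H2 ** A2)
      (3 * r ^ n + real (M1 - 1) * exp (- real n * g1) + real (M1 - 1) * real (M2 - 1) * exp (- real n * g12))"
    using joint_decoding[OF B1(2) e(1) B(2) e(2) g'] by blast
  obtain \<eta> where \<eta>: "\<And>n. good_receiver n (num_msgs n R2) (num_msgs n R1) (H4 ** A2) (0 :: real^'t^'n) (\<eta> n)"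
    "\<And>n. 0 \<le> \<eta> n" "\<eta> \<longlonglongrightarrow> 0"
    using interference_free_receiver[OF R2[unfolded A2]] by blast
  let ?\<eta> = "\<lambda>n. 3 * r ^ n + real (num_msgs n R1 - 1) * exp (- real n * g1)
     + real (num_msgs n R1 - 1) * real (num_msgs n R2 - 1) * exp (- real n * g12)"
  show ?thesis
  proof (rule achievable_from_receivers[OF N P R \<delta> S(3,4)[unfolded A1 A2] _ \<eta>(1) _ \<eta>(2) _ \<eta>(3)])
    show "good_receiver n (num_msgs n R1) (num_msgs n R2) (H1 ** A1) (H2 ** A2) (?\<eta> n)" for n
      by (intro r num_msgs_pos)
    have "?\<eta> \<longlonglongrightarrow> 3 * 0 + 0 + 0"
      using r g1(1) g12(1) by (intro tendsto_add tendsto_mult_left LIMSEQ_realpow_zero msgs_vanish msgs_vanish_pair) auto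
    then show "?\<eta> \<longlonglongrightarrow> 0" by simp
  qed (use r(1) in auto)
qed

section \<open>The sum-rate capacity\<close>

text \<open>The codes of \<open>direct\<close> keep a fraction \<delta> of the power in reserve. The
  maximiser is therefore shrunk, and continuity of the objective recovers its value in the limit.
  For the upper bound, the half-plane of pairs with bounded sum is closed, so it contains the
  closure in \<open>capacity_region\<close>.\<close>

lemma is_max_over_sum_capacity:
  fixes H1 :: "real^'t^'n" and H2 :: "real^'u^'n"
  assumes P: "0 \<le> P1" "0 \<le> P2"
    and cont: "continuous_on (cov_set P1 \<times> cov_set P2) f"
    and converse: "\<And>R1 R2 V. achievable H1 H2 H3 H4 N P1 P2 (R1, R2) \<Longrightarrow>
        (\<And>S1 S2. S1 \<in> cov_set P1 \<Longrightarrow> S2 \<in> cov_set P2 \<Longrightarrow> f (S1, S2) \<le> V) \<Longrightarrow> R1 + R2 \<le> V"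
    and direct: "\<And>S1 S2 \<delta> \<epsilon>. pos_semidef S1 \<Longrightarrow> pos_semidef S2 \<Longrightarrow> 0 < \<delta> \<Longrightarrow> \<delta> \<le> 1 \<Longrightarrow> 0 < \<epsilon>
        \<Longrightarrow> trace S1 \<le> (1 - \<delta>) * P1 \<Longrightarrow> trace S2 \<le> (1 - \<delta>) * P2
        \<Longrightarrow> \<exists>R1 R2. achievable H1 H2 H3 H4 N P1 P2 (R1, R2) \<and> f (S1, S2) - \<epsilon> \<le> R1 + R2"
  shows "is_max_over (sum_capacity H1 H2 H3 H4 N P1 P2) f (cov_set P1 \<times> cov_set P2)"
proof -
  let ?K = "cov_set P1 \<times> cov_set P2" and ?C = "sum_capacity H1 H2 H3 H4 N P1 P2"
  have "compact ?K" by (intro compact_Times compact_cov_set)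
  moreover have "?K \<noteq> {}" using zero_in_cov_set[OF P(1)] zero_in_cov_set[OF P(2)] by blast
  ultimately obtain p where p: "p \<in> ?K" "\<And>q. q \<in> ?K \<Longrightarrow> f q \<le> f p"
    using continuous_attains_sup[OF _ _ cont] by blast
  have ub: "R1 + R2 \<le> f p" if "(R1, R2) \<in> capacity_region H1 H2 H3 H4 N P1 P2" for R1 R2
  proof -
    have "closed {R. fst R + snd R \<le> f p}" by (intro closed_Collect_le continuous_intros)
    moreover have "{R. achievable H1 H2 H3 H4 N P1 P2 R} \<subseteq> {R. fst R + snd R \<le> f p}"
      using converse p(2) by auto
    ultimately have "capacity_region H1 H2 H3 H4 N P1 P2 \<subseteq> {R. fst R + snd R \<le> f p}"
      unfolding capacity_region_def by (intro closure_minimal)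
    then show ?thesis using that by auto
  qed
  have "?C \<le> ereal (f p)"
    unfolding sum_capacity_def using ub by (intro SUP_least) auto
  moreover have "ereal (f p) \<le> ?C"
  proof -
    obtain S1 S2 where pS: "p = (S1, S2)" and S: "pos_semidef S1" "trace S1 \<le> P1" "pos_semidef S2" "trace S2 \<le> P2"
      using p(1) by (auto simp: cov_set_def)
    \<comment> \<open>For \<open>k = 0\<close> both covariances are 0 and the reserve is the whole
      power; later terms approach the maximiser.\<close>
    define q where "q k = (1 - inverse (real (Suc k))) *\<^sub>R p" for k
    have tr: "trace ((1 - d) *\<^sub>R S1) \<le> (1 - d) * P1" "trace ((1 - d) *\<^sub>R S2) \<le> (1 - d) * P2" if "d \<le> 1" for d
      using S that by (auto simp: trace_scaleR intro: mult_left_mono)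
    have d: "0 < inverse (real (Suc k))" "inverse (real (Suc k)) \<le> 1" for k
      by (auto simp: field_simps)
    have ps: "pos_semidef ((1 - inverse (real (Suc k))) *\<^sub>R S1)" "pos_semidef ((1 - inverse (real (Suc k))) *\<^sub>R S2)" for k
      using d[of k] S by (auto intro!: pos_semidef_scaleR)
    have qK: "q k \<in> ?K" for k
    proof -
      have "(1 - inverse (real (Suc k))) * P1 \<le> P1" "(1 - inverse (real (Suc k))) * P2 \<le> P2"
        using d[of k] P by (auto intro!: mult_left_le_one_le)
      then show ?thesis using ps[of k] tr[OF d(2)[of k]] by (auto simp: q_def pS cov_set_def)
    qed
    have "q \<longlonglongrightarrow> (1 - 0) *\<^sub>R p"
      unfolding q_def by (intro tendsto_intros LIMSEQ_inverse_real_of_nat)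
    then have "(\<lambda>k. f (q k)) \<longlonglongrightarrow> f p"
      using qK p(1) by (intro continuous_on_tendsto_compose[OF cont]) auto
    then have "(\<lambda>k. f (q k) - inverse (real (Suc k))) \<longlonglongrightarrow> f p - 0"
      by (intro tendsto_intros LIMSEQ_inverse_real_of_nat)
    then have lim: "(\<lambda>k. ereal (f (q k) - inverse (real (Suc k)))) \<longlonglongrightarrow> ereal (f p)" by simp
    show ?thesis
    proof (rule LIMSEQ_le_const2[OF lim], intro exI[of _ 0] allI impI)
      fix k
      \<comment> \<open>The same sequence serves as power reserve and as loss of rate.\<close>
      from direct[OF ps(1)[of k] ps(2)[of k] d(1)[of k] d(2)[of k] d(1)[of k] tr[OF d(2)[of k]]]
      obtain R1 R2 where R: "achievable H1 H2 H3 H4 N P1 P2 (R1, R2)" "f (q k) - inverse (real (Suc k)) \<le> R1 + R2"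
        unfolding q_def pS by auto
      have "(R1, R2) \<in> capacity_region H1 H2 H3 H4 N P1 P2"
        unfolding capacity_region_def using R(1) closure_subset by blast
      then have "ereal (R1 + R2) \<le> ?C" unfolding sum_capacity_def by (rule SUP_upper2) simp
      moreover have "ereal (f (q k) - inverse (real (Suc k))) \<le> ereal (R1 + R2)" using R(2) by simp
      ultimately show "ereal (f (q k) - inverse (real (Suc k))) \<le> ?C" by (rule order_trans[rotated])
    qed
  qed
  ultimately have "?C = ereal (f p)" by (rule antisym)
  then show ?thesis using p unfolding is_max_over_def by auto
qed

lemma is_max_over_cong: "(\<And>a. a \<in> A \<Longrightarrow> f a = g a) \<Longrightarrow> is_max_over v f A \<longleftrightarrow> is_max_over v g A"
  by (auto simp: is_max_over_def)

text \<open>\<open>mat 1 + G K^{-1}\<close> is \<open>(K + G) K^{-1}\<close>, which turns the rate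
  with interference as noise into a difference of log-determinants.\<close>

lemma det_noise_whitening:
  fixes K G :: "real^'n^'n"
  assumes "invertible K"
  shows "det (mat 1 + G ** matrix_inv K) = det (K + G) / det K"
proof -
  have 1: "K ** matrix_inv K = mat 1" by (rule matrix_inv_right[OF assms])
  then have "mat 1 + G ** matrix_inv K = (K + G) ** matrix_inv K" by (simp add: matrix_add_rdistrib)
  moreover have "det K * det (matrix_inv K) = 1" using 1 by (metis det_I det_mul)
  ultimately show ?thesis using assms by (simp add: det_mul invertible_det_nz field_simps)
qed

text \<open>Setting one of the two matrices to 0 yields the other log-determinants of the
  objectives.\<close>

lemma continuous_on_ln_det_gains:
  fixes H1 :: "real^'t^'n" and H2 :: "real^'u^'n"
  shows "continuous_on (cov_set P1 \<times> cov_set P2) (\<lambda>p. ln (det (mat 1 + gain H1 (fst p) + gain H2 (snd p))))"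
proof (intro continuous_on_ln)
  show "continuous_on (cov_set P1 \<times> cov_set P2) (\<lambda>p. det (mat 1 + gain H1 (fst p) + gain H2 (snd p)))"
    unfolding gain_def by (intro continuous_intros)
  have "0 < det (mat 1 + gain H1 S1 + gain H2 S2)" if "S1 \<in> cov_set P1" "S2 \<in> cov_set P2" for S1 S2
    using that by (intro pos_def_det pos_def_add pos_def_mat_1_gain pos_semidef_gain) (auto simp: cov_set_def)
  then show "\<forall>p\<in>cov_set P1 \<times> cov_set P2. det (mat 1 + gain H1 (fst p) + gain H2 (snd p)) \<noteq> 0"
    by fastforce
qed

lemma gain_zero [simp]: "gain 0 S = 0"
  by (simp add: gain_def)

lemma sum_capacity_weak_interference:
  fixes H1 :: "real^'t^'n" and H2 H4 :: "real^'n^'n"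
  assumes N: "noise_law N" and P: "0 \<le> P1" "0 \<le> P2" and inv: "invertible H2" "invertible H4"
    and less: "transpose H2 ** H2 \<prec>\<^sub>L transpose H4 ** H4"
  shows "is_max_over (sum_capacity H1 H2 (0 :: real^'t^'n) H4 N P1 P2)
    (\<lambda>p. (ln (det (mat 1 + gain H1 (fst p) + gain H2 (snd p))) - ln (det (mat 1 + gain H2 (snd p)))
       + ln (det (mat 1 + gain H4 (snd p)))) / 2) (cov_set P1 \<times> cov_set P2)"
    (is "is_max_over _ ?f _")
proof (rule is_max_over_sum_capacity[OF P])
  show "continuous_on (cov_set P1 \<times> cov_set P2) ?f"
    by (intro continuous_on_divide continuous_on_add continuous_on_diff continuous_on_const continuous_on_ln_det_gains
        continuous_on_ln_det_gains[where ?H1.0 = "0 :: real^'t^'n", unfolded gain_zero add_0_right]) simp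
  show "R1 + R2 \<le> V" if "achievable H1 H2 0 H4 N P1 P2 (R1, R2)"
    "\<And>S1 S2. S1 \<in> cov_set P1 \<Longrightarrow> S2 \<in> cov_set P2 \<Longrightarrow> ?f (S1, S2) \<le> V" for R1 R2 V
    using that(2) by (intro converse_weak_interference[OF N inv less that(1)]) simp
next
  fix S1 :: "real^'t^'t" and S2 :: "real^'n^'n" and \<delta> \<epsilon> :: real
  assume S: "pos_semidef S1" "pos_semidef S2" "trace S1 \<le> (1 - \<delta>) * P1" "trace S2 \<le> (1 - \<delta>) * P2"
    and \<delta>: "0 < \<delta>" "\<delta> \<le> 1" and \<epsilon>: "0 < \<epsilon>"
  let ?a = "(ln (det (mat 1 + gain H1 S1 + gain H2 S2)) - ln (det (mat 1 + gain H2 S2))) / 2"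
  let ?b = "ln (det (mat 1 + gain H4 S2)) / 2"
  \<comment> \<open>Each user gives up half of \<epsilon>; a negative target is replaced by rate
    0.\<close>
  define R1 where "R1 = max 0 (?a - \<epsilon> / 2)"
  define R2 where "R2 = max 0 (?b - \<epsilon> / 2)"
  have "achievable H1 H2 0 H4 N P1 P2 (R1, R2)"
  proof (rule achievable_treating_interference_as_noise[OF N P _ _ \<delta> S])
    have backoff: "max 0 (x - \<epsilon> / 2) = 0 \<or> max 0 (x - \<epsilon> / 2) < x" for x :: real
      using \<epsilon> by (auto simp: max_def)
    show "R1 = 0 \<or> R1 < ?a" "R2 = 0 \<or> R2 < ?b"
      unfolding R1_def R2_def by (rule backoff)+
  qed (simp_all add: R1_def R2_def)
  moreover have "?f (S1, S2) - \<epsilon> \<le> R1 + R2"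
  proof -
    have "?f (S1, S2) = ?a + ?b" by (simp add: add_divide_distrib)
    moreover have "?a - \<epsilon> / 2 \<le> R1" "?b - \<epsilon> / 2 \<le> R2"
      by (simp_all only: R1_def R2_def max.cobounded2)
    ultimately show ?thesis by linarith
  qed
  ultimately show "\<exists>R1 R2. achievable H1 H2 0 H4 N P1 P2 (R1, R2) \<and> ?f (S1, S2) - \<epsilon> \<le> R1 + R2" by blast
qed

lemma sum_capacity_strong_interference:
  fixes H1 :: "real^'t^'n" and H2 H4 :: "real^'n^'n"
  assumes N: "noise_law N" and P: "0 \<le> P1" "0 \<le> P2" and inv: "invertible H2" "invertible H4"
    and le: "transpose H2 ** H2 \<succeq>\<^sub>L transpose H4 ** H4"
  shows "is_max_over (sum_capacity H1 H2 (0 :: real^'t^'n) H4 N P1 P2)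
    (\<lambda>p. min (ln (det (mat 1 + gain H1 (fst p) + gain H2 (snd p))) / 2)
       (ln (det (mat 1 + gain H1 (fst p))) / 2 + ln (det (mat 1 + gain H4 (snd p))) / 2)) (cov_set P1 \<times> cov_set P2)"
    (is "is_max_over _ ?f _")
proof (rule is_max_over_sum_capacity[OF P])
  show "continuous_on (cov_set P1 \<times> cov_set P2) ?f"
    by (intro continuous_on_min continuous_on_divide continuous_on_add continuous_on_const continuous_on_ln_det_gains
        continuous_on_ln_det_gains[where ?H1.0 = "0 :: real^'t^'n", unfolded gain_zero add_0_right]
        continuous_on_ln_det_gains[where ?H2.0 = "0 :: real^'n^'n", unfolded gain_zero add_0_right]) simp_all
  show "R1 + R2 \<le> V" if "achievable H1 H2 0 H4 N P1 P2 (R1, R2)"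
    "\<And>S1 S2. S1 \<in> cov_set P1 \<Longrightarrow> S2 \<in> cov_set P2 \<Longrightarrow> ?f (S1, S2) \<le> V" for R1 R2 V
    using that(2) by (intro converse_strong_interference[OF N inv le that(1)]) simp
next
  fix S1 :: "real^'t^'t" and S2 :: "real^'n^'n" and \<delta> \<epsilon> :: real
  assume S: "pos_semidef S1" "pos_semidef S2" "trace S1 \<le> (1 - \<delta>) * P1" "trace S2 \<le> (1 - \<delta>) * P2"
    and \<delta>: "0 < \<delta>" "\<delta> \<le> 1" and \<epsilon>: "0 < \<epsilon>"
  let ?a = "ln (det (mat 1 + gain H1 S1)) / 2" and ?b = "ln (det (mat 1 + gain H4 S2)) / 2"
  let ?c = "ln (det (mat 1 + gain H1 S1 + gain H2 S2)) / 2"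
  \<comment> \<open>User 2 takes its single-user rate, user 1 what the sum constraint leaves, up to
    its own limit. Then \<open>min ?a (?c - ?b) + ?b\<close> is the minimum of
    \<open>?a + ?b\<close> and \<open>?c\<close>, which is the objective.\<close>
  define R2 where "R2 = max 0 (?b - \<epsilon> / 2)"
  define R1 where "R1 = max 0 (min ?a (?c - ?b) - \<epsilon> / 2)"
  have "achievable H1 H2 0 H4 N P1 P2 (R1, R2)"
    using \<epsilon> by (intro achievable_joint_decoding[OF N P _ _ \<delta> S]) (auto simp: R1_def R2_def max_def min_def)
  moreover have "?f (S1, S2) - \<epsilon> \<le> R1 + R2"
    by (simp add: R1_def R2_def max_def min_def)
  ultimately show "\<exists>R1 R2. achievable H1 H2 0 H4 N P1 P2 (R1, R2) \<and> ?f (S1, S2) - \<epsilon> \<le> R1 + R2" by blast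
qed

theorem theorem3:
  fixes H1 :: "real^'t^'n" and H2 :: "real^'n^'n"
    and H3 :: "real^'t^'n" and H4 :: "real^'n^'n"
    and N :: "((real^'n) \<times> (real^'n)) measure"
    and P1 P2 :: real
  assumes "noise_law N"
    and "0 \<le> P1" and "0 \<le> P2"
    and "H3 = 0" and "invertible H2" and "invertible H4"
  shows "(transpose H2 ** H2 \<prec>\<^sub>L transpose H4 ** H4 \<longrightarrow>
      is_max_over (sum_capacity H1 H2 H3 H4 N P1 P2)
        (\<lambda>(S1, S2).
           1/2 * ln (det (mat 1 + H1 ** S1 ** transpose H1
                            ** matrix_inv (mat 1 + H2 ** S2 ** transpose H2)))
           + 1/2 * ln (det (mat 1 + H4 ** S2 ** transpose H4)))
        (cov_set P1 \<times> cov_set P2))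
    \<and> (transpose H2 ** H2 \<succeq>\<^sub>L transpose H4 ** H4 \<longrightarrow>
      is_max_over (sum_capacity H1 H2 H3 H4 N P1 P2)
        (\<lambda>(S1, S2).
           min (1/2 * ln (det (mat 1 + H1 ** S1 ** transpose H1 + H2 ** S2 ** transpose H2)))
               (1/2 * ln (det (mat 1 + H1 ** S1 ** transpose H1))
                + 1/2 * ln (det (mat 1 + H4 ** S2 ** transpose H4))))
        (cov_set P1 \<times> cov_set P2))"
proof (intro conjI impI)
  \<comment> \<open>With the gains the objective becomes a combination of log-determinants, the form
    shared by the converse and the direct part.\<close>
  have obj: "1/2 * ln (det (mat 1 + H1 ** S1 ** transpose H1 ** matrix_inv (mat 1 + H2 ** S2 ** transpose H2)))
      + 1/2 * ln (det (mat 1 + H4 ** S2 ** transpose H4))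
    = (ln (det (mat 1 + gain H1 S1 + gain H2 S2)) - ln (det (mat 1 + gain H2 S2)) + ln (det (mat 1 + gain H4 S2))) / 2"
    if S: "S1 \<in> cov_set P1" "S2 \<in> cov_set P2" for S1 S2
  proof -
    have pd: "pos_def (mat 1 + gain H2 S2)" "pos_def (mat 1 + gain H2 S2 + gain H1 S1)"
      using S by (auto simp: cov_set_def intro!: pos_def_mat_1_gain pos_def_add pos_semidef_gain)
    have "ln (det (mat 1 + gain H1 S1 ** matrix_inv (mat 1 + gain H2 S2)))
        = ln (det (mat 1 + gain H2 S2 + gain H1 S1)) - ln (det (mat 1 + gain H2 S2))"
      using pos_def_det[OF pd(1)] pos_def_det[OF pd(2)]
      by (simp add: det_noise_whitening[OF pos_def_invertible[OF pd(1)]] ln_div)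
    then show ?thesis by (simp add: gain_def ac_simps add_divide_distrib)
  qed
  show "is_max_over (sum_capacity H1 H2 H3 H4 N P1 P2)
        (\<lambda>(S1, S2).
           1/2 * ln (det (mat 1 + H1 ** S1 ** transpose H1
                            ** matrix_inv (mat 1 + H2 ** S2 ** transpose H2)))
           + 1/2 * ln (det (mat 1 + H4 ** S2 ** transpose H4)))
        (cov_set P1 \<times> cov_set P2)" if less: "transpose H2 ** H2 \<prec>\<^sub>L transpose H4 ** H4"
    unfolding assms(4)
  proof (rule iffD2[OF is_max_over_cong sum_capacity_weak_interference[OF assms(1-3,5,6) less, of H1]], elim SigmaE)
    fix p and S1 :: "real^'t^'t" and S2 :: "real^'n^'n"
    assume "p = (S1, S2)" "S1 \<in> cov_set P1" "S2 \<in> cov_set P2"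
    then show "(case p of (S1, S2) \<Rightarrow> 1/2 * ln (det (mat 1 + H1 ** S1 ** transpose H1 ** matrix_inv (mat 1 + H2 ** S2 ** transpose H2)))
        + 1/2 * ln (det (mat 1 + H4 ** S2 ** transpose H4)))
      = (ln (det (mat 1 + gain H1 (fst p) + gain H2 (snd p))) - ln (det (mat 1 + gain H2 (snd p)))
        + ln (det (mat 1 + gain H4 (snd p)))) / 2"
      by (simp only: prod.case fst_conv snd_conv obj)
  qed
  show "is_max_over (sum_capacity H1 H2 H3 H4 N P1 P2)
        (\<lambda>(S1, S2).
           min (1/2 * ln (det (mat 1 + H1 ** S1 ** transpose H1 + H2 ** S2 ** transpose H2)))
               (1/2 * ln (det (mat 1 + H1 ** S1 ** transpose H1))
                + 1/2 * ln (det (mat 1 + H4 ** S2 ** transpose H4))))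
        (cov_set P1 \<times> cov_set P2)" if le: "transpose H2 ** H2 \<succeq>\<^sub>L transpose H4 ** H4"
    unfolding assms(4)
    by (rule iffD2[OF is_max_over_cong sum_capacity_strong_interference[OF assms(1-3,5,6) le, of H1]]) (auto simp: gain_def)
qed

end
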